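(* Let $\Omega$, $V$, $\lambda$, $L_2$ and $\mu(x)$ be as in the context, and let $\mu$ be the first eigenvalue of the ordinary differential operator $$\mathcal{A}=-\frac{d^2}{dx^2}+\mu(x)$$ on the projection of $\Omega$ onto the $x$-axis with zero boundary conditions. Then there is an absolute constant $C$ such that the first Dirichlet eigenvalue $\lambda$ of $-\Delta_{x,y}+V(x,y)$ on $\Omega$ satisfies $$\mu\le\lambda\le\mu+CL_2^{-2}.$$
   Context: Domain. $\Omega\subset\mathbb{R}^2$ is a bounded convex domain with inner radius $N_1$ (radius of the largest inscribed disc) and diameter $N_2$; $N_1$ is bounded below by a fixed absolute constant and $N_2$ is at least a fixed sufficiently large absolute constant. Potential. $V(x,y)=h(x,y)^{-2}$ on $\Omega$, where $h$ is concave with $0\le h\le 1$ and $\max_\Omega h=1$ (the maximum may be attained on the boundary, $h$ being extended to the closure). Thus $V$ is convex with minimum $1$; no further regularity is assumed. $\lambda$ is the first Dirichlet eigenvalue of $-\Delta_{x,y}+V(x,y)$ on $\Omega$. Length scales. For $s\ge 0$ let $\Omega_s=\{(x,y)\in\Omega: V(x,y)\le 1+s\}$. $L_1$ is the largest value such that $\Omega_{L_1^{-2}}$ has inner radius at least $L_1$. $\tilde L_1$ is the diameter of $\Omega_{L_1^{-2}}$. Orientation: rotate so that the projection of $\Omega_{L_1^{-2}}$ onto the $y$-axis has the smallest length among its projections onto all lines. For each $x$ let $\Omega(x)$ be the cross-section of $\Omega$ at $x$ (an interval in $y$), let $\mu(x)$ be the first eigenvalue of $-\frac{d^2}{dy^2}+V(x,y)$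 on $\Omega(x)$ with zero boundary conditions, and $\mu^*=\min_x\mu(x)$. Fix a large absolute constant $\tilde C$. If $\tilde L_1<\tilde C L_1$ (i.e. $L_1,\tilde L_1$ are comparable), set $L_2=L_1$. If $\tilde L_1\ge\tilde C L_1$ (written $\tilde L_1\gg L_1$), $L_2$ is the largest value such that $\mu^*\le\mu(x)\le\mu^*+L_2^{-2}$ for all $x$ in an interval $I$ of length at least $L_2$. An absolute constant is a positive constant depending only on the fixed constants above, not on $\Omega,V,N_1,N_2,L_1,L_2$. *)

theory Defs
  imports "HOL-Analysis.Analysis"
begin

section \<open>Dirichlet eigenvalues of Schroedinger operators\<close>

text \<open>
  The operator \<open>- Laplacian + V\<close> on an open set \<open>\<Omega>\<close> with zero boundary conditions is understood
  in the usual weak sense, for \<open>V\<close> nonnegative and locally bounded on \<open>\<Omega>\<close> (\<open>V\<close> may blow up at the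
  boundary). The same definitions serve on the plane and, with \<open>'a = real\<close>, for ordinary
  differential operators. Values of functions outside \<open>\<Omega>\<close> play no role.
\<close>

definition test_function :: "'a::euclidean_space set \<Rightarrow> ('a \<Rightarrow> real) \<Rightarrow> ('a \<Rightarrow> 'a) \<Rightarrow> bool" where
  "test_function \<Omega> \<phi> \<phi>' \<longleftrightarrow>
     (\<forall>x. GDERIV \<phi> x :> \<phi>' x) \<and> continuous_on UNIV \<phi>' \<and>
     (\<exists>K. compact K \<and> K \<subseteq> \<Omega> \<and> (\<forall>x. x \<notin> K \<longrightarrow> \<phi> x = 0))"

text \<open>
  The form domain: the closure of the compactly supported \<open>C\<^sup>1\<close> functions on \<open>\<Omega>\<close> in the norm whose
  square is the integral of \<open>u\<^sup>2 + norm (grad u)\<^sup>2 + V u\<^sup>2\<close>. This is the space of those \<open>u\<close> in the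
  Sobolev space of functions vanishing on the boundary for which \<open>V u\<^sup>2\<close> is integrable; \<open>g\<close> is the
  weak gradient of \<open>u\<close>.
\<close>

definition form_domain ::
    "'a::euclidean_space set \<Rightarrow> ('a \<Rightarrow> real) \<Rightarrow> ('a \<Rightarrow> real) \<Rightarrow> ('a \<Rightarrow> 'a) \<Rightarrow> bool" where
  "form_domain \<Omega> V u g \<longleftrightarrow>
     u \<in> borel_measurable borel \<and> g \<in> borel_measurable borel \<and>
     (\<exists>\<phi> \<phi>'. (\<forall>n::nat. test_function \<Omega> (\<phi> n) (\<phi>' n)) \<and>
        (\<lambda>n. \<integral>\<^sup>+x\<in>\<Omega>. ennreal ((\<phi> n x - u x)\<^sup>2 + (norm (\<phi>' n x - g x))\<^sup>2 + V x * (\<phi> n x - u x)\<^sup>2)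
               \<partial>lborel) \<longlonglongrightarrow> 0)"

definition dirichlet_eigenvalue :: "'a::euclidean_space set \<Rightarrow> ('a \<Rightarrow> real) \<Rightarrow> real \<Rightarrow> bool" where
  "dirichlet_eigenvalue \<Omega> V l \<longleftrightarrow>
     (\<exists>u g. form_domain \<Omega> V u g \<and> \<not> (AE x in lborel. x \<in> \<Omega> \<longrightarrow> u x = 0) \<and>
        (\<forall>\<phi> \<phi>'. test_function \<Omega> \<phi> \<phi>' \<longrightarrow>
           (LINT x:\<Omega>|lborel. g x \<bullet> \<phi>' x + V x * u x * \<phi> x) = l * (LINT x:\<Omega>|lborel. u x * \<phi> x)))"

text \<open>For bounded \<open>\<Omega>\<close> the spectrum is discrete, so that the infimum is a minimum.\<close>

definition first_eigenvalue :: "'a::euclidean_space set \<Rightarrow> ('a \<Rightarrow> real) \<Rightarrow> real" where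
  "first_eigenvalue \<Omega> V = Inf {l. dirichlet_eigenvalue \<Omega> V l}"


section \<open>The length scales\<close>

definition potential :: "(real \<times> real \<Rightarrow> real) \<Rightarrow> real \<times> real \<Rightarrow> real" where
  "potential h z = 1 / (h z)\<^sup>2"

definition inner_radius :: "'a::metric_space set \<Rightarrow> real" where
  "inner_radius S = Sup {r. \<exists>c. ball c r \<subseteq> S}"

definition sublevel :: "(real \<times> real) set \<Rightarrow> (real \<times> real \<Rightarrow> real) \<Rightarrow> real \<Rightarrow> (real \<times> real) set" where
  "sublevel \<Omega> V s = {z \<in> \<Omega>. V z \<le> 1 + s}"

text \<open>
  Both in this definition and in that of \<open>L2\<close> below, the largest admissible value exists and is
  given by the supremum.
\<close>

definition L1 :: "(real \<times> real) set \<Rightarrow> (real \<times> real \<Rightarrow> real) \<Rightarrow> real" where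
  "L1 \<Omega> V = Sup {L. 0 < L \<and> L \<le> inner_radius (sublevel \<Omega> V (1 / L\<^sup>2))}"

abbreviation level_set_L1 :: "(real \<times> real) set \<Rightarrow> (real \<times> real \<Rightarrow> real) \<Rightarrow> (real \<times> real) set" where
  "level_set_L1 \<Omega> V \<equiv> sublevel \<Omega> V (1 / (L1 \<Omega> V)\<^sup>2)"

definition L1_tilde :: "(real \<times> real) set \<Rightarrow> (real \<times> real \<Rightarrow> real) \<Rightarrow> real" where
  "L1_tilde \<Omega> V = diameter (level_set_L1 \<Omega> V)"

text \<open>Length of the projection of a convex set onto the line spanned by the unit vector \<open>e\<close>.\<close>

definition projection_length :: "(real \<times> real) set \<Rightarrow> real \<times> real \<Rightarrow> real" where
  "projection_length S e = diameter ((\<lambda>z. z \<bullet> e) ` S)"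

definition normalized_orientation :: "(real \<times> real) set \<Rightarrow> (real \<times> real \<Rightarrow> real) \<Rightarrow> bool" where
  "normalized_orientation \<Omega> V \<longleftrightarrow>
     (\<forall>e. norm e = 1 \<longrightarrow>
        projection_length (level_set_L1 \<Omega> V) (0, 1) \<le> projection_length (level_set_L1 \<Omega> V) e)"

definition cross_section :: "(real \<times> real) set \<Rightarrow> real \<Rightarrow> real set" where
  "cross_section \<Omega> x = {y. (x, y) \<in> \<Omega>}"

definition mu_cross :: "(real \<times> real) set \<Rightarrow> (real \<times> real \<Rightarrow> real) \<Rightarrow> real \<Rightarrow> real" where
  "mu_cross \<Omega> V x = first_eigenvalue (cross_section \<Omega> x) (\<lambda>y. V (x, y))"

text \<open>
  An infimum, since (like the maximum of \<open>h\<close>) the minimum of \<open>mu_cross\<close> may be attained only in the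
  limit at an endpoint of the open interval \<open>fst ` \<Omega>\<close>.
\<close>

definition mu_star :: "(real \<times> real) set \<Rightarrow> (real \<times> real \<Rightarrow> real) \<Rightarrow> real" where
  "mu_star \<Omega> V = (INF x\<in>fst ` \<Omega>. mu_cross \<Omega> V x)"

definition L2 :: "real \<Rightarrow> (real \<times> real) set \<Rightarrow> (real \<times> real \<Rightarrow> real) \<Rightarrow> real" where
  "L2 Ct \<Omega> V =
     (if L1_tilde \<Omega> V < Ct * L1 \<Omega> V then L1 \<Omega> V
      else Sup {L. 0 < L \<and>
             (\<exists>a b. L \<le> b - a \<and> {a<..<b} \<subseteq> fst ` \<Omega> \<and>
                (\<forall>x\<in>{a<..<b}. mu_star \<Omega> V \<le> mu_cross \<Omega> V x \<and>
                              mu_cross \<Omega> V x \<le> mu_star \<Omega> V + 1 / L\<^sup>2))})"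

text \<open>
  \<open>h\<close> is only used on the open set \<open>\<Omega>\<close>. The supremum over \<open>\<Omega>\<close> is the maximum over the closure of
  the (upper semicontinuous) extension of \<open>h\<close>.
\<close>

definition admissible :: "(real \<times> real) set \<Rightarrow> (real \<times> real \<Rightarrow> real) \<Rightarrow> bool" where
  "admissible \<Omega> h \<longleftrightarrow>
     open \<Omega> \<and> bounded \<Omega> \<and> convex \<Omega> \<and> \<Omega> \<noteq> {} \<and>
     concave_on \<Omega> h \<and> (\<forall>z\<in>\<Omega>. 0 \<le> h z \<and> h z \<le> 1) \<and> (SUP z\<in>\<Omega>. h z) = 1"

end

theory Submission
  imports Defs
begin

text \<open>
  The lower bound is separation of variables. For a test function \<open>\<phi>\<close> on
  \<open>\<Omega>\<close> and fixed \<open>x\<close>, the \<open>y\<close>-part of the energy is at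
  least \<open>\<mu>(x)\<close> times the mass of the section, by definition of
  \<open>\<mu>(x)\<close>; for fixed \<open>y\<close>, the resulting one-dimensional energy in
  \<open>x\<close> with potential \<open>\<mu>(x)\<close> is at least \<open>\<mu>\<close> times the
  mass. Tonelli does the rest (\<open>mu1_le_first_eigenvalue\<close>). In the text below
  \<open>\<mu>(x)\<close>, \<open>\<mu>*\<close>, \<open>\<mu>\<close> and \<open>L1\<close> are
  called \<open>mu x\<close>, \<open>mu_min\<close>, \<open>mu1\<close> and \<open>len\<close>.

  For the upper bound it suffices to find \<open>C\<close> with
  \<open>\<lambda> \<le> \<mu>* + C / L\<^sup>2\<close> for every \<open>L\<close> that competes in
  the definition of \<open>L2\<close>, because \<open>\<mu>* \<le> \<mu>\<close>. A bump function on
  a disc of radius comparable to \<open>L1\<close> gives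
  \<open>\<lambda> \<le> 1 + C / L1\<^sup>2\<close>, which settles \<open>L2 = L1\<close> and all
  \<open>L \<le> L1\<close>. There remains an interval of length \<open>L \<ge> L1\<close> on which
  \<open>\<mu>(x) \<le> \<mu>* + 1 / L\<^sup>2\<close>. The natural test function is a bump in
  \<open>x\<close> times the ground state of the cross-section at \<open>x\<close>; it fails because
  nothing controls the \<open>x\<close>-derivative of that ground state. Instead only two
  cross-sections, at \<open>a\<close> and \<open>b\<close> with \<open>b - a\<close> comparable to
  \<open>L\<close>, are used, and their ground states are interpolated.

  The interpolation rests on the convexity of \<open>V\<close>. Put
  \<open>m = \<mu>* + 2 / L\<^sup>2\<close>. Since \<open>m\<close> exceeds the first eigenvalue of
  the section, a subinterval of the section carries a positive solution of
  \<open>- \<psi>'' + V \<psi> = m \<psi>\<close> vanishing at both ends. It is log-concave because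
  \<open>V\<close> is convex (\<open>ground_state_log_concave\<close>), so its logarithmic slope
  \<open>p = - \<psi>' / \<psi>\<close> increases from minus to plus infinity and serves as a
  coordinate: \<open>y = Y(p)\<close> and, up to a constant, \<open>- ln \<psi> = A(p)\<close> with
  \<open>A' = p Y'\<close>, and the Riccati equation becomes
  \<open>V(Y(p)) = m + p\<^sup>2 - 1 / Y'(p)\<close>
  (\<open>ground_state_slope_parametrization\<close>). Points of equal slope are now joined by
  segments: \<open>Y\<close> and \<open>A\<close> are interpolated linearly in \<open>x\<close> for
  each \<open>p\<close>, which is the inf-convolution of the two convex functions
  \<open>- ln \<psi>\<close>. Convexity of \<open>V\<close> and the inequality of harmonic and
  arithmetic mean turn the two Riccati equations into
  \<open>V(x, Y\<^sub>x(p)) \<le> m + p\<^sup>2 - 1 / Y\<^sub>x'(p)\<close> (\<open>Yx_V\<close>).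
  Hence every section of \<open>v = exp (- W)\<close> has energy at most \<open>m\<close> times its
  mass, since integration by parts bounds the excess by a boundary term of the right sign
  (\<open>virial_inequality\<close>).

  The \<open>x\<close>-derivative of \<open>W\<close> at slope \<open>p\<close> is
  \<open>- D(p) / (b - a)\<close>, where \<open>D\<close> is the difference of the Legendre
  transforms of the two profiles; it is at most the length scale of the sections times
  \<open>\<bar>p\<bar>\<close>, up to a factor that a part of the decay of \<open>v\<close> absorbs
  (\<open>D_bound\<close>). Slopes are of the size \<open>1 / L1\<close> on average, and the
  sections have height comparable to \<open>L1\<close>, so the error is of order
  \<open>1 / (b - a)\<^sup>2\<close>, as is the energy of the bump in \<open>x\<close>
  (\<open>first_eigenvalue_le\<close>).

  The height bound is geometry (\<open>level_height\<close>). By maximality of \<open>L1\<close> and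
  convexity of \<open>V\<close>, the level set defining \<open>L1\<close> contains no disc of radius
  above \<open>16 L1\<close>; a planar convex set has width at most \<open>12\<close> times its
  inradius in some direction; and the coordinates are chosen so that the \<open>y\<close>-direction
  is the narrowest.

  The eigenvalues are infima over weak solutions. All of the above works with test functions only,
  after the first eigenvalue has been identified with the infimum of the Rayleigh quotient
  (\<open>first_eigenvalue_eq_rayleigh\<close>). That this infimum is attained follows from
  compactness of minimizing sequences, obtained from a Poincare inequality on small cubes.
\<close>

section \<open>Square mean convergence and translations\<close>

lemma ennreal_term_le_suminf:
  fixes f :: "nat \<Rightarrow> ennreal"
  shows "f k \<le> suminf f"
  using sum_le_suminf[OF summableI, of "{k}" f] by simp

text \<open>
  Along a subsequence the squared increments decay like \<open>4\<close> to the power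
  \<open>- k\<close>, so even after multiplication by \<open>2\<close> to the power \<open>k\<close>
  they have finite total integral. At almost every point the increments themselves are then
  dominated by a geometric series.
\<close>

lemma L2_cauchy_imp_AE_convergent_subsequence:
  fixes F :: "nat \<Rightarrow> 'a \<Rightarrow> 'b::{banach,second_countable_topology}"
  assumes meas [measurable]: "\<And>n. F n \<in> borel_measurable M"
    and Cauchy: "\<And>e. e > 0 \<Longrightarrow> \<exists>N. \<forall>j\<ge>N. \<forall>k\<ge>N.
      (\<integral>\<^sup>+x. ennreal ((norm (F j x - F k x))\<^sup>2) \<partial>M) \<le> ennreal e"
  shows "\<exists>r G. strict_mono (r::nat \<Rightarrow> nat) \<and> G \<in> borel_measurable M \<and>
    (AE x in M. (\<lambda>k. F (r k) x) \<longlonglongrightarrow> G x)"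
proof -
  have "\<forall>k. \<exists>N. \<forall>i\<ge>N. \<forall>j\<ge>N.
      (\<integral>\<^sup>+x. ennreal ((norm (F i x - F j x))\<^sup>2) \<partial>M) \<le> ennreal ((1/4)^k)"
    by (intro allI Cauchy) simp
  then obtain N where N: "\<And>k i j. N k \<le> i \<Longrightarrow> N k \<le> j \<Longrightarrow>
      (\<integral>\<^sup>+x. ennreal ((norm (F i x - F j x))\<^sup>2) \<partial>M) \<le> ennreal ((1/4)^k)"
    by metis
  define r where "r k = (\<Sum>i\<le>k. N i) + k" for k
  have r_mono: "strict_mono r"
    by (rule strict_monoI_Suc) (simp add: r_def)
  have r_ge: "N k \<le> r k" for k
    unfolding r_def by (simp add: trans_le_add1 member_le_sum)
  have r_ge': "N k \<le> r (Suc k)" for k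
    using r_ge[of k] strict_monoD[OF r_mono, of k "Suc k"] by simp
  define d where "d k x = norm (F (r (Suc k)) x - F (r k) x)" for k x
  have [measurable]: "d k \<in> borel_measurable M" for k
    unfolding d_def by measurable
  have "(\<integral>\<^sup>+x. (\<Sum>k. ennreal (2^k * (d k x)\<^sup>2)) \<partial>M) = (\<Sum>k. \<integral>\<^sup>+x. ennreal (2^k * (d k x)\<^sup>2) \<partial>M)"
    by (rule nn_integral_suminf) measurable
  also have "\<dots> \<le> (\<Sum>k. ennreal ((1/2)^k))"
  proof (rule suminf_le)
    fix k
    have "(\<integral>\<^sup>+x. ennreal (2^k * (d k x)\<^sup>2) \<partial>M) = ennreal (2^k) * (\<integral>\<^sup>+x. ennreal ((d k x)\<^sup>2) \<partial>M)"
      by (subst nn_integral_cmult[symmetric]) (auto simp: ennreal_mult)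
    also have "\<dots> \<le> ennreal (2^k) * ennreal ((1/4)^k)"
      unfolding d_def by (intro mult_left_mono N r_ge r_ge') simp
    also have "\<dots> = ennreal ((1/2)^k)"
      by (simp add: ennreal_mult[symmetric] power_mult_distrib[symmetric])
    finally show "(\<integral>\<^sup>+x. ennreal (2^k * (d k x)\<^sup>2) \<partial>M) \<le> ennreal ((1/2)^k)" .
  qed auto
  also have "\<dots> = ennreal (\<Sum>k. (1/2)^k)"
    by (intro suminf_ennreal2) auto
  also have "\<dots> < \<infinity>" by simp
  finally have "AE x in M. (\<Sum>k. ennreal (2^k * (d k x)\<^sup>2)) \<noteq> \<infinity>"
    by (intro nn_integral_PInf_AE) auto
  then have conv: "AE x in M. convergent (\<lambda>k. F (r k) x)"
  proof eventually_elim
    case (elim x)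
    have "\<exists>S. 0 \<le> S \<and> (\<Sum>k. ennreal (2^k * (d k x)\<^sup>2)) = ennreal S"
      using elim by (metis ennreal_cases infinity_ennreal_def)
    then obtain S where S: "0 \<le> S" "(\<Sum>k. ennreal (2^k * (d k x)\<^sup>2)) = ennreal S" by blast
    have bound: "d k x \<le> sqrt S * (1 / sqrt 2)^k" for k
    proof -
      have "ennreal (2^k * (d k x)\<^sup>2) \<le> (\<Sum>k. ennreal (2^k * (d k x)\<^sup>2))"
        by (rule ennreal_term_le_suminf)
      then have "2^k * (d k x)\<^sup>2 \<le> S" using S(1) unfolding S(2) by (simp only: ennreal_le_iff)
      then have "sqrt (2^k * (d k x)\<^sup>2) \<le> sqrt S" by (rule real_sqrt_le_mono)
      then have "sqrt 2^k * d k x \<le> sqrt S"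
        by (simp add: real_sqrt_mult real_sqrt_power d_def)
      then show ?thesis by (simp add: field_simps power_divide)
    qed
    have "summable (\<lambda>k. sqrt S * (1 / sqrt 2)^k)"
      by (intro summable_mult summable_geometric) simp
    then have "summable (\<lambda>k. F (r (Suc k)) x - F (r k) x)"
      by (rule summable_comparison_test'[where N=0]) (use bound in \<open>simp add: d_def\<close>)
    then have "(\<lambda>n. \<Sum>k<n. F (r (Suc k)) x - F (r k) x) \<longlonglongrightarrow> (\<Sum>k. F (r (Suc k)) x - F (r k) x)"
      by (rule summable_LIMSEQ)
    from tendsto_add[OF this tendsto_const[of "F (r 0) x"]]
    have "(\<lambda>n. F (r n) x) \<longlonglongrightarrow> (\<Sum>k. F (r (Suc k)) x - F (r k) x) + F (r 0) x"
      unfolding sum_lessThan_telescope[of "\<lambda>k. F (r k) x"] by simp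
    then show ?case by (rule convergentI)
  qed
  have "(\<lambda>x. lim (\<lambda>k. F (r k) x)) \<in> borel_measurable M"
    by (rule borel_measurable_lim_metric) measurable
  moreover have "AE x in M. (\<lambda>k. F (r k) x) \<longlonglongrightarrow> lim (\<lambda>k. F (r k) x)"
    using conv by eventually_elim (simp add: convergent_LIMSEQ_iff)
  ultimately show ?thesis using r_mono by blast
qed

lemma square_integral_le_integral_square:
  fixes g :: "real \<Rightarrow> real"
  assumes "continuous_on {0..1} g"
  shows "(integral {0..1} g)\<^sup>2 \<le> integral {0..1} (\<lambda>t. (g t)\<^sup>2)"
proof -
  define c where "c = integral {0..1} g"
  have g: "g integrable_on {0..1}" and g2: "(\<lambda>t. (g t)\<^sup>2) integrable_on {0..1}"
    by (auto intro!: integrable_continuous_real continuous_intros assms)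
  have "((\<lambda>t. (g t)\<^sup>2 - 2 * c * g t + c\<^sup>2) has_integral
       (integral {0..1} (\<lambda>t. (g t)\<^sup>2) - 2 * c * c + (1 - 0) *\<^sub>R c\<^sup>2)) {0..1}"
    unfolding c_def
    by (intro has_integral_add has_integral_diff integrable_integral g2
        has_integral_mult_right g has_integral_const_real[of "_\<^sup>2" 0 1, simplified]) (simp add: has_integral_const_real[of "_\<^sup>2" 0 1, simplified])
  moreover have "0 \<le> (g t)\<^sup>2 - 2 * c * g t + c\<^sup>2" for t
    using zero_le_power2[of "g t - c"] by (simp add: power2_eq_square algebra_simps)
  ultimately have "0 \<le> integral {0..1} (\<lambda>t. (g t)\<^sup>2) - 2 * c * c + (1 - 0) *\<^sub>R c\<^sup>2"
    by (rule has_integral_nonneg)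
  then show ?thesis by (simp add: c_def power2_eq_square)
qed

lemma nn_integral_translation:
  fixes f :: "'a::euclidean_space \<Rightarrow> ennreal"
  assumes [measurable]: "f \<in> borel_measurable borel"
  shows "(\<integral>\<^sup>+x. f (x + h) \<partial>lborel) = (\<integral>\<^sup>+x. f x \<partial>lborel)"
proof -
  have "(\<integral>\<^sup>+x. f x \<partial>lborel) = (\<integral>\<^sup>+x. f x \<partial>(distr lborel borel ((+) h)))"
    by (simp add: lborel_distr_plus)
  also have "\<dots> = (\<integral>\<^sup>+x. f (h + x) \<partial>lborel)"
    by (subst nn_integral_distr) auto
  finally show ?thesis by (simp add: add.commute)
qed

lemma nn_integral_plane:
  fixes f :: "real \<times> real \<Rightarrow> ennreal"
  assumes "f \<in> borel_measurable borel"
  shows "(\<integral>\<^sup>+z. f z \<partial>lborel) = (\<integral>\<^sup>+x. \<integral>\<^sup>+y. f (x, y) \<partial>lborel \<partial>lborel)"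
    and "(\<lambda>x. \<integral>\<^sup>+y. f (x, y) \<partial>lborel) \<in> borel_measurable borel"
proof -
  have m: "f \<in> borel_measurable (lborel \<Otimes>\<^sub>M lborel)" using assms by (simp add: lborel_prod)
  show "(\<integral>\<^sup>+z. f z \<partial>lborel) = (\<integral>\<^sup>+x. \<integral>\<^sup>+y. f (x, y) \<partial>lborel \<partial>lborel)"
    using lborel.nn_integral_fst[OF m] by (simp add: lborel_prod)
  show "(\<lambda>x. \<integral>\<^sup>+y. f (x, y) \<partial>lborel) \<in> borel_measurable borel"
    using lborel.borel_measurable_nn_integral_fst[OF m] by simp
qed

text \<open>
  Write the difference as the integral of the derivative along the segment from \<open>x\<close> to
  \<open>x + h\<close>, apply Cauchy-Schwarz in the segment parameter, and use translation
  invariance after exchanging the integrals.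
\<close>

lemma L2_translation_estimate:
  fixes \<phi> :: "'a::euclidean_space \<Rightarrow> real"
  assumes D: "\<And>x. GDERIV \<phi> x :> \<phi>' x" and cont: "continuous_on UNIV \<phi>'"
  shows "(\<integral>\<^sup>+x. ennreal ((\<phi> (x + h) - \<phi> x)\<^sup>2) \<partial>lborel) \<le>
    ennreal ((norm h)\<^sup>2) * (\<integral>\<^sup>+x. ennreal ((norm (\<phi>' x))\<^sup>2) \<partial>lborel)"
proof -
  have c2: "continuous_on A (\<lambda>t. \<phi>' (f t))" if "continuous_on A f" for A and f :: "'c::topological_space \<Rightarrow> 'a"
    by (rule continuous_on_compose2[OF cont that]) auto
  have pt: "ennreal ((\<phi> (x + h) - \<phi> x)\<^sup>2) \<le>
     ennreal ((norm h)\<^sup>2) * (\<integral>\<^sup>+t. ennreal ((norm (\<phi>' (x + t *\<^sub>R h)))\<^sup>2) * indicator {0..1} t \<partial>lborel)" for x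
  proof -
    have "((\<lambda>t. \<phi> (x + t *\<^sub>R h)) has_vector_derivative (h \<bullet> \<phi>' (x + t *\<^sub>R h))) (at t within {0..1})" for t
    proof -
      have "(\<phi> has_derivative (\<lambda>k. k \<bullet> \<phi>' (x + t *\<^sub>R h))) (at (x + t *\<^sub>R h))"
        using D by (simp add: gderiv_def)
      moreover have "((\<lambda>t. x + t *\<^sub>R h) has_derivative (\<lambda>s. s *\<^sub>R h)) (at t within {0..1})"
        by (auto intro!: derivative_eq_intros)
      ultimately show ?thesis unfolding has_vector_derivative_def
        using has_derivative_compose[of "\<lambda>t. x + t *\<^sub>R h" "\<lambda>s. s *\<^sub>R h" t "{0..1}" \<phi> "\<lambda>k. k \<bullet> \<phi>' (x + t *\<^sub>R h)"]
        by simp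
    qed
    then have "((\<lambda>t. h \<bullet> \<phi>' (x + t *\<^sub>R h)) has_integral (\<phi> (x + 1 *\<^sub>R h) - \<phi> (x + 0 *\<^sub>R h))) {0..1}"
      by (intro fundamental_theorem_of_calculus) auto
    then have "\<phi> (x + h) - \<phi> x = integral {0..1} (\<lambda>t. h \<bullet> \<phi>' (x + t *\<^sub>R h))"
      by (simp add: integral_unique)
    then have "(\<phi> (x + h) - \<phi> x)\<^sup>2 \<le> integral {0..1} (\<lambda>t. (h \<bullet> \<phi>' (x + t *\<^sub>R h))\<^sup>2)"
      by (simp only:) (intro square_integral_le_integral_square continuous_intros c2)
    also have "\<dots> \<le> integral {0..1} (\<lambda>t. (norm h)\<^sup>2 * (norm (\<phi>' (x + t *\<^sub>R h)))\<^sup>2)"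
    proof (intro integral_le integrable_continuous_real continuous_intros c2)
      fix t show "(h \<bullet> \<phi>' (x + t *\<^sub>R h))\<^sup>2 \<le> (norm h)\<^sup>2 * (norm (\<phi>' (x + t *\<^sub>R h)))\<^sup>2"
        using Cauchy_Schwarz_ineq2[of h "\<phi>' (x + t *\<^sub>R h)"]
        by (metis abs_le_square_iff abs_mult abs_norm_cancel power_mult_distrib)
    qed
    also have "\<dots> = (norm h)\<^sup>2 * integral {0..1} (\<lambda>t. (norm (\<phi>' (x + t *\<^sub>R h)))\<^sup>2)"
      by simp
    finally have "(\<phi> (x + h) - \<phi> x)\<^sup>2 \<le> (norm h)\<^sup>2 * integral {0..1} (\<lambda>t. (norm (\<phi>' (x + t *\<^sub>R h)))\<^sup>2)" .
    moreover have "(\<integral>\<^sup>+t. ennreal ((norm (\<phi>' (x + t *\<^sub>R h)))\<^sup>2) * indicator {0..1} t \<partial>lborel)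
       = ennreal (integral {0..1} (\<lambda>t. (norm (\<phi>' (x + t *\<^sub>R h)))\<^sup>2))"
    proof (rule nn_integral_has_integral_lebesgue')
      show "((\<lambda>t. (norm (\<phi>' (x + t *\<^sub>R h)))\<^sup>2) has_integral
          integral {0..1} (\<lambda>t. (norm (\<phi>' (x + t *\<^sub>R h)))\<^sup>2)) {0..1}"
        by (intro integrable_integral integrable_continuous_real continuous_intros c2)
    qed auto
    ultimately show ?thesis
      by (simp add: ennreal_mult[symmetric] integral_nonneg integrable_continuous_real continuous_intros c2 ennreal_leI)
  qed
  have [measurable]: "\<phi>' \<in> borel_measurable borel"
    using cont by (rule borel_measurable_continuous_onI)
  have "(\<integral>\<^sup>+x. ennreal ((\<phi> (x + h) - \<phi> x)\<^sup>2) \<partial>lborel) \<le>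
     (\<integral>\<^sup>+x. ennreal ((norm h)\<^sup>2) * (\<integral>\<^sup>+t. ennreal ((norm (\<phi>' (x + t *\<^sub>R h)))\<^sup>2) * indicator {0..1::real} t \<partial>lborel) \<partial>lborel)"
    by (intro nn_integral_mono pt)
  also have "\<dots> = ennreal ((norm h)\<^sup>2) *
     (\<integral>\<^sup>+x. (\<integral>\<^sup>+t. ennreal ((norm (\<phi>' (x + t *\<^sub>R h)))\<^sup>2) * indicator {0..1::real} t \<partial>lborel) \<partial>lborel)"
    by (rule nn_integral_cmult) measurable
  also have "(\<integral>\<^sup>+x. (\<integral>\<^sup>+t. ennreal ((norm (\<phi>' (x + t *\<^sub>R h)))\<^sup>2) * indicator {0..1::real} t \<partial>lborel) \<partial>lborel) =
     (\<integral>\<^sup>+t. (\<integral>\<^sup>+x. ennreal ((norm (\<phi>' (x + t *\<^sub>R h)))\<^sup>2) * indicator {0..1::real} t \<partial>lborel) \<partial>lborel)"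
    by (rule lborel_pair.Fubini') measurable
  also have "\<dots> = (\<integral>\<^sup>+t. (\<integral>\<^sup>+x. ennreal ((norm (\<phi>' x))\<^sup>2) \<partial>lborel) * indicator {0..1::real} t \<partial>lborel)"
  proof (rule nn_integral_cong)
    fix t :: real
    have "(\<integral>\<^sup>+x. ennreal ((norm (\<phi>' (x + t *\<^sub>R h)))\<^sup>2) * indicator {0..1::real} t \<partial>lborel)
      = (\<integral>\<^sup>+x. ennreal ((norm (\<phi>' (x + t *\<^sub>R h)))\<^sup>2) \<partial>lborel) * indicator {0..1::real} t"
      by (rule nn_integral_multc) measurable
    also have "(\<integral>\<^sup>+x. ennreal ((norm (\<phi>' (x + t *\<^sub>R h)))\<^sup>2) \<partial>lborel) = (\<integral>\<^sup>+x. ennreal ((norm (\<phi>' x))\<^sup>2) \<partial>lborel)"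
      by (rule nn_integral_translation[where f="\<lambda>x. ennreal ((norm (\<phi>' x))\<^sup>2)"]) measurable
    finally show "(\<integral>\<^sup>+x. ennreal ((norm (\<phi>' (x + t *\<^sub>R h)))\<^sup>2) * indicator {0..1::real} t \<partial>lborel)
      = (\<integral>\<^sup>+x. ennreal ((norm (\<phi>' x))\<^sup>2) \<partial>lborel) * indicator {0..1::real} t" .
  qed
  also have "\<dots> = (\<integral>\<^sup>+x. ennreal ((norm (\<phi>' x))\<^sup>2) \<partial>lborel)"
    by (simp add: nn_integral_cmult)
  finally show ?thesis .
qed

lemma integrable_compact_support:
  fixes f :: "'a::euclidean_space \<Rightarrow> real"
  assumes "f \<in> borel_measurable borel" "compact K" "\<And>x. x \<notin> K \<Longrightarrow> f x = 0"
    "\<And>x. x \<in> K \<Longrightarrow> \<bar>f x\<bar> \<le> c"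
  shows "integrable lborel f"
proof (rule integrableI_bounded_set[where A=K and B=c])
  show "K \<in> sets lborel" using \<open>compact K\<close> by (simp add: compact_imp_closed)
  show "emeasure lborel K < \<infinity>"
    using emeasure_bounded_finite[OF compact_imp_bounded[OF \<open>compact K\<close>]] by simp
qed (use assms in auto)

lemma integrable_continuous_compact_support:
  fixes f :: "'a::euclidean_space \<Rightarrow> real"
  assumes "continuous_on UNIV f" "compact K" "\<And>x. x \<notin> K \<Longrightarrow> f x = 0"
  shows "integrable lborel f"
proof -
  have "compact ((\<lambda>x. f x) ` K)"
    by (rule compact_continuous_image) (use assms continuous_on_subset[OF assms(1)] in auto)
  then obtain c where "\<forall>y\<in>f ` K. norm y \<le> c"
    using compact_imp_bounded bounded_iff by metis
  with assms show ?thesis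
    by (intro integrable_compact_support[where K=K and c=c] borel_measurable_continuous_onI) auto
qed

section \<open>A Poincare inequality on a grid of cubes\<close>

text \<open>
  Half-open cubes, so that a grid of them is an exact partition.
\<close>

definition grid_cell :: "real \<Rightarrow> 'a::euclidean_space \<Rightarrow> 'a set" where
  "grid_cell s a = {x. \<forall>i\<in>Basis. a \<bullet> i \<le> x \<bullet> i \<and> x \<bullet> i < a \<bullet> i + s}"

lemma grid_cell_measurable [measurable]: "grid_cell s a \<in> sets borel"
  unfolding grid_cell_def by measurable

lemma emeasure_grid_cell:
  fixes a :: "'a::euclidean_space"
  assumes "0 < s"
  shows "emeasure lborel (grid_cell s a) = ennreal (s ^ DIM('a))"
proof (rule antisym)
  have "emeasure lborel (grid_cell s a) \<le> emeasure lborel (cbox a (a + s *\<^sub>R One))"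
    by (rule emeasure_mono) (auto simp: grid_cell_def mem_box inner_add_left less_imp_le)
  also have "\<dots> = ennreal (s ^ DIM('a))"
    using assms by (subst emeasure_lborel_cbox) (auto simp: inner_add_left)
  finally show "emeasure lborel (grid_cell s a) \<le> ennreal (s ^ DIM('a))" .
  have "ennreal (s ^ DIM('a)) = emeasure lborel (box a (a + s *\<^sub>R One))"
    using assms by (subst emeasure_lborel_box) (auto simp: inner_add_left)
  also have "\<dots> \<le> emeasure lborel (grid_cell s a)"
    by (rule emeasure_mono) (auto simp: grid_cell_def mem_box inner_add_left less_imp_le)
  finally show "ennreal (s ^ DIM('a)) \<le> emeasure lborel (grid_cell s a)" .
qed

text \<open>
  The right-hand side is \<open>2 m\<^sup>2\<close> times the variance of \<open>f\<close> on
  \<open>Q\<close>. In this form the variance is controlled by translations of \<open>f\<close>.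
\<close>

lemma double_integral_difference_square:
  fixes f :: "'a::euclidean_space \<Rightarrow> real"
  assumes [measurable]: "Q \<in> sets borel" and Q: "emeasure lborel Q = ennreal m" "0 \<le> m"
    and f: "integrable lborel f" and f2: "integrable lborel (\<lambda>x. (f x)\<^sup>2)"
  shows "(\<integral>\<^sup>+x. \<integral>\<^sup>+y. ennreal ((f y - f x)\<^sup>2) * indicator Q x * indicator Q y \<partial>lborel \<partial>lborel) =
    ennreal (2 * m * (LINT x:Q|lborel. (f x)\<^sup>2) - 2 * (LINT x:Q|lborel. f x)\<^sup>2)"
proof -
  define I where "I = (LINT x:Q|lborel. f x)"
  define I2 where "I2 = (LINT x:Q|lborel. (f x)\<^sup>2)"
  have [measurable]: "f \<in> borel_measurable borel" using f by auto
  have mQ: "measure lborel Q = m" using Q by (simp add: measure_def)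
  have i1: "integrable lborel (\<lambda>y. c * indicator Q y)" for c :: real
    using Q by (intro integrable_mult_right integrable_real_indicator) auto
  have i2: "integrable lborel (\<lambda>y. f y * indicator Q y)"
    by (rule integrable_real_mult_indicator) (use f in auto)
  have i3: "integrable lborel (\<lambda>y. (f y)\<^sup>2 * indicator Q y)"
    by (rule integrable_real_mult_indicator) (use f2 in auto)
  have h: "has_bochner_integral lborel (\<lambda>y. f y * indicator Q y) I"
    "has_bochner_integral lborel (\<lambda>y. (f y)\<^sup>2 * indicator Q y) I2"
    "has_bochner_integral lborel (\<lambda>y. indicator Q y) m"
    using i1[of 1] i2 i3 mQ
    by (simp_all add: has_bochner_integral_iff I_def I2_def set_lebesgue_integral_def mult.commute)
  have inner_h: "has_bochner_integral lborel (\<lambda>y. (f y - f x)\<^sup>2 * indicator Q y) (I2 - 2 * f x * I + (f x)\<^sup>2 * m)" for x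
  proof -
    have eq: "(\<lambda>y. (f y - f x)\<^sup>2 * indicator Q y) =
        (\<lambda>y. (f y)\<^sup>2 * indicator Q y - (2 * f x) * (f y * indicator Q y) + (f x)\<^sup>2 * indicator Q y)"
      by (simp add: power2_eq_square algebra_simps)
    show ?thesis unfolding eq
      by (intro has_bochner_integral_add has_bochner_integral_diff has_bochner_integral_mult_right h)
  qed
  have inner: "(\<integral>\<^sup>+y. ennreal ((f y - f x)\<^sup>2) * indicator Q x * indicator Q y \<partial>lborel) =
      ennreal ((I2 - 2 * f x * I + (f x)\<^sup>2 * m) * indicator Q x)" for x
  proof -
    have "(\<integral>\<^sup>+y. ennreal ((f y - f x)\<^sup>2) * indicator Q x * indicator Q y \<partial>lborel) =
        (\<integral>\<^sup>+y. ennreal ((f y - f x)\<^sup>2 * indicator Q y) \<partial>lborel) * indicator Q x"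
      by (subst nn_integral_multc[symmetric]) (auto intro!: nn_integral_cong simp: indicator_def)
    also have "(\<integral>\<^sup>+y. ennreal ((f y - f x)\<^sup>2 * indicator Q y) \<partial>lborel) =
        ennreal (LINT y|lborel. (f y - f x)\<^sup>2 * indicator Q y)"
      by (rule nn_integral_eq_integral) (use inner_h in \<open>auto simp: has_bochner_integral_iff\<close>)
    also have "(LINT y|lborel. (f y - f x)\<^sup>2 * indicator Q y) = I2 - 2 * f x * I + (f x)\<^sup>2 * m"
      using inner_h by (rule has_bochner_integral_integral_eq)
    finally show ?thesis by (simp add: indicator_def)
  qed
  have nn: "0 \<le> (I2 - 2 * f x * I + (f x)\<^sup>2 * m) * indicator Q x" for x
  proof -
    have "0 \<le> (LINT y|lborel. (f y - f x)\<^sup>2 * indicator Q y)"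
      by (rule Bochner_Integration.integral_nonneg) simp
    then show ?thesis unfolding has_bochner_integral_integral_eq[OF inner_h] by simp
  qed
  have outer_h: "has_bochner_integral lborel (\<lambda>x. (I2 - 2 * f x * I + (f x)\<^sup>2 * m) * indicator Q x)
      (I2 * m - 2 * I * I + m * I2)"
  proof -
    have eq: "(\<lambda>x. (I2 - 2 * f x * I + (f x)\<^sup>2 * m) * indicator Q x) =
      (\<lambda>x. I2 * indicator Q x - (2 * I) * (f x * indicator Q x) + m * ((f x)\<^sup>2 * indicator Q x))"
      by (simp add: algebra_simps)
    show ?thesis unfolding eq
      by (intro has_bochner_integral_add has_bochner_integral_diff has_bochner_integral_mult_right h)
  qed
  have "(\<integral>\<^sup>+x. ennreal ((I2 - 2 * f x * I + (f x)\<^sup>2 * m) * indicator Q x) \<partial>lborel) =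
      ennreal (LINT x|lborel. (I2 - 2 * f x * I + (f x)\<^sup>2 * m) * indicator Q x)"
    by (rule nn_integral_eq_integral) (use nn outer_h in \<open>auto simp: has_bochner_integral_iff\<close>)
  also have "(LINT x|lborel. (I2 - 2 * f x * I + (f x)\<^sup>2 * m) * indicator Q x) = I2 * m - 2 * I * I + m * I2"
    using outer_h by (rule has_bochner_integral_integral_eq)
  finally show ?thesis
    unfolding inner I_def[symmetric] I2_def[symmetric] by (simp add: power2_eq_square algebra_simps)
qed

text \<open>
  Two points of a cube of side \<open>s\<close> differ by a vector of the cube
  \<open>[-s, s]\<close>, so this double integral dominates the sum of the variances over all cells
  of a grid at once.
\<close>

lemma translation_energy_on_cube:
  fixes \<phi> :: "'a::euclidean_space \<Rightarrow> real" and s :: real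
  assumes D: "\<And>x. GDERIV \<phi> x :> \<phi>' x" and cont: "continuous_on UNIV \<phi>'" and "0 < s"
  shows "(\<integral>\<^sup>+x. \<integral>\<^sup>+y. ennreal ((\<phi> y - \<phi> x)\<^sup>2) * indicator (cbox (- s *\<^sub>R One) (s *\<^sub>R One)) (y - x)
      \<partial>lborel \<partial>lborel) \<le>
    ennreal ((2 * s) ^ DIM('a) * (DIM('a) * s)\<^sup>2) * (\<integral>\<^sup>+x. ennreal ((norm (\<phi>' x))\<^sup>2) \<partial>lborel)"
proof -
  let ?H = "cbox (- s *\<^sub>R One) (s *\<^sub>R One) :: 'a set"
  let ?E = "\<integral>\<^sup>+x. ennreal ((norm (\<phi>' x))\<^sup>2) \<partial>lborel"
  have "continuous_on UNIV \<phi>"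
    using D by (auto simp: gderiv_def intro!: continuous_at_imp_continuous_on has_derivative_continuous)
  then have [measurable]: "\<phi> \<in> borel_measurable borel" by (rule borel_measurable_continuous_onI)
  have shift: "(\<integral>\<^sup>+y. ennreal ((\<phi> y - \<phi> x)\<^sup>2) * indicator ?H (y - x) \<partial>lborel) =
      (\<integral>\<^sup>+h. ennreal ((\<phi> (x + h) - \<phi> x)\<^sup>2) * indicator ?H h \<partial>lborel)" for x
    by (subst nn_integral_translation[symmetric, where h=x]) (auto simp: add.commute)
  have bound: "(\<integral>\<^sup>+x. ennreal ((\<phi> (x + h) - \<phi> x)\<^sup>2) * indicator ?H h \<partial>lborel) \<le>
      ennreal ((DIM('a) * s)\<^sup>2) * ?E * indicator ?H h" for h
  proof (cases "h \<in> ?H")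
    case True
    have "norm h \<le> (\<Sum>i\<in>Basis. \<bar>h \<bullet> i\<bar>)" by (rule norm_le_l1)
    also have "\<dots> \<le> (\<Sum>i\<in>(Basis::'a set). s)"
      using True by (intro sum_mono) (auto simp: mem_box abs_le_iff)
    finally have "norm h \<le> DIM('a) * s" by simp
    then have "ennreal ((norm h)\<^sup>2) \<le> ennreal ((DIM('a) * s)\<^sup>2)"
      by (intro ennreal_leI power_mono) auto
    with L2_translation_estimate[OF D cont, of h]
    have "(\<integral>\<^sup>+x. ennreal ((\<phi> (x + h) - \<phi> x)\<^sup>2) \<partial>lborel) \<le> ennreal ((DIM('a) * s)\<^sup>2) * ?E"
      by (meson mult_right_mono order_trans zero_le)
    with True show ?thesis by simp
  qed simp
  have "(\<integral>\<^sup>+x. \<integral>\<^sup>+y. ennreal ((\<phi> y - \<phi> x)\<^sup>2) * indicator ?H (y - x) \<partial>lborel \<partial>lborel) =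
      (\<integral>\<^sup>+x. \<integral>\<^sup>+h. ennreal ((\<phi> (x + h) - \<phi> x)\<^sup>2) * indicator ?H h \<partial>lborel \<partial>lborel)"
    by (simp only: shift)
  also have "\<dots> = (\<integral>\<^sup>+h. \<integral>\<^sup>+x. ennreal ((\<phi> (x + h) - \<phi> x)\<^sup>2) * indicator ?H h \<partial>lborel \<partial>lborel)"
    by (rule lborel_pair.Fubini') measurable
  also have "\<dots> \<le> (\<integral>\<^sup>+h. ennreal ((DIM('a) * s)\<^sup>2) * ?E * indicator ?H h \<partial>lborel)"
    by (intro nn_integral_mono bound)
  also have "\<dots> = ennreal ((DIM('a) * s)\<^sup>2) * ?E * emeasure lborel ?H"
    by (rule nn_integral_cmult_indicator) auto
  also have "emeasure lborel ?H = ennreal ((2 * s) ^ DIM('a))"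
    using \<open>0 < s\<close> by (subst emeasure_lborel_cbox) (auto simp: algebra_simps)
  finally show ?thesis
    using \<open>0 < s\<close> by (subst ennreal_mult) (auto simp: ac_simps)
qed

text \<open>
  On each cell the integral of \<open>\<phi>\<^sup>2\<close> splits into the contribution of the
  average and the variance, and all variances together cost a multiple of \<open>s\<^sup>2\<close>
  times the Dirichlet energy. Small cells thus reduce control of the mass to finitely many averages;
  this is the compactness of the Sobolev embedding in quantitative form.
\<close>

lemma grid_poincare_inequality:
  fixes \<phi> :: "'a::euclidean_space \<Rightarrow> real" and s :: real
  assumes D: "\<And>x. GDERIV \<phi> x :> \<phi>' x" and cont: "continuous_on UNIV \<phi>'" and "0 < s"
    and K: "compact K" "\<And>x. x \<notin> K \<Longrightarrow> \<phi> x = 0" and int: "integrable lborel (\<lambda>x. (norm (\<phi>' x))\<^sup>2)"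
    and A: "finite A" "disjoint_family_on (grid_cell s) A" "K \<subseteq> (\<Union>a\<in>A. grid_cell s a)"
  shows "(LINT x|lborel. (\<phi> x)\<^sup>2) \<le> (\<Sum>a\<in>A. (LINT x:grid_cell s a|lborel. \<phi> x)\<^sup>2) / s ^ DIM('a) +
    2 ^ DIM('a) * (DIM('a) * s)\<^sup>2 / 2 * (LINT x|lborel. (norm (\<phi>' x))\<^sup>2)"
proof -
  let ?H = "cbox (- s *\<^sub>R One) (s *\<^sub>R One) :: 'a set"
  let ?m = "s ^ DIM('a)"
  let ?E = "LINT x|lborel. (norm (\<phi>' x))\<^sup>2"
  define I where "I a = (LINT x:grid_cell s a|lborel. \<phi> x)" for a
  define I2 where "I2 a = (LINT x:grid_cell s a|lborel. (\<phi> x)\<^sup>2)" for a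
  have c: "continuous_on UNIV \<phi>"
    using D by (auto simp: gderiv_def intro!: continuous_at_imp_continuous_on has_derivative_continuous)
  then have [measurable]: "\<phi> \<in> borel_measurable borel" by (rule borel_measurable_continuous_onI)
  have f: "integrable lborel \<phi>" "integrable lborel (\<lambda>x. (\<phi> x)\<^sup>2)"
    using K by (auto intro!: integrable_continuous_compact_support[where K=K] continuous_intros c)
  have nnI: "0 \<le> 2 * ?m * I2 a - 2 * (I a)\<^sup>2" for a
  proof -
    have "(I a)\<^sup>2 \<le> ?m * I2 a"
    proof -
      have g: "integrable lborel (\<lambda>x. indicator (grid_cell s a) x :: real)" for a :: 'a
        using emeasure_grid_cell[OF \<open>0 < s\<close>, of a] by (intro integrable_real_indicator) auto
      have "I a / ?m * I a * 2 \<le> I2 a + (I a / ?m)\<^sup>2 * ?m"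
      proof -
        let ?c = "I a / ?m"
        have ig: "integrable lborel (\<lambda>x. indicator (grid_cell s a) x * \<phi> x)"
           "integrable lborel (\<lambda>x. indicator (grid_cell s a) x * (\<phi> x)\<^sup>2)"
          using integrable_real_mult_indicator[OF _ f(1)] integrable_real_mult_indicator[OF _ f(2)]
          by (simp_all add: mult.commute)
        have "0 \<le> (LINT x|lborel. indicator (grid_cell s a) x * (\<phi> x)\<^sup>2
            - 2 * ?c * (indicator (grid_cell s a) x * \<phi> x) + ?c\<^sup>2 * indicator (grid_cell s a) x)"
        proof (rule Bochner_Integration.integral_nonneg)
          fix x
          have "indicator (grid_cell s a) x * (\<phi> x)\<^sup>2
            - 2 * ?c * (indicator (grid_cell s a) x * \<phi> x) + ?c\<^sup>2 * indicator (grid_cell s a) x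
            = indicator (grid_cell s a) x * (\<phi> x - ?c)\<^sup>2"
            by (simp add: power2_eq_square algebra_simps)
          then show "0 \<le> indicator (grid_cell s a) x * (\<phi> x)\<^sup>2
            - 2 * ?c * (indicator (grid_cell s a) x * \<phi> x) + ?c\<^sup>2 * indicator (grid_cell s a) x"
            by (metis indicator_pos_le mult_nonneg_nonneg zero_le_power2)
        qed
        also have "\<dots> = I2 a - 2 * ?c * I a + ?c\<^sup>2 * ?m"
          using emeasure_grid_cell[OF \<open>0 < s\<close>, of a] \<open>0 < s\<close>
          by (simp add: ig g I_def I2_def set_lebesgue_integral_def measure_def)
        finally show ?thesis by (simp add: mult.commute mult.left_commute)
      qed
      then show ?thesis using \<open>0 < s\<close> by (simp add: field_simps power2_eq_square)
    qed
    then show ?thesis by simp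
  qed
  have "ennreal (\<Sum>a\<in>A. 2 * ?m * I2 a - 2 * (I a)\<^sup>2) = (\<Sum>a\<in>A. ennreal (2 * ?m * I2 a - 2 * (I a)\<^sup>2))"
    by (rule sum_ennreal[symmetric]) (use nnI in auto)
  also have "\<dots> = (\<Sum>a\<in>A. \<integral>\<^sup>+x. \<integral>\<^sup>+y. ennreal ((\<phi> y - \<phi> x)\<^sup>2) *
      indicator (grid_cell s a) x * indicator (grid_cell s a) y \<partial>lborel \<partial>lborel)"
    unfolding I_def I2_def
    by (intro sum.cong refl double_integral_difference_square[symmetric] emeasure_grid_cell f)
       (use \<open>0 < s\<close> in auto)
  also have "\<dots> = (\<integral>\<^sup>+x. \<integral>\<^sup>+y. (\<Sum>a\<in>A. ennreal ((\<phi> y - \<phi> x)\<^sup>2) *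
      indicator (grid_cell s a) x * indicator (grid_cell s a) y) \<partial>lborel \<partial>lborel)"
    by (subst nn_integral_sum[symmetric], measurable, intro nn_integral_cong, subst nn_integral_sum[symmetric])
       auto
  also have "\<dots> \<le> (\<integral>\<^sup>+x. \<integral>\<^sup>+y. ennreal ((\<phi> y - \<phi> x)\<^sup>2) * indicator ?H (y - x) \<partial>lborel \<partial>lborel)"
  proof (intro nn_integral_mono)
    fix x y :: 'a
    show "(\<Sum>a\<in>A. ennreal ((\<phi> y - \<phi> x)\<^sup>2) * indicator (grid_cell s a) x * indicator (grid_cell s a) y) \<le>
       ennreal ((\<phi> y - \<phi> x)\<^sup>2) * indicator ?H (y - x)"
    proof (cases "\<exists>b\<in>A. x \<in> grid_cell s b \<and> y \<in> grid_cell s b")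
      case False
      then have "(\<Sum>a\<in>A. ennreal ((\<phi> y - \<phi> x)\<^sup>2) * indicator (grid_cell s a) x * indicator (grid_cell s a) y) = 0"
        by (intro sum.neutral) (auto simp: indicator_def)
      then show ?thesis by simp
    next
      case True
      then obtain b where b: "b \<in> A" "x \<in> grid_cell s b" "y \<in> grid_cell s b" by blast
      have "y - x \<in> ?H"
        using b(2,3) by (force simp: grid_cell_def mem_box inner_diff_left)
      moreover have "(\<Sum>a\<in>A. ennreal ((\<phi> y - \<phi> x)\<^sup>2) * indicator (grid_cell s a) x * indicator (grid_cell s a) y)
        = (\<Sum>a\<in>{b}. ennreal ((\<phi> y - \<phi> x)\<^sup>2) * indicator (grid_cell s a) x * indicator (grid_cell s a) y)"
      proof (rule sum.mono_neutral_right[OF \<open>finite A\<close>])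
        show "\<forall>a\<in>A - {b}. ennreal ((\<phi> y - \<phi> x)\<^sup>2) * indicator (grid_cell s a) x * indicator (grid_cell s a) y = 0"
          using A(2) b by (fastforce simp: disjoint_family_on_def indicator_def)
      qed (use b in auto)
      ultimately show ?thesis using b by simp
    qed
  qed
  also have "\<dots> \<le> ennreal ((2 * s) ^ DIM('a) * (DIM('a) * s)\<^sup>2) * (\<integral>\<^sup>+x. ennreal ((norm (\<phi>' x))\<^sup>2) \<partial>lborel)"
    by (rule translation_energy_on_cube[OF D cont \<open>0 < s\<close>])
  also have "(\<integral>\<^sup>+x. ennreal ((norm (\<phi>' x))\<^sup>2) \<partial>lborel) = ennreal ?E"
    by (rule nn_integral_eq_integral) (use int in auto)
  also have "ennreal ((2 * s) ^ DIM('a) * (DIM('a) * s)\<^sup>2) * ennreal ?E =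
      ennreal ((2 * s) ^ DIM('a) * (DIM('a) * s)\<^sup>2 * ?E)"
    using \<open>0 < s\<close> by (subst ennreal_mult) (auto intro!: Bochner_Integration.integral_nonneg)
  finally have "(\<Sum>a\<in>A. 2 * ?m * I2 a - 2 * (I a)\<^sup>2) \<le> (2 * s) ^ DIM('a) * (DIM('a) * s)\<^sup>2 * ?E"
    using \<open>0 < s\<close> by (subst (asm) ennreal_le_iff) (auto intro!: mult_nonneg_nonneg Bochner_Integration.integral_nonneg)
  then have main: "2 * ?m * (\<Sum>a\<in>A. I2 a) \<le> 2 * (\<Sum>a\<in>A. (I a)\<^sup>2) + (2 * s) ^ DIM('a) * (DIM('a) * s)\<^sup>2 * ?E"
    by (simp add: sum_subtractf sum_distrib_left)
  have "(\<Sum>a\<in>A. I2 a) = (LINT x:(\<Union>a\<in>A. grid_cell s a)|lborel. (\<phi> x)\<^sup>2)"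
    unfolding I2_def
    by (rule set_integral_finite_Union[symmetric])
       (use A integrable_real_mult_indicator[OF _ f(2)] in \<open>auto simp: set_integrable_def mult.commute\<close>)
  also have "\<dots> = (LINT x|lborel. (\<phi> x)\<^sup>2)"
    unfolding set_lebesgue_integral_def
    by (intro Bochner_Integration.integral_cong) (use K A(3) in \<open>auto simp: indicator_def\<close>)
  finally have "2 * ?m * (LINT x|lborel. (\<phi> x)\<^sup>2) \<le>
     2 * (\<Sum>a\<in>A. (I a)\<^sup>2) + (2 * s) ^ DIM('a) * (DIM('a) * s)\<^sup>2 * ?E" using main by simp
  moreover have "(2 * s) ^ DIM('a) = 2 ^ DIM('a) * ?m" by (rule power_mult_distrib)
  moreover have "2 * ?m * (X / ?m + Y / 2 * Z) = 2 * X + Y * ?m * Z" for X Y Z :: real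
    using \<open>0 < s\<close> by (simp add: distrib_left)
  ultimately have "2 * ?m * (LINT x|lborel. (\<phi> x)\<^sup>2) \<le>
     2 * ?m * ((\<Sum>a\<in>A. (I a)\<^sup>2) / ?m + 2 ^ DIM('a) * (DIM('a) * s)\<^sup>2 / 2 * ?E)"
    by (simp only:) (simp only: ac_simps)
  then show ?thesis using \<open>0 < s\<close> unfolding I_def by simp
qed

lemma finite_grid_cover:
  fixes S :: "'a::euclidean_space set"
  assumes "bounded S" "0 < s"
  obtains A where "finite A" "disjoint_family_on (grid_cell s) A" "S \<subseteq> (\<Union>a\<in>A. grid_cell s a)"
proof -
  obtain b where b: "\<And>x. x \<in> S \<Longrightarrow> norm x \<le> b" using assms(1) bounded_iff by metis
  \<comment> \<open>\<open>c x\<close> is the lower corner of the cell of \<open>x\<close> in the grid \<open>s\<close> times the integer lattice\<close>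
  define c :: "'a \<Rightarrow> 'a" where "c x = (\<Sum>i\<in>Basis. (s * of_int \<lfloor>(x \<bullet> i) / s\<rfloor>) *\<^sub>R i)" for x
  have ci: "c x \<bullet> i = s * of_int \<lfloor>(x \<bullet> i) / s\<rfloor>" if "i \<in> Basis" for x i
    unfolding c_def using that by (simp add: inner_sum_left_Basis)
  have mem: "x \<in> grid_cell s (c x)" for x
  proof -
    have "s * of_int \<lfloor>(x \<bullet> i) / s\<rfloor> \<le> x \<bullet> i \<and> x \<bullet> i < s * of_int \<lfloor>(x \<bullet> i) / s\<rfloor> + s" for i
    proof -
      have "of_int \<lfloor>(x \<bullet> i) / s\<rfloor> \<le> (x \<bullet> i) / s" "(x \<bullet> i) / s < of_int \<lfloor>(x \<bullet> i) / s\<rfloor> + 1"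
        by linarith+
      from mult_left_mono[OF this(1), of s] mult_strict_left_mono[OF this(2), of s]
      show ?thesis using \<open>0 < s\<close> by (simp add: distrib_left)
    qed
    then show ?thesis by (auto simp: grid_cell_def ci)
  qed
  have uniq: "c x = c y" if "x \<in> grid_cell s (c y)" for x y
  proof (rule euclidean_eqI)
    fix i :: 'a assume i: "i \<in> Basis"
    define k where "k = \<lfloor>(y \<bullet> i) / s\<rfloor>"
    have "s * of_int k \<le> x \<bullet> i" "x \<bullet> i < s * of_int k + s"
      using that i by (auto simp: grid_cell_def ci k_def)
    then have "of_int k \<le> (x \<bullet> i) / s" "(x \<bullet> i) / s < of_int k + 1"
      using \<open>0 < s\<close> by (auto simp: field_simps)
    then have "\<lfloor>(x \<bullet> i) / s\<rfloor> = k" by linarith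
    then show "c x \<bullet> i = c y \<bullet> i" using i by (simp add: ci k_def)
  qed
  have "finite (c ` S)"
  proof (rule finite_subset)
    let ?Z = "{- \<lceil>b / s\<rceil> - 1 .. \<lceil>b / s\<rceil> + 1}"
    show "finite ((\<lambda>f. \<Sum>i\<in>Basis. (s * of_int (f i)) *\<^sub>R i :: 'a) ` (Basis \<rightarrow>\<^sub>E ?Z))"
      by (intro finite_imageI finite_PiE) auto
    show "c ` S \<subseteq> (\<lambda>f. \<Sum>i\<in>Basis. (s * of_int (f i)) *\<^sub>R i :: 'a) ` (Basis \<rightarrow>\<^sub>E ?Z)"
    proof
      fix z assume "z \<in> c ` S"
      then obtain x where x: "x \<in> S" "z = c x" by blast
      have rng: "\<lfloor>(x \<bullet> i) / s\<rfloor> \<in> ?Z" if "i \<in> Basis" for i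
      proof -
        have "\<bar>x \<bullet> i\<bar> \<le> b" using Basis_le_norm[OF that, of x] b[OF x(1)] by linarith
        then have "\<bar>(x \<bullet> i) / s\<bar> \<le> b / s" using \<open>0 < s\<close> by (simp add: divide_right_mono)
        then have "- (b / s) \<le> (x \<bullet> i) / s" "(x \<bullet> i) / s \<le> b / s" by (simp_all only: abs_le_iff) linarith+
        then have "- \<lceil>b / s\<rceil> - 1 \<le> \<lfloor>(x \<bullet> i) / s\<rfloor>" "\<lfloor>(x \<bullet> i) / s\<rfloor> \<le> \<lceil>b / s\<rceil> + 1" by linarith+
        then show ?thesis by simp
      qed
      have "z = (\<Sum>i\<in>Basis. (s * of_int (restrict (\<lambda>i. \<lfloor>(x \<bullet> i) / s\<rfloor>) Basis i)) *\<^sub>R i)"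
        unfolding x(2) c_def by (intro sum.cong) auto
      then show "z \<in> (\<lambda>f. \<Sum>i\<in>Basis. (s * of_int (f i)) *\<^sub>R i :: 'a) ` (Basis \<rightarrow>\<^sub>E ?Z)"
        by (rule image_eqI[where x="restrict (\<lambda>i. \<lfloor>(x \<bullet> i) / s\<rfloor>) Basis"]) (use rng in \<open>simp only: restrict_PiE_iff; blast\<close>)
    qed
  qed
  moreover have "disjoint_family_on (grid_cell s) (c ` S)"
    unfolding disjoint_family_on_def
  proof (intro ballI impI)
    fix u v assume uv: "u \<in> c ` S" "v \<in> c ` S" "u \<noteq> v"
    show "grid_cell s u \<inter> grid_cell s v = {}"
    proof (rule ccontr)
      assume "grid_cell s u \<inter> grid_cell s v \<noteq> {}"
      then obtain x where "x \<in> grid_cell s u" "x \<in> grid_cell s v" by blast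
      moreover obtain p q where "u = c p" "v = c q" using uv by blast
      ultimately have "c x = u" "c x = v" using uniq by blast+
      with uv show False by simp
    qed
  qed
  moreover have "S \<subseteq> (\<Union>a\<in>c ` S. grid_cell s a)" using mem by blast
  ultimately show thesis by (rule that)
qed

section \<open>Test functions\<close>

lemma max_zero_square_has_real_derivative:
  "((\<lambda>z. (max 0 z)\<^sup>2) has_real_derivative 2 * max 0 z) (at (z::real))"
proof -
  consider "z < 0" | "z > 0" | "z = 0" by linarith
  then show ?thesis
  proof cases
    case 1
    have "((\<lambda>z. 0) has_real_derivative 0) (at z)" by simp
    then have "((\<lambda>z. (max 0 z)\<^sup>2) has_real_derivative 0) (at z)"
      by (rule DERIV_cong_ev[THEN iffD1, rotated 3])
         (use 1 in \<open>auto intro!: eventually_mono[OF eventually_nhds_in_open[of "{..<0}"]]\<close>)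
    with 1 show ?thesis by simp
  next
    case 2
    have "((\<lambda>z. z\<^sup>2) has_real_derivative 2 * z) (at z)"
      by (auto intro!: derivative_eq_intros)
    then have "((\<lambda>z. (max 0 z)\<^sup>2) has_real_derivative 2 * z) (at z)"
      by (rule DERIV_cong_ev[THEN iffD1, rotated 3])
         (use 2 in \<open>auto intro!: eventually_mono[OF eventually_nhds_in_open[of "{0<..}"]]\<close>)
    with 2 show ?thesis by simp
  next
    case 3
    have "((\<lambda>h. (max 0 (0 + h))\<^sup>2 / h) \<longlongrightarrow> 0) (at (0::real))"
    proof (rule Lim_null_comparison)
      show "\<forall>\<^sub>F h in at (0::real). norm ((max 0 (0 + h))\<^sup>2 / h) \<le> \<bar>h\<bar>"
        by (rule always_eventually) (auto simp: power2_eq_square max_def)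
      show "((\<lambda>h. \<bar>h\<bar>) \<longlongrightarrow> 0) (at (0::real))"
        using tendsto_rabs[OF tendsto_ident_at, of 0] by simp
    qed
    then show ?thesis unfolding DERIV_def using 3 by simp
  qed
qed

lemma test_functionE:
  assumes "test_function \<Omega> \<phi> \<phi>'"
  obtains K where "compact K" "K \<subseteq> \<Omega>" "\<And>x. x \<notin> K \<Longrightarrow> \<phi> x = 0" "\<And>x. x \<notin> K \<Longrightarrow> \<phi>' x = 0"
proof -
  from assms obtain K where K: "compact K" "K \<subseteq> \<Omega>" "\<And>x. x \<notin> K \<Longrightarrow> \<phi> x = 0"
    and D: "\<And>x. GDERIV \<phi> x :> \<phi>' x" unfolding test_function_def by auto
  have "\<phi>' x = 0" if "x \<notin> K" for x
  proof -
    have "((\<lambda>x. 0) has_derivative (\<lambda>h. 0)) (at x)" by simp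
    then have "(\<phi> has_derivative (\<lambda>h. 0)) (at x)"
      by (rule has_derivative_transform_within_open[of _ _ _ _ "- K"])
         (use that K in \<open>auto simp: compact_imp_closed\<close>)
    moreover have "(\<phi> has_derivative (\<lambda>h. h \<bullet> \<phi>' x)) (at x)" using D by (simp add: gderiv_def)
    ultimately have "(\<lambda>h. h \<bullet> \<phi>' x) = (\<lambda>h. 0)" using has_derivative_unique by blast
    then have "\<phi>' x \<bullet> \<phi>' x = 0" by metis
    then show ?thesis by simp
  qed
  with K show thesis using that by blast
qed

lemma test_function_continuous:
  assumes "test_function \<Omega> \<phi> \<phi>'"
  shows "continuous_on UNIV \<phi>" "continuous_on UNIV \<phi>'"
  using assms by (auto simp: test_function_def gderiv_def intro!: continuous_at_imp_continuous_on has_derivative_continuous)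

lemma test_function_measurable:
  assumes "test_function \<Omega> \<phi> \<phi>'"
  shows "\<phi> \<in> borel_measurable borel" "\<phi>' \<in> borel_measurable borel"
  using test_function_continuous[OF assms] by (auto intro: borel_measurable_continuous_onI)

lemma test_function_add_scaled:
  assumes "test_function \<Omega> \<phi> \<phi>'" "test_function \<Omega> \<psi> \<psi>'"
  shows "test_function \<Omega> (\<lambda>x. \<phi> x + s * \<psi> x) (\<lambda>x. \<phi>' x + s *\<^sub>R \<psi>' x)"
proof -
  from assms obtain K where K: "compact K" "K \<subseteq> \<Omega>" "\<And>x. x \<notin> K \<Longrightarrow> \<phi> x = 0"
    by (auto simp: test_function_def)
  from assms obtain K' where K': "compact K'" "K' \<subseteq> \<Omega>" "\<And>x. x \<notin> K' \<Longrightarrow> \<psi> x = 0"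
    by (auto simp: test_function_def)
  have "GDERIV (\<lambda>x. \<phi> x + s * \<psi> x) x :> \<phi>' x + s *\<^sub>R \<psi>' x" for x
    using assms unfolding test_function_def gderiv_def
    by (auto intro!: derivative_eq_intros simp: inner_add_right)
  moreover have "continuous_on UNIV (\<lambda>x. \<phi>' x + s *\<^sub>R \<psi>' x)"
    using test_function_continuous[OF assms(1)] test_function_continuous[OF assms(2)]
    by (intro continuous_intros)
  moreover have "compact (K \<union> K')" "K \<union> K' \<subseteq> \<Omega>" "\<forall>x. x \<notin> K \<union> K' \<longrightarrow> \<phi> x + s * \<psi> x = 0"
    using K K' by auto
  ultimately show ?thesis unfolding test_function_def by blast
qed

lemma test_function_scale:
  assumes "test_function \<Omega> \<phi> \<phi>'"
  shows "test_function \<Omega> (\<lambda>x. s * \<phi> x) (\<lambda>x. s *\<^sub>R \<phi>' x)"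
  using test_function_add_scaled[OF assms assms, of "s - 1"] by (simp add: algebra_simps)

text \<open>
  The squared positive part makes the function continuously differentiable across the sphere.
\<close>

lemma test_function_bump:
  fixes c :: "'a::euclidean_space"
  assumes "cball c \<rho> \<subseteq> \<Omega>"  "0 < \<rho>"
  shows "test_function \<Omega> (\<lambda>x. (max 0 (\<rho>\<^sup>2 - (x - c) \<bullet> (x - c)))\<^sup>2)
    (\<lambda>x. (- 4 * max 0 (\<rho>\<^sup>2 - (x - c) \<bullet> (x - c))) *\<^sub>R (x - c))"
  unfolding test_function_def
proof (intro conjI allI)
  fix x
  have "((\<lambda>x. \<rho>\<^sup>2 - (x - c) \<bullet> (x - c)) has_derivative (\<lambda>h. - 2 * (h \<bullet> (x - c)))) (at x)"
    by (auto intro!: derivative_eq_intros simp: inner_commute)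
  moreover have "((\<lambda>z. (max 0 z)\<^sup>2) has_derivative (*) (2 * max 0 (\<rho>\<^sup>2 - (x - c) \<bullet> (x - c))))
      (at (\<rho>\<^sup>2 - (x - c) \<bullet> (x - c)))"
    using max_zero_square_has_real_derivative[of "\<rho>\<^sup>2 - (x - c) \<bullet> (x - c)"]
    by (simp add: has_field_derivative_def)
  ultimately have "((\<lambda>x. (max 0 (\<rho>\<^sup>2 - (x - c) \<bullet> (x - c)))\<^sup>2) has_derivative
      (\<lambda>h. 2 * max 0 (\<rho>\<^sup>2 - (x - c) \<bullet> (x - c)) * (- 2 * (h \<bullet> (x - c))))) (at x)"
    by (rule has_derivative_compose)
  then show "GDERIV (\<lambda>x. (max 0 (\<rho>\<^sup>2 - (x - c) \<bullet> (x - c)))\<^sup>2) x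
     :> (- 4 * max 0 (\<rho>\<^sup>2 - (x - c) \<bullet> (x - c))) *\<^sub>R (x - c)"
    unfolding gderiv_def by (simp add: mult.assoc mult.left_commute)
next
  show "continuous_on UNIV (\<lambda>x. (- 4 * max 0 (\<rho>\<^sup>2 - (x - c) \<bullet> (x - c))) *\<^sub>R (x - c))"
    by (intro continuous_intros)
next
  show "\<exists>K. compact K \<and> K \<subseteq> \<Omega> \<and> (\<forall>x. x \<notin> K \<longrightarrow> (max 0 (\<rho>\<^sup>2 - (x - c) \<bullet> (x - c)))\<^sup>2 = 0)"
  proof (intro exI[of _ "cball c \<rho>"] conjI allI impI)
    fix x assume "x \<notin> cball c \<rho>"
    then have "\<rho>\<^sup>2 \<le> (norm (x - c))\<^sup>2"
      using assms by (intro power_mono) (auto simp: dist_norm norm_minus_commute)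
    then show "(max 0 (\<rho>\<^sup>2 - (x - c) \<bullet> (x - c)))\<^sup>2 = 0" by (simp add: power2_norm_eq_inner)
  qed (use assms in auto)
qed

section \<open>The Rayleigh quotient\<close>

lemma finite_family_convergent_subsequence:
  fixes f :: "'i \<Rightarrow> nat \<Rightarrow> real"
  assumes "finite A" "\<And>a. a \<in> A \<Longrightarrow> bounded (range (f a))"
  shows "\<exists>r. strict_mono (r::nat \<Rightarrow> nat) \<and> (\<forall>a\<in>A. convergent (f a \<circ> r))"
  using assms
proof (induction A)
  case empty
  then show ?case using strict_mono_id by blast
next
  case (insert b A)
  then have "\<exists>r. strict_mono (r::nat \<Rightarrow> nat) \<and> (\<forall>a\<in>A. convergent (f a \<circ> r))" by blast
  then obtain r where r: "strict_mono (r::nat \<Rightarrow> nat)" "\<forall>a\<in>A. convergent (f a \<circ> r)" by blast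
  have "range (f b \<circ> r) \<subseteq> range (f b)" by auto
  then have "bounded (range (f b \<circ> r))" using insert.prems[of b] bounded_subset by blast
  then obtain l r' where r': "strict_mono r'" "((f b \<circ> r) \<circ> r') \<longlonglongrightarrow> l"
    using bounded_imp_convergent_subsequence by blast
  have "convergent (f a \<circ> (r \<circ> r'))" if "a \<in> insert b A" for a
  proof (cases "a = b")
    case True
    then show ?thesis using r'(2) by (auto simp: o_assoc convergent_def)
  next
    case False
    then have "convergent (f a \<circ> r)" using that r by auto
    from convergent_subseq_convergent[OF this r'(1)] show ?thesis by (simp add: o_assoc)
  qed
  then show ?case using strict_mono_o[OF r(1) r'(1)] by blast
qed

lemma quadratic_nonneg_imp_discriminant:
  fixes A b C :: real
  assumes "\<And>s. 0 \<le> A + 2 * s * b + s\<^sup>2 * C"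
  shows "b\<^sup>2 \<le> A * C"
proof (cases "C = 0")
  case True
  have "b = 0"
  proof (rule ccontr)
    assume "b \<noteq> 0"
    with assms[of "- (A + 1) / (2 * b)"] True show False by (simp add: field_simps)
  qed
  with True show ?thesis by simp
next
  case False
  have "0 \<le> C"
  proof (rule ccontr)
    assume "\<not> 0 \<le> C"
    then have "C < 0" by simp
    \<comment> \<open>so large that the negative quadratic term outweighs the other two\<close>
    define s where "s = (\<bar>A\<bar> + 1) / (-C) + 2 * \<bar>b\<bar> / (- C) + 1"
    have "0 \<le> (\<bar>A\<bar> + 1) / (-C)" "0 \<le> 2 * \<bar>b\<bar> / (- C)"
      using \<open>C < 0\<close> by (intro divide_nonneg_pos; simp)+
    then have s1: "s \<ge> 1" unfolding s_def by linarith
    have "(x / (- C) + y / (- C) + 1) * (- C) = x + y + (- C)" for x y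
    proof -
      have "(x / D + y / D + 1) * D = x + y + D" if "D > 0" for D
        using that by (simp add: distrib_right)
      then show ?thesis using \<open>C < 0\<close> by (metis neg_0_less_iff_less)
    qed
    then have "s * (- C) \<ge> \<bar>A\<bar> + 1 + 2 * \<bar>b\<bar>" unfolding s_def using \<open>C < 0\<close> by (metis add_increasing2 less_imp_le neg_0_le_iff_le order_refl)
    then have "s * (s * (-C)) \<ge> s * (\<bar>A\<bar> + 1 + 2 * \<bar>b\<bar>)" using s1 by (intro mult_left_mono) auto
    moreover have "s * (\<bar>A\<bar> + 1) \<ge> \<bar>A\<bar> + 1" using s1 mult_right_mono[of 1 s "\<bar>A\<bar> + 1"] by simp
    moreover have "s * b \<le> s * \<bar>b\<bar>" using s1 by (intro mult_left_mono) auto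
    ultimately show False using assms[of s] by (simp add: power2_eq_square algebra_simps)
  qed
  with False have "C > 0" by simp
  with assms[of "- b / C"] show ?thesis by (simp add: power2_eq_square field_simps)
qed

text \<open>
  Upper semicontinuous potentials have to be covered besides continuous ones, because the effective
  potential \<open>\<mu>(x)\<close> of the one-dimensional problem is one; hence measurability and
  local boundedness.
\<close>

locale dirichlet_form =
  fixes \<Omega> :: "'a::euclidean_space set" and V :: "'a \<Rightarrow> real"
  assumes open_dom: "open \<Omega>" and bounded_dom: "bounded \<Omega>" and nonempty_dom: "\<Omega> \<noteq> {}"
    and V_nonneg: "\<And>x. x \<in> \<Omega> \<Longrightarrow> 0 \<le> V x"
    and V_measurable: "(\<lambda>x. indicator \<Omega> x * V x) \<in> borel_measurable borel"
    and V_locally_bounded: "\<And>K. compact K \<Longrightarrow> K \<subseteq> \<Omega> \<Longrightarrow> \<exists>c. \<forall>x\<in>K. V x \<le> c"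
begin

text \<open>
  Values of \<open>V\<close> outside \<open>\<Omega>\<close> are arbitrary; the extension by zero is
  Borel measurable and lets all integrals run over the whole space.
\<close>

definition U :: "'a \<Rightarrow> real" where "U x = indicator \<Omega> x * V x"

lemma U_nonneg: "0 \<le> U x" using V_nonneg by (simp add: U_def indicator_def)
lemma U_measurable [measurable]: "U \<in> borel_measurable borel"
  using V_measurable by (simp add: U_def[abs_def])
lemma dom_measurable [measurable]: "\<Omega> \<in> sets borel" using open_dom by simp

abbreviation test where "test \<equiv> test_function \<Omega>"

definition energy :: "('a \<Rightarrow> real) \<Rightarrow> ('a \<Rightarrow> 'a) \<Rightarrow> ('a \<Rightarrow> real) \<Rightarrow> ('a \<Rightarrow> 'a) \<Rightarrow> real" where
  "energy \<phi> \<phi>' \<psi> \<psi>' = (LINT x|lborel. \<phi>' x \<bullet> \<psi>' x + U x * \<phi> x * \<psi> x)"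

definition mass :: "('a \<Rightarrow> real) \<Rightarrow> ('a \<Rightarrow> real) \<Rightarrow> real" where
  "mass \<phi> \<psi> = (LINT x|lborel. \<phi> x * \<psi> x)"

lemma test_integrable:
  assumes \<phi>: "test \<phi> \<phi>'" and \<psi>: "test \<psi> \<psi>'"
  shows "integrable lborel (\<lambda>x. \<phi> x * \<psi> x)" "integrable lborel (\<lambda>x. \<phi>' x \<bullet> \<psi>' x)"
    "integrable lborel (\<lambda>x. U x * \<phi> x * \<psi> x)"
proof -
  obtain K where K: "compact K" "K \<subseteq> \<Omega>" "\<And>x. x \<notin> K \<Longrightarrow> \<phi> x = 0" "\<And>x. x \<notin> K \<Longrightarrow> \<phi>' x = 0"
    using test_functionE[OF \<phi>] by blast
  note c = test_function_continuous[OF \<phi>] test_function_continuous[OF \<psi>]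
  note [measurable] = test_function_measurable[OF \<phi>] test_function_measurable[OF \<psi>]
  show i: "integrable lborel (\<lambda>x. \<phi> x * \<psi> x)" "integrable lborel (\<lambda>x. \<phi>' x \<bullet> \<psi>' x)"
    by (rule integrable_continuous_compact_support[where K=K];
        use K c in \<open>auto intro!: continuous_intros\<close>)+
  obtain b where b: "\<And>x. x \<in> K \<Longrightarrow> V x \<le> b" using V_locally_bounded[OF K(1,2)] by blast
  have "integrable lborel (\<lambda>x. b * \<bar>\<phi> x * \<psi> x\<bar>)"
    by (intro Bochner_Integration.integrable_mult_right Bochner_Integration.integrable_abs i)
  then show "integrable lborel (\<lambda>x. U x * \<phi> x * \<psi> x)"
  proof (rule Bochner_Integration.integrable_bound)
    show "AE x in lborel. norm (U x * \<phi> x * \<psi> x) \<le> norm (b * \<bar>\<phi> x * \<psi> x\<bar>)"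
    proof (rule AE_I2)
      fix x
      show "norm (U x * \<phi> x * \<psi> x) \<le> norm (b * \<bar>\<phi> x * \<psi> x\<bar>)"
      proof (cases "x \<in> K")
        case True
        then have "\<bar>U x\<bar> \<le> \<bar>b\<bar>" using b[of x] V_nonneg[of x] K(2) by (auto simp: U_def)
        then show ?thesis by (simp add: abs_mult mult_right_mono mult.assoc)
      qed (use K in auto)
    qed
  qed measurable
qed

lemma energy_integrable:
  assumes "test \<phi> \<phi>'" "test \<psi> \<psi>'"
  shows "integrable lborel (\<lambda>x. \<phi>' x \<bullet> \<psi>' x + U x * \<phi> x * \<psi> x)"
  using test_integrable[OF assms] by simp

lemma energy_nonneg: "0 \<le> energy \<phi> \<phi>' \<phi> \<phi>'"
  unfolding energy_def
  by (intro Bochner_Integration.integral_nonneg) (use U_nonneg in \<open>simp add: mult.assoc\<close>)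

lemma mass_nonneg: "0 \<le> mass \<phi> \<phi>"
  unfolding mass_def by (intro Bochner_Integration.integral_nonneg) simp

lemma energy_add_scaled:
  assumes "test \<phi> \<phi>'" "test \<psi> \<psi>'"
  shows "energy (\<lambda>x. \<phi> x + s * \<psi> x) (\<lambda>x. \<phi>' x + s *\<^sub>R \<psi>' x) (\<lambda>x. \<phi> x + s * \<psi> x) (\<lambda>x. \<phi>' x + s *\<^sub>R \<psi>' x) =
    energy \<phi> \<phi>' \<phi> \<phi>' + 2 * s * energy \<phi> \<phi>' \<psi> \<psi>' + s\<^sup>2 * energy \<psi> \<psi>' \<psi> \<psi>'"
proof -
  have "(\<lambda>x. (\<phi>' x + s *\<^sub>R \<psi>' x) \<bullet> (\<phi>' x + s *\<^sub>R \<psi>' x) + U x * (\<phi> x + s * \<psi> x) * (\<phi> x + s * \<psi> x)) =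
    (\<lambda>x. (\<phi>' x \<bullet> \<phi>' x + U x * \<phi> x * \<phi> x) + (2 * s) * (\<phi>' x \<bullet> \<psi>' x + U x * \<phi> x * \<psi> x) +
      s\<^sup>2 * (\<psi>' x \<bullet> \<psi>' x + U x * \<psi> x * \<psi> x))"
    by (simp add: inner_add_left inner_add_right inner_commute power2_eq_square algebra_simps)
  then show ?thesis
    unfolding energy_def
    using energy_integrable[OF assms] energy_integrable[OF assms(1) assms(1)] energy_integrable[OF assms(2) assms(2)]
    by (simp only: Bochner_Integration.integral_add Bochner_Integration.integral_mult_right
        Bochner_Integration.integrable_add Bochner_Integration.integrable_mult_right)
qed

lemma mass_add_scaled:
  assumes "test \<phi> \<phi>'" "test \<psi> \<psi>'"
  shows "mass (\<lambda>x. \<phi> x + s * \<psi> x) (\<lambda>x. \<phi> x + s * \<psi> x) = mass \<phi> \<phi> + 2 * s * mass \<phi> \<psi> + s\<^sup>2 * mass \<psi> \<psi>"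
proof -
  have "(\<lambda>x. (\<phi> x + s * \<psi> x) * (\<phi> x + s * \<psi> x)) =
    (\<lambda>x. \<phi> x * \<phi> x + (2 * s) * (\<phi> x * \<psi> x) + s\<^sup>2 * (\<psi> x * \<psi> x))"
    by (simp add: power2_eq_square algebra_simps)
  then show ?thesis
    unfolding mass_def
    using test_integrable[OF assms] test_integrable[OF assms(1) assms(1)] test_integrable[OF assms(2) assms(2)]
    by (simp only: Bochner_Integration.integral_add Bochner_Integration.integral_mult_right
        Bochner_Integration.integrable_add Bochner_Integration.integrable_mult_right)
qed

definition rayleigh :: real where
  "rayleigh = Inf {energy \<phi> \<phi>' \<phi> \<phi>' | \<phi> \<phi>'. test \<phi> \<phi>' \<and> mass \<phi> \<phi> = 1}"

lemma mass_pos: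
  assumes "test \<phi> \<phi>'" "\<phi> x \<noteq> 0"
  shows "0 < mass \<phi> \<phi>"
proof -
  have "continuous_on UNIV (\<lambda>x. \<phi> x * \<phi> x)" using test_function_continuous[OF assms(1)] by (intro continuous_intros)
  then have "open ((\<lambda>x. \<phi> x * \<phi> x) -` {0<..})" by (rule open_vimage[OF open_greaterThan])
  moreover have "x \<in> (\<lambda>x. \<phi> x * \<phi> x) -` {0<..}" using assms(2) by (auto simp: zero_less_mult_iff)
  ultimately obtain e where e: "e > 0" "ball x e \<subseteq> (\<lambda>x. \<phi> x * \<phi> x) -` {0<..}"
    using open_contains_ball by blast
  have "mass \<phi> \<phi> \<noteq> 0"
  proof
    assume "mass \<phi> \<phi> = 0"
    then have "AE y in lborel. \<phi> y * \<phi> y = 0"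
      unfolding mass_def
      by (subst (asm) integral_nonneg_eq_0_iff_AE) (use test_integrable[OF assms(1) assms(1)] in auto)
    then have "AE y in lborel. y \<notin> ball x e" by eventually_elim (use e(2) in auto)
    then have "emeasure lborel (ball x e) = 0" by (subst (asm) AE_iff_measurable[of "ball x e"]) auto
    then show False using e(1) by (simp add: emeasure_ball unit_ball_vol_pos less_imp_neq[symmetric])
  qed
  with mass_nonneg[of \<phi>] show ?thesis by simp
qed

lemma test_nonzero_exists: "\<exists>\<phi> \<phi>'. test \<phi> \<phi>' \<and> mass \<phi> \<phi> = 1"
proof -
  obtain c where "c \<in> \<Omega>" using nonempty_dom by blast
  then obtain \<rho> where \<rho>: "0 < \<rho>" "cball c \<rho> \<subseteq> \<Omega>" using open_dom open_contains_cball by blast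
  note t = test_function_bump[OF \<rho>(2,1)]
  have m: "0 < mass (\<lambda>x. (max 0 (\<rho>\<^sup>2 - (x - c) \<bullet> (x - c)))\<^sup>2) (\<lambda>x. (max 0 (\<rho>\<^sup>2 - (x - c) \<bullet> (x - c)))\<^sup>2)"
    by (rule mass_pos[OF t, of c]) (use \<rho> in auto)
  define m where "m = mass (\<lambda>x. (max 0 (\<rho>\<^sup>2 - (x - c) \<bullet> (x - c)))\<^sup>2) (\<lambda>x. (max 0 (\<rho>\<^sup>2 - (x - c) \<bullet> (x - c)))\<^sup>2)"
  have "mass (\<lambda>x. (1 / sqrt m) * (max 0 (\<rho>\<^sup>2 - (x - c) \<bullet> (x - c)))\<^sup>2) (\<lambda>x. (1 / sqrt m) * (max 0 (\<rho>\<^sup>2 - (x - c) \<bullet> (x - c)))\<^sup>2) = 1"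
  proof -
    have "mass (\<lambda>x. k * f x) (\<lambda>x. k * f x) = k\<^sup>2 * mass f f" for k and f :: "'a \<Rightarrow> real"
    proof -
      have "(\<lambda>x. k * f x * (k * f x)) = (\<lambda>x. k\<^sup>2 * (f x * f x))" by (simp add: power2_eq_square ac_simps)
      then show ?thesis unfolding mass_def by simp
    qed
    then show ?thesis using m by (simp only: m_def[symmetric]) (simp add: power_divide m_def[symmetric])
  qed
  with test_function_scale[OF t, of "1 / sqrt m"] show ?thesis by blast
qed

lemma rayleigh_nonneg: "0 \<le> rayleigh"
  unfolding rayleigh_def using test_nonzero_exists energy_nonneg
  by (intro cInf_greatest) auto

lemma rayleigh_le:
  assumes "test \<phi> \<phi>'"
  shows "rayleigh * mass \<phi> \<phi> \<le> energy \<phi> \<phi>' \<phi> \<phi>'"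
proof (cases "mass \<phi> \<phi> = 0")
  case True
  then show ?thesis using energy_nonneg by simp
next
  case False
  then have m: "0 < mass \<phi> \<phi>" using mass_nonneg[of \<phi>] by simp
  define k where "k = 1 / sqrt (mass \<phi> \<phi>)"
  have k2: "k\<^sup>2 = 1 / mass \<phi> \<phi>" using m by (simp add: k_def power_divide)
  have "mass (\<lambda>x. k * \<phi> x) (\<lambda>x. k * \<phi> x) = k\<^sup>2 * mass \<phi> \<phi>"
  proof -
    have "(\<lambda>x. k * \<phi> x * (k * \<phi> x)) = (\<lambda>x. k\<^sup>2 * (\<phi> x * \<phi> x))" by (simp add: power2_eq_square ac_simps)
    then show ?thesis unfolding mass_def by simp
  qed
  then have "mass (\<lambda>x. k * \<phi> x) (\<lambda>x. k * \<phi> x) = 1" using m k2 by simp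
  moreover have "energy (\<lambda>x. k * \<phi> x) (\<lambda>x. k *\<^sub>R \<phi>' x) (\<lambda>x. k * \<phi> x) (\<lambda>x. k *\<^sub>R \<phi>' x) = k\<^sup>2 * energy \<phi> \<phi>' \<phi> \<phi>'"
  proof -
    have "(\<lambda>x. (k *\<^sub>R \<phi>' x) \<bullet> (k *\<^sub>R \<phi>' x) + U x * (k * \<phi> x) * (k * \<phi> x)) =
       (\<lambda>x. k\<^sup>2 * (\<phi>' x \<bullet> \<phi>' x + U x * \<phi> x * \<phi> x))" by (simp add: power2_eq_square algebra_simps)
    then show ?thesis unfolding energy_def by simp
  qed
  ultimately have "rayleigh \<le> k\<^sup>2 * energy \<phi> \<phi>' \<phi> \<phi>'"
    unfolding rayleigh_def
    by (intro cInf_lower bdd_belowI[where m=0]) (use test_function_scale[OF assms, of k] energy_nonneg in force)+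
  then show ?thesis using m unfolding k2 by (simp add: field_simps)
qed

text \<open>
  A nonnegative quadratic form. The parallelogram law and the Cauchy-Schwarz inequality for it show
  that minimizing sequences are Cauchy and that limits solve the Euler-Lagrange equation.
\<close>

definition defect :: "('a \<Rightarrow> real) \<Rightarrow> ('a \<Rightarrow> 'a) \<Rightarrow> real" where
  "defect \<phi> \<phi>' = energy \<phi> \<phi>' \<phi> \<phi>' - rayleigh * mass \<phi> \<phi>"

lemma defect_nonneg: "test \<phi> \<phi>' \<Longrightarrow> 0 \<le> defect \<phi> \<phi>'"
  using rayleigh_le by (simp add: defect_def)

lemma defect_add_scaled:
  assumes "test \<phi> \<phi>'" "test \<psi> \<psi>'"
  shows "defect (\<lambda>x. \<phi> x + s * \<psi> x) (\<lambda>x. \<phi>' x + s *\<^sub>R \<psi>' x) =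
    defect \<phi> \<phi>' + 2 * s * (energy \<phi> \<phi>' \<psi> \<psi>' - rayleigh * mass \<phi> \<psi>) + s\<^sup>2 * defect \<psi> \<psi>'"
  unfolding defect_def energy_add_scaled[OF assms] mass_add_scaled[OF assms] by (simp add: algebra_simps)

lemma defect_diff_le:
  assumes "test \<phi> \<phi>'" "test \<psi> \<psi>'"
  shows "defect (\<lambda>x. \<phi> x - \<psi> x) (\<lambda>x. \<phi>' x - \<psi>' x) \<le> 2 * defect \<phi> \<phi>' + 2 * defect \<psi> \<psi>'"
  using defect_add_scaled[OF assms, of 1] defect_add_scaled[OF assms, of "-1"]
    defect_nonneg[OF test_function_add_scaled[OF assms, of 1]] by simp

lemma minimizing_sequence:
  "\<exists>\<phi> \<phi>'. \<forall>n::nat. test (\<phi> n) (\<phi>' n) \<and> mass (\<phi> n) (\<phi> n) = 1 \<and> defect (\<phi> n) (\<phi>' n) \<le> 1 / (real n + 1)"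
proof -
  have "\<exists>\<phi> \<phi>'. test \<phi> \<phi>' \<and> mass \<phi> \<phi> = 1 \<and> defect \<phi> \<phi>' \<le> 1 / (real n + 1)" for n
  proof -
    let ?S = "{energy \<phi> \<phi>' \<phi> \<phi>' | \<phi> \<phi>'. test \<phi> \<phi>' \<and> mass \<phi> \<phi> = 1}"
    have "?S \<noteq> {}" using test_nonzero_exists by auto
    moreover have "Inf ?S < rayleigh + 1 / (real n + 1)" unfolding rayleigh_def[symmetric] by simp
    ultimately have "\<exists>e\<in>?S. e < rayleigh + 1 / (real n + 1)" by (rule cInf_lessD)
    then obtain \<phi> \<phi>' where "test \<phi> \<phi>'" "mass \<phi> \<phi> = 1" "energy \<phi> \<phi>' \<phi> \<phi>' < rayleigh + 1 / (real n + 1)"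
      by blast
    then show ?thesis by (intro exI[of _ \<phi>] exI[of _ \<phi>']) (simp add: defect_def)
  qed
  then show ?thesis by metis
qed

section \<open>Compactness of minimizing sequences\<close>

lemma finitely_many_averages_control_mass:
  assumes "0 < \<epsilon>"
  shows "\<exists>A C. finite A \<and> (\<forall>Q\<in>A. Q \<in> sets borel \<and> emeasure lborel Q < \<infinity>) \<and> 0 \<le> C \<and>
    (\<forall>\<phi> \<phi>'. test \<phi> \<phi>' \<longrightarrow> mass \<phi> \<phi> \<le> C * (\<Sum>Q\<in>A. (LINT x:Q|lborel. \<phi> x)\<^sup>2) + \<epsilon> * energy \<phi> \<phi>' \<phi> \<phi>')"
proof -
  define M where "M = 2 ^ DIM('a) * (real DIM('a))\<^sup>2 / 2"
  have "M > 0" unfolding M_def by simp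
  \<comment> \<open>the side length for which the energy constant of the grid inequality equals \<open>\<epsilon>\<close>\<close>
  define s where "s = sqrt (\<epsilon> / M)"
  have s: "0 < s" "M * s\<^sup>2 = \<epsilon>" using assms \<open>M > 0\<close> by (auto simp: s_def)
  obtain A where A: "finite A" "disjoint_family_on (grid_cell s) A" "\<Omega> \<subseteq> (\<Union>a\<in>A. grid_cell s a)"
    using finite_grid_cover[OF bounded_dom s(1)] by blast
  have inj: "inj_on (grid_cell s) A"
  proof (rule inj_onI)
    fix a b assume ab: "a \<in> A" "b \<in> A" "grid_cell s a = grid_cell s b"
    have "a \<in> grid_cell s a" using s by (simp add: grid_cell_def)
    with ab A(2) show "a = b" by (auto simp: disjoint_family_on_def)
  qed
  show ?thesis
  proof (intro exI[of _ "grid_cell s ` A"] exI[of _ "1 / s ^ DIM('a)"] conjI allI impI ballI)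
    fix \<phi> \<phi>' assume t: "test \<phi> \<phi>'"
    obtain K where K: "compact K" "K \<subseteq> \<Omega>" "\<And>x. x \<notin> K \<Longrightarrow> \<phi> x = 0" "\<And>x. x \<notin> K \<Longrightarrow> \<phi>' x = 0"
      using test_functionE[OF t] by blast
    have "(LINT x|lborel. (\<phi> x)\<^sup>2) \<le> (\<Sum>a\<in>A. (LINT x:grid_cell s a|lborel. \<phi> x)\<^sup>2) / s ^ DIM('a) +
      2 ^ DIM('a) * (DIM('a) * s)\<^sup>2 / 2 * (LINT x|lborel. (norm (\<phi>' x))\<^sup>2)"
    proof (rule grid_poincare_inequality[where K=K])
      show "integrable lborel (\<lambda>x. (norm (\<phi>' x))\<^sup>2)"
        using test_integrable(2)[OF t t] by (simp add: power2_norm_eq_inner)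
    qed (use t s K A in \<open>auto simp: test_function_def\<close>)
    moreover have "(LINT x|lborel. (norm (\<phi>' x))\<^sup>2) \<le> energy \<phi> \<phi>' \<phi> \<phi>'"
      unfolding energy_def power2_norm_eq_inner
      by (intro integral_mono test_integrable[OF t t] energy_integrable[OF t t])
         (use U_nonneg in \<open>simp add: mult.assoc\<close>)
    moreover have "2 ^ DIM('a) * (DIM('a) * s)\<^sup>2 / 2 = \<epsilon>"
      using s(2) by (simp add: M_def power_mult_distrib)
    moreover have "(\<Sum>Q\<in>grid_cell s ` A. (LINT x:Q|lborel. \<phi> x)\<^sup>2) = (\<Sum>a\<in>A. (LINT x:grid_cell s a|lborel. \<phi> x)\<^sup>2)"
      using inj by (simp add: sum.reindex)
    moreover have "\<epsilon> * (LINT x|lborel. (norm (\<phi>' x))\<^sup>2) \<le> \<epsilon> * energy \<phi> \<phi>' \<phi> \<phi>'"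
      using assms calculation(2) by (intro mult_left_mono) auto
    ultimately show "mass \<phi> \<phi> \<le> 1 / s ^ DIM('a) * (\<Sum>Q\<in>grid_cell s ` A. (LINT x:Q|lborel. \<phi> x)\<^sup>2) + \<epsilon> * energy \<phi> \<phi>' \<phi> \<phi>'"
      unfolding mass_def power2_eq_square[symmetric] by simp
  next
    fix Q assume "Q \<in> grid_cell s ` A"
    then show "Q \<in> sets borel" "emeasure lborel Q < \<infinity>"
      using s by (auto simp: emeasure_grid_cell)
  qed (use A s in auto)
qed

lemma test_set_integral:
  assumes t: "test \<phi> \<phi>'" and "test \<psi> \<psi>'" and Q: "Q \<in> sets borel" "emeasure lborel Q < \<infinity>"
  shows "(LINT x:Q|lborel. \<phi> x - \<psi> x) = (LINT x:Q|lborel. \<phi> x) - (LINT x:Q|lborel. \<psi> x)"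
    and "\<bar>LINT x:Q|lborel. \<phi> x\<bar> \<le> measure lborel Q + mass \<phi> \<phi>"
proof -
  have i: "set_integrable lborel Q \<phi>" if t: "test \<phi> \<phi>'" for \<phi> \<phi>'
  proof -
    obtain K where "compact K" "K \<subseteq> \<Omega>" "\<And>x. x \<notin> K \<Longrightarrow> \<phi> x = 0" using test_functionE[OF t] by metis
    then have "integrable lborel \<phi>"
      by (intro integrable_continuous_compact_support[where K=K] test_function_continuous[OF t])
    then show ?thesis unfolding set_integrable_def
      by (intro integrable_mult_indicator) (use Q in auto)
  qed
  show "(LINT x:Q|lborel. \<phi> x - \<psi> x) = (LINT x:Q|lborel. \<phi> x) - (LINT x:Q|lborel. \<psi> x)"
    by (rule set_integral_diff(2)) (use i assms in auto)
  have "\<bar>LINT x:Q|lborel. \<phi> x\<bar> \<le> (LINT x|lborel. indicator Q x + \<phi> x * \<phi> x)"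
    unfolding set_lebesgue_integral_def
  proof (rule order_trans[OF integral_abs_bound])
    show "(LINT x|lborel. \<bar>indicator Q x *\<^sub>R \<phi> x\<bar>) \<le> (LINT x|lborel. indicator Q x + \<phi> x * \<phi> x)"
    proof (intro integral_mono Bochner_Integration.integrable_abs Bochner_Integration.integrable_add test_integrable[OF t t])
      show "integrable lborel (indicator Q :: 'a \<Rightarrow> real)" by (intro integrable_real_indicator) (use Q in auto)
      show "integrable lborel (\<lambda>x. indicator Q x *\<^sub>R \<phi> x)" using i[OF t] by (simp add: set_integrable_def)
      fix x
      have "\<bar>\<phi> x\<bar> \<le> 1 + \<phi> x * \<phi> x"
        using zero_le_power2[of "\<bar>\<phi> x\<bar> - 1"] by (simp add: power2_eq_square algebra_simps abs_mult_self_eq)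
      then show "\<bar>indicator Q x *\<^sub>R \<phi> x\<bar> \<le> indicator Q x + \<phi> x * \<phi> x"
        by (auto simp: indicator_def)
    qed
  qed
  also have "\<dots> = measure lborel Q + mass \<phi> \<phi>"
    unfolding mass_def using Q test_integrable[OF t t]
    by (subst Bochner_Integration.integral_add) (auto intro!: integrable_real_indicator)
  finally show "\<bar>LINT x:Q|lborel. \<phi> x\<bar> \<le> measure lborel Q + mass \<phi> \<phi>" .
qed

text \<open>
  The defect of a difference of two members of a minimizing sequence is small by the parallelogram
  law, so its energy is essentially \<open>rayleigh\<close> times its mass. The mass is bounded by
  finitely many averages, which converge along a subsequence, plus a small multiple of the energy,
  which can be absorbed.
\<close>

lemma minimizing_cauchy_sequence:
  "\<exists>\<phi> \<phi>'. (\<forall>n::nat. test (\<phi> n) (\<phi>' n) \<and> mass (\<phi> n) (\<phi> n) = 1 \<and> defect (\<phi> n) (\<phi>' n) \<le> 1 / (real n + 1)) \<and>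
    (\<forall>e>0. \<exists>N. \<forall>j\<ge>N. \<forall>k\<ge>N.
      mass (\<lambda>x. \<phi> j x - \<phi> k x) (\<lambda>x. \<phi> j x - \<phi> k x) +
      energy (\<lambda>x. \<phi> j x - \<phi> k x) (\<lambda>x. \<phi>' j x - \<phi>' k x) (\<lambda>x. \<phi> j x - \<phi> k x) (\<lambda>x. \<phi>' j x - \<phi>' k x) \<le> e)"
proof -
  obtain \<phi> \<phi>' where ms: "\<And>n::nat. test (\<phi> n) (\<phi>' n)" "\<And>n. mass (\<phi> n) (\<phi> n) = 1"
      "\<And>n. defect (\<phi> n) (\<phi>' n) \<le> 1 / (real n + 1)"
    using minimizing_sequence by metis
  \<comment> \<open>chosen so that \<open>\<epsilon> * energy\<close> costs at most half of the mass\<close>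
  define \<epsilon> where "\<epsilon> = 1 / (2 * (rayleigh + 1))"
  have \<epsilon>: "0 < \<epsilon>" "\<epsilon> * rayleigh \<le> 1 / 2" "\<epsilon> \<le> 1 / 2"
    using rayleigh_nonneg by (auto simp: \<epsilon>_def field_simps)
  obtain A C where A: "finite A" "\<And>Q. Q \<in> A \<Longrightarrow> Q \<in> sets borel" "\<And>Q. Q \<in> A \<Longrightarrow> emeasure lborel Q < \<infinity>" "0 \<le> C"
    "\<And>\<phi> \<phi>'. test \<phi> \<phi>' \<Longrightarrow> mass \<phi> \<phi> \<le> C * (\<Sum>Q\<in>A. (LINT x:Q|lborel. \<phi> x)\<^sup>2) + \<epsilon> * energy \<phi> \<phi>' \<phi> \<phi>'"
    using finitely_many_averages_control_mass[OF \<epsilon>(1)] by metis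
  have "bounded (range (\<lambda>n. LINT x:Q|lborel. \<phi> n x))" if "Q \<in> A" for Q
    using test_set_integral(2)[OF ms(1) ms(1) A(2)[OF that] A(3)[OF that]] ms(2)
    by (auto simp: bounded_iff intro!: exI[of _ "measure lborel Q + 1"])
  from finite_family_convergent_subsequence[OF A(1), of "\<lambda>Q n. LINT x:Q|lborel. \<phi> n x", OF this]
  obtain r where r: "strict_mono (r::nat\<Rightarrow>nat)"
      "\<And>Q. Q \<in> A \<Longrightarrow> convergent (\<lambda>n. LINT x:Q|lborel. \<phi> (r n) x)"
    by (auto simp: o_def)
  have def_r: "defect (\<phi> (r n)) (\<phi>' (r n)) \<le> 1 / (real n + 1)" for n
  proof -
    have "1 / (real (r n) + 1) \<le> 1 / (real n + 1)"
      using seq_suble[OF r(1), of n] by (intro divide_left_mono) auto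
    with ms(3)[of "r n"] show ?thesis by linarith
  qed
  have cauchy: "\<exists>N. \<forall>j\<ge>N. \<forall>k\<ge>N.
      mass (\<lambda>x. \<phi> (r j) x - \<phi> (r k) x) (\<lambda>x. \<phi> (r j) x - \<phi> (r k) x) +
      energy (\<lambda>x. \<phi> (r j) x - \<phi> (r k) x) (\<lambda>x. \<phi>' (r j) x - \<phi>' (r k) x)
        (\<lambda>x. \<phi> (r j) x - \<phi> (r k) x) (\<lambda>x. \<phi>' (r j) x - \<phi>' (r k) x) \<le> e" if "0 < e" for e
  proof -
    define S where "S j k = (\<Sum>Q\<in>A. ((LINT x:Q|lborel. \<phi> (r j) x) - (LINT x:Q|lborel. \<phi> (r k) x))\<^sup>2)" for j k
    define d where "d = e / (4 * (rayleigh + 2) * (C + 2))"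
    have d: "0 < d" using that rayleigh_nonneg A(4) by (simp add: d_def)
    have "\<exists>N. \<forall>j\<ge>N. \<forall>k\<ge>N. ((LINT x:Q|lborel. \<phi> (r j) x) - (LINT x:Q|lborel. \<phi> (r k) x))\<^sup>2 \<le> d / (real (card A) + 1)"
      if "Q \<in> A" for Q
    proof -
      have "Cauchy (\<lambda>n. LINT x:Q|lborel. \<phi> (r n) x)" using r(2)[OF that] by (simp add: Cauchy_convergent_iff)
      moreover have "0 < sqrt (d / (real (card A) + 1))" using d by simp
      ultimately obtain N where "\<And>j k. j \<ge> N \<Longrightarrow> k \<ge> N \<Longrightarrow>
         \<bar>(LINT x:Q|lborel. \<phi> (r j) x) - (LINT x:Q|lborel. \<phi> (r k) x)\<bar> < sqrt (d / (real (card A) + 1))"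
        unfolding Cauchy_def dist_real_def by metis
      moreover have "x\<^sup>2 \<le> d / (real (card A) + 1)" if "\<bar>x\<bar> < sqrt (d / (real (card A) + 1))" for x
        using power_mono[OF less_imp_le[OF that] abs_ge_zero, of 2] d by simp
      ultimately show ?thesis by blast
    qed
    then obtain N where N: "\<And>Q j k. Q \<in> A \<Longrightarrow> j \<ge> N Q \<Longrightarrow> k \<ge> N Q \<Longrightarrow>
        ((LINT x:Q|lborel. \<phi> (r j) x) - (LINT x:Q|lborel. \<phi> (r k) x))\<^sup>2 \<le> d / (real (card A) + 1)"
      by metis
    obtain N1 :: nat where N1: "1 / d \<le> real N1" using real_arch_simple by blast
    define M where "M = (\<Sum>Q\<in>A. N Q) + N1"
    have "mass (\<lambda>x. \<phi> (r j) x - \<phi> (r k) x) (\<lambda>x. \<phi> (r j) x - \<phi> (r k) x) +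
      energy (\<lambda>x. \<phi> (r j) x - \<phi> (r k) x) (\<lambda>x. \<phi>' (r j) x - \<phi>' (r k) x)
        (\<lambda>x. \<phi> (r j) x - \<phi> (r k) x) (\<lambda>x. \<phi>' (r j) x - \<phi>' (r k) x) \<le> e" if jk: "M \<le> j" "M \<le> k" for j k
    proof -
      let ?w = "\<lambda>x. \<phi> (r j) x - \<phi> (r k) x" and ?w' = "\<lambda>x. \<phi>' (r j) x - \<phi>' (r k) x"
      have tw: "test ?w ?w'" using test_function_add_scaled[OF ms(1) ms(1), of "r j" "-1" "r k"] by simp
      have "S j k \<le> (\<Sum>Q\<in>A. d / (real (card A) + 1))"
        unfolding S_def
      proof (intro sum_mono N)
        fix Q assume "Q \<in> A"
        then have "N Q \<le> (\<Sum>Q\<in>A. N Q)" using A(1) by (simp add: member_le_sum)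
        then show "N Q \<le> j" "N Q \<le> k" using jk by (auto simp: M_def)
      qed
      also have "\<dots> \<le> d" using d by (simp add: field_simps)
      finally have S: "S j k \<le> d" .
      have small: "defect (\<phi> (r n)) (\<phi>' (r n)) \<le> d" if "M \<le> n" for n
      proof -
        have "1 / d \<le> real n + 1" using N1 that by (simp add: M_def)
        then have "1 / (real n + 1) \<le> d" using d by (simp add: field_simps)
        with def_r[of n] show ?thesis by linarith
      qed
      have D: "defect ?w ?w' \<le> 4 * d"
        using defect_diff_le[OF ms(1) ms(1), of "r j" "r k"] small[OF jk(1)] small[OF jk(2)] by linarith
      have "mass ?w ?w \<le> C * (\<Sum>Q\<in>A. (LINT x:Q|lborel. ?w x)\<^sup>2) + \<epsilon> * energy ?w ?w' ?w ?w'"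
        by (rule A(5)[OF tw])
      also have "(\<Sum>Q\<in>A. (LINT x:Q|lborel. ?w x)\<^sup>2) = S j k"
        unfolding S_def by (intro sum.cong refl) (use test_set_integral(1)[OF ms(1) ms(1)] A(2,3) in auto)
      finally have m1: "mass ?w ?w \<le> C * S j k + \<epsilon> * (defect ?w ?w' + rayleigh * mass ?w ?w)"
        by (simp add: defect_def)
      have "C * S j k \<le> C * d" using S A(4) by (rule mult_left_mono)
      moreover have "\<epsilon> * defect ?w ?w' \<le> 1 / 2 * (4 * d)"
        using D \<epsilon> defect_nonneg[OF tw] by (intro mult_mono) auto
      moreover have "(\<epsilon> * rayleigh) * mass ?w ?w \<le> 1 / 2 * mass ?w ?w"
        using \<epsilon>(2) mass_nonneg by (rule mult_right_mono)
      ultimately have m2: "mass ?w ?w \<le> 2 * (C + 2) * d" using m1 by (simp add: algebra_simps)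
      have "mass ?w ?w + energy ?w ?w' ?w ?w' = defect ?w ?w' + (rayleigh + 1) * mass ?w ?w"
        by (simp add: defect_def algebra_simps)
      also have "\<dots> \<le> 4 * d + (rayleigh + 1) * (2 * (C + 2) * d)"
        using D m2 rayleigh_nonneg by (intro add_mono mult_left_mono) auto
      also have "\<dots> \<le> 4 * (rayleigh + 2) * (C + 2) * d"
      proof -
        have "4 * (rayleigh + 2) * (C + 2) * d - (4 * d + (rayleigh + 1) * (2 * (C + 2) * d))
           = d * (2 * rayleigh * (C + 2) + 6 * C + 8)" by (simp add: algebra_simps)
        moreover have "0 \<le> d * (2 * rayleigh * (C + 2) + 6 * C + 8)"
          using d rayleigh_nonneg A(4) by simp
        ultimately show ?thesis by linarith
      qed
      also have "\<dots> = e" using rayleigh_nonneg A(4) by (simp add: d_def)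
      finally show ?thesis .
    qed
    then show ?thesis by blast
  qed
  show ?thesis
  proof (rule exI[of _ "\<lambda>n. \<phi> (r n)"], rule exI[of _ "\<lambda>n. \<phi>' (r n)"], intro conjI allI impI)
    fix e :: real assume "0 < e"
    then show "\<exists>N. \<forall>j\<ge>N. \<forall>k\<ge>N.
      mass (\<lambda>x. \<phi> (r j) x - \<phi> (r k) x) (\<lambda>x. \<phi> (r j) x - \<phi> (r k) x) +
      energy (\<lambda>x. \<phi> (r j) x - \<phi> (r k) x) (\<lambda>x. \<phi>' (r j) x - \<phi>' (r k) x)
        (\<lambda>x. \<phi> (r j) x - \<phi> (r k) x) (\<lambda>x. \<phi>' (r j) x - \<phi>' (r k) x) \<le> e" by (rule cauchy)
  qed (rule ms def_r)+
qed

section \<open>The first eigenvalue as a minimum\<close>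

definition form_dist :: "('a \<Rightarrow> real) \<Rightarrow> ('a \<Rightarrow> 'a) \<Rightarrow> ennreal" where
  "form_dist u g = (\<integral>\<^sup>+x\<in>\<Omega>. ennreal ((u x)\<^sup>2 + (norm (g x))\<^sup>2 + V x * (u x)\<^sup>2) \<partial>lborel)"

lemma form_dist_test:
  assumes t: "test \<phi> \<phi>'"
  shows "form_dist \<phi> \<phi>' = ennreal (mass \<phi> \<phi> + energy \<phi> \<phi>' \<phi> \<phi>')"
proof -
  obtain K where K: "compact K" "K \<subseteq> \<Omega>" "\<And>x. x \<notin> K \<Longrightarrow> \<phi> x = 0" "\<And>x. x \<notin> K \<Longrightarrow> \<phi>' x = 0"
    using test_functionE[OF t] by blast
  have eq: "ennreal ((\<phi> x)\<^sup>2 + (norm (\<phi>' x))\<^sup>2 + V x * (\<phi> x)\<^sup>2) * indicator \<Omega> x =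
      ennreal (\<phi> x * \<phi> x + (\<phi>' x \<bullet> \<phi>' x + U x * \<phi> x * \<phi> x))" for x
  proof (cases "x \<in> \<Omega>")
    case True
    then show ?thesis unfolding power2_norm_eq_inner by (simp add: U_def power2_eq_square mult.assoc add.assoc)
  next
    case False
    then have "x \<notin> K" using K by auto
    with K False show ?thesis by simp
  qed
  have "form_dist \<phi> \<phi>' = ennreal (LINT x|lborel. \<phi> x * \<phi> x + (\<phi>' x \<bullet> \<phi>' x + U x * \<phi> x * \<phi> x))"
    unfolding form_dist_def eq
    by (intro nn_integral_eq_integral Bochner_Integration.integrable_add test_integrable[OF t t] AE_I2)
       (use U_nonneg in \<open>simp add: mult.assoc\<close>)
  also have "(LINT x|lborel. \<phi> x * \<phi> x + (\<phi>' x \<bullet> \<phi>' x + U x * \<phi> x * \<phi> x)) = mass \<phi> \<phi> + energy \<phi> \<phi>' \<phi> \<phi>'"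
    unfolding mass_def energy_def
    by (intro Bochner_Integration.integral_add test_integrable[OF t t] energy_integrable[OF t t])
  finally show ?thesis .
qed

text \<open>
  Completeness of the form domain: the limit is taken pointwise along a subsequence of the pairs of
  function and gradient, and Fatou's lemma transfers the Cauchy estimate to it.
\<close>

lemma form_complete:
  assumes t: "\<And>n::nat. test (\<phi> n) (\<phi>' n)"
    and cauchy: "\<And>e. 0 < e \<Longrightarrow> \<exists>N. \<forall>j\<ge>N. \<forall>k\<ge>N.
      mass (\<lambda>x. \<phi> j x - \<phi> k x) (\<lambda>x. \<phi> j x - \<phi> k x) +
      energy (\<lambda>x. \<phi> j x - \<phi> k x) (\<lambda>x. \<phi>' j x - \<phi>' k x) (\<lambda>x. \<phi> j x - \<phi> k x) (\<lambda>x. \<phi>' j x - \<phi>' k x) \<le> e"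
  shows "\<exists>u g. u \<in> borel_measurable borel \<and> g \<in> borel_measurable borel \<and>
    (\<lambda>n. form_dist (\<lambda>x. \<phi> n x - u x) (\<lambda>x. \<phi>' n x - g x)) \<longlonglongrightarrow> 0"
proof -
  note [measurable] = test_function_measurable[OF t]
  have td: "test (\<lambda>x. \<phi> j x - \<phi> k x) (\<lambda>x. \<phi>' j x - \<phi>' k x)" for j k
    using test_function_add_scaled[OF t t, of j "-1" k] by simp
  have cauchy': "\<exists>N. \<forall>j\<ge>N. \<forall>k\<ge>N. form_dist (\<lambda>x. \<phi> j x - \<phi> k x) (\<lambda>x. \<phi>' j x - \<phi>' k x) \<le> ennreal e"
    if "0 < e" for e
    unfolding form_dist_test[OF td] using cauchy[OF that] that by (simp add: ennreal_le_iff)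
  define F where "F n x = (\<phi> n x, \<phi>' n x)" for n x
  have [measurable]: "F n \<in> borel_measurable lborel" for n
    unfolding F_def by measurable
  have F_le: "(\<integral>\<^sup>+x. ennreal ((norm (F j x - F k x))\<^sup>2) \<partial>lborel) \<le> form_dist (\<lambda>x. \<phi> j x - \<phi> k x) (\<lambda>x. \<phi>' j x - \<phi>' k x)" for j k
    unfolding form_dist_def
  proof (intro nn_integral_mono)
    fix x
    obtain K where K: "compact K" "K \<subseteq> \<Omega>" "\<And>x. x \<notin> K \<Longrightarrow> \<phi> j x - \<phi> k x = 0" "\<And>x. x \<notin> K \<Longrightarrow> \<phi>' j x - \<phi>' k x = 0"
      using test_functionE[OF td[of j k]] by blast
    show "ennreal ((norm (F j x - F k x))\<^sup>2) \<le>
      ennreal ((\<phi> j x - \<phi> k x)\<^sup>2 + (norm (\<phi>' j x - \<phi>' k x))\<^sup>2 + V x * (\<phi> j x - \<phi> k x)\<^sup>2) * indicator \<Omega> x"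
    proof (cases "x \<in> \<Omega>")
      case True
      then show ?thesis using V_nonneg[OF True] by (auto simp: F_def norm_Pair intro!: ennreal_leI)
    next
      case False
      then have "x \<notin> K" using K by auto
      with K(3,4)[of x] False show ?thesis by (simp add: F_def zero_prod_def[symmetric])
    qed
  qed
  have "\<exists>r G. strict_mono (r::nat \<Rightarrow> nat) \<and> G \<in> borel_measurable lborel \<and>
    (AE x in lborel. (\<lambda>k. F (r k) x) \<longlonglongrightarrow> G x)"
  proof (rule L2_cauchy_imp_AE_convergent_subsequence)
    fix e :: real assume "0 < e"
    from cauchy'[OF this] obtain N where
      N: "\<And>j k. j \<ge> N \<Longrightarrow> k \<ge> N \<Longrightarrow> form_dist (\<lambda>x. \<phi> j x - \<phi> k x) (\<lambda>x. \<phi>' j x - \<phi>' k x) \<le> ennreal e"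
      by blast
    show "\<exists>N. \<forall>j\<ge>N. \<forall>k\<ge>N. (\<integral>\<^sup>+x. ennreal ((norm (F j x - F k x))\<^sup>2) \<partial>lborel) \<le> ennreal e"
      by (intro exI[of _ N] allI impI order_trans[OF F_le N])
  qed measurable
  then obtain r G where r: "strict_mono (r::nat \<Rightarrow> nat)" and G: "G \<in> borel_measurable lborel"
    and lim: "AE x in lborel. (\<lambda>k. F (r k) x) \<longlonglongrightarrow> G x" by blast
  define u where "u x = fst (G x)" for x
  define g where "g x = snd (G x)" for x
  have G': "G \<in> borel_measurable borel" using G by simp
  have [measurable]: "u \<in> borel_measurable borel" "g \<in> borel_measurable borel"
    unfolding u_def g_def using G'
    by (auto intro!: measurable_compose[OF _ borel_measurable_continuous_onI[OF continuous_on_fst[OF continuous_on_id]]]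
       measurable_compose[OF _ borel_measurable_continuous_onI[OF continuous_on_snd[OF continuous_on_id]]])
  have lim_u: "AE x in lborel. (\<lambda>k. \<phi> (r k) x) \<longlonglongrightarrow> u x \<and> (\<lambda>k. \<phi>' (r k) x) \<longlonglongrightarrow> g x"
    using lim
  proof eventually_elim
    case (elim x)
    from tendsto_fst[OF this] tendsto_snd[OF this] show ?case by (simp add: F_def u_def g_def)
  qed
  have fatou: "form_dist (\<lambda>x. \<phi> n x - u x) (\<lambda>x. \<phi>' n x - g x) \<le>
      liminf (\<lambda>k. form_dist (\<lambda>x. \<phi> n x - \<phi> (r k) x) (\<lambda>x. \<phi>' n x - \<phi>' (r k) x))" for n
  proof -
    let ?h = "\<lambda>u g x. ennreal ((\<phi> n x - u x)\<^sup>2 + (norm (\<phi>' n x - g x))\<^sup>2 + U x * (\<phi> n x - u x)\<^sup>2) * indicator \<Omega> x"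
    have U_eq: "form_dist (\<lambda>x. \<phi> n x - u x) (\<lambda>x. \<phi>' n x - g x) = (\<integral>\<^sup>+x. ?h u g x \<partial>lborel)" for u g
      unfolding form_dist_def by (intro nn_integral_cong) (simp add: U_def indicator_def)
    have "(\<integral>\<^sup>+x. ?h u g x \<partial>lborel) \<le> (\<integral>\<^sup>+x. liminf (\<lambda>k. ?h (\<phi> (r k)) (\<phi>' (r k)) x) \<partial>lborel)"
    proof (rule nn_integral_mono_AE, use lim_u in eventually_elim)
      case (elim x)
      have "(\<lambda>k. ?h (\<phi> (r k)) (\<phi>' (r k)) x) \<longlonglongrightarrow> ?h u g x"
      proof (cases "x \<in> \<Omega>")
        case True
        have "(\<lambda>k. (\<phi> n x - \<phi> (r k) x)\<^sup>2 + (norm (\<phi>' n x - \<phi>' (r k) x))\<^sup>2 + U x * (\<phi> n x - \<phi> (r k) x)\<^sup>2)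
           \<longlonglongrightarrow> (\<phi> n x - u x)\<^sup>2 + (norm (\<phi>' n x - g x))\<^sup>2 + U x * (\<phi> n x - u x)\<^sup>2"
          using elim by (auto intro!: tendsto_intros)
        with True show ?thesis by (simp add: tendsto_ennrealI)
      qed simp
      from lim_imp_Liminf[OF sequentially_bot this] show ?case by simp
    qed
    also have "\<dots> \<le> liminf (\<lambda>k. \<integral>\<^sup>+x. ?h (\<phi> (r k)) (\<phi>' (r k)) x \<partial>lborel)"
      by (rule nn_integral_liminf) measurable
    finally show ?thesis unfolding U_eq .
  qed
  have "(\<lambda>n. form_dist (\<lambda>x. \<phi> n x - u x) (\<lambda>x. \<phi>' n x - g x)) \<longlonglongrightarrow> 0"
  proof (rule tendsto_zero_ennreal)
    fix e :: real assume e: "0 < e"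
    then obtain N where N: "\<And>j k. j \<ge> N \<Longrightarrow> k \<ge> N \<Longrightarrow> form_dist (\<lambda>x. \<phi> j x - \<phi> k x) (\<lambda>x. \<phi>' j x - \<phi>' k x) \<le> ennreal (e / 2)"
      using cauchy'[of "e / 2"] by (metis half_gt_zero)
    have "form_dist (\<lambda>x. \<phi> n x - u x) (\<lambda>x. \<phi>' n x - g x) < ennreal e" if "n \<ge> N" for n
    proof -
      have "liminf (\<lambda>k. form_dist (\<lambda>x. \<phi> n x - \<phi> (r k) x) (\<lambda>x. \<phi>' n x - \<phi>' (r k) x)) \<le> liminf (\<lambda>k. ennreal (e / 2))"
      proof (rule Liminf_mono)
        show "\<forall>\<^sub>F k in sequentially. form_dist (\<lambda>x. \<phi> n x - \<phi> (r k) x) (\<lambda>x. \<phi>' n x - \<phi>' (r k) x) \<le> ennreal (e / 2)"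
          using eventually_ge_at_top[of N]
        proof eventually_elim
          case (elim k)
          then have "N \<le> r k" using seq_suble[OF r, of k] by linarith
          with that show ?case by (rule N)
        qed
      qed
      also have "\<dots> = ennreal (e / 2)" by (rule Liminf_const) simp
      finally have "form_dist (\<lambda>x. \<phi> n x - u x) (\<lambda>x. \<phi>' n x - g x) \<le> ennreal (e / 2)"
        by (rule order_trans[OF fatou])
      also have "\<dots> < ennreal e" using e by (simp add: ennreal_less_iff)
      finally show ?thesis .
    qed
    then show "\<forall>\<^sub>F n in sequentially. form_dist (\<lambda>x. \<phi> n x - u x) (\<lambda>x. \<phi>' n x - g x) < ennreal e"
      unfolding eventually_sequentially by blast
  qed
  then show ?thesis by (intro exI[of _ u] exI[of _ g]) simp
qed

text \<open>
  A Cauchy-Schwarz inequality in Young's form. With the free parameter \<open>\<eta>\<close> no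
  square roots of extended nonnegative integrals arise.
\<close>

lemma form_pairing:
  assumes [measurable]: "u \<in> borel_measurable borel" "g \<in> borel_measurable borel"
    and e: "form_dist u g \<le> ennreal e" "0 \<le> e" and t: "test \<psi> \<psi>'" and "0 < \<eta>"
  shows "set_integrable lborel \<Omega> (\<lambda>x. g x \<bullet> \<psi>' x + V x * u x * \<psi> x)"
    "set_integrable lborel \<Omega> (\<lambda>x. u x * \<psi> x)"
    "\<bar>LINT x:\<Omega>|lborel. g x \<bullet> \<psi>' x + V x * u x * \<psi> x\<bar> \<le> e / (2 * \<eta>) + \<eta> / 2 * energy \<psi> \<psi>' \<psi> \<psi>'"
    "\<bar>LINT x:\<Omega>|lborel. u x * \<psi> x\<bar> \<le> e / (2 * \<eta>) + \<eta> / 2 * mass \<psi> \<psi>"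
proof -
  note [measurable] = test_function_measurable[OF t]
  \<comment> \<open>the density of \<open>form_dist\<close>, with \<open>V\<close> replaced by its extension \<open>U\<close>\<close>
  define D where "D x = indicator \<Omega> x * ((u x)\<^sup>2 + (norm (g x))\<^sup>2) + U x * (u x)\<^sup>2" for x
  have [measurable]: "D \<in> borel_measurable borel" unfolding D_def by measurable
  have D0: "0 \<le> D x" for x using U_nonneg[of x] by (simp add: D_def)
  have Dint: "(\<integral>\<^sup>+x. ennreal (D x) \<partial>lborel) = form_dist u g"
    unfolding form_dist_def by (intro nn_integral_cong) (auto simp: D_def U_def indicator_def)
  then have iD: "integrable lborel D"
    by (intro integrableI_nonneg) (use e D0 in \<open>auto simp: le_less_trans\<close>)
  have "ennreal (LINT x|lborel. D x) = (\<integral>\<^sup>+x. ennreal (D x) \<partial>lborel)"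
    by (rule nn_integral_eq_integral[symmetric]) (use iD D0 in auto)
  then have De: "(LINT x|lborel. D x) \<le> e" using e unfolding Dint
    by (metis ennreal_le_iff)
  have amgm: "\<bar>a * b\<bar> \<le> a\<^sup>2 / (2 * \<eta>) + \<eta> / 2 * b\<^sup>2" for a b :: real
  proof -
    have "0 \<le> (\<bar>a\<bar> - \<eta> * \<bar>b\<bar>)\<^sup>2 / (2 * \<eta>)" using \<open>0 < \<eta>\<close> by simp
    also have "\<dots> = a\<^sup>2 / (2 * \<eta>) + \<eta> / 2 * b\<^sup>2 - \<bar>a * b\<bar>"
      using \<open>0 < \<eta>\<close> by (simp add: power2_eq_square field_simps abs_mult)
    finally show ?thesis by simp
  qed
  define f1 where "f1 x = indicator \<Omega> x *\<^sub>R (g x \<bullet> \<psi>' x + V x * u x * \<psi> x)" for x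
  define f2 where "f2 x = indicator \<Omega> x *\<^sub>R (u x * \<psi> x)" for x
  have f1U: "f1 = (\<lambda>x. indicator \<Omega> x * (g x \<bullet> \<psi>' x) + U x * (u x * \<psi> x))"
    by (auto simp: f1_def U_def indicator_def)
  have [measurable]: "f1 \<in> borel_measurable borel" "f2 \<in> borel_measurable borel"
    unfolding f1U f2_def by measurable
  have b1: "\<bar>f1 x\<bar> \<le> D x / (2 * \<eta>) + \<eta> / 2 * (\<psi>' x \<bullet> \<psi>' x + U x * \<psi> x * \<psi> x)" for x
  proof -
    have "\<bar>indicator \<Omega> x * (g x \<bullet> \<psi>' x)\<bar> \<le> indicator \<Omega> x * (norm (g x))\<^sup>2 / (2 * \<eta>) + \<eta> / 2 * (\<psi>' x \<bullet> \<psi>' x)"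
    proof (cases "x \<in> \<Omega>")
      case True
      have "\<bar>g x \<bullet> \<psi>' x\<bar> \<le> \<bar>norm (g x) * norm (\<psi>' x)\<bar>" using Cauchy_Schwarz_ineq2[of "g x" "\<psi>' x"] by simp
      also note amgm[of "norm (g x)" "norm (\<psi>' x)"]
      finally show ?thesis using True by (simp add: power2_norm_eq_inner)
    qed (use \<open>0 < \<eta>\<close> in simp)
    moreover have "\<bar>U x * (u x * \<psi> x)\<bar> \<le> U x * ((u x)\<^sup>2 / (2 * \<eta>) + \<eta> / 2 * (\<psi> x)\<^sup>2)"
      using amgm[of "u x" "\<psi> x"] U_nonneg[of x] by (simp add: abs_mult mult_left_mono)
    moreover have "indicator \<Omega> x * (norm (g x))\<^sup>2 / (2 * \<eta>) + U x * ((u x)\<^sup>2 / (2 * \<eta>)) \<le> D x / (2 * \<eta>)"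
    proof -
      have "indicator \<Omega> x * (norm (g x))\<^sup>2 + U x * (u x)\<^sup>2 \<le> D x" by (simp add: D_def algebra_simps)
      from divide_right_mono[OF this, of "2 * \<eta>"] \<open>0 < \<eta>\<close> show ?thesis by (simp add: add_divide_distrib)
    qed
    ultimately show ?thesis unfolding f1U using abs_triangle_ineq[of "indicator \<Omega> x * (g x \<bullet> \<psi>' x)" "U x * (u x * \<psi> x)"]
      by (simp add: power2_eq_square algebra_simps)
  qed
  have b2: "\<bar>f2 x\<bar> \<le> D x / (2 * \<eta>) + \<eta> / 2 * (\<psi> x * \<psi> x)" for x
  proof (cases "x \<in> \<Omega>")
    case True
    have "(u x)\<^sup>2 \<le> D x" using True U_nonneg[of x] by (simp add: D_def)
    from divide_right_mono[OF this, of "2 * \<eta>"] \<open>0 < \<eta>\<close> True amgm[of "u x" "\<psi> x"]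
    show ?thesis by (simp add: f2_def power2_eq_square)
  qed (use \<open>0 < \<eta>\<close> D0[of x] in \<open>simp add: f2_def\<close>)
  have i1: "integrable lborel (\<lambda>x. D x / (2 * \<eta>) + \<eta> / 2 * (\<psi>' x \<bullet> \<psi>' x + U x * \<psi> x * \<psi> x))"
    and i2: "integrable lborel (\<lambda>x. D x / (2 * \<eta>) + \<eta> / 2 * (\<psi> x * \<psi> x))"
    by (intro Bochner_Integration.integrable_add Bochner_Integration.integrable_divide
        Bochner_Integration.integrable_mult_right iD test_integrable[OF t t] impI)+
  have i1': "integrable lborel f1"
    by (rule Bochner_Integration.integrable_bound[OF i1])
      (auto intro!: AE_I2 simp del: times_divide_eq_left intro: order_trans[OF b1 abs_ge_self])
  have i2': "integrable lborel f2"
    by (rule Bochner_Integration.integrable_bound[OF i2])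
      (auto intro!: AE_I2 simp del: times_divide_eq_left intro: order_trans[OF b2 abs_ge_self])
  show "set_integrable lborel \<Omega> (\<lambda>x. g x \<bullet> \<psi>' x + V x * u x * \<psi> x)"
    using i1' unfolding set_integrable_def f1_def[abs_def] .
  show "set_integrable lborel \<Omega> (\<lambda>x. u x * \<psi> x)"
    using i2' unfolding set_integrable_def f2_def[abs_def] .
  have "\<bar>LINT x|lborel. f1 x\<bar> \<le> (LINT x|lborel. D x / (2 * \<eta>) + \<eta> / 2 * (\<psi>' x \<bullet> \<psi>' x + U x * \<psi> x * \<psi> x))"
    by (rule order_trans[OF integral_abs_bound], rule integral_mono) (use i1 i1' b1 in auto)
  also have "\<dots> = (LINT x|lborel. D x) / (2 * \<eta>) + \<eta> / 2 * energy \<psi> \<psi>' \<psi> \<psi>'"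
    unfolding energy_def using iD energy_integrable[OF t t]
    by (subst Bochner_Integration.integral_add) simp_all
  also have "\<dots> \<le> e / (2 * \<eta>) + \<eta> / 2 * energy \<psi> \<psi>' \<psi> \<psi>'"
    using De \<open>0 < \<eta>\<close> by (simp add: divide_right_mono)
  finally show "\<bar>LINT x:\<Omega>|lborel. g x \<bullet> \<psi>' x + V x * u x * \<psi> x\<bar> \<le> e / (2 * \<eta>) + \<eta> / 2 * energy \<psi> \<psi>' \<psi> \<psi>'"
    unfolding set_lebesgue_integral_def f1_def .
  have "\<bar>LINT x|lborel. f2 x\<bar> \<le> (LINT x|lborel. D x / (2 * \<eta>) + \<eta> / 2 * (\<psi> x * \<psi> x))"
    by (rule order_trans[OF integral_abs_bound], rule integral_mono) (use i2 i2' b2 in auto)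
  also have "\<dots> = (LINT x|lborel. D x) / (2 * \<eta>) + \<eta> / 2 * mass \<psi> \<psi>"
    unfolding mass_def using iD test_integrable[OF t t]
    by (subst Bochner_Integration.integral_add) simp_all
  also have "\<dots> \<le> e / (2 * \<eta>) + \<eta> / 2 * mass \<psi> \<psi>"
    using De \<open>0 < \<eta>\<close> by (simp add: divide_right_mono)
  finally show "\<bar>LINT x:\<Omega>|lborel. u x * \<psi> x\<bar> \<le> e / (2 * \<eta>) + \<eta> / 2 * mass \<psi> \<psi>"
    unfolding set_lebesgue_integral_def f2_def .
qed

lemma test_set_integral_energy:
  assumes t: "test \<phi> \<phi>'" and t': "test \<psi> \<psi>'"
  shows "(LINT x:\<Omega>|lborel. \<phi>' x \<bullet> \<psi>' x + V x * \<phi> x * \<psi> x) = energy \<phi> \<phi>' \<psi> \<psi>'"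
    "(LINT x:\<Omega>|lborel. \<phi> x * \<psi> x) = mass \<phi> \<psi>"
proof -
  obtain K where K: "compact K" "K \<subseteq> \<Omega>" "\<And>x. x \<notin> K \<Longrightarrow> \<phi> x = 0" "\<And>x. x \<notin> K \<Longrightarrow> \<phi>' x = 0"
    using test_functionE[OF t] by blast
  then have *: "x \<notin> \<Omega> \<Longrightarrow> \<phi> x = 0" "x \<notin> \<Omega> \<Longrightarrow> \<phi>' x = 0" for x by auto
  show "(LINT x:\<Omega>|lborel. \<phi>' x \<bullet> \<psi>' x + V x * \<phi> x * \<psi> x) = energy \<phi> \<phi>' \<psi> \<psi>'"
    unfolding set_lebesgue_integral_def energy_def
    by (intro Bochner_Integration.integral_cong) (auto simp: * U_def indicator_def)
  show "(LINT x:\<Omega>|lborel. \<phi> x * \<psi> x) = mass \<phi> \<psi>"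
    unfolding set_lebesgue_integral_def mass_def
    by (intro Bochner_Integration.integral_cong) (auto simp: * indicator_def)
qed

lemma form_pairing_diff:
  assumes m [measurable]: "u \<in> borel_measurable borel" "g \<in> borel_measurable borel" and t: "test \<phi> \<phi>'"
    and e: "form_dist (\<lambda>x. \<phi> x - u x) (\<lambda>x. \<phi>' x - g x) \<le> ennreal e" "0 \<le> e" and t': "test \<psi> \<psi>'" and "0 < \<eta>"
  shows "\<bar>energy \<phi> \<phi>' \<psi> \<psi>' - (LINT x:\<Omega>|lborel. g x \<bullet> \<psi>' x + V x * u x * \<psi> x)\<bar> \<le> e / (2 * \<eta>) + \<eta> / 2 * energy \<psi> \<psi>' \<psi> \<psi>'"
    "\<bar>mass \<phi> \<psi> - (LINT x:\<Omega>|lborel. u x * \<psi> x)\<bar> \<le> e / (2 * \<eta>) + \<eta> / 2 * mass \<psi> \<psi>"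
proof -
  note [measurable] = test_function_measurable[OF t]
  have p1: "set_integrable lborel \<Omega> (\<lambda>x. (\<phi>' x - g x) \<bullet> \<psi>' x + V x * (\<phi> x - u x) * \<psi> x)"
    "set_integrable lborel \<Omega> (\<lambda>x. (\<phi> x - u x) * \<psi> x)"
    by (rule form_pairing[OF _ _ e t' \<open>0 < \<eta>\<close>]; measurable)+
  have p2: "\<bar>LINT x:\<Omega>|lborel. (\<phi>' x - g x) \<bullet> \<psi>' x + V x * (\<phi> x - u x) * \<psi> x\<bar> \<le> e / (2 * \<eta>) + \<eta> / 2 * energy \<psi> \<psi>' \<psi> \<psi>'"
    "\<bar>LINT x:\<Omega>|lborel. (\<phi> x - u x) * \<psi> x\<bar> \<le> e / (2 * \<eta>) + \<eta> / 2 * mass \<psi> \<psi>"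
    by (rule form_pairing[OF _ _ e t' \<open>0 < \<eta>\<close>]; measurable)+
  have q: "set_integrable lborel \<Omega> (\<lambda>x. \<phi>' x \<bullet> \<psi>' x + V x * \<phi> x * \<psi> x)"
    "set_integrable lborel \<Omega> (\<lambda>x. \<phi> x * \<psi> x)"
  proof -
    have fin: "form_dist \<phi> \<phi>' \<le> ennreal (mass \<phi> \<phi> + energy \<phi> \<phi>' \<phi> \<phi>')"
      using form_dist_test[OF t] by simp
    have "0 \<le> mass \<phi> \<phi> + energy \<phi> \<phi>' \<phi> \<phi>'" using mass_nonneg energy_nonneg by (intro add_nonneg_nonneg)
    note r = form_pairing[OF test_function_measurable[OF t] fin this t' \<open>0 < \<eta>\<close>]
    show "set_integrable lborel \<Omega> (\<lambda>x. \<phi>' x \<bullet> \<psi>' x + V x * \<phi> x * \<psi> x)"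
      "set_integrable lborel \<Omega> (\<lambda>x. \<phi> x * \<psi> x)" by (rule r)+
  qed
  have e1: "(LINT x:\<Omega>|lborel. g x \<bullet> \<psi>' x + V x * u x * \<psi> x) = energy \<phi> \<phi>' \<psi> \<psi>' -
      (LINT x:\<Omega>|lborel. (\<phi>' x - g x) \<bullet> \<psi>' x + V x * (\<phi> x - u x) * \<psi> x)"
    unfolding test_set_integral_energy(1)[OF t t', symmetric] set_integral_diff(2)[OF q(1) p1(1), symmetric]
    by (simp add: inner_diff_left algebra_simps)
  have e2: "(LINT x:\<Omega>|lborel. u x * \<psi> x) = mass \<phi> \<psi> - (LINT x:\<Omega>|lborel. (\<phi> x - u x) * \<psi> x)"
    unfolding test_set_integral_energy(2)[OF t t', symmetric] set_integral_diff(2)[OF q(2) p1(2), symmetric]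
    by (simp add: algebra_simps)
  show "\<bar>energy \<phi> \<phi>' \<psi> \<psi>' - (LINT x:\<Omega>|lborel. g x \<bullet> \<psi>' x + V x * u x * \<psi> x)\<bar> \<le> e / (2 * \<eta>) + \<eta> / 2 * energy \<psi> \<psi>' \<psi> \<psi>'"
    using p2(1) unfolding e1 by simp
  show "\<bar>mass \<phi> \<psi> - (LINT x:\<Omega>|lborel. u x * \<psi> x)\<bar> \<le> e / (2 * \<eta>) + \<eta> / 2 * mass \<psi> \<psi>"
    using p2(2) unfolding e2 by simp
qed

lemma form_dist_imp_real:
  assumes "(\<lambda>n. form_dist (u n) (g n)) \<longlonglongrightarrow> 0" "0 < e"
  shows "\<forall>\<^sub>F n in sequentially. form_dist (u n) (g n) \<le> ennreal e"
  using order_tendstoD(2)[OF assms(1), of "ennreal e"] assms(2) by (auto elim: eventually_mono)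

lemma form_limit:
  assumes m: "u \<in> borel_measurable borel" "g \<in> borel_measurable borel" and t: "\<And>n::nat. test (\<phi> n) (\<phi>' n)"
    and conv: "(\<lambda>n. form_dist (\<lambda>x. \<phi> n x - u x) (\<lambda>x. \<phi>' n x - g x)) \<longlonglongrightarrow> 0" and t': "test \<psi> \<psi>'"
  shows "(\<lambda>n. energy (\<phi> n) (\<phi>' n) \<psi> \<psi>') \<longlonglongrightarrow> (LINT x:\<Omega>|lborel. g x \<bullet> \<psi>' x + V x * u x * \<psi> x)"
    "(\<lambda>n. mass (\<phi> n) \<psi>) \<longlonglongrightarrow> (LINT x:\<Omega>|lborel. u x * \<psi> x)"
proof -
  have *: "\<forall>\<^sub>F n in sequentially. \<bar>f n - L\<bar> < \<epsilon>"
    if "0 < \<epsilon>" "0 \<le> E" and b: "\<And>n e \<eta>. form_dist (\<lambda>x. \<phi> n x - u x) (\<lambda>x. \<phi>' n x - g x) \<le> ennreal e \<Longrightarrow> 0 \<le> e \<Longrightarrow> 0 < \<eta> \<Longrightarrow>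
      \<bar>f n - L\<bar> \<le> e / (2 * \<eta>) + \<eta> / 2 * E" for f :: "nat \<Rightarrow> real" and L \<epsilon> E :: real
  proof -
    define \<eta> where "\<eta> = \<epsilon> / (E + 1)"
    have \<eta>: "0 < \<eta>" "\<eta> / 2 * E < \<epsilon> / 2 + 0" using that by (auto simp: \<eta>_def field_simps)
    define e where "e = \<eta> * \<epsilon>"
    have e: "0 < e" "e / (2 * \<eta>) = \<epsilon> / 2" using \<eta> \<open>0 < \<epsilon>\<close> by (auto simp: e_def)
    show ?thesis using form_dist_imp_real[OF conv e(1)]
    proof eventually_elim
      case (elim n)
      from b[OF this _ \<eta>(1)] e \<eta> show ?case by simp
    qed
  qed
  show "(\<lambda>n. energy (\<phi> n) (\<phi>' n) \<psi> \<psi>') \<longlonglongrightarrow> (LINT x:\<Omega>|lborel. g x \<bullet> \<psi>' x + V x * u x * \<psi> x)"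
    unfolding tendsto_iff dist_real_def
    by (intro allI impI *[OF _ energy_nonneg[of \<psi> \<psi>']] form_pairing_diff(1)[OF m t _ _ t'])
  show "(\<lambda>n. mass (\<phi> n) \<psi>) \<longlonglongrightarrow> (LINT x:\<Omega>|lborel. u x * \<psi> x)"
    unfolding tendsto_iff dist_real_def
    by (intro allI impI *[OF _ mass_nonneg[of \<psi>]] form_pairing_diff(2)[OF m t _ _ t'])
qed

lemma form_domain_iff:
  "form_domain \<Omega> V u g \<longleftrightarrow> u \<in> borel_measurable borel \<and> g \<in> borel_measurable borel \<and>
     (\<exists>\<phi> \<phi>'. (\<forall>n::nat. test (\<phi> n) (\<phi>' n)) \<and> (\<lambda>n. form_dist (\<lambda>x. \<phi> n x - u x) (\<lambda>x. \<phi>' n x - g x)) \<longlonglongrightarrow> 0)"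
  unfolding form_domain_def form_dist_def ..

text \<open>
  The masses of a test function and of a nearby element of the form domain are comparable up to
  their distance. So a limit of test functions of mass one is not zero, and a limit of test
  functions with masses tending to zero vanishes.
\<close>

lemma mass_le_of_limit:
  assumes m [measurable]: "u \<in> borel_measurable borel" "g \<in> borel_measurable borel" and t: "test \<phi> \<phi>'"
    and e: "form_dist (\<lambda>x. \<phi> x - u x) (\<lambda>x. \<phi>' x - g x) \<le> ennreal e" "0 \<le> e"
  shows "ennreal (mass \<phi> \<phi>) \<le> ennreal (2 * e) + 2 * (\<integral>\<^sup>+x. ennreal ((u x)\<^sup>2) * indicator \<Omega> x \<partial>lborel)"
    "(\<integral>\<^sup>+x. ennreal ((u x)\<^sup>2) * indicator \<Omega> x \<partial>lborel) \<le> ennreal (2 * e + 2 * mass \<phi> \<phi>)"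
proof -
  note [measurable] = test_function_measurable[OF t]
  obtain K where K: "compact K" "K \<subseteq> \<Omega>" "\<And>x. x \<notin> K \<Longrightarrow> \<phi> x = 0" "\<And>x. x \<notin> K \<Longrightarrow> \<phi>' x = 0"
    using test_functionE[OF t] by blast
  let ?d = "\<integral>\<^sup>+x. ennreal ((\<phi> x - u x)\<^sup>2) * indicator \<Omega> x \<partial>lborel"
  have "?d \<le> form_dist (\<lambda>x. \<phi> x - u x) (\<lambda>x. \<phi>' x - g x)"
    unfolding form_dist_def
    by (intro nn_integral_mono) (use V_nonneg in \<open>auto simp: indicator_def intro!: ennreal_leI add_increasing2\<close>)
  with e have d: "?d \<le> ennreal e" by simp
  have mm: "(\<integral>\<^sup>+x. ennreal ((\<phi> x)\<^sup>2) * indicator \<Omega> x \<partial>lborel) = ennreal (mass \<phi> \<phi>)"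
  proof -
    have "(\<integral>\<^sup>+x. ennreal ((\<phi> x)\<^sup>2) * indicator \<Omega> x \<partial>lborel) = (\<integral>\<^sup>+x. ennreal (\<phi> x * \<phi> x) \<partial>lborel)"
      by (intro nn_integral_cong) (use K in \<open>auto simp: indicator_def power2_eq_square\<close>)
    also have "\<dots> = ennreal (mass \<phi> \<phi>)" unfolding mass_def
      by (intro nn_integral_eq_integral test_integrable[OF t t]) auto
    finally show ?thesis .
  qed
  have sq: "ennreal (b\<^sup>2) \<le> 2 * ennreal ((a - b)\<^sup>2) + 2 * ennreal (a\<^sup>2)" for a b :: real
  proof -
    have "b\<^sup>2 \<le> 2 * (a - b)\<^sup>2 + 2 * a\<^sup>2"
      using zero_le_power2[of "2 * a - b"] by (simp add: power2_eq_square algebra_simps)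
    then have "ennreal (b\<^sup>2) \<le> ennreal (2 * (a - b)\<^sup>2 + 2 * a\<^sup>2)" by (rule ennreal_leI)
    also have "\<dots> = 2 * ennreal ((a - b)\<^sup>2) + 2 * ennreal (a\<^sup>2)"
      by (simp add: ennreal_plus[symmetric] ennreal_mult'[symmetric] del: ennreal_plus flip: ennreal_numeral)
    finally show ?thesis .
  qed
  have "ennreal (mass \<phi> \<phi>) \<le> (\<integral>\<^sup>+x. 2 * (ennreal ((\<phi> x - u x)\<^sup>2) * indicator \<Omega> x) + 2 * (ennreal ((u x)\<^sup>2) * indicator \<Omega> x) \<partial>lborel)"
    unfolding mm[symmetric]
    by (intro nn_integral_mono) (use sq[of "_" "_"] in \<open>auto simp: indicator_def power2_commute\<close>)
  also have "\<dots> = 2 * ?d + 2 * (\<integral>\<^sup>+x. ennreal ((u x)\<^sup>2) * indicator \<Omega> x \<partial>lborel)"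
    by (simp add: nn_integral_add nn_integral_cmult)
  also have "2 * ?d \<le> 2 * ennreal e" using d by (rule mult_left_mono) simp
  also have "2 * ennreal e = ennreal (2 * e)" using e by (simp add: ennreal_mult flip: ennreal_numeral)
  finally show "ennreal (mass \<phi> \<phi>) \<le> ennreal (2 * e) + 2 * (\<integral>\<^sup>+x. ennreal ((u x)\<^sup>2) * indicator \<Omega> x \<partial>lborel)"
    by (simp add: add_mono)
  have "(\<integral>\<^sup>+x. ennreal ((u x)\<^sup>2) * indicator \<Omega> x \<partial>lborel) \<le>
     (\<integral>\<^sup>+x. 2 * (ennreal ((\<phi> x - u x)\<^sup>2) * indicator \<Omega> x) + 2 * (ennreal ((\<phi> x)\<^sup>2) * indicator \<Omega> x) \<partial>lborel)"
    by (intro nn_integral_mono) (use sq in \<open>auto simp: indicator_def\<close>)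
  also have "\<dots> = 2 * ?d + 2 * ennreal (mass \<phi> \<phi>)"
    by (simp add: nn_integral_add nn_integral_cmult mm)
  also have "\<dots> \<le> 2 * ennreal e + 2 * ennreal (mass \<phi> \<phi>)" using d by (intro add_right_mono mult_left_mono) auto
  also have "\<dots> = ennreal (2 * e + 2 * mass \<phi> \<phi>)"
    using e mass_nonneg[of \<phi>] by (simp add: ennreal_mult flip: ennreal_numeral)
  finally show "(\<integral>\<^sup>+x. ennreal ((u x)\<^sup>2) * indicator \<Omega> x \<partial>lborel) \<le> ennreal (2 * e + 2 * mass \<phi> \<phi>)" .
qed

text \<open>
  The limit \<open>u\<close> of a minimizing sequence satisfies the weak equation: pairing with
  \<open>\<psi>\<close> in the defect form is bounded, by Cauchy-Schwarz for that form, by the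
  square root of a defect that tends to zero.
\<close>

theorem rayleigh_is_eigenvalue: "dirichlet_eigenvalue \<Omega> V rayleigh"
proof -
  from minimizing_cauchy_sequence obtain \<phi> \<phi>' where
    s: "\<forall>n::nat. test (\<phi> n) (\<phi>' n) \<and> mass (\<phi> n) (\<phi> n) = 1 \<and> defect (\<phi> n) (\<phi>' n) \<le> 1 / (real n + 1)"
    and c: "\<forall>e>0. \<exists>N. \<forall>j\<ge>N. \<forall>k\<ge>N.
      mass (\<lambda>x. \<phi> j x - \<phi> k x) (\<lambda>x. \<phi> j x - \<phi> k x) +
      energy (\<lambda>x. \<phi> j x - \<phi> k x) (\<lambda>x. \<phi>' j x - \<phi>' k x) (\<lambda>x. \<phi> j x - \<phi> k x) (\<lambda>x. \<phi>' j x - \<phi>' k x) \<le> e"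
    by (elim exE conjE)
  from s have t: "\<And>n::nat. test (\<phi> n) (\<phi>' n)" and m1: "\<And>n. mass (\<phi> n) (\<phi> n) = 1"
    and def: "\<And>n. defect (\<phi> n) (\<phi>' n) \<le> 1 / (real n + 1)" by simp_all
  note complete = form_complete[OF t c[rule_format]]
  obtain u g where u: "u \<in> borel_measurable borel" "g \<in> borel_measurable borel"
    and conv: "(\<lambda>n. form_dist (\<lambda>x. \<phi> n x - u x) (\<lambda>x. \<phi>' n x - g x)) \<longlonglongrightarrow> 0"
    using complete by blast
  have "\<not> (AE x in lborel. x \<in> \<Omega> \<longrightarrow> u x = 0)"
  proof
    assume ae: "AE x in lborel. x \<in> \<Omega> \<longrightarrow> u x = 0"
    have z: "(\<integral>\<^sup>+x. ennreal ((u x)\<^sup>2) * indicator \<Omega> x \<partial>lborel) = 0"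
    proof -
      have "(\<integral>\<^sup>+x. ennreal ((u x)\<^sup>2) * indicator \<Omega> x \<partial>lborel) = (\<integral>\<^sup>+x. 0 \<partial>(lborel :: 'a measure))"
        by (rule nn_integral_cong_AE) (use ae in \<open>eventually_elim, auto simp: indicator_def\<close>)
      then show ?thesis by simp
    qed
    obtain n where "form_dist (\<lambda>x. \<phi> n x - u x) (\<lambda>x. \<phi>' n x - g x) \<le> ennreal (1/4)"
      using eventually_happens[OF form_dist_imp_real[OF conv, of "1/4"]] by auto
    from mass_le_of_limit(1)[OF u t this] have "ennreal 1 \<le> ennreal (2 * (1/4))"
      by (simp only: z m1 mult_zero_right add_0_right)
    then show False by (subst (asm) ennreal_le_iff) auto
  qed
  moreover have "(LINT x:\<Omega>|lborel. g x \<bullet> \<psi>' x + V x * u x * \<psi> x) = rayleigh * (LINT x:\<Omega>|lborel. u x * \<psi> x)"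
    if t': "test \<psi> \<psi>'" for \<psi> \<psi>'
  proof -
    have lim: "(\<lambda>n. energy (\<phi> n) (\<phi>' n) \<psi> \<psi>' - rayleigh * mass (\<phi> n) \<psi>) \<longlonglongrightarrow>
       (LINT x:\<Omega>|lborel. g x \<bullet> \<psi>' x + V x * u x * \<psi> x) - rayleigh * (LINT x:\<Omega>|lborel. u x * \<psi> x)"
      by (intro tendsto_intros form_limit[OF u t conv t'])
    define a where "a n = energy (\<phi> n) (\<phi>' n) \<psi> \<psi>' - rayleigh * mass (\<phi> n) \<psi>" for n
    define L where "L = (LINT x:\<Omega>|lborel. g x \<bullet> \<psi>' x + V x * u x * \<psi> x) - rayleigh * (LINT x:\<Omega>|lborel. u x * \<psi> x)"
    have aL: "a \<longlonglongrightarrow> L" using lim unfolding a_def[abs_def] L_def .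
    have a_le: "(a n)\<^sup>2 \<le> 1 / (real n + 1) * defect \<psi> \<psi>'" for n
    proof -
      have "(energy (\<phi> n) (\<phi>' n) \<psi> \<psi>' - rayleigh * mass (\<phi> n) \<psi>)\<^sup>2 \<le> defect (\<phi> n) (\<phi>' n) * defect \<psi> \<psi>'"
        by (rule quadratic_nonneg_imp_discriminant)
           (metis defect_add_scaled[OF t t'] defect_nonneg[OF test_function_add_scaled[OF t t']])
      also have "\<dots> \<le> 1 / (real n + 1) * defect \<psi> \<psi>'"
        using def defect_nonneg[OF t'] by (rule mult_right_mono)
      finally show ?thesis unfolding a_def .
    qed
    have "(\<lambda>n. 1 / (real n + 1) * defect \<psi> \<psi>') \<longlonglongrightarrow> 0 * defect \<psi> \<psi>'"
      using LIMSEQ_inverse_real_of_nat by (intro tendsto_mult tendsto_const) (simp add: inverse_eq_divide add.commute)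
    then have h0: "(\<lambda>n. 1 / (real n + 1) * defect \<psi> \<psi>') \<longlonglongrightarrow> 0" by simp
    have "(\<lambda>n. (a n)\<^sup>2) \<longlonglongrightarrow> 0"
      by (rule tendsto_sandwich[OF _ _ tendsto_const h0]; rule always_eventually; rule allI)
         (rule zero_le_power2, rule a_le)
    with tendsto_power[OF aL, of 2] have "L\<^sup>2 = 0" by (rule LIMSEQ_unique)
    then show ?thesis by (simp add: L_def)
  qed
  moreover have "form_domain \<Omega> V u g" unfolding form_domain_iff using u t conv by blast
  ultimately show ?thesis unfolding dirichlet_eigenvalue_def by blast
qed

text \<open>
  The equation is tested with approximating test functions \<open>\<phi> n\<close> of the
  eigenfunction \<open>u\<close>. Up to errors that vanish in the limit this gives
  \<open>energy = l * mass\<close>, so for \<open>l < rayleigh\<close> the masses tend to zero and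
  \<open>u\<close> vanishes.
\<close>

theorem eigenvalue_ge_rayleigh:
  assumes "dirichlet_eigenvalue \<Omega> V l"
  shows "rayleigh \<le> l"
proof (rule ccontr)
  assume "\<not> rayleigh \<le> l"
  then have l: "l < rayleigh" by simp
  obtain u g where "form_domain \<Omega> V u g" and nz: "\<not> (AE x in lborel. x \<in> \<Omega> \<longrightarrow> u x = 0)"
    and eq: "\<And>\<psi> \<psi>'. test \<psi> \<psi>' \<Longrightarrow>
      (LINT x:\<Omega>|lborel. g x \<bullet> \<psi>' x + V x * u x * \<psi> x) = l * (LINT x:\<Omega>|lborel. u x * \<psi> x)"
    using assms unfolding dirichlet_eigenvalue_def by blast
  then obtain \<phi> \<phi>' where u: "u \<in> borel_measurable borel" "g \<in> borel_measurable borel"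
    and t: "\<And>n::nat. test (\<phi> n) (\<phi>' n)"
    and conv: "(\<lambda>n. form_dist (\<lambda>x. \<phi> n x - u x) (\<lambda>x. \<phi>' n x - g x)) \<longlonglongrightarrow> 0"
    unfolding form_domain_iff by blast
  define R where "R = rayleigh"
  define d where "d = R - l"
  have d: "0 < d" "0 \<le> R" using l rayleigh_nonneg by (auto simp: d_def R_def)
  \<comment> \<open>small enough that the terms with \<open>\<eta>\<close> below consume at most half of the gap \<open>d\<close>\<close>
  define \<eta> where "\<eta> = d / (2 * (R + \<bar>l\<bar> + d))"
  have pos: "0 < R + \<bar>l\<bar> + d" using d by simp
  have \<eta>: "0 < \<eta>" "\<eta> * (R + \<bar>l\<bar> + d) = d / 2" "\<eta> \<le> 1"
    using d pos by (auto simp: \<eta>_def field_simps)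
  define B where "B = 2 * (\<bar>l\<bar> + 1) / (2 * \<eta> * d)"
  have mass_small: "mass (\<phi> n) (\<phi> n) \<le> B * e"
    if e: "form_dist (\<lambda>x. \<phi> n x - u x) (\<lambda>x. \<phi>' n x - g x) \<le> ennreal e" "0 \<le> e" for n e
  proof -
    let ?E = "energy (\<phi> n) (\<phi>' n) (\<phi> n) (\<phi>' n)" and ?m = "mass (\<phi> n) (\<phi> n)"
    let ?I = "LINT x:\<Omega>|lborel. u x * \<phi> n x"
    have "\<bar>?E - l * ?I\<bar> \<le> e / (2 * \<eta>) + \<eta> / 2 * ?E"
      using form_pairing_diff(1)[OF u t e t \<eta>(1)] unfolding eq[OF t] .
    then have 1: "?E * (1 - \<eta> / 2) \<le> l * ?I + e / (2 * \<eta>)" by (simp add: algebra_simps abs_le_iff)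
    have 2: "\<bar>?m - ?I\<bar> \<le> e / (2 * \<eta>) + \<eta> / 2 * ?m"
      by (rule form_pairing_diff(2)[OF u t e t \<eta>(1)])
    have "l * ?I = l * ?m - l * (?m - ?I)" by (simp add: algebra_simps)
    moreover have "- (l * (?m - ?I)) \<le> \<bar>l\<bar> * (e / (2 * \<eta>) + \<eta> / 2 * ?m)"
    proof -
      have "- (l * (?m - ?I)) \<le> \<bar>l\<bar> * \<bar>?m - ?I\<bar>" unfolding abs_mult[symmetric] by (rule abs_ge_minus_self)
      also have "\<dots> \<le> \<bar>l\<bar> * (e / (2 * \<eta>) + \<eta> / 2 * ?m)" using 2 by (rule mult_left_mono) simp
      finally show ?thesis .
    qed
    ultimately have 3: "l * ?I \<le> l * ?m + \<bar>l\<bar> * (e / (2 * \<eta>) + \<eta> / 2 * ?m)" by simp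
    have "R * ?m * (1 - \<eta> / 2) \<le> ?E * (1 - \<eta> / 2)"
      using rayleigh_le[OF t] \<eta> unfolding R_def by (intro mult_right_mono) auto
    with 1 3 have "R * ?m * (1 - \<eta> / 2) \<le> l * ?m + \<bar>l\<bar> * (e / (2 * \<eta>) + \<eta> / 2 * ?m) + e / (2 * \<eta>)" by linarith
    then have "?m * (d - \<eta> / 2 * (R + \<bar>l\<bar>)) \<le> (\<bar>l\<bar> + 1) * (e / (2 * \<eta>))"
      by (simp add: d_def algebra_simps add_divide_distrib)
    moreover have "d / 2 \<le> d - \<eta> / 2 * (R + \<bar>l\<bar>)"
    proof -
      have "\<eta> * (R + \<bar>l\<bar>) \<le> \<eta> * (R + \<bar>l\<bar> + d)" using \<eta> d by (intro mult_left_mono) auto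
      then show ?thesis using \<eta>(2) d by simp
    qed
    ultimately have "?m * (d / 2) \<le> (\<bar>l\<bar> + 1) * (e / (2 * \<eta>))"
      by (meson mult_left_mono mass_nonneg order_trans)
    then show ?thesis using d \<eta> by (simp add: B_def field_simps)
  qed
  have B: "0 \<le> B" using d \<eta> by (simp add: B_def)
  have "(\<integral>\<^sup>+x. ennreal ((u x)\<^sup>2) * indicator \<Omega> x \<partial>lborel) \<le> 0 + ennreal e" if "0 < e" for e
  proof -
    define e' where "e' = e / (2 + 2 * B)"
    have "e' * (2 + 2 * B) = e" using B unfolding e'_def by simp
    then have "2 * e' + 2 * (B * e') = e" by (simp add: algebra_simps)
    moreover have "0 < e'" using that B by (simp add: e'_def)
    ultimately have e': "0 < e'" "2 * e' + 2 * (B * e') = e" by auto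
    obtain n where n: "form_dist (\<lambda>x. \<phi> n x - u x) (\<lambda>x. \<phi>' n x - g x) \<le> ennreal e'"
      using eventually_happens[OF form_dist_imp_real[OF conv e'(1)]] by auto
    have "(\<integral>\<^sup>+x. ennreal ((u x)\<^sup>2) * indicator \<Omega> x \<partial>lborel) \<le> ennreal (2 * e' + 2 * mass (\<phi> n) (\<phi> n))"
      by (rule mass_le_of_limit(2)[OF u t n]) (use e' in simp)
    also have "\<dots> \<le> ennreal e"
      using mass_small[OF n] e' by (intro ennreal_leI) simp
    finally show ?thesis by simp
  qed
  then have "(\<integral>\<^sup>+x. ennreal ((u x)\<^sup>2) * indicator \<Omega> x \<partial>lborel) \<le> 0"
    by (rule ennreal_le_epsilon)
  then have "(\<integral>\<^sup>+x. ennreal ((u x)\<^sup>2) * indicator \<Omega> x \<partial>lborel) = 0" by simp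
  then have "AE x in lborel. ennreal ((u x)\<^sup>2) * indicator \<Omega> x = 0"
    using u by (subst (asm) nn_integral_0_iff_AE) auto
  then have "AE x in lborel. x \<in> \<Omega> \<longrightarrow> u x = 0"
    by eventually_elim (auto simp: indicator_def)
  with nz show False by simp
qed

theorem first_eigenvalue_eq_rayleigh: "first_eigenvalue \<Omega> V = rayleigh"
  unfolding first_eigenvalue_def
  by (rule cInf_eq_minimum) (use rayleigh_is_eigenvalue eigenvalue_ge_rayleigh in auto)

lemma nn_energy:
  assumes t: "test \<phi> \<phi>'"
  shows "(\<integral>\<^sup>+x\<in>\<Omega>. ennreal ((norm (\<phi>' x))\<^sup>2 + V x * (\<phi> x)\<^sup>2) \<partial>lborel) = ennreal (energy \<phi> \<phi>' \<phi> \<phi>')"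
    "(\<integral>\<^sup>+x\<in>\<Omega>. ennreal ((\<phi> x)\<^sup>2) \<partial>lborel) = ennreal (mass \<phi> \<phi>)"
proof -
  obtain K where K: "compact K" "K \<subseteq> \<Omega>" "\<And>x. x \<notin> K \<Longrightarrow> \<phi> x = 0" "\<And>x. x \<notin> K \<Longrightarrow> \<phi>' x = 0"
    using test_functionE[OF t] by blast
  then have *: "x \<notin> \<Omega> \<Longrightarrow> \<phi> x = 0" "x \<notin> \<Omega> \<Longrightarrow> \<phi>' x = 0" for x by auto
  have "(\<integral>\<^sup>+x\<in>\<Omega>. ennreal ((norm (\<phi>' x))\<^sup>2 + V x * (\<phi> x)\<^sup>2) \<partial>lborel) =
     (\<integral>\<^sup>+x. ennreal (\<phi>' x \<bullet> \<phi>' x + U x * \<phi> x * \<phi> x) \<partial>lborel)"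
    unfolding power2_norm_eq_inner
    by (intro nn_integral_cong) (auto simp: * U_def indicator_def power2_eq_square mult.assoc)
  also have "\<dots> = ennreal (energy \<phi> \<phi>' \<phi> \<phi>')" unfolding energy_def
    by (intro nn_integral_eq_integral energy_integrable[OF t t] AE_I2) (use U_nonneg in \<open>simp add: mult.assoc\<close>)
  finally show "(\<integral>\<^sup>+x\<in>\<Omega>. ennreal ((norm (\<phi>' x))\<^sup>2 + V x * (\<phi> x)\<^sup>2) \<partial>lborel) = ennreal (energy \<phi> \<phi>' \<phi> \<phi>')" .
  have "(\<integral>\<^sup>+x\<in>\<Omega>. ennreal ((\<phi> x)\<^sup>2) \<partial>lborel) = (\<integral>\<^sup>+x. ennreal (\<phi> x * \<phi> x) \<partial>lborel)"
    by (intro nn_integral_cong) (auto simp: * indicator_def power2_eq_square)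
  also have "\<dots> = ennreal (mass \<phi> \<phi>)" unfolding mass_def
    by (intro nn_integral_eq_integral test_integrable[OF t t]) auto
  finally show "(\<integral>\<^sup>+x\<in>\<Omega>. ennreal ((\<phi> x)\<^sup>2) \<partial>lborel) = ennreal (mass \<phi> \<phi>)" .
qed

theorem first_eigenvalue_nonneg: "0 \<le> first_eigenvalue \<Omega> V"
  using rayleigh_nonneg first_eigenvalue_eq_rayleigh by simp

theorem first_eigenvalue_mass_le_energy:
  assumes t: "test \<phi> \<phi>'"
  shows "ennreal (first_eigenvalue \<Omega> V) * (\<integral>\<^sup>+x\<in>\<Omega>. ennreal ((\<phi> x)\<^sup>2) \<partial>lborel) \<le>
     (\<integral>\<^sup>+x\<in>\<Omega>. ennreal ((norm (\<phi>' x))\<^sup>2 + V x * (\<phi> x)\<^sup>2) \<partial>lborel)"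
  unfolding nn_energy[OF t] first_eigenvalue_eq_rayleigh
  using rayleigh_le[OF t] rayleigh_nonneg mass_nonneg by (simp add: ennreal_mult[symmetric] ennreal_leI)

theorem le_first_eigenvalue:
  assumes "\<And>\<phi> \<phi>'. test \<phi> \<phi>' \<Longrightarrow> ennreal r * (\<integral>\<^sup>+x\<in>\<Omega>. ennreal ((\<phi> x)\<^sup>2) \<partial>lborel) \<le>
     (\<integral>\<^sup>+x\<in>\<Omega>. ennreal ((norm (\<phi>' x))\<^sup>2 + V x * (\<phi> x)\<^sup>2) \<partial>lborel)"
  shows "r \<le> first_eigenvalue \<Omega> V"
proof (cases "0 \<le> r")
  case True
  have "r \<le> energy \<phi> \<phi>' \<phi> \<phi>'" if t: "test \<phi> \<phi>'" and m: "mass \<phi> \<phi> = 1" for \<phi> \<phi>'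
    using assms[OF t] energy_nonneg m unfolding nn_energy[OF t] by simp
  then show ?thesis
    unfolding first_eigenvalue_eq_rayleigh rayleigh_def
    by (intro cInf_greatest) (use test_nonzero_exists in auto)
next
  case False
  then show ?thesis using first_eigenvalue_nonneg by simp
qed

end

section \<open>Width and inradius of planar convex sets\<close>

text \<open>
  The disc is centred at the centroid, where all barycentric coordinates are \<open>1/3\<close>. A
  displacement \<open>w\<close> changes them by cross products of \<open>w\<close> with the sides,
  divided by \<open>A\<close>, twice the signed area.
\<close>

lemma ball_subset_triangle:
  fixes P Q T :: "real \<times> real"
  assumes conv: "convex S" and mem: "P \<in> S" "Q \<in> S" "T \<in> S"
    and A: "A = (fst Q - fst P) * (snd T - snd P) - (snd Q - snd P) * (fst T - fst P)" "A \<noteq> 0"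
    and d: "dist P Q \<le> d" "dist Q T \<le> d" "dist P T \<le> d" and r: "3 * r * d \<le> \<bar>A\<bar>" "0 \<le> d"
  shows "\<exists>c. ball c r \<subseteq> S"
proof -
  define G where "G = (1/3) *\<^sub>R (P + Q + T)"
  have cross: "\<bar>fst u * snd v - snd u * fst v\<bar> \<le> norm u * norm v" for u v :: "real \<times> real"
    using Cauchy_Schwarz_ineq2[of u "(snd v, - fst v)"]
    by (cases u; cases v) (simp add: inner_prod_def norm_Pair add.commute)
  have "z \<in> S" if z: "z \<in> ball G r" for z
  proof -
    define w where "w = z - G"
    have nw: "norm w < r" using z by (simp add: w_def dist_norm norm_minus_commute)
    define a where "a v = (snd w * fst v - fst w * snd v) / A" for v
    have a_le: "\<bar>a v\<bar> \<le> 1/3" if "norm v \<le> d" for v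
    proof -
      have "\<bar>snd w * fst v - fst w * snd v\<bar> \<le> norm w * norm v" using cross[of w v] by (simp only: abs_minus_commute)
      also have "\<dots> \<le> r * d" using nw that by (intro mult_mono) (auto intro: order_trans[OF norm_ge_zero less_imp_le])
      finally have "3 * \<bar>snd w * fst v - fst w * snd v\<bar> \<le> \<bar>A\<bar>" using r by simp
      then show ?thesis unfolding a_def abs_divide using A(2) by (subst divide_le_eq) auto
    qed
    define lP where "lP = 1/3 + a (T - Q)"
    define lQ where "lQ = 1/3 + a (P - T)"
    define lT where "lT = 1/3 + a (Q - P)"
    have nonneg: "0 \<le> lP" "0 \<le> lQ" "0 \<le> lT"
      using a_le[of "T - Q"] a_le[of "P - T"] a_le[of "Q - P"] d
      by (auto simp: lP_def lQ_def lT_def dist_norm norm_minus_commute)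
    have sum: "lP + lQ + lT = 1"
      by (simp add: lP_def lQ_def lT_def a_def add_divide_distrib[symmetric] algebra_simps)
    have aA: "a v * A = snd w * fst v - fst w * snd v" for v using A(2) by (simp add: a_def)
    have "A * (lP * fst P + lQ * fst Q + lT * fst T) = A * fst z"
    proof -
      have "A * (lP * fst P + lQ * fst Q + lT * fst T) =
         A * fst G + (a (T - Q) * A) * fst P + (a (P - T) * A) * fst Q + (a (Q - P) * A) * fst T"
        by (simp add: lP_def lQ_def lT_def G_def algebra_simps)
      also have "\<dots> = A * fst G + A * fst w" unfolding aA unfolding A(1) by (simp add: algebra_simps)
      finally show ?thesis by (simp add: w_def algebra_simps)
    qed
    moreover have "A * (lP * snd P + lQ * snd Q + lT * snd T) = A * snd z"
    proof -
      have "A * (lP * snd P + lQ * snd Q + lT * snd T) =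
         A * snd G + (a (T - Q) * A) * snd P + (a (P - T) * A) * snd Q + (a (Q - P) * A) * snd T"
        by (simp add: lP_def lQ_def lT_def G_def algebra_simps)
      also have "\<dots> = A * snd G + A * snd w" unfolding aA unfolding A(1) by (simp add: algebra_simps)
      finally show ?thesis by (simp add: w_def algebra_simps)
    qed
    ultimately have "z = lP *\<^sub>R P + lQ *\<^sub>R Q + lT *\<^sub>R T"
      using A(2) by (simp add: prod_eq_iff)
    moreover have "lP *\<^sub>R P + lQ *\<^sub>R Q + lT *\<^sub>R T \<in> convex hull {P, Q, T}"
      unfolding convex_hull_3 using nonneg sum by blast
    moreover have "convex hull {P, Q, T} \<subseteq> S"
      using conv mem by (intro hull_minimal) auto
    ultimately show ?thesis by blast
  qed
  then show ?thesis by blast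
qed

text \<open>
  Choose \<open>P\<close> and \<open>Q\<close> at a distance of at least half the diameter. A point
  at height \<open>k\<close> above the line \<open>PQ\<close> spans with them a triangle whose
  inscribed disc at the centroid has radius at least \<open>k / 6\<close>. All heights on either
  side are therefore at most \<open>6 \<rho>\<close>, and the width is at most
  \<open>12 \<rho>\<close> in the direction normal to \<open>PQ\<close>.
\<close>

lemma convex_narrow_direction:
  fixes S :: "(real \<times> real) set"
  assumes conv: "convex S" and bdd: "bounded S" and balls: "\<And>c r. ball c r \<subseteq> S \<Longrightarrow> r \<le> \<rho>" and "0 \<le> \<rho>"
  shows "\<exists>e. norm e = 1 \<and> (\<forall>z\<in>S. \<forall>z'\<in>S. \<bar>(z - z') \<bullet> e\<bar> \<le> 12 * \<rho>)"
proof (cases "\<exists>z\<in>S. \<exists>z'\<in>S. z \<noteq> z'")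
  case False
  then have "\<forall>z\<in>S. \<forall>z'\<in>S. \<bar>(z - z') \<bullet> (1, 0)\<bar> \<le> 12 * \<rho>" using \<open>0 \<le> \<rho>\<close> by fastforce
  then show ?thesis by (intro exI[of _ "(1::real, 0::real)"]) (simp add: norm_Pair)
next
  case True
  then obtain z0 z0' where z0: "z0 \<in> S" "z0' \<in> S" "z0 \<noteq> z0'" by blast
  define d where "d = diameter S"
  have dist_le: "dist x y \<le> d" if "x \<in> S" "y \<in> S" for x y
    unfolding d_def using bdd that by (rule diameter_bounded_bound)
  have "0 < dist z0 z0'" using z0 by simp
  also have "\<dots> \<le> d" using z0 dist_le by blast
  finally have d: "0 < d" .
  then obtain P Q where PQ: "P \<in> S" "Q \<in> S" "d / 2 < dist P Q"
    using diameter_bounded(2)[OF bdd, rule_format, of "d / 2"] unfolding d_def by auto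
  define n where "n = norm (Q - P)"
  have n: "d / 2 < n" "0 < n" using PQ(3) d by (auto simp: n_def dist_norm norm_minus_commute)
  define e where "e = (1 / n) *\<^sub>R (- snd (Q - P), fst (Q - P))"
  have "norm e = 1"
  proof -
    have "norm (- snd (Q - P), fst (Q - P)) = n"
      unfolding n_def norm_prod_def by (simp add: add.commute power2_commute[of "snd P"])
    then show ?thesis using n unfolding e_def norm_scaleR by simp
  qed
  have height: "\<bar>(T - P) \<bullet> e\<bar> \<le> 6 * \<rho>" if T: "T \<in> S" for T
  proof (rule ccontr)
    assume "\<not> ?thesis"
    then have k: "6 * \<rho> < \<bar>(T - P) \<bullet> e\<bar>" by simp
    define A where "A = (fst Q - fst P) * (snd T - snd P) - (snd Q - snd P) * (fst T - fst P)"
    have Ae: "A = n * ((T - P) \<bullet> e)"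
      using n by (simp add: A_def e_def inner_prod_def algebra_simps)
    define r where "r = \<bar>A\<bar> / (3 * d)"
    have "A \<noteq> 0" using Ae n k \<open>0 \<le> \<rho>\<close> by auto
    have "\<exists>c. ball c r \<subseteq> S"
      by (rule ball_subset_triangle[OF conv PQ(1,2) T A_def \<open>A \<noteq> 0\<close>, of d])
         (use dist_le PQ T d in \<open>auto simp: r_def\<close>)
    then have "r \<le> \<rho>" using balls by blast
    then have "\<bar>A\<bar> \<le> 3 * d * \<rho>" using d by (simp add: r_def field_simps)
    moreover have "d / 2 * (6 * \<rho>) < n * \<bar>(T - P) \<bullet> e\<bar>"
      using n k d \<open>0 \<le> \<rho>\<close> by (intro mult_strict_mono') auto
    ultimately show False using Ae n by (simp add: abs_mult)
  qed
  have "\<bar>(z - z') \<bullet> e\<bar> \<le> 12 * \<rho>" if "z \<in> S" "z' \<in> S" for z z'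
  proof -
    have "(z - z') \<bullet> e = (z - P) \<bullet> e - (z' - P) \<bullet> e" by (simp add: inner_diff_left)
    with height[OF that(1)] height[OF that(2)] show ?thesis by linarith
  qed
  with \<open>norm e = 1\<close> show ?thesis by blast
qed

section \<open>Convex wells in the plane\<close>

lemma convex_combination_le: "(1 - t) * a + t * b \<le> c" if "a \<le> c" "b \<le> c" "0 \<le> t" "t \<le> (1::real)" for a b c t
  using that by (metis add.commute convex_bound_le diff_add_cancel diff_ge_0_iff_ge)

lemma inverse_square_convex:
  fixes a b t :: real
  assumes "0 < a" "0 < b" "0 \<le> t" "t \<le> 1"
  shows "1 / ((1 - t) * a + t * b)\<^sup>2 \<le> (1 - t) * (1 / a\<^sup>2) + t * (1 / b\<^sup>2)"
proof -
  have "convex_on {0<..} (\<lambda>x::real. 1 / x\<^sup>2)"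
  proof (rule f''_ge0_imp_convex[where f' = "\<lambda>x. - 2 / x ^ 3" and f'' = "\<lambda>x. 6 / x ^ 4"])
    fix x :: real assume x: "x \<in> {0<..}"
    then show "((\<lambda>x. 1 / x\<^sup>2) has_real_derivative - 2 / x ^ 3) (at x)"
      by (auto intro!: derivative_eq_intros simp: divide_simps eval_nat_numeral)
    from x show "((\<lambda>x. - 2 / x ^ 3) has_real_derivative 6 / x ^ 4) (at x)"
      by (auto intro!: derivative_eq_intros simp: divide_simps eval_nat_numeral)
  qed auto
  from convex_onD[OF this assms(3,4), of a b] assms show ?thesis by simp
qed

locale convex_well =
  fixes \<Omega> :: "(real \<times> real) set" and h :: "real \<times> real \<Rightarrow> real"
  assumes adm: "admissible \<Omega> h"
begin

definition V :: "real \<times> real \<Rightarrow> real" where "V = potential h"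

lemma dom: "open \<Omega>" "bounded \<Omega>" "convex \<Omega>" "\<Omega> \<noteq> {}"
  and h_concave: "concave_on \<Omega> h" and h_range: "z \<in> \<Omega> \<Longrightarrow> 0 \<le> h z" "z \<in> \<Omega> \<Longrightarrow> h z \<le> 1"
  and h_sup: "(SUP z\<in>\<Omega>. h z) = 1"
  using adm unfolding admissible_def by auto

lemma exists_h_gt: "s < 1 \<Longrightarrow> \<exists>z\<in>\<Omega>. s < h z"
  using less_cSUP_iff[OF dom(4) bdd_aboveI2[of \<Omega> h 1, OF h_range(2)], of s] h_sup by simp

text \<open>
  A nonnegative concave function that is positive at \<open>w\<close> is positive on the open set
  \<open>\<Omega>\<close>: a segment from \<open>w\<close> through \<open>z\<close> can be prolonged
  beyond \<open>z\<close> inside \<open>\<Omega>\<close>.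
\<close>

lemma h_pos: assumes z: "z \<in> \<Omega>" shows "0 < h z"
proof -
  obtain w where w: "w \<in> \<Omega>" "1/2 < h w" using exists_h_gt[of "1/2"] by auto
  obtain e where e: "0 < e" "ball z e \<subseteq> \<Omega>" using dom(1) z open_contains_ball by blast
  define k where "k = e / (2 * (norm (z - w) + 1))"
  have k: "0 < k" using e by (simp add: k_def add_nonneg_pos)
  define v where "v = z + k *\<^sub>R (z - w)"
  have "norm (k *\<^sub>R (z - w)) < e"
  proof -
    have "x < 2 * (x + 1)" if "0 \<le> x" for x :: real using that by simp
    from this[OF norm_ge_zero] have "norm (z - w) < 2 * (norm (z - w) + 1)" .
    then have "k * norm (z - w) < k * (2 * (norm (z - w) + 1))" using k by (rule mult_strict_left_mono)
    also have "\<dots> = e" using norm_ge_zero[of "z - w"] unfolding k_def by (simp add: field_simps add_nonneg_eq_0_iff)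
    finally show ?thesis using k by simp
  qed
  then have v: "v \<in> \<Omega>" using e by (intro subsetD[OF e(2)]) (simp add: v_def dist_norm)
  \<comment> \<open>the weight for which \<open>z\<close> is a convex combination of \<open>v\<close> and \<open>w\<close>\<close>
  define t where "t = k / (1 + k)"
  have t: "0 < t" "t < 1" "t * (1 + k) = k" using k by (auto simp: t_def)
  have "(1 - t) *\<^sub>R v + t *\<^sub>R w = z + (k - t * (1 + k)) *\<^sub>R (z - w)"
    by (simp add: v_def algebra_simps)
  then have "z = (1 - t) *\<^sub>R v + t *\<^sub>R w" using t(3) by simp
  moreover have "h ((1 - t) *\<^sub>R v + t *\<^sub>R w) \<ge> (1 - t) * h v + t * h w"
    using h_concave v w t unfolding concave_on_iff by auto
  moreover have "0 \<le> (1 - t) * h v" using t h_range(1)[OF v] by simp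
  moreover have "0 < t * h w" using t w by simp
  ultimately show ?thesis by simp
qed

lemma V_eq: "V z = 1 / (h z)\<^sup>2" by (simp add: V_def potential_def)

lemma V_ge_1: "z \<in> \<Omega> \<Longrightarrow> 1 \<le> V z"
  using h_pos[of z] h_range(2)[of z] power_le_one[of "h z" 2] by (simp add: V_eq field_simps)

lemma V_convex:
  assumes "z \<in> \<Omega>" "w \<in> \<Omega>" "0 \<le> t" "t \<le> 1"
  shows "V ((1 - t) *\<^sub>R z + t *\<^sub>R w) \<le> (1 - t) * V z + t * V w"
proof -
  have p: "0 < (1 - t) * h z + t * h w"
    using h_pos[OF assms(1)] h_pos[OF assms(2)] assms(3,4)
    by (cases "t = 0") (auto intro: add_nonneg_pos)
  have "(1 - t) * h z + t * h w \<le> h ((1 - t) *\<^sub>R z + t *\<^sub>R w)"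
    using h_concave assms unfolding concave_on_iff by auto
  then have "V ((1 - t) *\<^sub>R z + t *\<^sub>R w) \<le> 1 / ((1 - t) * h z + t * h w)\<^sup>2"
    unfolding V_eq using p by (intro divide_left_mono power_mono mult_pos_pos zero_less_power) auto
  also have "\<dots> \<le> (1 - t) * V z + t * V w"
    unfolding V_eq using assms h_pos by (intro inverse_square_convex) auto
  finally show ?thesis .
qed

lemma V_convex_on: "convex_on \<Omega> V"
  by (rule convex_onI) (use V_convex dom in auto)

lemma V_continuous: "continuous_on \<Omega> V"
  by (rule convex_on_continuous[OF dom(1) V_convex_on])

lemma exists_V_le: "0 < \<epsilon> \<Longrightarrow> \<exists>z\<in>\<Omega>. V z \<le> 1 + \<epsilon>"
proof -
  assume e: "0 < \<epsilon>"
  obtain z where z: "z \<in> \<Omega>" "1 / sqrt (1 + \<epsilon>) < h z" using exists_h_gt[of "1 / sqrt (1 + \<epsilon>)"] e by auto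
  then have "(1 / sqrt (1 + \<epsilon>))\<^sup>2 \<le> (h z)\<^sup>2" using e by (intro power_mono) auto
  then have "1 / (1 + \<epsilon>) \<le> (h z)\<^sup>2" using e by (simp add: power_divide)
  then have "V z \<le> 1 + \<epsilon>" using h_pos[OF z(1)] e by (simp add: V_eq field_simps)
  with z show ?thesis by blast
qed

abbreviation S where "S s \<equiv> sublevel \<Omega> V s"

lemma sublevel_iff: "z \<in> S s \<longleftrightarrow> z \<in> \<Omega> \<and> V z \<le> 1 + s"
  by (simp add: sublevel_def)

lemma convex_sublevel: "convex (S s)"
proof (rule convexI)
  fix x y u v assume *: "x \<in> S s" "y \<in> S s" "0 \<le> (u::real)" "0 \<le> v" "u + v = 1"
  then have u: "u = 1 - v" "v \<le> 1" by auto
  have "V ((1 - v) *\<^sub>R x + v *\<^sub>R y) \<le> (1 - v) * V x + v * V y"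
    using * u by (intro V_convex) (auto simp: sublevel_iff)
  also have "\<dots> \<le> 1 + s" using * u by (intro convex_combination_le) (auto simp: sublevel_iff)
  finally show "u *\<^sub>R x + v *\<^sub>R y \<in> S s"
    using * convexD[OF dom(3), of x y u v] by (auto simp: sublevel_iff u)
qed

lemma bounded_sublevel: "bounded (S s)"
  by (rule bounded_subset[OF dom(2)]) (auto simp: sublevel_iff)

text \<open>
  Scaling the level set towards a near-minimum \<open>w\<close> of \<open>V\<close> lowers the level
  in proportion. The factor \<open>2\<close> compensates that the infimum of \<open>V\<close> may be
  attained only at the boundary.
\<close>

lemma sublevel_contraction:
  assumes "0 < \<theta>" "\<theta> \<le> 1" "0 < s"
  shows "\<exists>w\<in>\<Omega>. \<forall>z\<in>S s. (1 - \<theta>) *\<^sub>R w + \<theta> *\<^sub>R z \<in> S (2 * \<theta> * s)"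
proof -
  obtain w where w: "w \<in> \<Omega>" "V w \<le> 1 + \<theta> * s" using exists_V_le[of "\<theta> * s"] assms by auto
  have "(1 - \<theta>) *\<^sub>R w + \<theta> *\<^sub>R z \<in> S (2 * \<theta> * s)" if z: "z \<in> S s" for z
  proof -
    have "V ((1 - \<theta>) *\<^sub>R w + \<theta> *\<^sub>R z) \<le> (1 - \<theta>) * V w + \<theta> * V z"
      using w z assms by (intro V_convex) (auto simp: sublevel_iff)
    also have "\<dots> \<le> (1 - \<theta>) * (1 + \<theta> * s) + \<theta> * (1 + s)"
      using w z assms by (intro add_mono mult_left_mono) (auto simp: sublevel_iff)
    also have "\<dots> \<le> 1 + 2 * \<theta> * s"
    proof -
      have "0 \<le> \<theta> * (\<theta> * s)" using assms by simp
      then show ?thesis by (simp add: algebra_simps)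
    qed
    finally show ?thesis using convexD[OF dom(3) w(1), of z "1 - \<theta>" \<theta>] z assms by (auto simp: sublevel_iff)
  qed
  with w show ?thesis by blast
qed

sublocale dirichlet_form \<Omega> V
proof
  show "open \<Omega>" "bounded \<Omega>" "\<Omega> \<noteq> {}" by (fact dom)+
  show "0 \<le> V x" if "x \<in> \<Omega>" for x using V_ge_1[OF that] by simp
  show "(\<lambda>x. indicator \<Omega> x * V x) \<in> borel_measurable borel"
    using borel_measurable_continuous_on_indicator[OF _ V_continuous] dom(1) by simp
  show "\<exists>c. \<forall>x\<in>K. V x \<le> c" if K: "compact K" "K \<subseteq> \<Omega>" for K
  proof -
    have "bounded (V ` K)"
      using K by (intro compact_imp_bounded compact_continuous_image continuous_on_subset[OF V_continuous])
    then obtain c where "\<forall>y\<in>V ` K. norm y \<le> c" using bounded_iff by blast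
    then show ?thesis by (intro exI[of _ c]) auto
  qed
qed

end

section \<open>Linear second order equations\<close>

lemma has_integral_power_bound:
  fixes c y :: real
  assumes "0 \<le> y"
  shows "((\<lambda>s. c * s ^ n / fact n) has_integral c * y ^ Suc n / fact (Suc n)) {0..y}"
proof -
  have "((\<lambda>s. c * s ^ n / fact n) has_integral (c * y ^ Suc n / fact (Suc n) - c * 0 ^ Suc n / fact (Suc n))) {0..y}"
  proof (rule fundamental_theorem_of_calculus)
    fix s assume "s \<in> {0..y}"
    have "((\<lambda>s. c * s ^ Suc n / fact (Suc n)) has_real_derivative c * (real (Suc n) * s ^ n) / fact (Suc n)) (at s within {0..y})"
    proof -
      have "((\<lambda>s. s ^ Suc n) has_real_derivative real (Suc n) * s ^ n) (at s within {0..y})"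
        using DERIV_pow[of "Suc n" s "{0..y}"] by simp
      from DERIV_cdivide[OF DERIV_cmult[OF this, of c], of "fact (Suc n)"] show ?thesis .
    qed
    moreover have "c * (real (Suc n) * s ^ n) / fact (Suc n) = c * s ^ n / fact n"
      by (simp add: fact_Suc del: of_nat_Suc)
    ultimately show "((\<lambda>s. c * s ^ Suc n / fact (Suc n)) has_vector_derivative c * s ^ n / fact n) (at s within {0..y})"
      by (simp add: has_real_derivative_iff_has_vector_derivative)
  qed (use assms in simp)
  then show ?thesis by simp
qed

lemma integral_bound_power:
  fixes f :: "real \<Rightarrow> real"
  assumes "0 \<le> y" "continuous_on {0..y} f" "\<And>s. s \<in> {0..y} \<Longrightarrow> \<bar>f s\<bar> \<le> c * s ^ n / fact n"
  shows "\<bar>integral {0..y} f\<bar> \<le> c * y ^ Suc n / fact (Suc n)"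
proof -
  have "norm (integral {0..y} f) \<le> integral {0..y} (\<lambda>s. c * s ^ n / fact n)"
    by (rule integral_norm_bound_integral)
       (use assms has_integral_integrable[OF has_integral_power_bound[OF assms(1), of c n]] in \<open>auto intro!: integrable_continuous_real\<close>)
  also have "\<dots> = c * y ^ Suc n / fact (Suc n)"
    using has_integral_power_bound[OF assms(1)] by (rule integral_unique)
  finally show ?thesis by simp
qed

text \<open>
  The solution is the Picard series: \<open>U n\<close> is the \<open>n\<close>-fold application of
  the double integral of \<open>Q u\<close> to the function \<open>y\<close>, and
  \<open>D n\<close>, \<open>E n\<close> are its first two derivatives. The factorial in the bound
  on \<open>U n\<close> allows termwise differentiation twice.
\<close>

lemma linear_ode_solution_from_zero:
  fixes Q :: "real \<Rightarrow> real"
  assumes "0 < T" and Q: "continuous_on {0..T} Q"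
  shows "\<exists>\<psi> \<psi>'. \<psi> 0 = 0 \<and> \<psi>' 0 = 1 \<and>
    (\<forall>y\<in>{0..T}. (\<psi> has_real_derivative \<psi>' y) (at y within {0..T}) \<and>
       (\<psi>' has_real_derivative Q y * \<psi> y) (at y within {0..T}))"
proof -
  let ?I = "{0..T}"
  obtain c where c: "\<And>y. y \<in> ?I \<Longrightarrow> \<bar>Q y\<bar> \<le> c" "0 < c"
  proof -
    have "bounded (Q ` ?I)" using Q by (intro compact_imp_bounded compact_continuous_image) auto
    then obtain b where "\<forall>x\<in>Q ` ?I. norm x \<le> b" using bounded_iff by blast
    then have "\<bar>Q y\<bar> \<le> max b 1" if "y \<in> ?I" for y using that by (simp add: le_max_iff_disj)
    then show thesis by (rule that) auto
  qed
  define U where "U = rec_nat (\<lambda>y. y) (\<lambda>n u y. integral {0..y} (\<lambda>s. integral {0..s} (\<lambda>r. Q r * u r)))"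
  have U0: "U 0 = (\<lambda>y. y)" and USuc: "U (Suc n) = (\<lambda>y. integral {0..y} (\<lambda>s. integral {0..s} (\<lambda>r. Q r * U n r)))" for n
    by (simp_all add: U_def)
  define D where "D n = (case n of 0 \<Rightarrow> (\<lambda>y. 1) | Suc m \<Rightarrow> (\<lambda>y. integral {0..y} (\<lambda>r. Q r * U m r)))" for n
  define E where "E n = (case n of 0 \<Rightarrow> (\<lambda>y. 0) | Suc m \<Rightarrow> (\<lambda>y. Q y * U m y))" for n
  have contU: "continuous_on ?I (U n)" for n
  proof (induction n)
    case 0
    then show ?case by (simp add: U0 continuous_on_id)
  next
    case (Suc n)
    have "continuous_on ?I (\<lambda>r. Q r * U n r)" by (intro continuous_intros Q Suc)
    then have "continuous_on ?I (\<lambda>s. integral {0..s} (\<lambda>r. Q r * U n r))"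
      by (intro indefinite_integral_continuous_1 integrable_continuous_real)
    then show ?case unfolding USuc
      by (rule indefinite_integral_continuous_1[OF integrable_continuous_real])
  qed
  have contQU: "continuous_on ?I (\<lambda>r. Q r * U n r)" for n by (intro continuous_intros Q contU)
  have contD: "continuous_on ?I (D n)" for n
    unfolding D_def by (cases n) (auto intro!: indefinite_integral_continuous_1 integrable_continuous_real contQU)
  have dU: "(U n has_real_derivative D n y) (at y within ?I)" if "y \<in> ?I" for n y
  proof (cases n)
    case 0
    then show ?thesis by (simp add: U0 D_def)
  next
    case (Suc m)
    then have "D n = (\<lambda>s. integral {0..s} (\<lambda>r. Q r * U m r))" by (simp add: D_def)
    then show ?thesis using integral_has_real_derivative[OF contD[of n] that] Suc by (simp add: USuc)
  qed
  have dD: "(D n has_real_derivative E n y) (at y within ?I)" if "y \<in> ?I" for n y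
    using integral_has_real_derivative[OF contQU that]
    by (cases n) (auto simp: D_def E_def)
  have bound: "y \<in> ?I \<Longrightarrow> \<bar>U n y\<bar> \<le> T * (c * T) ^ n * y ^ n / fact n" for n y
  proof (induction n arbitrary: y)
    case 0
    then show ?case by (simp add: U0)
  next
    case (Suc n)
    have b1: "\<bar>integral {0..s} (\<lambda>r. Q r * U n r)\<bar> \<le> (c * T) ^ Suc n * s ^ Suc n / fact (Suc n)" if s: "s \<in> ?I" for s
    proof (rule integral_bound_power)
      show "continuous_on {0..s} (\<lambda>r. Q r * U n r)" using s by (intro continuous_on_subset[OF contQU]) auto
      fix r assume "r \<in> {0..s}"
      then have r: "r \<in> ?I" using s by auto
      have "\<bar>Q r * U n r\<bar> \<le> c * (T * (c * T) ^ n * r ^ n / fact n)"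
        unfolding abs_mult using c r Suc.IH[OF r] by (intro mult_mono) auto
      then show "\<bar>Q r * U n r\<bar> \<le> (c * T) ^ Suc n * r ^ n / fact n" by (simp add: ac_simps)
    qed (use s in simp)
    have "\<bar>integral {0..y} (\<lambda>s. integral {0..s} (\<lambda>r. Q r * U n r))\<bar> \<le> integral {0..y} (\<lambda>s. (c * T) ^ Suc n * y ^ Suc n / fact (Suc n))"
      (is "\<bar>integral _ ?f\<bar> \<le> _")
    proof -
      have "norm (integral {0..y} ?f) \<le> integral {0..y} (\<lambda>s. (c * T) ^ Suc n * y ^ Suc n / fact (Suc n))"
      proof (rule integral_norm_bound_integral)
        have "continuous_on ?I ?f" using contD[of "Suc n"] by (simp add: D_def)
        then show "?f integrable_on {0..y}"
          using Suc.prems by (intro integrable_continuous_real) (auto intro: continuous_on_subset)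
        fix s assume s: "s \<in> {0..y}"
        then have "\<bar>?f s\<bar> \<le> (c * T) ^ Suc n * s ^ Suc n / fact (Suc n)" using Suc.prems by (intro b1) auto
        also have "\<dots> \<le> (c * T) ^ Suc n * y ^ Suc n / fact (Suc n)"
          using s c assms by (intro divide_right_mono mult_left_mono power_mono) auto
        finally show "norm (?f s) \<le> (c * T) ^ Suc n * y ^ Suc n / fact (Suc n)" by simp
      qed auto
      then show ?thesis by simp
    qed
    also have "\<dots> = y * ((c * T) ^ Suc n * y ^ Suc n / fact (Suc n))" using Suc.prems by simp
    also have "\<dots> \<le> T * ((c * T) ^ Suc n * y ^ Suc n / fact (Suc n))"
      using Suc.prems c assms by (intro mult_right_mono) auto
    finally show ?case by (simp add: USuc mult.assoc)
  qed
  have boundT: "\<bar>U n y\<bar> \<le> T * (c * T * T) ^ n / fact n" if "y \<in> ?I" for n y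
  proof -
    have "T * (c * T) ^ n * y ^ n / fact n \<le> T * (c * T) ^ n * T ^ n / fact n"
      using that c assms by (intro divide_right_mono mult_left_mono power_mono) auto
    with bound[OF that, of n] show ?thesis by (simp add: power_mult_distrib mult.assoc)
  qed
  define M where "M n = T * (c * T * T) ^ n / fact n" for n
  have sM: "summable M"
  proof -
    have "summable (\<lambda>n. T * ((c * T * T) ^ n /\<^sub>R fact n))"
      by (intro summable_mult summable_exp_generic)
    then show ?thesis unfolding M_def by (simp add: divide_inverse ac_simps)
  qed
  have unifE: "uniform_limit ?I (\<lambda>n y. \<Sum>i<n. E i y) (\<lambda>y. \<Sum>i. E i y) sequentially"
  proof (rule Weierstrass_m_test)
    show "summable (\<lambda>n. c * (case n of 0 \<Rightarrow> 0 | Suc m \<Rightarrow> M m))"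
      by (intro summable_mult, subst summable_Suc_iff[symmetric]) (simp add: sM)
    fix n y assume "y \<in> ?I"
    then have "\<bar>Q y\<bar> * \<bar>U m y\<bar> \<le> c * M m" for m
      using c boundT[of y m] by (intro mult_mono) (auto simp: M_def)
    then show "norm (E n y) \<le> c * (case n of 0 \<Rightarrow> 0 | Suc m \<Rightarrow> M m)"
      by (cases n) (simp_all add: E_def abs_mult)
  qed
  have I: "0 \<in> ?I" "convex ?I" using assms by auto
  have D0: "D n 0 = (if n = 0 then 1 else 0)" and U_0: "U n 0 = 0" for n
    by (cases n; simp add: D_def U0 USuc)+
  have "summable (\<lambda>n. D n 0)" by (rule summable_finite[of "{0}"]) (auto simp: D0)
  from has_field_derivative_series[OF I(2) dD unifE I(1) this]
  obtain \<psi>' where p': "\<And>y. y \<in> ?I \<Longrightarrow> (\<lambda>n. D n y) sums \<psi>' y"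
    "\<And>y. y \<in> ?I \<Longrightarrow> (\<psi>' has_real_derivative (\<Sum>i. E i y)) (at y within ?I)" by blast
  have unifD: "uniform_limit ?I (\<lambda>n y. \<Sum>i<n. D i y) (\<lambda>y. \<Sum>i. D i y) sequentially"
  proof (rule Weierstrass_m_test)
    show "summable (\<lambda>n. (case n of 0 \<Rightarrow> 1 | Suc m \<Rightarrow> T * (c * M m)))"
      using summable_mult[OF summable_mult[OF sM, of c], of T] by (subst summable_Suc_iff[symmetric]) simp
    fix n y assume y: "y \<in> ?I"
    show "norm (D n y) \<le> (case n of 0 \<Rightarrow> 1 | Suc m \<Rightarrow> T * (c * M m))"
    proof (cases n)
      case (Suc m)
      have "norm (integral {0..y} (\<lambda>r. Q r * U m r)) \<le> integral {0..y} (\<lambda>r. c * M m)"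
      proof (rule integral_norm_bound_integral)
        show "(\<lambda>r. Q r * U m r) integrable_on {0..y}"
          using y by (intro integrable_continuous_real continuous_on_subset[OF contQU]) auto
        fix r assume "r \<in> {0..y}"
        then have "r \<in> ?I" using y by auto
        then have "\<bar>Q r\<bar> * \<bar>U m r\<bar> \<le> c * M m"
          using c boundT[of r m] by (intro mult_mono) (auto simp: M_def)
        then show "norm (Q r * U m r) \<le> c * M m" by (simp add: abs_mult)
      qed auto
      also have "\<dots> = y * (c * M m)" using y by simp
      also have "\<dots> \<le> T * (c * M m)" using y c assms by (intro mult_right_mono) (auto simp: M_def)
      finally show ?thesis using Suc by (simp add: D_def)
    qed (simp add: D_def)
  qed
  have "summable (\<lambda>n. U n 0)" by (simp add: U_0)
  from has_field_derivative_series[OF I(2) dU unifD I(1) this]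
  obtain \<psi> where p: "\<And>y. y \<in> ?I \<Longrightarrow> (\<lambda>n. U n y) sums \<psi> y"
    "\<And>y. y \<in> ?I \<Longrightarrow> (\<psi> has_real_derivative (\<Sum>i. D i y)) (at y within ?I)" by blast
  have E_sum: "(\<Sum>i. E i y) = Q y * \<psi> y" if "y \<in> ?I" for y
  proof -
    have "(\<lambda>n. E (Suc n) y) sums (Q y * \<psi> y)"
      unfolding E_def using sums_mult[OF p(1)[OF that], of "Q y"] by simp
    then have "(\<lambda>n. E n y) sums (Q y * \<psi> y + E 0 y)" using sums_Suc_iff[of "\<lambda>n. E n y" "Q y * \<psi> y"] by blast
    then show ?thesis by (simp add: E_def sums_iff)
  qed
  have "\<psi> 0 = 0" using p(1)[OF I(1)] by (simp add: U_0 sums_unique2 sums_0 sums_iff)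
  moreover have "\<psi>' 0 = 1"
  proof -
    have "(\<lambda>n. D n 0) sums (\<Sum>n\<in>{0}. D n 0)" by (rule sums_finite) (auto simp: D0)
    with p'(1)[OF I(1)] show ?thesis using sums_unique2 by (fastforce simp: D0)
  qed
  moreover have "(\<psi> has_real_derivative \<psi>' y) (at y within ?I)" if "y \<in> ?I" for y
    using p(2)[OF that] p'(1)[OF that] by (simp add: sums_iff)
  moreover have "(\<psi>' has_real_derivative Q y * \<psi> y) (at y within ?I)" if "y \<in> ?I" for y
    using p'(2)[OF that] E_sum[OF that] by simp
  ultimately show ?thesis by blast
qed

lemma linear_ode_solution:
  fixes Q :: "real \<Rightarrow> real"
  assumes "a < b" and Q: "continuous_on {a..b} Q"
  shows "\<exists>\<psi> \<psi>'. \<psi> a = 0 \<and> \<psi>' a = 1 \<and>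
    (\<forall>y\<in>{a..b}. (\<psi> has_real_derivative \<psi>' y) (at y within {a..b}) \<and>
       (\<psi>' has_real_derivative Q y * \<psi> y) (at y within {a..b}))"
proof -
  have "continuous_on {0..b - a} (\<lambda>y. Q (y + a))"
    by (intro continuous_on_compose2[OF Q] continuous_intros) auto
  from linear_ode_solution_from_zero[OF _ this] assms(1) obtain u u' where u: "u 0 = 0" "u' 0 = 1"
    "\<And>y. y \<in> {0..b - a} \<Longrightarrow> (u has_real_derivative u' y) (at y within {0..b - a})"
    "\<And>y. y \<in> {0..b - a} \<Longrightarrow> (u' has_real_derivative Q (y + a) * u y) (at y within {0..b - a})" by auto
  have im: "(\<lambda>y. y - a) ` {a..b} = {0..b - a}" by (auto simp: image_iff intro!: bexI[of _ "_ + a"])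
  have sh: "((\<lambda>y. f (y - a)) has_real_derivative d) (at y within {a..b})"
    if "(f has_real_derivative d) (at (y - a) within {0..b - a})" for f d and y :: real
  proof -
    have "((\<lambda>y. y - a) has_real_derivative 1) (at y within {a..b})" by (auto intro!: derivative_eq_intros)
    with DERIV_image_chain[of f d "\<lambda>y. y - a" y "{a..b}" 1] that show ?thesis unfolding im by (simp add: o_def)
  qed
  show ?thesis
  proof (rule exI[of _ "\<lambda>y. u (y - a)"], rule exI[of _ "\<lambda>y. u' (y - a)"], intro conjI ballI)
    fix y assume "y \<in> {a..b}"
    then have y: "y - a \<in> {0..b - a}" by auto
    show "((\<lambda>y. u (y - a)) has_real_derivative u' (y - a)) (at y within {a..b})" by (rule sh[OF u(3)[OF y]])
    show "((\<lambda>y. u' (y - a)) has_real_derivative Q y * u (y - a)) (at y within {a..b})" using sh[OF u(4)[OF y]] by simp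
  qed (use u in auto)
qed

lemma nn_integral_continuous_interval:
  fixes f :: "real \<Rightarrow> real"
  assumes "continuous_on {a..b} f" "\<And>x. x \<in> {a..b} \<Longrightarrow> 0 \<le> f x"
  shows "(\<integral>\<^sup>+x. ennreal (f x) * indicator {a..b} x \<partial>lborel) = ennreal (integral {a..b} f)"
proof (rule nn_integral_has_integral_lebesgue')
  show "(f has_integral integral {a..b} f) {a..b}"
    by (intro integrable_integral integrable_continuous_real assms)
qed (rule assms(2))

text \<open>
  Picone's identity: for a positive solution \<open>\<psi>\<close>, the integrand
  \<open>\<phi>'\<^sup>2 + (V - m) \<phi>\<^sup>2\<close> is a square plus the derivative of
  \<open>\<phi>\<^sup>2 \<psi>' / \<psi>\<close>. Contrapositively, a test function with Rayleigh
  quotient below \<open>m\<close> forces every solution to have a zero near the support.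
\<close>

lemma positive_solution_rayleigh_bound:
  fixes V :: "real \<Rightarrow> real"
  assumes t: "test_function J \<phi> \<phi>'" and K: "K \<subseteq> {k1<..<k2}" "\<And>x. x \<notin> K \<Longrightarrow> \<phi> x = 0" "\<And>x. x \<notin> K \<Longrightarrow> \<phi>' x = 0"
    and J: "{k1..k2} \<subseteq> J" "k1 < k2" and V: "continuous_on {k1..k2} V" "\<And>y. y \<in> J \<Longrightarrow> 0 \<le> V y" and m: "0 \<le> m"
    and pos: "\<And>y. y \<in> {k1..k2} \<Longrightarrow> 0 < \<psi> y"
    and d: "\<And>y. y \<in> {k1..k2} \<Longrightarrow> (\<psi> has_real_derivative \<psi>' y) (at y within {k1..k2})"
    and dd: "\<And>y. y \<in> {k1..k2} \<Longrightarrow> (\<psi>' has_real_derivative (V y - m) * \<psi> y) (at y within {k1..k2})"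
  shows "ennreal m * (\<integral>\<^sup>+x\<in>J. ennreal ((\<phi> x)\<^sup>2) \<partial>lborel) \<le>
     (\<integral>\<^sup>+x\<in>J. ennreal ((norm (\<phi>' x))\<^sup>2 + V x * (\<phi> x)\<^sup>2) \<partial>lborel)"
proof -
  let ?I = "{k1..k2}"
  have cont: "continuous_on A \<phi>" "continuous_on A \<phi>'" for A
    using test_function_continuous[OF t] continuous_on_subset by blast+
  have D\<phi>: "(\<phi> has_real_derivative \<phi>' y) (at y within ?I)" for y
    using t by (auto simp: test_function_def intro: has_field_derivative_at_within)
  have c\<psi>: "continuous_on ?I \<psi>" "continuous_on ?I \<psi>'"
    by (rule DERIV_continuous_on, erule d) (rule DERIV_continuous_on, erule dd)
  define R where "R y = (\<phi> y)\<^sup>2 * \<psi>' y / \<psi> y" for y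
  define R' where "R' y = (norm (\<phi>' y))\<^sup>2 + V y * (\<phi> y)\<^sup>2 - m * (\<phi> y)\<^sup>2 - (\<phi>' y - \<phi> y * \<psi>' y / \<psi> y)\<^sup>2" for y
  have dR: "(R has_real_derivative R' y) (at y within ?I)" if "y \<in> ?I" for y
  proof -
    have nz: "\<psi> y \<noteq> 0" using pos[OF that] by simp
    have "(R has_real_derivative (2 * \<phi> y * \<phi>' y * \<psi>' y + (\<phi> y)\<^sup>2 * ((V y - m) * \<psi> y)) / \<psi> y - (\<phi> y)\<^sup>2 * \<psi>' y * \<psi>' y / (\<psi> y)\<^sup>2)
        (at y within ?I)"
      unfolding R_def using nz
      by (auto intro!: derivative_eq_intros D\<phi> d[OF that] dd[OF that] simp: power2_eq_square field_simps)
    moreover have "(2 * \<phi> y * \<phi>' y * \<psi>' y + (\<phi> y)\<^sup>2 * ((V y - m) * \<psi> y)) / \<psi> y - (\<phi> y)\<^sup>2 * \<psi>' y * \<psi>' y / (\<psi> y)\<^sup>2 = R' y"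
      unfolding R'_def using nz by (simp add: field_simps power2_eq_square)
    ultimately show ?thesis by simp
  qed
  have "(R' has_integral (R k2 - R k1)) ?I"
    by (intro fundamental_theorem_of_calculus) (use dR J in \<open>auto simp flip: has_real_derivative_iff_has_vector_derivative\<close>)
  moreover have "k1 \<notin> K" "k2 \<notin> K" using K(1) by auto
  then have "R k2 = 0" "R k1 = 0" using K(2) by (simp_all add: R_def)
  ultimately have R'0: "integral ?I R' = 0" by (simp add: integral_unique)
  let ?e = "\<lambda>y. (norm (\<phi>' y))\<^sup>2 + V y * (\<phi> y)\<^sup>2"
  have ce: "continuous_on ?I ?e" by (intro continuous_intros cont V)
  have c2: "continuous_on ?I (\<lambda>y. (\<phi> y)\<^sup>2)" by (intro continuous_intros cont)
  have cR: "continuous_on ?I (\<lambda>y. (\<phi>' y - \<phi> y * \<psi>' y / \<psi> y)\<^sup>2)"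
    by (intro continuous_intros cont c\<psi>) (use pos in force)
  have "(R' has_integral (integral ?I ?e - m * integral ?I (\<lambda>y. (\<phi> y)\<^sup>2) - integral ?I (\<lambda>y. (\<phi>' y - \<phi> y * \<psi>' y / \<psi> y)\<^sup>2))) ?I"
    unfolding R'_def
    by (intro has_integral_diff has_integral_mult_right integrable_integral integrable_continuous_real ce c2 cR)
  then have "integral ?I ?e - m * integral ?I (\<lambda>y. (\<phi> y)\<^sup>2) - integral ?I (\<lambda>y. (\<phi>' y - \<phi> y * \<psi>' y / \<psi> y)\<^sup>2) = integral ?I R'"
    by (simp add: integral_unique)
  moreover have "0 \<le> integral ?I (\<lambda>y. (\<phi>' y - \<phi> y * \<psi>' y / \<psi> y)\<^sup>2)"
    by (intro integral_nonneg integrable_continuous_real cR) auto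
  ultimately have main: "m * integral ?I (\<lambda>y. (\<phi> y)\<^sup>2) \<le> integral ?I ?e" using R'0 by simp
  have "(\<integral>\<^sup>+x\<in>J. ennreal ((\<phi> x)\<^sup>2) \<partial>lborel) = (\<integral>\<^sup>+x. ennreal ((\<phi> x)\<^sup>2) * indicator ?I x \<partial>lborel)"
  proof (intro nn_integral_cong)
    fix x
    show "ennreal ((\<phi> x)\<^sup>2) * indicator J x = ennreal ((\<phi> x)\<^sup>2) * indicator ?I x"
    proof (cases "x \<in> ?I")
      case False
      then have "x \<notin> K" using K(1) by auto
      then show ?thesis using K by simp
    qed (use J in auto)
  qed
  also have "\<dots> = ennreal (integral ?I (\<lambda>y. (\<phi> y)\<^sup>2))"
    by (rule nn_integral_continuous_interval[OF c2]) simp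
  finally have 1: "(\<integral>\<^sup>+x\<in>J. ennreal ((\<phi> x)\<^sup>2) \<partial>lborel) = ennreal (integral ?I (\<lambda>y. (\<phi> y)\<^sup>2))" .
  have "(\<integral>\<^sup>+x\<in>J. ennreal (?e x) \<partial>lborel) = (\<integral>\<^sup>+x. ennreal (?e x) * indicator ?I x \<partial>lborel)"
  proof (intro nn_integral_cong)
    fix x
    show "ennreal (?e x) * indicator J x = ennreal (?e x) * indicator ?I x"
    proof (cases "x \<in> ?I")
      case False
      then have "x \<notin> K" using K(1) by auto
      then show ?thesis using K by simp
    qed (use J in auto)
  qed
  also have "\<dots> = ennreal (integral ?I ?e)"
    by (rule nn_integral_continuous_interval[OF ce]) (use V J in auto)
  finally have 2: "(\<integral>\<^sup>+x\<in>J. ennreal (?e x) \<partial>lborel) = ennreal (integral ?I ?e)" .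
  show ?thesis unfolding 1 2 using main m
    by (simp add: ennreal_mult[symmetric] integral_nonneg integrable_continuous_real c2 ennreal_leI)
qed

lemma first_zero:
  fixes \<psi> :: "real \<Rightarrow> real"
  assumes "a < b" and cont: "continuous_on {a..b} \<psi>" and d: "(\<psi> has_real_derivative 1) (at a within {a..b})" "\<psi> a = 0"
    and npos: "\<exists>y\<in>{a<..b}. \<psi> y \<le> 0"
  shows "\<exists>\<beta>\<in>{a<..b}. \<psi> \<beta> = 0 \<and> (\<forall>y\<in>{a<..<\<beta>}. 0 < \<psi> y)"
proof -
  obtain e where e: "0 < e" "\<And>h. 0 < h \<Longrightarrow> a + h \<in> {a..b} \<Longrightarrow> h < e \<Longrightarrow> 0 < \<psi> (a + h)"
    using has_real_derivative_pos_inc_right[OF d(1)] d(2) by force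
  have near: "0 < \<psi> y" if "a < y" "y < a + e" "y \<le> b" for y
    using e(2)[of "y - a"] that by auto
  obtain y0 where y0: "a < y0" "y0 \<le> b" "\<psi> y0 \<le> 0" using npos by auto
  have ae: "a + e \<le> y0" using near[of y0] y0 by force
  define Z where "Z = {a + e/2..b} \<inter> \<psi> -` {..0}"
  have "compact Z"
  proof -
    have "closed Z" unfolding Z_def
      by (rule continuous_closed_preimage) (use e in \<open>auto intro: continuous_on_subset[OF cont]\<close>)
    then show ?thesis using bounded_subset[of "{a + e/2..b}" Z] by (auto simp: compact_eq_bounded_closed Z_def)
  qed
  moreover have "y0 \<in> Z" using y0 ae e by (auto simp: Z_def)
  ultimately obtain \<beta> where \<beta>: "\<beta> \<in> Z" "\<And>z. z \<in> Z \<Longrightarrow> \<beta> \<le> z"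
    using compact_attains_inf[of Z] by auto
  have \<beta>1: "a < \<beta>" "\<beta> \<le> b" "\<psi> \<beta> \<le> 0" using \<beta>(1) e by (auto simp: Z_def)
  have pos: "0 < \<psi> y" if "a < y" "y < \<beta>" for y
  proof (rule ccontr)
    assume n: "\<not> 0 < \<psi> y"
    show False
    proof (cases "y < a + e")
      case True
      then show False using near[of y] that n \<beta>1 by auto
    next
      case False
      then have "y \<in> Z" using that n \<beta>1 e by (auto simp: Z_def)
      then show False using \<beta>(2)[of y] that by simp
    qed
  qed
  have "\<not> \<psi> \<beta> < 0"
  proof
    assume neg: "\<psi> \<beta> < 0"
    define y1 where "y1 = min (a + e/2) ((a + \<beta>)/2)"
    have y1: "a < y1" "y1 < \<beta>" using e \<beta>1 by (auto simp: y1_def min_less_iff_disj)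
    have "\<exists>x\<ge>y1. x \<le> \<beta> \<and> \<psi> x = 0"
      by (rule IVT2') (use pos[OF y1] neg y1 \<beta>1 in \<open>auto intro!: continuous_on_subset[OF cont]\<close>)
    then obtain x where "y1 \<le> x" "x \<le> \<beta>" "\<psi> x = 0" by blast
    with pos[of x] y1 neg show False by (cases "x = \<beta>") auto
  qed
  with \<beta>1 have "\<psi> \<beta> = 0" by simp
  with \<beta>1 pos show ?thesis by auto
qed

text \<open>
  Backward uniqueness by Gronwall: \<open>\<psi>\<^sup>2 + \<psi>'\<^sup>2\<close> decays at most
  exponentially.
\<close>

lemma linear_ode_no_double_zero:
  fixes \<psi> :: "real \<Rightarrow> real"
  assumes "a \<le> b" and Q: "continuous_on {a..b} Q"
    and d: "\<And>y. y \<in> {a..b} \<Longrightarrow> (\<psi> has_real_derivative \<psi>' y) (at y within {a..b})"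
    and dd: "\<And>y. y \<in> {a..b} \<Longrightarrow> (\<psi>' has_real_derivative Q y * \<psi> y) (at y within {a..b})"
    and a: "\<psi>' a = 1"
  shows "\<not> (\<psi> b = 0 \<and> \<psi>' b = 0)"
proof
  assume z: "\<psi> b = 0 \<and> \<psi>' b = 0"
  obtain c where c: "\<And>y. y \<in> {a..b} \<Longrightarrow> \<bar>Q y\<bar> \<le> c"
  proof -
    have "bounded (Q ` {a..b})" using Q by (intro compact_imp_bounded compact_continuous_image) auto
    then obtain k where "\<forall>x\<in>Q ` {a..b}. norm x \<le> k" using bounded_iff by blast
    then show thesis using that[of k] by simp
  qed
  define E where "E y = ((\<psi> y)\<^sup>2 + (\<psi>' y)\<^sup>2) * exp ((1 + c) * y)" for y
  have "E a \<le> E b"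
  proof (rule DERIV_nonneg_imp_increasing_open[OF \<open>a \<le> b\<close>])
    show "continuous_on {a..b} E" unfolding E_def
      using d dd by (intro continuous_intros DERIV_continuous_on) auto
    fix y assume y: "a < y" "y < b"
    then have "(\<psi> has_real_derivative \<psi>' y) (at y)" "(\<psi>' has_real_derivative Q y * \<psi> y) (at y)"
      using d[of y] dd[of y] y unfolding at_within_Icc_at[OF y] by auto
    then have "(E has_real_derivative (2 * \<psi> y * \<psi>' y + 2 * \<psi>' y * (Q y * \<psi> y) + (1 + c) * ((\<psi> y)\<^sup>2 + (\<psi>' y)\<^sup>2)) * exp ((1 + c) * y)) (at y)"
      unfolding E_def by (auto intro!: derivative_eq_intros simp: algebra_simps power2_eq_square)
    moreover have "0 \<le> 2 * \<psi> y * \<psi>' y + 2 * \<psi>' y * (Q y * \<psi> y) + (1 + c) * ((\<psi> y)\<^sup>2 + (\<psi>' y)\<^sup>2)"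
    proof -
      have s: "\<bar>2 * \<psi> y * \<psi>' y\<bar> \<le> (\<psi> y)\<^sup>2 + (\<psi>' y)\<^sup>2"
        using zero_le_power2[of "\<psi> y - \<psi>' y"] zero_le_power2[of "\<psi> y + \<psi>' y"]
        by (simp add: power2_eq_square algebra_simps abs_le_iff)
      have "\<bar>Q y * (2 * \<psi> y * \<psi>' y)\<bar> \<le> c * ((\<psi> y)\<^sup>2 + (\<psi>' y)\<^sup>2)"
        unfolding abs_mult[of "Q y"] using c[of y] y s by (intro mult_mono) auto
      then show ?thesis using s by (simp add: algebra_simps abs_le_iff)
    qed
    ultimately show "\<exists>d. (E has_real_derivative d) (at y) \<and> 0 \<le> d" by (metis exp_ge_zero mult_nonneg_nonneg)
  qed
  moreover have "0 < E a" using a by (simp add: E_def add_nonneg_pos)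
  moreover have "E b = 0" using z by (simp add: E_def)
  ultimately show False by simp
qed

section \<open>Ground states of convex wells on an interval\<close>

lemma convex_monotone_side:
  fixes V :: "real \<Rightarrow> real"
  assumes V: "convex_on {a..b} V" and y: "y \<in> {a..b}"
  shows "(\<forall>s t. y \<le> s \<longrightarrow> s \<le> t \<longrightarrow> t \<le> b \<longrightarrow> V s \<le> V t) \<or> (\<forall>s t. a \<le> s \<longrightarrow> s \<le> t \<longrightarrow> t \<le> y \<longrightarrow> V t \<le> V s)"
proof (rule ccontr)
  assume "\<not> ?thesis"
  then obtain s t s' t' where *: "y \<le> s" "s \<le> t" "t \<le> b" "V t < V s" "a \<le> s'" "s' \<le> t'" "t' \<le> y" "V s' < V t'"
    by (meson not_le)
  then have "s < t" "s' < t'" by (auto simp: less_le)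
  have "(V s' - V t') / (s' - t') \<le> (V s' - V t) / (s' - t)"
    by (rule convex_on_slope_le(1)[OF V]) (use * \<open>s < t\<close> \<open>s' < t'\<close> in auto)
  also have "\<dots> \<le> (V s - V t) / (s - t)"
    by (rule convex_on_slope_le(2)[OF V]) (use * \<open>s < t\<close> \<open>s' < t'\<close> in auto)
  also have "\<dots> < 0" using * \<open>s < t\<close> by (intro divide_pos_neg) auto
  finally have "(V s' - V t') / (s' - t') < 0" .
  moreover have "0 < (V s' - V t') / (s' - t')" using * \<open>s' < t'\<close> by (intro divide_neg_neg) auto
  ultimately show False by simp
qed

text \<open>
  The expression is \<open>\<psi>\<^sup>2\<close> times minus the second derivative of
  \<open>ln \<psi>\<close>. Freeze the potential at its value in \<open>y\<close> and let
  \<open>\<Phi>(s) = \<psi>'(s)\<^sup>2 + (m - V(y)) \<psi>(s)\<^sup>2\<close>; its derivative is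
  \<open>(V(s) - V(y))\<close> times that of \<open>\<psi>\<^sup>2\<close>. By convexity
  \<open>V\<close> is monotone from \<open>y\<close> to one of the ends, and the second mean value
  theorem for integrals shows that \<open>\<Phi>\<close> does not increase from \<open>y\<close> to
  that end, where it is the positive number \<open>\<psi>'\<^sup>2\<close>.
\<close>

lemma ground_state_log_concave:
  fixes V :: "real \<Rightarrow> real"
  assumes "a < b" and V: "convex_on {a..b} V" "continuous_on {a..b} V"
    and d: "\<And>y. y \<in> {a..b} \<Longrightarrow> (\<psi> has_real_derivative \<psi>' y) (at y within {a..b})"
    and dd: "\<And>y. y \<in> {a..b} \<Longrightarrow> (\<psi>' has_real_derivative (V y - m) * \<psi> y) (at y within {a..b})"
    and ends: "\<psi> a = 0" "\<psi> b = 0" "\<psi>' a \<noteq> 0" "\<psi>' b \<noteq> 0" and y: "y \<in> {a..b}"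
  shows "0 < (\<psi>' y)\<^sup>2 + (m - V y) * (\<psi> y)\<^sup>2"
proof -
  define G' where "G' s = 2 * \<psi> s * \<psi>' s" for s
  define \<Phi> where "\<Phi> s = (\<psi>' s)\<^sup>2 + (m - V y) * (\<psi> s)\<^sup>2" for s
  have dG: "((\<lambda>s. (\<psi> s)\<^sup>2) has_real_derivative G' s) (at s within T)" if "s \<in> {a..b}" "T \<subseteq> {a..b}" for s T
    unfolding G'_def
    by (rule DERIV_subset[OF _ that(2)]) (auto intro!: derivative_eq_intros d[OF that(1)])
  have d\<Phi>: "(\<Phi> has_real_derivative (V s - V y) * G' s) (at s within T)" if "s \<in> {a..b}" "T \<subseteq> {a..b}" for s T
    unfolding \<Phi>_def G'_def
    by (rule DERIV_subset[OF _ that(2)])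
       (auto intro!: derivative_eq_intros d[OF that(1)] dd[OF that(1)] simp: algebra_simps power2_eq_square)
  have iG: "(G' has_integral ((\<psi> t)\<^sup>2 - (\<psi> s)\<^sup>2)) {s..t}" if "a \<le> s" "s \<le> t" "t \<le> b" for s t
    by (intro fundamental_theorem_of_calculus)
       (use that dG in \<open>auto simp flip: has_real_derivative_iff_has_vector_derivative\<close>)
  have i\<Phi>: "((\<lambda>s. (V s - V y) * G' s) has_integral (\<Phi> t - \<Phi> s)) {s..t}" if "a \<le> s" "s \<le> t" "t \<le> b" for s t
    by (intro fundamental_theorem_of_calculus)
       (use that d\<Phi> in \<open>auto simp flip: has_real_derivative_iff_has_vector_derivative\<close>)
  have "0 < \<Phi> y"
    using convex_monotone_side[OF V(1) y]
  proof
    assume mono: "\<forall>s t. y \<le> s \<longrightarrow> s \<le> t \<longrightarrow> t \<le> b \<longrightarrow> V s \<le> V t"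
    obtain c where c: "c \<in> {y..b}" and I: "((\<lambda>s. (V s - V y) * G' s) has_integral
        ((V y - V y) * integral {y..c} G' + (V b - V y) * integral {c..b} G')) {y..b}"
      by (rule second_mean_value_theorem_full[of G' y b "\<lambda>s. V s - V y"]) (use iG[of y b] y mono in auto)
    have "\<Phi> b - \<Phi> y = (V b - V y) * integral {c..b} G'"
      using has_integral_unique[OF I i\<Phi>[of y b]] y by simp
    moreover have "integral {c..b} G' = - (\<psi> c)\<^sup>2"
      using integral_unique[OF iG[of c b]] c y ends by simp
    moreover have "V y \<le> V b" using mono y by auto
    ultimately have "\<Phi> b - \<Phi> y \<le> 0" by (simp add: mult_nonneg_nonpos)
    moreover have "0 < \<Phi> b" using ends by (simp add: \<Phi>_def)
    ultimately show ?thesis by simp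
  next
    assume mono: "\<forall>s t. a \<le> s \<longrightarrow> s \<le> t \<longrightarrow> t \<le> y \<longrightarrow> V t \<le> V s"
    obtain c where c: "c \<in> {a..y}" and I: "((\<lambda>s. (V y - V s) * G' s) has_integral
        ((V y - V a) * integral {a..c} G' + (V y - V y) * integral {c..y} G')) {a..y}"
      by (rule second_mean_value_theorem_full[of G' a y "\<lambda>s. V y - V s"]) (use iG[of a y] y mono in auto)
    have "((\<lambda>s. (V y - V s) * G' s) has_integral - (\<Phi> y - \<Phi> a)) {a..y}"
      using has_integral_neg[OF i\<Phi>[of a y]] y by (simp add: algebra_simps)
    from has_integral_unique[OF I this] have "- (\<Phi> y - \<Phi> a) = (V y - V a) * integral {a..c} G'" by simp
    moreover have "integral {a..c} G' = (\<psi> c)\<^sup>2"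
      using integral_unique[OF iG[of a c]] c y ends by simp
    moreover have "V y \<le> V a" using mono y by auto
    ultimately have "- (\<Phi> y - \<Phi> a) \<le> 0" by (simp add: mult_nonpos_nonneg)
    moreover have "0 < \<Phi> a" using ends by (simp add: \<Phi>_def)
    ultimately show ?thesis by simp
  qed
  then show ?thesis by (simp add: \<Phi>_def)
qed

text \<open>
  Start a solution with \<open>\<psi>(a) = 0\<close> just left of the support of a test function
  with Rayleigh quotient below \<open>m\<close>. It must vanish again, at \<open>b\<close> say, and
  on the interval from \<open>a\<close> to \<open>b\<close> it is a ground state with eigenvalue
  exactly \<open>m\<close>. Shrinking the interval in this way instead of taking the ground state of
  \<open>J\<close> itself avoids boundary behaviour of \<open>V\<close>. By log-concavity
  \<open>p = - \<psi>' / \<psi>\<close> is a strictly increasing coordinate, and \<open>Y\<close> is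
  its inverse.
\<close>

lemma ground_state_slope_parametrization:
  fixes V :: "real \<Rightarrow> real"
  assumes J: "open J" "convex J" and V: "convex_on J V" "\<And>y. y \<in> J \<Longrightarrow> 0 \<le> V y" and m: "0 \<le> m"
    and t: "test_function J \<phi> \<phi>'"
    and small: "(\<integral>\<^sup>+x\<in>J. ennreal ((norm (\<phi>' x))\<^sup>2 + V x * (\<phi> x)\<^sup>2) \<partial>lborel) <
      ennreal m * (\<integral>\<^sup>+x\<in>J. ennreal ((\<phi> x)\<^sup>2) \<partial>lborel)"
  shows "\<exists>Y Y' A. continuous_on UNIV Y' \<and> A 0 = 0 \<and>
    (\<forall>p. (Y has_real_derivative Y' p) (at p) \<and> (A has_real_derivative p * Y' p) (at p) \<and>
      0 < Y' p \<and> Y p \<in> J \<and> V (Y p) = m + p\<^sup>2 - 1 / Y' p)"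
proof -
  obtain K where K: "compact K" "K \<subseteq> J" "\<And>x. x \<notin> K \<Longrightarrow> \<phi> x = 0" "\<And>x. x \<notin> K \<Longrightarrow> \<phi>' x = 0"
    using test_functionE[OF t] by blast
  have "K \<noteq> {}"
  proof
    assume "K = {}"
    then have "\<phi> x = 0" for x using K(3) by auto
    then show False using small by simp
  qed
  with K(1) obtain k k' where k: "k \<in> K" "\<And>x. x \<in> K \<Longrightarrow> k \<le> x" and k': "k' \<in> K" "\<And>x. x \<in> K \<Longrightarrow> x \<le> k'"
    using compact_attains_inf compact_attains_sup by metis
  obtain e where e: "0 < e" "cball k e \<subseteq> J" using J(1) k K(2) open_contains_cball by blast
  obtain e' where e': "0 < e'" "cball k' e' \<subseteq> J" using J(1) k' K(2) open_contains_cball by blast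
  define a where "a = k - e"
  define c where "c = k' + e'"
  have "k \<le> k'" using k k' by auto
  have ac: "a < k" "k' < c" "a < c" using e e' \<open>k \<le> k'\<close> by (auto simp: a_def c_def)
  have "a \<in> J" "c \<in> J" using e e' by (auto simp: a_def c_def dist_real_def subset_iff)
  have sub: "{a..c} \<subseteq> J"
    using J(2) \<open>a \<in> J\<close> \<open>c \<in> J\<close> by (meson is_interval_convex_1 mem_is_interval_1_I atLeastAtMost_iff subsetI)
  have contV: "continuous_on J V" by (rule convex_on_continuous[OF J(1) V(1)])
  then have contQ: "continuous_on {a..c} (\<lambda>y. V y - m)"
    using continuous_on_subset[OF _ sub] by (intro continuous_intros) auto
  obtain \<psi> \<psi>' where \<psi>: "\<psi> a = 0" "\<psi>' a = 1"
    "\<And>y. y \<in> {a..c} \<Longrightarrow> (\<psi> has_real_derivative \<psi>' y) (at y within {a..c})"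
    "\<And>y. y \<in> {a..c} \<Longrightarrow> (\<psi>' has_real_derivative (V y - m) * \<psi> y) (at y within {a..c})"
    using linear_ode_solution[OF ac(3) contQ] by blast
  have c\<psi>: "continuous_on {a..c} \<psi>" "continuous_on {a..c} \<psi>'"
    by (rule DERIV_continuous_on, erule \<psi>(3)) (rule DERIV_continuous_on, erule \<psi>(4))
  have "\<exists>y\<in>{a<..c}. \<psi> y \<le> 0"
  proof (rule ccontr)
    assume "\<not> ?thesis"
    then have pos: "\<And>y. a < y \<Longrightarrow> y \<le> c \<Longrightarrow> 0 < \<psi> y" by force
    \<comment> \<open>\<open>\<psi>\<close> vanishes at \<open>a\<close>, so the comparison is made on a smaller interval that still contains \<open>K\<close>\<close>
    define k1 where "k1 = (a + k) / 2"
    have k1: "a < k1" "k1 < k" using ac by (auto simp: k1_def)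
    have "ennreal m * (\<integral>\<^sup>+x\<in>J. ennreal ((\<phi> x)\<^sup>2) \<partial>lborel) \<le>
     (\<integral>\<^sup>+x\<in>J. ennreal ((norm (\<phi>' x))\<^sup>2 + V x * (\<phi> x)\<^sup>2) \<partial>lborel)"
    proof (rule positive_solution_rayleigh_bound[OF t, where K=K and ?k1.0=k1 and ?k2.0=c])
      show "K \<subseteq> {k1<..<c}" using k k' k1 ac by force
      show "{k1..c} \<subseteq> J" using sub k1 by auto
      show "continuous_on {k1..c} V" by (rule continuous_on_subset[OF contV]) (use sub k1 in auto)
      fix y assume "y \<in> {k1..c}"
      then show "0 < \<psi> y" "(\<psi> has_real_derivative \<psi>' y) (at y within {k1..c})"
        "(\<psi>' has_real_derivative (V y - m) * \<psi> y) (at y within {k1..c})"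
        using pos k1 by (auto intro!: DERIV_subset[OF \<psi>(3)] DERIV_subset[OF \<psi>(4)])
    qed (use K V m k1 ac \<open>k \<le> k'\<close> in auto)
    with small show False by simp
  qed
  from first_zero[OF ac(3) c\<psi>(1) _ \<psi>(1) this] \<psi>(2) \<psi>(3)[of a] ac
  obtain b where b: "a < b" "b \<le> c" "\<psi> b = 0" and pos: "\<And>y. a < y \<Longrightarrow> y < b \<Longrightarrow> 0 < \<psi> y" by auto
  have subb: "{a..b} \<subseteq> {a..c}" using b by auto
  have d: "(\<psi> has_real_derivative \<psi>' y) (at y within {a..b})"
    "(\<psi>' has_real_derivative (V y - m) * \<psi> y) (at y within {a..b})" if "y \<in> {a..b}" for y
    using that subb by (auto intro!: DERIV_subset[OF \<psi>(3) subb] DERIV_subset[OF \<psi>(4) subb])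
  have "\<psi>' b \<noteq> 0"
    using linear_ode_no_double_zero[OF less_imp_le[OF b(1)] continuous_on_subset[OF contQ subb] d \<psi>(2)] b(3) by simp
  have "\<not> 0 < \<psi>' b"
  proof
    assume "0 < \<psi>' b"
    from has_real_derivative_pos_inc_left[OF d(1)[of b] this] b obtain r where r: "0 < r"
      "\<And>h. 0 < h \<Longrightarrow> b - h \<in> {a..b} \<Longrightarrow> h < r \<Longrightarrow> \<psi> (b - h) < 0" by auto
    define h where "h = min (r/2) ((b - a)/2)"
    have "0 < h" "h < r" "h < b - a" using r b by (auto simp: h_def min_less_iff_disj)
    then show False using r(2)[of h] pos[of "b - h"] by auto
  qed
  with \<open>\<psi>' b \<noteq> 0\<close> have \<psi>'b: "\<psi>' b < 0" by simp
  have F: "0 < (\<psi>' y)\<^sup>2 + (m - V y) * (\<psi> y)\<^sup>2" if "y \<in> {a..b}" for y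
  proof (rule ground_state_log_concave[OF b(1) _ _ d \<psi>(1) b(3) _ _ that])
    have "{a..b} \<subseteq> J" using subb sub by blast
    then show "convex_on {a..b} V" "continuous_on {a..b} V"
      using V(1) contV by (blast intro: convex_on_subset continuous_on_subset)+
  qed (use \<psi>(2) \<psi>'b in auto)
  \<comment> \<open>\<open>p'\<close> is the derivative of the slope \<open>p\<close>; log-concavity makes it positive\<close>
  define p where "p y = - \<psi>' y / \<psi> y" for y
  define p' where "p' y = ((\<psi>' y)\<^sup>2 + (m - V y) * (\<psi> y)\<^sup>2) / (\<psi> y)\<^sup>2" for y
  have p'pos: "0 < p' y" if "a < y" "y < b" for y
    using F[of y] pos[OF that] that by (simp add: p'_def)
  have dp: "(p has_real_derivative p' y) (at y)" if "a < y" "y < b" for y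
  proof -
    have "(\<psi> has_real_derivative \<psi>' y) (at y)" "(\<psi>' has_real_derivative (V y - m) * \<psi> y) (at y)"
      using d[of y] that unfolding at_within_Icc_at[OF that] by auto
    then have "(p has_real_derivative (- ((V y - m) * \<psi> y) * \<psi> y - (- \<psi>' y) * \<psi>' y) / (\<psi> y * \<psi> y)) (at y)"
      unfolding p_def using pos[OF that] by (intro DERIV_divide DERIV_minus) auto
    moreover have "(- ((V y - m) * \<psi> y) * \<psi> y - (- \<psi>' y) * \<psi>' y) / (\<psi> y * \<psi> y) = p' y"
      by (simp add: p'_def power2_eq_square algebra_simps)
    ultimately show ?thesis by simp
  qed
  have p_mono: "p x < p y" if "a < x" "x < y" "y < b" for x y
  proof (rule DERIV_pos_imp_increasing[OF that(2)])
    fix z assume "x \<le> z" "z \<le> y"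
    then have "a < z" "z < b" using that by auto
    from dp[OF this] p'pos[OF this] show "\<exists>d. (p has_real_derivative d) (at z) \<and> 0 < d" by blast
  qed
  have V_eq: "V y = m + (p y)\<^sup>2 - p' y" if "a < y" "y < b" for y
    using pos[OF that] by (simp add: p_def p'_def field_simps power2_eq_square)
  have lim_b: "filterlim p at_top (at_left b)"
  proof -
    have "((\<lambda>y. - \<psi>' y) \<longlongrightarrow> - \<psi>' b) (at b within {a..b})" "(\<psi> \<longlongrightarrow> \<psi> b) (at b within {a..b})"
      using DERIV_continuous[OF d(1)[of b]] DERIV_continuous[OF d(2)[of b]] b
      unfolding continuous_within by (auto intro: tendsto_minus)
    then have l: "((\<lambda>y. - \<psi>' y) \<longlongrightarrow> - \<psi>' b) (at_left b)" "(\<psi> \<longlongrightarrow> 0) (at_left b)"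
      using b by (auto simp: at_within_Icc_at_left)
    have "\<forall>\<^sub>F y in at_left b. 0 < \<psi> y"
      using eventually_at_left_real[OF b(1)] by eventually_elim (use pos in auto)
    from LIM_at_top_divide[OF l(1) _ l(2) this] \<psi>'b show ?thesis unfolding p_def[abs_def] by simp
  qed
  have lim_a: "filterlim (\<lambda>y. - p y) at_top (at_right a)"
  proof -
    have "(\<psi>' \<longlongrightarrow> \<psi>' a) (at a within {a..b})" "(\<psi> \<longlongrightarrow> \<psi> a) (at a within {a..b})"
      using DERIV_continuous[OF d(1)[of a]] DERIV_continuous[OF d(2)[of a]] b
      unfolding continuous_within by auto
    then have l: "(\<psi>' \<longlongrightarrow> 1) (at_right a)" "(\<psi> \<longlongrightarrow> 0) (at_right a)"
      using b \<psi> by (auto simp: at_within_Icc_at_right)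
    have "\<forall>\<^sub>F y in at_right a. 0 < \<psi> y"
      using eventually_at_right_real[OF b(1)] by eventually_elim (use pos in auto)
    from LIM_at_top_divide[OF l(1) _ l(2) this] show ?thesis unfolding p_def[abs_def] by simp
  qed
  \<comment> \<open>\<open>\<psi>\<close> has simple zeros at both ends, so all slopes occur\<close>
  have surj: "\<exists>y. a < y \<and> y < b \<and> p y = q" for q
  proof -
    have "\<forall>\<^sub>F y in at_left b. q + 1 \<le> p y" using lim_b by (simp add: filterlim_at_top)
    with eventually_at_left_real[OF b(1)] have "\<forall>\<^sub>F y in at_left b. q + 1 \<le> p y \<and> y \<in> {a<..<b}"
      by (rule eventually_elim2) auto
    then have "\<exists>y. q + 1 \<le> p y \<and> y \<in> {a<..<b}"
      by (rule eventually_happens'[OF trivial_limit_at_left_real])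
    then obtain y2 where y2: "q + 1 \<le> p y2" "a < y2" "y2 < b" by auto
    have "\<forall>\<^sub>F y in at_right a. - q + 1 \<le> - p y" using lim_a by (simp add: filterlim_at_top)
    with eventually_at_right_real[OF b(1)] have "\<forall>\<^sub>F y in at_right a. - q + 1 \<le> - p y \<and> y \<in> {a<..<b}"
      by (rule eventually_elim2) auto
    then have "\<exists>y. - q + 1 \<le> - p y \<and> y \<in> {a<..<b}"
      by (rule eventually_happens'[OF trivial_limit_at_right_real])
    then obtain y1 where y1: "- q + 1 \<le> - p y1" "a < y1" "y1 < b" by auto
    have "y1 \<le> y2" using p_mono[of y2 y1] y1 y2 by force
    then have "\<exists>y\<ge>y1. y \<le> y2 \<and> p y = q"
    proof (intro IVT')
      show "continuous_on {y1..y2} p"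
        by (rule DERIV_continuous_on[where D=p'], rule has_field_derivative_at_within, rule dp) (use y1 y2 in auto)
    qed (use y1 y2 in auto)
    then obtain y where "y1 \<le> y" "y \<le> y2" "p y = q" by blast
    with y1 y2 show ?thesis by (intro exI[of _ y]) auto
  qed
  define Y where "Y q = (SOME y. a < y \<and> y < b \<and> p y = q)" for q
  have Y: "a < Y q" "Y q < b" "p (Y q) = q" for q
    using someI_ex[OF surj[of q]] by (auto simp: Y_def)
  have Yp: "Y (p y) = y" if "a < y" "y < b" for y
  proof (rule ccontr)
    assume "Y (p y) \<noteq> y"
    then show False using p_mono[of y "Y (p y)"] p_mono[of "Y (p y)" y] Y[of "p y"] that by (cases y "Y (p y)" rule: linorder_cases) auto
  qed
  have contY: "isCont Y q" for q
  proof -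
    have "isCont Y (p (Y q))"
      by (rule isCont_inverse_function2[where f=p and x="Y q" and a="(a + Y q)/2" and b="(Y q + b)/2"])
         (use Y[of q] Yp in \<open>auto intro!: DERIV_isCont[OF dp]\<close>)
    then show ?thesis by (simp add: Y)
  qed
  have dY: "(Y has_real_derivative inverse (p' (Y q))) (at q)" for q
    by (rule DERIV_inverse_function[of p, where a="q - 1" and b="q + 1"])
       (use Y dp p'pos contY in \<open>auto simp: less_imp_neq[symmetric]\<close>)
  have p'Y: "p' (Y q) = m + q\<^sup>2 - V (Y q)" for q
    using V_eq[of "Y q"] Y[of q] by simp
  have YJ: "Y q \<in> J" for q using Y[of q] b sub by auto
  have "continuous_on UNIV (\<lambda>q. inverse (m + q\<^sup>2 - V (Y q)))"
  proof (intro continuous_intros)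
    show "continuous_on UNIV (\<lambda>q. V (Y q))"
      by (rule continuous_on_compose2[OF contV]) (use contY YJ in \<open>auto intro: continuous_at_imp_continuous_on\<close>)
    show "\<forall>q\<in>UNIV. m + q\<^sup>2 - V (Y q) \<noteq> 0" using p'pos Y p'Y by (metis less_irrefl)
  qed
  moreover define A where "A q = ln (\<psi> (Y 0)) - ln (\<psi> (Y q))" for q
  have dA: "(A has_real_derivative q * inverse (p' (Y q))) (at q)" for q
  proof -
    have "(\<psi> has_real_derivative \<psi>' (Y q)) (at (Y q))"
      using d(1)[of "Y q"] Y[of q] unfolding at_within_Icc_at[OF Y(1,2)] by auto
    from DERIV_chain2[OF this dY]
    have "((\<lambda>q. \<psi> (Y q)) has_real_derivative \<psi>' (Y q) * inverse (p' (Y q))) (at q)" .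
    from DERIV_chain2[OF DERIV_ln_divide this] pos[OF Y(1,2)]
    have "((\<lambda>q. ln (\<psi> (Y q))) has_real_derivative 1 / \<psi> (Y q) * (\<psi>' (Y q) * inverse (p' (Y q)))) (at q)" by simp
    from DERIV_diff[OF DERIV_const this]
    have "(A has_real_derivative 0 - 1 / \<psi> (Y q) * (\<psi>' (Y q) * inverse (p' (Y q)))) (at q)"
      unfolding A_def[abs_def] .
    moreover have "0 - 1 / \<psi> (Y q) * (\<psi>' (Y q) * inverse (p' (Y q))) = p (Y q) * inverse (p' (Y q))"
      by (simp add: p_def)
    ultimately show ?thesis by (simp add: Y(3))
  qed
  moreover have "A 0 = 0" by (simp add: A_def)
  moreover have "0 < inverse (p' (Y q))" "V (Y q) = m + q\<^sup>2 - 1 / inverse (p' (Y q))" for q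
    using p'pos[OF Y(1,2)] V_eq[OF Y(1,2)] by (simp_all add: Y(3) inverse_eq_divide)
  ultimately show ?thesis using dY YJ unfolding p'Y
    by - (rule exI[of _ Y], rule exI[of _ "\<lambda>q. inverse (m + q\<^sup>2 - V (Y q))"], rule exI[of _ A], blast)
qed

section \<open>Profiles parametrized by slope\<close>

lemma nonneg_of_derivative_sign:
  fixes f f' :: "real \<Rightarrow> real"
  assumes d: "\<And>p. (f has_real_derivative f' p) (at p)" and s: "\<And>p. 0 \<le> (p - q) * f' p" and "f q = 0"
  shows "0 \<le> f p"
proof (cases "q \<le> p")
  case True
  have "f q \<le> f p"
  proof (rule DERIV_nonneg_imp_increasing_open[OF True])
    fix x assume x: "q < x" "x < p"
    then have "0 \<le> f' x" using s[of x] by (simp add: zero_le_mult_iff)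
    then show "\<exists>y. (f has_real_derivative y) (at x) \<and> 0 \<le> y" using d by blast
  qed (use d in \<open>auto intro!: continuous_at_imp_continuous_on DERIV_isCont\<close>)
  then show ?thesis using assms by simp
next
  case False
  then have "p \<le> q" by simp
  then have "f q \<le> f p"
  proof (rule DERIV_nonpos_imp_decreasing_open)
    fix x assume x: "p < x" "x < q"
    then have "f' x \<le> 0" using s[of x] by (simp add: zero_le_mult_iff)
    then show "\<exists>y. (f has_real_derivative y) (at x) \<and> y \<le> 0" using d by blast
  qed (use d in \<open>auto intro!: continuous_at_imp_continuous_on DERIV_isCont\<close>)
  then show ?thesis using assms by simp
qed

text \<open>
  \<open>W\<close> as a function of \<open>y = Y(p)\<close> is convex with slope \<open>p\<close>.
  The bound on \<open>Y'\<close> is what remains of the lower bound on the potential, and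
  \<open>1 / sqrt \<kappa>\<close> is the length scale of the profile. All integrals over the
  section become integrals over \<open>p\<close> with density \<open>Y'\<close>.
\<close>

locale slope_profile =
  fixes Y Y' W :: "real \<Rightarrow> real" and \<kappa> :: real
  assumes dY: "\<And>p. (Y has_real_derivative Y' p) (at p)"
    and dW: "\<And>p. (W has_real_derivative p * Y' p) (at p)"
    and Y'_cont: "continuous_on UNIV Y'" and W0: "W 0 = 0" and \<kappa>_pos: "0 < \<kappa>"
    and Y'_lower: "\<And>p. 1 / (p\<^sup>2 + \<kappa>) \<le> Y' p"
begin

lemma denom_pos: "0 < p\<^sup>2 + \<kappa>" using \<kappa>_pos by (simp add: add_nonneg_pos)

lemma Y'_pos: "0 < Y' p"
  using Y'_lower[of p] denom_pos[of p] by (meson less_le_trans zero_less_divide_1_iff)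

lemma cont: "continuous_on S Y" "continuous_on S W" "continuous_on S Y'"
  using DERIV_continuous_on[OF has_field_derivative_at_within[OF dY]]
    DERIV_continuous_on[OF has_field_derivative_at_within[OF dW]] continuous_on_subset[OF Y'_cont] by blast+

lemma Y_strict_mono: "strict_mono Y"
proof (rule strict_monoI)
  fix x y :: real assume "x < y"
  then show "Y x < Y y"
    by (rule DERIV_pos_imp_increasing) (use dY Y'_pos in blast)
qed

text \<open>
  The tangent inequality for the convex function \<open>y \<mapsto> W\<close>.
\<close>

lemma legendre: "0 \<le> W p - W q - q * (Y p - Y q)"
proof (rule nonneg_of_derivative_sign[where q=q and p=p and f="\<lambda>p. W p - W q - q * (Y p - Y q)"
      and f'="\<lambda>p. p * Y' p - q * Y' p"])
  fix p
  show "((\<lambda>p. W p - W q - q * (Y p - Y q)) has_real_derivative p * Y' p - q * Y' p) (at p)"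
    by (auto intro!: derivative_eq_intros dW dY)
  have "(p - q) * (p * Y' p - q * Y' p) = (p - q)\<^sup>2 * Y' p" by (simp add: power2_eq_square algebra_simps)
  then show "0 \<le> (p - q) * (p * Y' p - q * Y' p)" using Y'_pos[of p] by simp
qed simp

lemma W_nonneg: "0 \<le> W p" using legendre[of p 0] W0 by simp

lemma W_lower: "ln (1 + p\<^sup>2 / \<kappa>) / 2 \<le> W p"
proof -
  have "0 \<le> W p - ln (1 + p\<^sup>2 / \<kappa>) / 2"
  proof (rule nonneg_of_derivative_sign[where q=0 and p=p and f="\<lambda>p. W p - ln (1 + p\<^sup>2 / \<kappa>) / 2" and f'="\<lambda>p. p * Y' p - p / (p\<^sup>2 + \<kappa>)"])
    fix p
    have pos: "0 < 1 + p\<^sup>2 / \<kappa>" using \<kappa>_pos by (simp add: add_pos_nonneg)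
    have "((\<lambda>p. W p - ln (1 + p\<^sup>2 / \<kappa>) / 2) has_real_derivative p * Y' p - (1 / (1 + p\<^sup>2 / \<kappa>) * (2 * p / \<kappa>)) / 2) (at p)"
      using pos \<kappa>_pos by (auto intro!: derivative_eq_intros dW simp: field_simps)
    moreover have "(1 / (1 + p\<^sup>2 / \<kappa>) * (2 * p / \<kappa>)) / 2 = p / (p\<^sup>2 + \<kappa>)"
    proof -
      have "1 + p\<^sup>2 / \<kappa> = (p\<^sup>2 + \<kappa>) / \<kappa>" using \<kappa>_pos by (simp add: field_simps)
      then have "(1 / (1 + p\<^sup>2 / \<kappa>) * (2 * p / \<kappa>)) / 2 = (2 * p) / (2 * (p\<^sup>2 + \<kappa>))" using \<kappa>_pos by simp
      then show ?thesis by (simp only: mult_divide_mult_cancel_left_if) simp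
    qed
    ultimately show "((\<lambda>p. W p - ln (1 + p\<^sup>2 / \<kappa>) / 2) has_real_derivative p * Y' p - p / (p\<^sup>2 + \<kappa>)) (at p)" by (simp only:)
    have "(p - 0) * (p * Y' p - p / (p\<^sup>2 + \<kappa>)) = p\<^sup>2 * (Y' p - 1 / (p\<^sup>2 + \<kappa>))"
      by (simp add: power2_eq_square algebra_simps)
    then show "0 \<le> (p - 0) * (p * Y' p - p / (p\<^sup>2 + \<kappa>))" using Y'_lower[of p] by simp
  qed (simp add: W0)
  then show ?thesis by simp
qed

lemma exp_W_upper: "exp (- (2 * W p)) \<le> \<kappa> / (p\<^sup>2 + \<kappa>)"
proof -
  have pos: "0 < 1 + p\<^sup>2 / \<kappa>" using \<kappa>_pos by (simp add: add_pos_nonneg)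
  have "exp (- (2 * W p)) \<le> exp (- ln (1 + p\<^sup>2 / \<kappa>))" using W_lower[of p] by simp
  also have "\<dots> = 1 / (1 + p\<^sup>2 / \<kappa>)" using pos by (simp add: exp_minus inverse_eq_divide)
  also have "\<dots> = \<kappa> / (p\<^sup>2 + \<kappa>)" using \<kappa>_pos denom_pos[of p] by (simp add: field_simps)
  finally show ?thesis .
qed

text \<open>
  The integrand is minus the derivative of \<open>p exp (- 2 W)\<close>, and the boundary terms have
  a sign. It measures by how much kinetic plus potential energy of \<open>exp (- W)\<close> exceeds
  \<open>m\<close> times the mass.
\<close>

lemma virial_inequality:
  assumes "0 \<le> M"
  shows "integral {-M..M} (\<lambda>p. (2 * p\<^sup>2 * Y' p - 1) * exp (- (2 * W p))) \<le> 0"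
proof -
  have "((\<lambda>p. (2 * p\<^sup>2 * Y' p - 1) * exp (- (2 * W p))) has_integral
      (- (M * exp (- (2 * W M))) - - (- M * exp (- (2 * W (- M)))))) {-M..M}"
  proof (rule fundamental_theorem_of_calculus)
    fix p
    have "((\<lambda>p. - (p * exp (- (2 * W p)))) has_real_derivative (2 * p\<^sup>2 * Y' p - 1) * exp (- (2 * W p))) (at p)"
      by (auto intro!: derivative_eq_intros dW simp: power2_eq_square algebra_simps)
    then show "((\<lambda>p. - (p * exp (- (2 * W p)))) has_vector_derivative (2 * p\<^sup>2 * Y' p - 1) * exp (- (2 * W p))) (at p within {-M..M})"
      unfolding has_real_derivative_iff_has_vector_derivative[symmetric] by (rule has_field_derivative_at_within)
  qed (use assms in simp)
  then have "integral {-M..M} (\<lambda>p. (2 * p\<^sup>2 * Y' p - 1) * exp (- (2 * W p))) =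
     - (M * exp (- (2 * W M))) - M * exp (- (2 * W (- M)))" by (simp add: integral_unique)
  also have "\<dots> \<le> 0"
    using mult_nonneg_nonneg[OF assms exp_ge_zero[of "- (2 * W M)"]]
      mult_nonneg_nonneg[OF assms exp_ge_zero[of "- (2 * W (- M))"]] by linarith
  finally show ?thesis .
qed

text \<open>
  The exponent \<open>3/2\<close> instead of \<open>2\<close> leaves a factor
  \<open>exp (- W / 2)\<close> to spare for polynomial losses, while the decay in \<open>p\<close>
  is still integrable.
\<close>

lemma exp_W_32_upper: "exp (- (3 / 2 * W p)) \<le> 2 * (1 + \<bar>p\<bar> / sqrt \<kappa>) powr (- 3 / 2)"
proof -
  define u where "u = \<bar>p\<bar> / sqrt \<kappa>"
  have u: "0 \<le> u" "u\<^sup>2 = p\<^sup>2 / \<kappa>" using \<kappa>_pos by (auto simp: u_def power_divide)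
  have "(1 + u)\<^sup>2 / 2 \<le> 1 + u\<^sup>2"
    using zero_le_power2[of "1 - u"] by (simp add: power2_eq_square algebra_simps)
  moreover have "0 < (1 + u)\<^sup>2 / 2" "0 < 1 + u\<^sup>2" using u(1) by (auto intro: add_pos_nonneg)
  ultimately have "ln ((1 + u)\<^sup>2 / 2) \<le> ln (1 + u\<^sup>2)" using ln_le_cancel_iff by blast
  also have "ln ((1 + u)\<^sup>2 / 2) = 2 * ln (1 + u) - ln 2" using u by (simp add: ln_div ln_realpow)
  finally have "ln (1 + u) - ln 2 / 2 \<le> W p" using W_lower[of p] u by simp
  then have "exp (- (3 / 2 * W p)) \<le> exp (3 / 4 * ln 2 + (- 3 / 2) * ln (1 + u))" by simp
  also have "\<dots> = exp (3 / 4 * ln 2) * (1 + u) powr (- 3 / 2)" using u(1) unfolding exp_add powr_def by simp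
  also have "exp (3 / 4 * ln 2) \<le> exp (ln (2::real))" unfolding exp_le_cancel_iff by simp
  also have "exp (ln (2::real)) = 2" by simp
  finally show ?thesis by (simp add: u_def mult_right_mono)
qed

lemma integral_majorant: "integral {0..M} (\<lambda>p. 2 * (1 + \<bar>p\<bar> / sqrt \<kappa>) powr (- 3 / 2)) \<le> 4 * sqrt \<kappa>"
  "(\<lambda>p. 2 * (1 + \<bar>p\<bar> / sqrt \<kappa>) powr (- 3 / 2)) integrable_on {0..M}" if "0 \<le> M"
proof -
  have s: "0 < sqrt \<kappa>" using \<kappa>_pos by simp
  define H where "H p = - 4 * sqrt \<kappa> * (1 + p / sqrt \<kappa>) powr (- 1 / 2)" for p
  have hi: "((\<lambda>p. 2 * (1 + \<bar>p\<bar> / sqrt \<kappa>) powr (- 3 / 2)) has_integral (H M - H 0)) {0..M}"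
  proof (rule fundamental_theorem_of_calculus[OF that])
    fix p assume p: "p \<in> {0..M}"
    have pos: "0 < 1 + p / sqrt \<kappa>" using p s by (simp add: add_pos_nonneg)
    have "((\<lambda>p. (1 + p / sqrt \<kappa>) powr (- 1 / 2)) has_real_derivative (- 1 / 2) * (1 + p / sqrt \<kappa>) powr (- 1 / 2 - 1) * (1 / sqrt \<kappa>)) (at p)"
    proof (rule DERIV_chain2[where f="\<lambda>z. z powr (- 1 / 2)" and g="\<lambda>p. 1 + p / sqrt \<kappa>"])
      show "((\<lambda>z. z powr (- 1 / 2)) has_real_derivative (- 1 / 2) * (1 + p / sqrt \<kappa>) powr (- 1 / 2 - 1)) (at (1 + p / sqrt \<kappa>))"
        using pos by (rule has_real_derivative_powr)
      show "((\<lambda>p. 1 + p / sqrt \<kappa>) has_real_derivative 1 / sqrt \<kappa>) (at p)"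
        using DERIV_add[OF DERIV_const[of 1] DERIV_cdivide[OF DERIV_ident, of "sqrt \<kappa>"]] by simp
    qed
    from DERIV_cmult[OF this, of "- 4 * sqrt \<kappa>"]
    have "(H has_real_derivative 2 * (1 + p / sqrt \<kappa>) powr (- 3 / 2)) (at p)"
      unfolding H_def using s by simp
    then show "(H has_vector_derivative 2 * (1 + \<bar>p\<bar> / sqrt \<kappa>) powr (- 3 / 2)) (at p within {0..M})"
      using p unfolding has_real_derivative_iff_has_vector_derivative[symmetric]
      by (simp add: has_field_derivative_at_within)
  qed
  have "H M - H 0 \<le> 4 * sqrt \<kappa>" using s by (simp add: H_def)
  with integral_unique[OF hi] has_integral_integrable[OF hi] show "integral {0..M} (\<lambda>p. 2 * (1 + \<bar>p\<bar> / sqrt \<kappa>) powr (- 3 / 2)) \<le> 4 * sqrt \<kappa>"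
    "(\<lambda>p. 2 * (1 + \<bar>p\<bar> / sqrt \<kappa>) powr (- 3 / 2)) integrable_on {0..M}"
    by (simp_all only:)
qed

lemma integral_exp_32:
  assumes "0 \<le> M"
  shows "integral {-M..M} (\<lambda>p. exp (- (3 / 2 * W p))) \<le> 8 * sqrt \<kappa>"
proof -
  let ?g = "\<lambda>p. exp (- (3 / 2 * W p))"
  have c: "continuous_on S ?g" for S by (intro continuous_intros cont)
  have c': "continuous_on S (\<lambda>p. ?g (- p))" for S
    by (rule continuous_on_compose2[OF c[of UNIV]]) (auto intro!: continuous_intros)
  have "integral {-M..M} ?g = integral {-M..0} ?g + integral {0..M} ?g"
    by (rule Henstock_Kurzweil_Integration.integral_combine[symmetric, OF _ _ integrable_continuous_real[OF c]])
       (use assms in auto)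
  also have "integral {-M..0} ?g = integral {0..M} (\<lambda>p. ?g (- p))"
    using Henstock_Kurzweil_Integration.integral_reflect_real[of "M" 0 "\<lambda>p. ?g (- p)"] by simp
  also have "integral {0..M} (\<lambda>p. ?g (- p)) \<le> integral {0..M} (\<lambda>p. 2 * (1 + \<bar>p\<bar> / sqrt \<kappa>) powr (- 3 / 2))"
  proof (rule integral_le[OF integrable_continuous_real[OF c'] integral_majorant(2)[OF assms]])
    fix p show "?g (- p) \<le> 2 * (1 + \<bar>p\<bar> / sqrt \<kappa>) powr (- 3 / 2)"
      using exp_W_32_upper[of "- p"] by (simp only: abs_minus_cancel)
  qed
  also have "integral {0..M} ?g \<le> integral {0..M} (\<lambda>p. 2 * (1 + \<bar>p\<bar> / sqrt \<kappa>) powr (- 3 / 2))"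
    by (rule integral_le[OF integrable_continuous_real[OF c] integral_majorant(2)[OF assms] exp_W_32_upper])
  finally show ?thesis using integral_majorant(1)[OF assms] by simp
qed

text \<open>
  Integration by parts removes the density \<open>Y'\<close>, which has no upper bound.
\<close>

lemma second_moment:
  assumes "0 \<le> M"
  shows "integral {-M..M} (\<lambda>p. p\<^sup>2 * Y' p * exp (- (3 / 2 * W p))) \<le> 6 * sqrt \<kappa>"
proof -
  let ?g = "\<lambda>p. exp (- (3 / 2 * W p))"
  have c: "continuous_on S ?g" for S by (intro continuous_intros cont)
  have "((\<lambda>p. p\<^sup>2 * Y' p * ?g p - 2 / 3 * ?g p) has_integral
      (- (2 / 3 * (M * ?g M)) - - (2 / 3 * (- M * ?g (- M))))) {-M..M}"
  proof (rule fundamental_theorem_of_calculus)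
    fix p
    have "((\<lambda>p. - (2 / 3 * (p * ?g p))) has_real_derivative p\<^sup>2 * Y' p * ?g p - 2 / 3 * ?g p) (at p)"
      by (auto intro!: derivative_eq_intros dW simp: power2_eq_square field_simps)
    then show "((\<lambda>p. - (2 / 3 * (p * ?g p))) has_vector_derivative p\<^sup>2 * Y' p * ?g p - 2 / 3 * ?g p) (at p within {-M..M})"
      unfolding has_real_derivative_iff_has_vector_derivative[symmetric] by (rule has_field_derivative_at_within)
  qed (use assms in simp)
  moreover have "((\<lambda>p. 2 / 3 * ?g p) has_integral 2 / 3 * integral {-M..M} ?g) {-M..M}"
    by (intro has_integral_mult_right integrable_integral integrable_continuous_real c)
  ultimately have "((\<lambda>p. (p\<^sup>2 * Y' p * ?g p - 2 / 3 * ?g p) + 2 / 3 * ?g p) has_integral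
      (- (2 / 3 * (M * ?g M)) - - (2 / 3 * (- M * ?g (- M)))) + 2 / 3 * integral {-M..M} ?g) {-M..M}"
    by (rule has_integral_add)
  then have "integral {-M..M} (\<lambda>p. p\<^sup>2 * Y' p * ?g p) =
      - (2 / 3 * (M * ?g M)) - 2 / 3 * (M * ?g (- M)) + 2 / 3 * integral {-M..M} ?g"
    by (simp add: integral_unique)
  also have "\<dots> \<le> 2 / 3 * integral {-M..M} ?g"
    using mult_nonneg_nonneg[OF assms, of "?g M"] mult_nonneg_nonneg[OF assms, of "?g (- M)"] by simp
  also have "\<dots> \<le> 2 / 3 * (8 * sqrt \<kappa>)" using integral_exp_32[OF assms] by simp
  also have "\<dots> \<le> 6 * sqrt \<kappa>" using \<kappa>_pos by simp
  finally show ?thesis .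
qed

text \<open>
  On \<open>0 \<le> p \<le> sqrt \<kappa>\<close> the density dominates
  \<open>p Y' / sqrt \<kappa>\<close>, whose integral against \<open>exp (- 2 W)\<close> is
  explicit.
\<close>

lemma mass_lower:
  assumes "sqrt \<kappa> \<le> M"
  shows "1 / (4 * sqrt \<kappa>) \<le> integral {-M..M} (\<lambda>p. exp (- (2 * W p)) * Y' p)"
proof -
  let ?P = "sqrt \<kappa>"
  have P: "0 < ?P" using \<kappa>_pos by simp
  have c: "continuous_on S (\<lambda>p. exp (- (2 * W p)) * Y' p)" for S by (intro continuous_intros cont)
  have hi: "((\<lambda>p. exp (- (2 * W p)) * (p * Y' p) / ?P) has_integral
      (- (exp (- (2 * W ?P)) / (2 * ?P)) - - (exp (- (2 * W 0)) / (2 * ?P)))) {0..?P}"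
  proof (rule fundamental_theorem_of_calculus)
    fix p
    have "((\<lambda>p. - (exp (- (2 * W p)) / (2 * ?P))) has_real_derivative exp (- (2 * W p)) * (p * Y' p) / ?P) (at p)"
      using P by (auto intro!: derivative_eq_intros dW simp: field_simps)
    then show "((\<lambda>p. - (exp (- (2 * W p)) / (2 * ?P))) has_vector_derivative exp (- (2 * W p)) * (p * Y' p) / ?P) (at p within {0..?P})"
      unfolding has_real_derivative_iff_has_vector_derivative[symmetric] by (rule has_field_derivative_at_within)
  qed (use P in simp)
  have i: "integral {0..?P} (\<lambda>p. exp (- (2 * W p)) * (p * Y' p) / ?P) = (1 - exp (- (2 * W ?P))) / (2 * ?P)"
    unfolding integral_unique[OF hi] by (simp add: W0 diff_divide_distrib)
  have "exp (- (2 * W ?P)) \<le> 1 / 2" using exp_W_upper[of ?P] \<kappa>_pos by simp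
  then have "1 / (4 * ?P) \<le> (1 - exp (- (2 * W ?P))) / (2 * ?P)" using P by (simp add: field_simps)
  also have "\<dots> = integral {0..?P} (\<lambda>p. exp (- (2 * W p)) * (p * Y' p) / ?P)" using i by simp
  also have "\<dots> \<le> integral {0..?P} (\<lambda>p. exp (- (2 * W p)) * Y' p)"
  proof (rule integral_le)
    show "(\<lambda>p. exp (- (2 * W p)) * (p * Y' p) / ?P) integrable_on {0..?P}"
      using P by (intro integrable_continuous_real continuous_intros cont) auto
    fix p assume p: "p \<in> {0..?P}"
    have "p * Y' p / ?P \<le> Y' p" using p P Y'_pos[of p] by (simp add: field_simps)
    from mult_left_mono[OF this, of "exp (- (2 * W p))"]
    show "exp (- (2 * W p)) * (p * Y' p) / ?P \<le> exp (- (2 * W p)) * Y' p" by simp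
  qed (intro integrable_continuous_real c)
  also have "\<dots> \<le> integral {-M..M} (\<lambda>p. exp (- (2 * W p)) * Y' p)"
  proof (rule integral_subset_le)
    have "- M \<le> 0" using assms P by linarith
    then show "{0..?P} \<subseteq> {-M..M}" using assms by auto
  qed (use Y'_pos in \<open>auto intro!: integrable_continuous_real c less_imp_le\<close>)
  finally show ?thesis .
qed

text \<open>
  For \<open>\<bar>p\<bar> \<le> sqrt \<kappa>\<close> the density integrates to the length of the
  corresponding part of the section; beyond it, insert \<open>p\<^sup>2 / \<kappa> \<ge> 1\<close>
  and use the second moment.
\<close>

lemma mass_upper:
  assumes "sqrt \<kappa> \<le> M"
  shows "integral {-M..M} (\<lambda>p. exp (- (3 / 2 * W p)) * Y' p) \<le> Y (sqrt \<kappa>) - Y (- sqrt \<kappa>) + 6 / sqrt \<kappa>"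
proof -
  let ?P = "sqrt \<kappa>"
  have P: "0 < ?P" "?P\<^sup>2 = \<kappa>" using \<kappa>_pos by auto
  have PM: "- M \<le> - ?P" "- ?P \<le> M" "- ?P \<le> ?P" using assms P(1) by linarith+
  let ?g = "\<lambda>p. exp (- (3 / 2 * W p)) * Y' p"
  let ?h = "\<lambda>p. p\<^sup>2 * Y' p * exp (- (3 / 2 * W p)) / \<kappa>"
  have c: "continuous_on S ?g" "continuous_on S ?h" for S
    using \<kappa>_pos by (intro continuous_intros cont; simp)+
  have iY: "(Y' has_integral (Y ?P - Y (- ?P))) {-?P..?P}"
    by (rule fundamental_theorem_of_calculus)
       (use P dY in \<open>auto simp flip: has_real_derivative_iff_has_vector_derivative intro: has_field_derivative_at_within\<close>)
  have g_le: "?g p \<le> ?h p" if "?P \<le> \<bar>p\<bar>" for p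
  proof -
    have "\<kappa> \<le> p\<^sup>2" using that P by (metis abs_le_square_iff abs_of_pos)
    then have "1 \<le> p\<^sup>2 / \<kappa>" using \<kappa>_pos by simp
    from mult_right_mono[OF this, of "?g p"] Y'_pos[of p] show ?thesis by (simp add: field_simps)
  qed
  have h0: "0 \<le> ?h p" for p using \<kappa>_pos Y'_pos[of p] by simp
  have "integral {-M..M} ?g = integral {-M..-?P} ?g + integral {-?P..M} ?g"
    by (rule Henstock_Kurzweil_Integration.integral_combine[symmetric, OF _ _ integrable_continuous_real[OF c(1)]])
       (auto intro: assms PM less_imp_le[OF \<kappa>_pos])
  also have "integral {-?P..M} ?g = integral {-?P..?P} ?g + integral {?P..M} ?g"
    by (rule Henstock_Kurzweil_Integration.integral_combine[symmetric, OF _ _ integrable_continuous_real[OF c(1)]])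
       (auto intro: assms PM less_imp_le[OF \<kappa>_pos])
  finally have 1: "integral {-M..M} ?g = integral {-M..-?P} ?g + (integral {-?P..?P} ?g + integral {?P..M} ?g)" .
  have "integral {-M..M} ?h = integral {-M..-?P} ?h + integral {-?P..M} ?h"
    by (rule Henstock_Kurzweil_Integration.integral_combine[symmetric, OF _ _ integrable_continuous_real[OF c(2)]])
       (auto intro: assms PM less_imp_le[OF \<kappa>_pos])
  also have "integral {-?P..M} ?h = integral {-?P..?P} ?h + integral {?P..M} ?h"
    by (rule Henstock_Kurzweil_Integration.integral_combine[symmetric, OF _ _ integrable_continuous_real[OF c(2)]])
       (auto intro: assms PM less_imp_le[OF \<kappa>_pos])
  finally have 2: "integral {-M..M} ?h = integral {-M..-?P} ?h + (integral {-?P..?P} ?h + integral {?P..M} ?h)" .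
  have "integral {-M..-?P} ?g \<le> integral {-M..-?P} ?h"
    by (intro integral_le integrable_continuous_real c g_le) (use P in auto)
  moreover have "integral {?P..M} ?g \<le> integral {?P..M} ?h"
    by (intro integral_le integrable_continuous_real c g_le) (use P in auto)
  moreover have "0 \<le> integral {-?P..?P} ?h"
    by (intro integral_nonneg integrable_continuous_real c h0)
  moreover have "integral {-?P..?P} ?g \<le> Y ?P - Y (- ?P)"
  proof -
    have "integral {-?P..?P} ?g \<le> integral {-?P..?P} Y'"
      by (intro integral_le integrable_continuous_real c cont)
         (use W_nonneg Y'_pos in \<open>auto intro!: mult_left_le_one_le less_imp_le\<close>)
    also have "\<dots> = Y ?P - Y (- ?P)" using iY by (rule integral_unique)
    finally show ?thesis .
  qed
  moreover have "integral {-M..M} ?h \<le> 6 / ?P"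
  proof -
    have "integral {-M..M} ?h = integral {-M..M} (\<lambda>p. p\<^sup>2 * Y' p * exp (- (3 / 2 * W p))) / \<kappa>" by simp
    also have "\<dots> \<le> 6 * ?P / \<kappa>"
      using order_trans[OF less_imp_le[OF P(1)] assms] \<kappa>_pos by (intro divide_right_mono second_moment) auto
    also have "\<dots> = 6 / ?P" using P by (simp add: field_simps power2_eq_square)
    finally show ?thesis .
  qed
  ultimately show ?thesis using 1 2 by linarith
qed

end

section \<open>Cutoff functions\<close>

text \<open>
  A continuously differentiable truncation of \<open>v\<close> that vanishes for
  \<open>v \<le> \<delta>\<close> and increases neither \<open>v\<close> nor its derivative. Applied
  to \<open>exp (- W)\<close> it produces compact support without raising the energy.
\<close>

definition cut :: "real \<Rightarrow> real \<Rightarrow> real" where "cut \<delta> v = (max 0 (v - \<delta>))\<^sup>2 / v"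
definition cut' :: "real \<Rightarrow> real \<Rightarrow> real" where
  "cut' \<delta> v = (2 * max 0 (v - \<delta>) * v - (max 0 (v - \<delta>))\<^sup>2) / v\<^sup>2"

lemma cut_has_derivative:
  assumes "0 < v"
  shows "(cut \<delta> has_real_derivative cut' \<delta> v) (at v)"
proof -
  have "((\<lambda>v. (max 0 (v - \<delta>))\<^sup>2) has_real_derivative 2 * max 0 (v - \<delta>) * 1) (at v)"
    by (rule DERIV_chain2[OF max_zero_square_has_real_derivative]) (auto intro!: derivative_eq_intros)
  from DERIV_divide[OF this DERIV_ident] assms show ?thesis
    unfolding cut_def[abs_def] cut'_def by (simp add: power2_eq_square)
qed

lemma cut_bounds:
  assumes "0 < v" "0 < \<delta>"
  shows "0 \<le> cut \<delta> v" "cut \<delta> v \<le> v" "0 \<le> cut' \<delta> v" "cut' \<delta> v \<le> 1"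
proof -
  define w where "w = max 0 (v - \<delta>)"
  have w: "0 \<le> w" "w \<le> v" using assms by (auto simp: w_def)
  show "0 \<le> cut \<delta> v" using assms by (simp add: cut_def)
  have "w\<^sup>2 \<le> v * v" unfolding power2_eq_square using w by (intro mult_mono) auto
  then show "cut \<delta> v \<le> v" using assms by (simp add: cut_def w_def[symmetric] divide_le_eq)
  have "w\<^sup>2 \<le> 2 * w * v" using w mult_left_mono[of w "2 * v" w] by (simp add: power2_eq_square ac_simps)
  then show "0 \<le> cut' \<delta> v" using assms by (simp add: cut'_def w_def[symmetric])
  have "2 * w * v - w\<^sup>2 \<le> v\<^sup>2" using zero_le_power2[of "v - w"] by (simp add: power2_eq_square algebra_simps)
  then show "cut' \<delta> v \<le> 1" using assms by (simp add: cut'_def w_def[symmetric] divide_le_eq)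
qed

lemma cut_zero: "0 < v \<Longrightarrow> v \<le> \<delta> \<Longrightarrow> cut \<delta> v = 0" "0 < v \<Longrightarrow> v \<le> \<delta> \<Longrightarrow> cut' \<delta> v = 0"
  by (simp_all add: cut_def cut'_def)

text \<open>
  The loss is stated with \<open>v\<close> to the power \<open>3/2\<close>, because the integral of
  \<open>exp (- 3/2 W)\<close> over a section has a bound that does not depend on the cutoff.
\<close>

lemma cut_square_lower:
  assumes "0 < v" "0 < \<delta>"
  shows "v\<^sup>2 - 3 * sqrt \<delta> * (v * sqrt v) \<le> (cut \<delta> v)\<^sup>2"
proof -
  define e where "e = v - cut \<delta> v"
  have e: "0 \<le> e" "e \<le> v" using cut_bounds[OF assms] by (auto simp: e_def)
  have "e \<le> 2 * \<delta>"
  proof (cases "v \<le> \<delta>")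
    case True
    then show ?thesis using cut_zero[of v \<delta>] assms by (simp add: e_def)
  next
    case False
    then have "cut \<delta> v * v = (v - \<delta>)\<^sup>2" using assms by (simp add: cut_def)
    then have "e * v = 2 * \<delta> * v - \<delta>\<^sup>2" by (simp add: e_def left_diff_distrib power2_eq_square algebra_simps)
    then have "e * v \<le> (2 * \<delta>) * v" by simp
    then show ?thesis using assms by (simp only: mult_le_cancel_right_pos)
  qed
  then have "e * e \<le> (2 * \<delta>) * v" using e assms by (intro mult_mono) auto
  then have "sqrt (e * e) \<le> sqrt ((2 * \<delta>) * v)" by (rule real_sqrt_le_mono)
  then have "e \<le> sqrt 2 * sqrt \<delta> * sqrt v" using e by (simp add: real_sqrt_mult)
  also have "\<dots> \<le> (3/2) * sqrt \<delta> * sqrt v"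
    using assms by (intro mult_right_mono real_le_lsqrt) (auto simp: power2_eq_square intro!: real_le_lsqrt)
  finally have "e \<le> (3/2) * sqrt \<delta> * sqrt v" .
  moreover have "v\<^sup>2 - (cut \<delta> v)\<^sup>2 = e * (v + cut \<delta> v)" by (simp add: e_def power2_eq_square algebra_simps)
  moreover have "e * (v + cut \<delta> v) \<le> e * (2 * v)" using e cut_bounds[OF assms] by (intro mult_left_mono) auto
  moreover have "e * (2 * v) \<le> ((3/2) * sqrt \<delta> * sqrt v) * (2 * v)"
    using calculation(1) assms by (intro mult_right_mono) auto
  ultimately show ?thesis by (simp add: algebra_simps)
qed

definition bump :: "real \<Rightarrow> real \<Rightarrow> real \<Rightarrow> real" where
  "bump x1 x2 x = (max 0 ((x - x1) * (x2 - x)))\<^sup>2"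
definition bump' :: "real \<Rightarrow> real \<Rightarrow> real \<Rightarrow> real" where
  "bump' x1 x2 x = 2 * max 0 ((x - x1) * (x2 - x)) * (x1 + x2 - 2 * x)"

lemma bump_has_derivative: "(bump x1 x2 has_real_derivative bump' x1 x2 x) (at x)"
  unfolding bump_def[abs_def] bump'_def
  by (rule DERIV_chain2[OF max_zero_square_has_real_derivative]) (auto intro!: derivative_eq_intros)

lemma bump_zero:
  assumes "x \<notin> {x1<..<x2}" "x1 \<le> x2"
  shows "bump x1 x2 x = 0" "bump' x1 x2 x = 0"
proof -
  have "(x - x1) * (x2 - x) \<le> 0"
    using assms by (cases "x \<le> x1") (auto intro: mult_nonpos_nonneg mult_nonneg_nonpos)
  then show "bump x1 x2 x = 0" "bump' x1 x2 x = 0" by (simp_all add: bump_def bump'_def)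
qed

lemma bump_continuous: "continuous_on S (bump x1 x2)" "continuous_on S (bump' x1 x2)"
  unfolding bump_def[abs_def] bump'_def[abs_def] by (intro continuous_intros)+

text \<open>
  Both bounds are crude: the maximum of the derivative on the whole interval, and the minimum of the
  function on the middle half, where \<open>(x - x1) (x2 - x) \<ge> 3/16 w\<^sup>2\<close>.
\<close>

lemma bump_integrals:
  assumes "x1 < x2"
  defines "w \<equiv> x2 - x1"
  shows "(\<integral>\<^sup>+x. ennreal ((bump' x1 x2 x)\<^sup>2) \<partial>lborel) \<le> ennreal (w ^ 7 / 4)"
    and "ennreal (w ^ 9 / 1700) \<le> (\<integral>\<^sup>+x. ennreal ((bump x1 x2 x)\<^sup>2) \<partial>lborel)"
proof -
  have w: "0 < w" using assms by simp
  have b': "(bump' x1 x2 x)\<^sup>2 \<le> w ^ 6 / 4" if "x \<in> {x1..x2}" for x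
  proof -
    define q where "q = (x - x1) * (x2 - x)"
    have "0 \<le> q" unfolding q_def using that by (intro mult_nonneg_nonneg) auto
    moreover have "q \<le> w\<^sup>2 / 4"
      using zero_le_power2[of "(x - x1) - (x2 - x)"] by (simp add: q_def w_def power2_eq_square algebra_simps)
    ultimately have q: "0 \<le> q" "q \<le> w\<^sup>2 / 4" by auto
    have s: "(x1 + x2 - 2 * x)\<^sup>2 \<le> w\<^sup>2" using q(1) by (simp add: q_def w_def power2_eq_square algebra_simps)
    have "(bump' x1 x2 x)\<^sup>2 = 4 * q\<^sup>2 * (x1 + x2 - 2 * x)\<^sup>2"
      using q(1) by (simp add: bump'_def q_def[symmetric] power_mult_distrib)
    also have "\<dots> \<le> 4 * (w\<^sup>2 / 4)\<^sup>2 * w\<^sup>2"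
      using s power_mono[OF q(2) q(1), of 2] by (intro mult_mono) auto
    also have "\<dots> = w ^ 6 / 4" by (simp add: power_divide eval_nat_numeral)
    finally show ?thesis .
  qed
  have "(\<integral>\<^sup>+x. ennreal ((bump' x1 x2 x)\<^sup>2) \<partial>lborel) \<le> (\<integral>\<^sup>+x. ennreal (w ^ 6 / 4) * indicator {x1..x2} x \<partial>lborel)"
  proof (rule nn_integral_mono)
    fix x
    show "ennreal ((bump' x1 x2 x)\<^sup>2) \<le> ennreal (w ^ 6 / 4) * indicator {x1..x2} x"
      using b'[of x] bump_zero(2)[of x x1 x2] assms by (cases "x \<in> {x1..x2}") (auto intro!: ennreal_leI)
  qed
  also have "\<dots> = ennreal (w ^ 6 / 4) * ennreal w"
    using assms by (subst nn_integral_cmult_indicator) auto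
  also have "\<dots> = ennreal (w ^ 7 / 4)" using w by (simp add: ennreal_mult[symmetric] eval_nat_numeral ac_simps)
  finally show "(\<integral>\<^sup>+x. ennreal ((bump' x1 x2 x)\<^sup>2) \<partial>lborel) \<le> ennreal (w ^ 7 / 4)" .
  have b: "81 / 65536 * w ^ 8 \<le> (bump x1 x2 x)\<^sup>2" if "x \<in> {x1 + w/4..x2 - w/4}" for x
  proof -
    define q where "q = (x - x1) * (x2 - x)"
    have "0 \<le> (x - x1 - w/4) * (x2 - x - w/4)" using that by (intro mult_nonneg_nonneg) auto
    moreover have "(u - (u + v)/4) * (v - (u + v)/4) = u * v - 3/16 * (u + v)\<^sup>2" for u v :: real
      by (simp add: power2_eq_square field_simps)
    from this[of "x - x1" "x2 - x"] have "(x - x1 - w/4) * (x2 - x - w/4) = q - 3/16 * w\<^sup>2"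
      by (simp add: q_def w_def)
    ultimately have q: "3/16 * w\<^sup>2 \<le> q" by simp
    then have q0: "0 \<le> q" using zero_le_power2[of w] by linarith
    have "(3/16 * w\<^sup>2) ^ 4 \<le> q ^ 4" using q by (intro power_mono) auto
    moreover have "(bump x1 x2 x)\<^sup>2 = q ^ 4" using q0 by (simp add: bump_def q_def[symmetric])
    moreover have "(3/16 * w\<^sup>2) ^ 4 = 81 / 65536 * w ^ 8" by (simp add: power_mult_distrib power_divide)
    ultimately show ?thesis by simp
  qed
  have "ennreal (w ^ 9 / 1700) \<le> ennreal (81 / 65536 * w ^ 8) * ennreal (w / 2)"
    using w by (simp add: ennreal_mult[symmetric] eval_nat_numeral ennreal_leI)
  also have "\<dots> = (\<integral>\<^sup>+x. ennreal (81 / 65536 * w ^ 8) * indicator {x1 + w/4..x2 - w/4} x \<partial>lborel)"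
  proof -
    have len: "x2 - w/4 - (x1 + w/4) = w / 2" by (simp add: w_def field_simps)
    then have le: "x1 + w/4 \<le> x2 - w/4" using w by linarith
    show ?thesis by (subst nn_integral_cmult_indicator, simp) (simp only: emeasure_lborel_Icc[OF le] len)
  qed
  also have "\<dots> \<le> (\<integral>\<^sup>+x. ennreal ((bump x1 x2 x)\<^sup>2) \<partial>lborel)"
  proof (rule nn_integral_mono)
    fix x
    show "ennreal (81 / 65536 * w ^ 8) * indicator {x1 + w/4..x2 - w/4} x \<le> ennreal ((bump x1 x2 x)\<^sup>2)"
      using b[of x] by (cases "x \<in> {x1 + w/4..x2 - w/4}") (auto intro!: ennreal_leI)
  qed
  finally show "ennreal (w ^ 9 / 1700) \<le> (\<integral>\<^sup>+x. ennreal ((bump x1 x2 x)\<^sup>2) \<partial>lborel)" .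
qed

section \<open>Interpolating two ground states\<close>

lemma harmonic_le_arithmetic:
  fixes u v t :: real
  assumes "0 < u" "0 < v" "0 \<le> t" "t \<le> 1"
  shows "1 / ((1 - t) * u + t * v) \<le> (1 - t) / u + t / v"
proof -
  have pos: "0 < (1 - t) * u + t * v"
    using assms by (cases "t = 0") (auto intro: add_nonneg_pos)
  have "((1 - t) / u + t / v) * ((1 - t) * u + t * v) - 1 = t * (1 - t) * (u - v)\<^sup>2 / (u * v)"
    using assms by (simp add: field_simps power2_eq_square)
  moreover have "0 \<le> t * (1 - t) * (u - v)\<^sup>2 / (u * v)" using assms by simp
  ultimately have "1 \<le> ((1 - t) / u + t / v) * ((1 - t) * u + t * v)" by linarith
  then show ?thesis using pos by (simp add: divide_le_eq)
qed

text \<open>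
  Two profiles at the sections \<open>a\<close> and \<open>b\<close> with a common eigenvalue
  \<open>m\<close>. The number \<open>R\<close> is a length scale that bounds the size of the
  sections and their mutual displacement.
\<close>

locale slope_bridge = convex_well \<Omega> h + pa: slope_profile Ya Ya' A \<kappa> + pb: slope_profile Yb Yb' B \<kappa>
  for \<Omega> h Ya Ya' A Yb Yb' B \<kappa> +
  fixes a b m R :: real
  assumes ab: "a < b"
    and mem: "\<And>p. (a, Ya p) \<in> \<Omega>" "\<And>p. (b, Yb p) \<in> \<Omega>"
    and Va: "\<And>p. V (a, Ya p) = m + p\<^sup>2 - 1 / Ya' p" and Vb: "\<And>p. V (b, Yb p) = m + p\<^sup>2 - 1 / Yb' p"
    and Ra: "\<And>p. \<bar>Ya p - Ya 0\<bar> \<le> R * (1 + A p)" and Rb: "\<And>p. \<bar>Yb p - Yb 0\<bar> \<le> R * (1 + B p)"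
    and R0: "\<bar>Yb 0 - Ya 0\<bar> \<le> R"
    and Rs: "Ya (sqrt \<kappa>) - Ya (- sqrt \<kappa>) \<le> 2 * R" "Yb (sqrt \<kappa>) - Yb (- sqrt \<kappa>) \<le> 2 * R"
begin

definition l :: real where "l = b - a"
definition t :: "real \<Rightarrow> real" where "t x = (x - a) / l"
definition Yx :: "real \<Rightarrow> real \<Rightarrow> real" where "Yx x p = (1 - t x) * Ya p + t x * Yb p"
definition Yx' :: "real \<Rightarrow> real \<Rightarrow> real" where "Yx' x p = (1 - t x) * Ya' p + t x * Yb' p"
definition Wx :: "real \<Rightarrow> real \<Rightarrow> real" where "Wx x p = (1 - t x) * A p + t x * B p"
text \<open>
  The difference of the Legendre transforms of the two profiles.
\<close>

definition D :: "real \<Rightarrow> real" where "D p = (p * Yb p - B p) - (p * Ya p - A p)"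

lemma l_pos: "0 < l" using ab by (simp add: l_def)

lemma t_range: "x \<in> {a..b} \<Longrightarrow> 0 \<le> t x" "x \<in> {a..b} \<Longrightarrow> t x \<le> 1"
  using l_pos by (auto simp: t_def l_def divide_le_eq)

lemma R_pos: "0 \<le> R" using R0 by linarith

lemma profile:
  assumes "x \<in> {a..b}"
  shows "slope_profile (Yx x) (Yx' x) (Wx x) \<kappa>"
proof
  note tr = t_range[OF assms]
  fix p
  show "(Yx x has_real_derivative Yx' x p) (at p)"
    unfolding Yx_def[abs_def] Yx'_def by (auto intro!: derivative_eq_intros pa.dY pb.dY)
  show "(Wx x has_real_derivative p * Yx' x p) (at p)"
    unfolding Wx_def[abs_def] Yx'_def by (auto intro!: derivative_eq_intros pa.dW pb.dW simp: algebra_simps)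
  have "c = (1 - t x) * c + t x * c" for c by (simp add: algebra_simps)
  then have "1 / (p\<^sup>2 + \<kappa>) = (1 - t x) * (1 / (p\<^sup>2 + \<kappa>)) + t x * (1 / (p\<^sup>2 + \<kappa>))" .
  also have "\<dots> \<le> Yx' x p"
    unfolding Yx'_def using tr pa.Y'_lower[of p] pb.Y'_lower[of p] by (intro add_mono mult_left_mono) auto
  finally show "1 / (p\<^sup>2 + \<kappa>) \<le> Yx' x p" .
next
  show "continuous_on UNIV (Yx' x)" unfolding Yx'_def[abs_def] by (intro continuous_intros pa.cont pb.cont)
  show "Wx x 0 = 0" by (simp add: Wx_def pa.W0 pb.W0)
  show "0 < \<kappa>" by (rule pa.\<kappa>_pos)
qed

text \<open>
  The point of slope \<open>p\<close> at \<open>x\<close> lies on the segment joining the points of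
  slope \<open>p\<close> at \<open>a\<close> and \<open>b\<close>. Convexity of \<open>V\<close> on
  this segment averages the values \<open>1 / Ya'\<close> and \<open>1 / Yb'\<close>, and the
  harmonic mean is at most the arithmetic mean \<open>Yx'\<close>.
\<close>

lemma Yx_in_dom: assumes "x \<in> {a..b}" shows "(x, Yx x p) \<in> \<Omega>"
  and Yx_V: "V (x, Yx x p) \<le> m + p\<^sup>2 - 1 / Yx' x p"
proof -
  note tr = t_range[OF assms]
  have x: "x = (1 - t x) * a + t x * b"
  proof -
    have "t x * l = x - a" using l_pos by (simp add: t_def)
    then show ?thesis by (simp add: l_def algebra_simps)
  qed
  have z: "(x, Yx x p) = (1 - t x) *\<^sub>R (a, Ya p) + t x *\<^sub>R (b, Yb p)"
    using x by (simp add: Yx_def)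
  show "(x, Yx x p) \<in> \<Omega>" unfolding z
    using tr by (intro convexD[OF dom(3) mem]) auto
  have "V (x, Yx x p) \<le> (1 - t x) * V (a, Ya p) + t x * V (b, Yb p)"
    unfolding z by (rule V_convex[OF mem tr])
  also have "\<dots> = m + p\<^sup>2 - ((1 - t x) / Ya' p + t x / Yb' p)" unfolding Va Vb by (simp add: algebra_simps diff_divide_distrib)
  also have "\<dots> \<le> m + p\<^sup>2 - 1 / Yx' x p"
    using harmonic_le_arithmetic[OF pa.Y'_pos pb.Y'_pos tr, of p p] unfolding Yx'_def by simp
  finally show "V (x, Yx x p) \<le> m + p\<^sup>2 - 1 / Yx' x p" .
qed

text \<open>
  With the origin at \<open>Y 0\<close>, each Legendre transform is at most
  \<open>\<bar>p\<bar>\<close> times the distance from \<open>Y 0\<close>, hence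
  \<open>\<bar>D p\<bar> \<le> R \<bar>p\<bar> (3 + A + B)\<close>. In the middle third
  \<open>A + B\<close> is at most \<open>3 Wx\<close>; near the ends it could be much larger than
  \<open>Wx\<close>. The factor \<open>1 + Wx\<close> is then paid for by a quarter power of
  \<open>exp Wx\<close>.
\<close>

lemma D_bound:
  assumes "x \<in> {a + l/3..b - l/3}"
  shows "(D p)\<^sup>2 * exp (- (2 * Wx x p)) \<le> 144 * R\<^sup>2 * p\<^sup>2 * exp (- (3 / 2 * Wx x p))"
proof -
  have tr: "1/3 \<le> t x" "t x \<le> 2/3" using assms l_pos by (auto simp: t_def l_def field_simps)
  have f: "0 \<le> p * (Y p - Y 0) - W p \<and> p * (Y p - Y 0) - W p \<le> \<bar>p\<bar> * \<bar>Y p - Y 0\<bar>"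
    if "slope_profile Y Y' W \<kappa>" for Y Y' W :: "real \<Rightarrow> real"
  proof -
    interpret slope_profile Y Y' W \<kappa> by fact
    have "p * (Y p - Y 0) \<le> \<bar>p\<bar> * \<bar>Y p - Y 0\<bar>" unfolding abs_mult[symmetric] by (rule abs_ge_self)
    moreover have "0 \<le> p * (Y p - Y 0) - W p" using legendre[of 0 p] W0 by (simp add: algebra_simps)
    ultimately show ?thesis using W_nonneg[of p] by linarith
  qed
  define fa where "fa = p * (Ya p - Ya 0) - A p"
  define fb where "fb = p * (Yb p - Yb 0) - B p"
  have fa: "0 \<le> fa" "fa \<le> \<bar>p\<bar> * \<bar>Ya p - Ya 0\<bar>" using f[OF pa.slope_profile_axioms] by (auto simp: fa_def)
  have fb: "0 \<le> fb" "fb \<le> \<bar>p\<bar> * \<bar>Yb p - Yb 0\<bar>" using f[OF pb.slope_profile_axioms] by (auto simp: fb_def)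
  have "D p = p * (Yb 0 - Ya 0) + fb - fa" by (simp add: D_def fa_def fb_def algebra_simps)
  then have "\<bar>D p\<bar> \<le> \<bar>p\<bar> * \<bar>Yb 0 - Ya 0\<bar> + \<bar>p\<bar> * \<bar>Yb p - Yb 0\<bar> + \<bar>p\<bar> * \<bar>Ya p - Ya 0\<bar>"
    using fa fb abs_mult[of p "Yb 0 - Ya 0"] by linarith
  also have "\<dots> \<le> \<bar>p\<bar> * R + \<bar>p\<bar> * (R * (1 + B p)) + \<bar>p\<bar> * (R * (1 + A p))"
    by (intro add_mono mult_left_mono Ra Rb R0) auto
  also have "\<dots> = \<bar>p\<bar> * R * (3 + (A p + B p))" by (simp add: algebra_simps)
  also have "\<dots> \<le> \<bar>p\<bar> * R * (3 + 3 * Wx x p)"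
  proof -
    have "1/3 * A p \<le> (1 - t x) * A p" "1/3 * B p \<le> t x * B p"
      using tr pa.W_nonneg pb.W_nonneg by (intro mult_right_mono; simp)+
    then have "A p + B p \<le> 3 * Wx x p" by (simp add: Wx_def)
    then show ?thesis using R_pos by (intro mult_left_mono) auto
  qed
  also have "\<dots> = 3 * R * \<bar>p\<bar> * (1 + Wx x p)" by (simp add: algebra_simps)
  also have "\<dots> \<le> 3 * R * \<bar>p\<bar> * (4 * exp (Wx x p / 4))"
  proof -
    have "x \<in> {a..b}" using assms l_pos by auto
    then interpret px: slope_profile "Yx x" "Yx' x" "Wx x" \<kappa> by (rule profile)
    have "1 + Wx x p \<le> 4 * (1 + Wx x p / 4)" using px.W_nonneg[of p] by simp
    also have "\<dots> \<le> 4 * exp (Wx x p / 4)" using exp_ge_add_one_self[of "Wx x p / 4"] by (rule mult_left_mono) simp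
    finally show ?thesis using R_pos by (intro mult_left_mono) auto
  qed
  finally have "\<bar>D p\<bar> \<le> 12 * R * \<bar>p\<bar> * exp (Wx x p / 4)" by simp
  then have "\<bar>D p\<bar>\<^sup>2 \<le> (12 * R * \<bar>p\<bar> * exp (Wx x p / 4))\<^sup>2" by (intro power_mono) auto
  then have "(D p)\<^sup>2 \<le> 144 * R\<^sup>2 * p\<^sup>2 * exp (Wx x p / 2)"
    by (simp add: power_mult_distrib exp_double[symmetric])
  then have "(D p)\<^sup>2 * exp (- (2 * Wx x p)) \<le> 144 * R\<^sup>2 * p\<^sup>2 * exp (Wx x p / 2) * exp (- (2 * Wx x p))"
    by (rule mult_right_mono) simp
  also have "\<dots> = 144 * R\<^sup>2 * p\<^sup>2 * (exp (Wx x p / 2) * exp (- (2 * Wx x p)))" by simp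
  also have "exp (Wx x p / 2) * exp (- (2 * Wx x p)) = exp (- (3 / 2 * Wx x p))"
    unfolding exp_add[symmetric] by simp
  finally show ?thesis .
qed

text \<open>
  Coordinates \<open>(x, p)\<close> on the region \<open>G\<close> swept out by the segments, with
  \<open>P\<close> the slope at a point. Openness of \<open>G\<close> and continuity of
  \<open>P\<close> come from invariance of domain, which spares a joint differentiability argument.
\<close>

definition T :: "real \<times> real \<Rightarrow> real \<times> real" where "T z = (fst z, Yx (fst z) (snd z))"
definition strip :: "(real \<times> real) set" where "strip = {a<..<b} \<times> UNIV"
definition G :: "(real \<times> real) set" where "G = T ` strip"
definition P :: "real \<times> real \<Rightarrow> real" where "P z = snd (inv_into strip T z)"

lemma T_continuous: "continuous_on X T"
proof -
  have c: "continuous_on X (\<lambda>z. f (snd z))" if "continuous_on UNIV f" for f :: "real \<Rightarrow> real" and X :: "(real \<times> real) set"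
    by (rule continuous_on_compose2[OF that]) (auto intro!: continuous_intros)
  show ?thesis unfolding T_def[abs_def] Yx_def t_def using l_pos
    by (intro continuous_intros c pa.cont pb.cont) auto
qed

lemma T_inj: "inj_on T strip"
proof (rule inj_onI)
  fix z w assume *: "z \<in> strip" "w \<in> strip" "T z = T w"
  then have f: "fst z = fst w" "Yx (fst z) (snd z) = Yx (fst z) (snd w)" by (auto simp: T_def)
  have "fst z \<in> {a..b}" using *(1) by (auto simp: strip_def)
  then interpret px: slope_profile "Yx (fst z)" "Yx' (fst z)" "Wx (fst z)" \<kappa> by (rule profile)
  have "snd z = snd w" using f(2) px.Y_strict_mono by (simp add: strict_mono_eq)
  with f show "z = w" by (simp add: prod_eq_iff)
qed

lemma open_strip: "open strip" unfolding strip_def by (intro open_Times) auto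

lemma G_open: "open G" unfolding G_def
  by (rule invariance_of_domain[OF T_continuous open_strip T_inj])

lemma P_T: "x \<in> {a<..<b} \<Longrightarrow> P (x, Yx x p) = p"
  using inv_into_f_f[OF T_inj, of "(x, p)"] by (simp add: P_def T_def strip_def)

lemma GE:
  assumes "z \<in> G"
  obtains x p where "z = (x, Yx x p)" "x \<in> {a<..<b}" "P z = p"
  using assms P_T by (auto simp: G_def T_def strip_def)

lemma G_I: "x \<in> {a<..<b} \<Longrightarrow> (x, Yx x p) \<in> G"
  by (force simp: G_def T_def strip_def)

lemma G_P: "z \<in> G \<Longrightarrow> fst z \<in> {a<..<b} \<and> snd z = Yx (fst z) (P z)"
  by (elim GE) simp

lemma P_continuous: "continuous_on G P"
proof -
  obtain g where g: "homeomorphism strip (T ` strip) T g"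
    using invariance_of_domain_homeomorphism[OF open_strip T_continuous _ T_inj] by blast
  then have "continuous_on G g" by (auto simp: G_def homeomorphism_def)
  moreover have "inv_into strip T z = g z" if "z \<in> G" for z
    using g that inv_into_f_f[OF T_inj] by (auto simp: G_def homeomorphism_def)
  ultimately have "continuous_on G (inv_into strip T)" by (simp cong: continuous_on_cong)
  then show ?thesis unfolding P_def[abs_def] by (intro continuous_on_snd)
qed

lemma G_subset: "G \<subseteq> \<Omega>"
proof
  fix z assume "z \<in> G"
  then obtain x p where "z = (x, Yx x p)" "x \<in> {a<..<b}" by (rule GE)
  then show "z \<in> \<Omega>" using Yx_in_dom[of x p] by simp
qed

text \<open>
  On \<open>G\<close>, \<open>W\<close> is the upper envelope of the affine functions
  \<open>aff q\<close>, attained at \<open>q = P z\<close>. An envelope whose maximizer depends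
  continuously on the point is continuously differentiable with the gradient of the touching
  function.
\<close>

definition W :: "real \<times> real \<Rightarrow> real" where "W z = Wx (fst z) (P z)"
definition gW :: "real \<times> real \<Rightarrow> real \<times> real" where "gW z = (- D (P z) / l, P z)"

definition aff :: "real \<Rightarrow> real \<times> real \<Rightarrow> real" where
  "aff q z = q * snd z - (1 - t (fst z)) * (q * Ya q - A q) - t (fst z) * (q * Yb q - B q)"

lemma aff_diff: "aff q z' - aff q z = (z' - z) \<bullet> (- D q / l, q)"
proof -
  have "t (fst z') - t (fst z) = (fst z' - fst z) / l" by (simp add: t_def diff_divide_distrib[symmetric])
  moreover have "aff q z' - aff q z = q * (snd z' - snd z) - (t (fst z') - t (fst z)) * D q"
    by (simp add: aff_def D_def algebra_simps)
  ultimately show ?thesis by (simp add: inner_prod_def algebra_simps)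
qed

lemma W_eq_aff: "z \<in> G \<Longrightarrow> W z = aff (P z) z"
proof -
  assume "z \<in> G"
  then have s: "snd z = Yx (fst z) (P z)" using G_P by blast
  show ?thesis unfolding W_def aff_def Wx_def s unfolding Yx_def by (simp add: algebra_simps)
qed

lemma W_ge_aff: assumes "z \<in> G" shows "aff q z \<le> W z"
proof -
  have tr: "0 \<le> t (fst z)" "t (fst z) \<le> 1" using G_P[OF assms] t_range[of "fst z"] by auto
  have "W z - aff q z = (1 - t (fst z)) * (A (P z) - A q - q * (Ya (P z) - Ya q)) + t (fst z) * (B (P z) - B q - q * (Yb (P z) - Yb q))"
  proof -
    have s: "snd z = Yx (fst z) (P z)" using G_P[OF assms] by blast
    show ?thesis unfolding W_def aff_def Wx_def s unfolding Yx_def by (simp add: algebra_simps)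
  qed
  also have "\<dots> \<ge> 0" using tr pa.legendre pb.legendre by (intro add_nonneg_nonneg mult_nonneg_nonneg) auto
  finally show ?thesis by simp
qed

lemma gW_continuous: "continuous_on G gW"
proof -
  have "continuous_on UNIV D" unfolding D_def[abs_def] by (intro continuous_intros pa.cont pb.cont)
  then have "continuous_on G (\<lambda>z. D (P z))" by (rule continuous_on_compose2[OF _ P_continuous]) auto
  then show ?thesis unfolding gW_def[abs_def] using l_pos by (intro continuous_intros P_continuous) auto
qed

text \<open>
  The touching affine functions at \<open>z\<close> and at \<open>z'\<close> enclose the increment
  of \<open>W\<close> between two linear expressions that differ by a change of the gradient.
\<close>

lemma W_has_derivative: assumes z: "z \<in> G" shows "(W has_derivative (\<lambda>h. h \<bullet> gW z)) (at z)"
proof -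
  have e: "norm (W z' - W z - (z' - z) \<bullet> gW z) \<le> norm (gW z' - gW z) * norm (z' - z)" if z': "z' \<in> G" for z'
  proof -
    have "W z' - W z \<ge> aff (P z) z' - aff (P z) z" using W_ge_aff[OF z'] W_eq_aff[OF z] by simp
    then have 1: "0 \<le> W z' - W z - (z' - z) \<bullet> gW z" unfolding aff_diff by (simp add: gW_def)
    have "W z' - W z \<le> aff (P z') z' - aff (P z') z" using W_ge_aff[OF z] W_eq_aff[OF z'] by simp
    then have "W z' - W z \<le> (z' - z) \<bullet> gW z'" unfolding aff_diff by (simp add: gW_def)
    then have "W z' - W z - (z' - z) \<bullet> gW z \<le> (z' - z) \<bullet> (gW z' - gW z)" by (simp add: inner_diff_right)
    also have "\<dots> \<le> norm (gW z' - gW z) * norm (z' - z)"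
      using Cauchy_Schwarz_ineq2[of "z' - z" "gW z' - gW z"] by (simp add: mult.commute abs_le_iff)
    finally show ?thesis using 1 by simp
  qed
  have c: "(gW \<longlongrightarrow> gW z) (at z)"
    using gW_continuous z G_open by (simp add: continuous_on_eq_continuous_at isCont_def)
  have lim: "((\<lambda>z'. norm (gW z' - gW z)) \<longlongrightarrow> 0) (at z)"
    using tendsto_norm_zero[OF LIM_zero[OF c]] .
  have "((\<lambda>z'. (1 / norm (z' - z)) *\<^sub>R (W z' - (W z + (z' - z) \<bullet> gW z))) \<longlongrightarrow> 0) (at z)"
  proof (rule Lim_null_comparison[OF _ lim])
    have "\<forall>\<^sub>F z' in at z. z' \<in> G" using G_open z by (simp add: eventually_at_in_open')
    moreover have "\<forall>\<^sub>F z' in at z. z' \<noteq> z" by (simp add: eventually_at_filter)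
    ultimately show "\<forall>\<^sub>F z' in at z. norm ((1 / norm (z' - z)) *\<^sub>R (W z' - (W z + (z' - z) \<bullet> gW z))) \<le> norm (gW z' - gW z)"
    proof eventually_elim
      case (elim z')
      then have n: "0 < norm (z' - z)" by simp
      have "norm ((1 / norm (z' - z)) *\<^sub>R (W z' - (W z + (z' - z) \<bullet> gW z))) = norm (W z' - W z - (z' - z) \<bullet> gW z) / norm (z' - z)"
        unfolding norm_scaleR diff_diff_eq[symmetric] using n by simp
      also have "\<dots> \<le> norm (gW z' - gW z)" using e[OF elim(1)] n by (simp only: divide_le_eq) simp
      finally show ?case .
    qed
  qed
  then show ?thesis
    unfolding has_derivative_within by (simp add: bounded_linear_inner_left)
qed

text \<open>
  The test function lives over the middle third of the interval, where \<open>D_bound\<close>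
  applies.
\<close>

definition x1 :: real where "x1 = a + l / 3"
definition x2 :: real where "x2 = b - l / 3"

lemma x12: "a < x1" "x1 < x2" "x2 < b" "x2 - x1 = l / 3"
  using l_pos by (auto simp: x1_def x2_def l_def field_simps)

definition \<phi> :: "real \<Rightarrow> real \<times> real \<Rightarrow> real" where
  "\<phi> \<delta> z = (if z \<in> G then bump x1 x2 (fst z) * cut \<delta> (exp (- W z)) else 0)"
definition \<phi>' :: "real \<Rightarrow> real \<times> real \<Rightarrow> real \<times> real" where
  "\<phi>' \<delta> z = (if z \<in> G then (bump' x1 x2 (fst z) * cut \<delta> (exp (- W z)), 0) -
      (bump x1 x2 (fst z) * cut' \<delta> (exp (- W z)) * exp (- W z)) *\<^sub>R gW z else 0)"

definition supp :: "real \<Rightarrow> (real \<times> real) set" where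
  "supp M = T ` ({x1..x2} \<times> {-M..M})"

lemma supp_compact: "compact (supp M)"
  unfolding supp_def by (intro compact_continuous_image T_continuous compact_Times) auto

lemma supp_subset: "supp M \<subseteq> G"
  unfolding supp_def G_def strip_def using x12 by (intro image_mono) auto

text \<open>
  The decay of \<open>exp (- W)\<close> in \<open>p\<close> shows that the cutoff at height
  \<open>\<delta>\<close> takes effect for
  \<open>\<bar>p\<bar> \<ge> sqrt \<kappa> / \<delta>\<close>, hence the compact support.
\<close>

lemma exp_W_small:
  assumes "x \<in> {a..b}" "0 < \<delta>" "sqrt \<kappa> / \<delta> \<le> \<bar>p\<bar>"
  shows "exp (- Wx x p) \<le> \<delta>"
proof -
  interpret px: slope_profile "Yx x" "Yx' x" "Wx x" \<kappa> by (rule profile[OF assms(1)])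
  have "(sqrt \<kappa> / \<delta>)\<^sup>2 \<le> \<bar>p\<bar>\<^sup>2" using assms pa.\<kappa>_pos by (intro power_mono) auto
  then have "\<kappa> \<le> \<delta>\<^sup>2 * p\<^sup>2" using assms pa.\<kappa>_pos by (simp add: power_divide divide_le_eq mult.commute)
  also have "\<dots> \<le> \<delta>\<^sup>2 * (p\<^sup>2 + \<kappa>)" using pa.\<kappa>_pos by (intro mult_left_mono) auto
  finally have "\<kappa> / (p\<^sup>2 + \<kappa>) \<le> \<delta>\<^sup>2" using pa.denom_pos[of p] by (simp add: divide_le_eq)
  with px.exp_W_upper[of p] have "exp (- (2 * Wx x p)) \<le> \<delta>\<^sup>2" by linarith
  then have "(exp (- Wx x p))\<^sup>2 \<le> \<delta>\<^sup>2" by (simp add: exp_double[symmetric])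
  then show ?thesis using assms by (simp add: power_mono_iff)
qed

lemma \<phi>_zero_outside:
  assumes "0 < \<delta>" "z \<notin> supp (sqrt \<kappa> / \<delta>)"
  shows "\<phi> \<delta> z = 0" "\<phi>' \<delta> z = 0"
proof -
  have "\<phi> \<delta> z = 0 \<and> \<phi>' \<delta> z = 0"
  proof (cases "z \<in> G")
    case True
    then obtain x p where z: "z = (x, Yx x p)" "x \<in> {a<..<b}" "P z = p" by (rule GE)
    show ?thesis
    proof (cases "x \<in> {x1<..<x2}")
      case False
      then have "bump x1 x2 x = 0" "bump' x1 x2 x = 0" using bump_zero x12 by auto
      then show ?thesis using z by (simp add: \<phi>_def \<phi>'_def zero_prod_def)
    next
      case True
      have "p \<notin> {- (sqrt \<kappa> / \<delta>)..sqrt \<kappa> / \<delta>}"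
      proof
        assume "p \<in> {- (sqrt \<kappa> / \<delta>)..sqrt \<kappa> / \<delta>}"
        then have "T (x, p) \<in> supp (sqrt \<kappa> / \<delta>)" unfolding supp_def using True by (intro imageI) auto
        then show False using assms z by (simp add: T_def)
      qed
      then have "sqrt \<kappa> / \<delta> \<le> \<bar>p\<bar>" by auto
      then have "exp (- W z) \<le> \<delta>" unfolding W_def using z by (simp add: exp_W_small[OF _ assms(1)])
      then show ?thesis by (simp add: \<phi>_def \<phi>'_def cut_zero zero_prod_def[symmetric])
    qed
  qed (simp add: \<phi>_def \<phi>'_def)
  then show "\<phi> \<delta> z = 0" "\<phi>' \<delta> z = 0" by auto
qed

text \<open>
  The two open sets \<open>G\<close> and the complement of the compact support cover the plane, and
  the function is of class \<open>C\<^sup>1\<close> on each.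
\<close>

lemma \<phi>_test:
  assumes "0 < \<delta>"
  shows "test_function \<Omega> (\<phi> \<delta>) (\<phi>' \<delta>)"
proof -
  let ?K = "supp (sqrt \<kappa> / \<delta>)"
  have openK: "open (- ?K)" using supp_compact by (simp add: compact_imp_closed open_Compl)
  have inside: "(\<phi> \<delta> has_derivative (\<lambda>h. h \<bullet> \<phi>' \<delta> z)) (at z)" if z: "z \<in> G" for z
  proof -
    define v where "v = exp (- W z)"
    have dv: "((\<lambda>z. exp (- W z)) has_derivative (\<lambda>h. - v * (h \<bullet> gW z))) (at z)"
      unfolding v_def by (auto intro!: derivative_eq_intros W_has_derivative[OF z])
    have "(cut \<delta> has_derivative (*) (cut' \<delta> v)) (at (exp (- W z)))"
      using cut_has_derivative[of v \<delta>] by (simp add: v_def has_field_derivative_def)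
    from has_derivative_compose[OF dv this]
    have dc: "((\<lambda>z. cut \<delta> (exp (- W z))) has_derivative (\<lambda>h. cut' \<delta> v * (- v * (h \<bullet> gW z)))) (at z)" .
    have "(bump x1 x2 has_derivative (*) (bump' x1 x2 (fst z))) (at (fst z))"
      using bump_has_derivative by (simp add: has_field_derivative_def)
    from has_derivative_compose[OF has_derivative_fst[OF has_derivative_ident] this]
    have db: "((\<lambda>z. bump x1 x2 (fst z)) has_derivative (\<lambda>h. bump' x1 x2 (fst z) * fst h)) (at z)" .
    have "((\<lambda>z. bump x1 x2 (fst z) * cut \<delta> (exp (- W z))) has_derivative (\<lambda>h. h \<bullet> \<phi>' \<delta> z)) (at z)"
      using has_derivative_mult[OF db dc]
    proof (rule has_derivative_eq_rhs)
      show "(\<lambda>h. bump x1 x2 (fst z) * (cut' \<delta> v * (- v * (h \<bullet> gW z))) + bump' x1 x2 (fst z) * fst h * cut \<delta> (exp (- W z))) = (\<lambda>h. h \<bullet> \<phi>' \<delta> z)"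
        using z by (simp add: \<phi>'_def v_def inner_diff_right inner_prod_def algebra_simps)
    qed
    then show ?thesis
      by (rule has_derivative_transform_within_open[OF _ G_open z]) (simp add: \<phi>_def)
  qed
  have outside: "(\<phi> \<delta> has_derivative (\<lambda>h. h \<bullet> \<phi>' \<delta> z)) (at z)" if z: "z \<in> - ?K" for z
  proof -
    have "((\<lambda>z. 0) has_derivative (\<lambda>h. h \<bullet> \<phi>' \<delta> z)) (at z)"
      using z by (simp add: \<phi>_zero_outside[OF assms])
    then show ?thesis
      by (rule has_derivative_transform_within_open[OF _ openK z]) (simp add: \<phi>_zero_outside[OF assms])
  qed
  have cov: "z \<in> G \<or> z \<in> - ?K" for z using supp_subset by blast
  have cont_in: "continuous_on G (\<phi>' \<delta>)"
  proof -
    have cW: "continuous_on G W"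
      using W_has_derivative by (intro continuous_at_imp_continuous_on ballI) (rule has_derivative_continuous)
    have cut_c: "continuous_on {0<..} (cut \<delta>)" "continuous_on {0<..} (cut' \<delta>)"
      unfolding cut_def[abs_def] cut'_def[abs_def] by (intro continuous_intros; auto)+
    have cc: "continuous_on G (\<lambda>z. cut \<delta> (exp (- W z)))" "continuous_on G (\<lambda>z. cut' \<delta> (exp (- W z)))"
      by (rule continuous_on_compose2[OF cut_c(1)] continuous_on_compose2[OF cut_c(2)]; auto intro!: continuous_intros cW)+
    have cb: "continuous_on G (\<lambda>z. bump x1 x2 (fst z))" "continuous_on G (\<lambda>z. bump' x1 x2 (fst z))"
      by (rule continuous_on_compose2[OF bump_continuous(1)[of UNIV]] continuous_on_compose2[OF bump_continuous(2)[of UNIV]];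
          auto intro!: continuous_intros)+
    have "continuous_on G (\<lambda>z. (bump' x1 x2 (fst z) * cut \<delta> (exp (- W z)), 0) -
      (bump x1 x2 (fst z) * cut' \<delta> (exp (- W z)) * exp (- W z)) *\<^sub>R gW z)"
      by (intro continuous_intros cc cb cW gW_continuous)
    then show ?thesis by (simp add: \<phi>'_def cong: continuous_on_cong)
  qed
  have "isCont (\<phi>' \<delta>) z" for z
    using cov[of z]
  proof
    assume "z \<in> G" then show ?thesis using cont_in G_open by (simp add: continuous_on_eq_continuous_at)
  next
    assume z: "z \<in> - ?K"
    have "continuous_on (- ?K) (\<phi>' \<delta>)"
      by (rule continuous_on_eq[OF continuous_on_const[of _ 0]]) (use \<phi>_zero_outside(2)[OF assms] in auto)
    then show ?thesis using z openK by (simp add: continuous_on_eq_continuous_at)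
  qed
  then have "continuous_on UNIV (\<phi>' \<delta>)" by (simp add: continuous_at_imp_continuous_on)
  moreover have "\<forall>z. GDERIV (\<phi> \<delta>) z :> \<phi>' \<delta> z"
    unfolding gderiv_def using cov inside outside by blast
  moreover have "compact ?K" "?K \<subseteq> \<Omega>" "\<forall>z. z \<notin> ?K \<longrightarrow> \<phi> \<delta> z = 0"
    using supp_compact supp_subset G_subset \<phi>_zero_outside(1)[OF assms] by auto
  ultimately show ?thesis unfolding test_function_def by blast
qed

section \<open>The energy of the interpolation\<close>

definition Z :: "real \<Rightarrow> real \<Rightarrow> real" where
  "Z M x = integral {-M..M} (\<lambda>p. exp (- (2 * Wx x p)) * Yx' x p)"

text \<open>
  A bound, common to all sections, for the integral of \<open>exp (- 3/2 W)\<close> and thus also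
  for the mass.
\<close>

definition mass_cap :: real where "mass_cap = 2 * R + 6 / sqrt \<kappa>"

lemma mass_cap_pos: "0 < mass_cap" using R_pos pa.\<kappa>_pos by (simp add: mass_cap_def add_nonneg_pos)

lemma sqrt\<kappa>: "0 < sqrt \<kappa>" "sqrt \<kappa> * sqrt \<kappa> = \<kappa>" using pa.\<kappa>_pos by auto

lemma three_halves_mass:
  assumes x: "x \<in> {a..b}" and M: "sqrt \<kappa> \<le> M"
  shows "integral {-M..M} (\<lambda>p. exp (- (3 / 2 * Wx x p)) * Yx' x p) \<le> mass_cap"
proof -
  interpret px: slope_profile "Yx x" "Yx' x" "Wx x" \<kappa> by (rule profile[OF x])
  note tr = t_range[OF x]
  have "Yx x (sqrt \<kappa>) - Yx x (- sqrt \<kappa>) = (1 - t x) * (Ya (sqrt \<kappa>) - Ya (- sqrt \<kappa>)) + t x * (Yb (sqrt \<kappa>) - Yb (- sqrt \<kappa>))"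
    by (simp add: Yx_def algebra_simps)
  also have "\<dots> \<le> (1 - t x) * (2 * R) + t x * (2 * R)"
    using tr Rs by (intro add_mono mult_left_mono) auto
  also have "\<dots> = 2 * R" by (simp add: algebra_simps)
  finally show ?thesis using px.mass_upper[OF M] by (simp add: mass_cap_def)
qed

lemma Z_bounds:
  assumes x: "x \<in> {a..b}" and M: "sqrt \<kappa> \<le> M"
  shows "1 / (4 * sqrt \<kappa>) \<le> Z M x" "Z M x \<le> mass_cap"
proof -
  interpret px: slope_profile "Yx x" "Yx' x" "Wx x" \<kappa> by (rule profile[OF x])
  show "1 / (4 * sqrt \<kappa>) \<le> Z M x" unfolding Z_def by (rule px.mass_lower[OF M])
  have "Z M x \<le> integral {-M..M} (\<lambda>p. exp (- (3 / 2 * Wx x p)) * Yx' x p)"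
    unfolding Z_def
    by (intro integral_le integrable_continuous_real continuous_intros px.cont mult_right_mono)
       (use px.W_nonneg px.Y'_pos in \<open>auto intro: less_imp_le\<close>)
  also note three_halves_mass[OF assms]
  finally show "Z M x \<le> mass_cap" .
qed

lemma nn_integral_section:
  fixes f :: "real \<Rightarrow> real"
  assumes x: "x \<in> {a..b}" and "0 \<le> M" and f: "f \<in> borel_measurable borel" "\<And>y. 0 \<le> f y"
    and zero: "\<And>y. y \<notin> {Yx x (- M)..Yx x M} \<Longrightarrow> f y = 0"
  shows "(\<integral>\<^sup>+y. ennreal (f y) \<partial>lborel) = (\<integral>\<^sup>+p. ennreal (f (Yx x p) * Yx' x p) * indicator {-M..M} p \<partial>lborel)"
proof -
  interpret px: slope_profile "Yx x" "Yx' x" "Wx x" \<kappa> by (rule profile[OF x])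
  have "(\<integral>\<^sup>+y. ennreal (f y) \<partial>lborel) = (\<integral>\<^sup>+y. ennreal (f y * indicator {Yx x (- M)..Yx x M} y) \<partial>lborel)"
    by (intro nn_integral_cong) (use zero in \<open>auto simp: indicator_def\<close>)
  also have "\<dots> = (\<integral>\<^sup>+p. ennreal (f (Yx x p) * Yx' x p * indicator {-M..M} p) \<partial>lborel)"
    by (rule nn_integral_substitution)
       (use assms px.dY px.cont px.Y'_pos in \<open>auto simp: set_borel_measurable_def intro: less_imp_le\<close>)
  also have "\<dots> = (\<integral>\<^sup>+p. ennreal (f (Yx x p) * Yx' x p) * indicator {-M..M} p \<partial>lborel)"
    by (intro nn_integral_cong) (auto simp: indicator_def)
  finally show ?thesis .
qed

lemma \<phi>_on_strip:
  assumes "x \<in> {a<..<b}"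
  shows "\<phi> \<delta> (x, Yx x p) = bump x1 x2 x * cut \<delta> (exp (- Wx x p))"
    "\<phi>' \<delta> (x, Yx x p) = (bump' x1 x2 x * cut \<delta> (exp (- Wx x p)) + bump x1 x2 x * cut' \<delta> (exp (- Wx x p)) * exp (- Wx x p) * D p / l,
      - (bump x1 x2 x * cut' \<delta> (exp (- Wx x p)) * exp (- Wx x p) * p))"
  using G_I[OF assms, of p] P_T[OF assms, of p] by (simp_all add: \<phi>_def \<phi>'_def W_def gW_def)

lemma section_zero:
  assumes \<delta>: "0 < \<delta>" and x: "x \<in> {a..b}" and y: "y \<notin> {Yx x (- (sqrt \<kappa> / \<delta>))..Yx x (sqrt \<kappa> / \<delta>)}"
  shows "\<phi> \<delta> (x, y) = 0" "\<phi>' \<delta> (x, y) = 0"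
proof -
  interpret px: slope_profile "Yx x" "Yx' x" "Wx x" \<kappa> by (rule profile[OF x])
  have "(x, y) \<notin> supp (sqrt \<kappa> / \<delta>)"
  proof
    assume "(x, y) \<in> supp (sqrt \<kappa> / \<delta>)"
    then obtain p where p: "y = Yx x p" "- (sqrt \<kappa> / \<delta>) \<le> p" "p \<le> sqrt \<kappa> / \<delta>"
      unfolding supp_def T_def by auto
    then show False using y px.Y_strict_mono by (simp add: strict_mono_less_eq)
  qed
  then show "\<phi> \<delta> (x, y) = 0" "\<phi>' \<delta> (x, y) = 0" using \<phi>_zero_outside[OF \<delta>] by auto
qed

text \<open>
  Contribution of the \<open>x\<close>-derivative of \<open>W\<close>:
  \<open>6912 = 288 * 24\<close>, where \<open>288 = 2 * 144\<close> comes from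
  \<open>D_bound\<close> and \<open>24 \<kappa>\<close> from comparing the second moment with the
  mass.
\<close>

definition tilt_const :: real where "tilt_const = 6912 * R\<^sup>2 * \<kappa>"

text \<open>
  The three terms are the energy of the bump together with \<open>m\<close> times the mass, the
  energy of the \<open>x\<close>-derivative of \<open>W\<close>, and the integrand of the virial
  inequality.
\<close>

lemma section_energy_pointwise:
  assumes \<delta>: "0 < \<delta>" and x: "x \<in> {x1..x2}"
  shows "((norm (\<phi>' \<delta> (x, Yx x p)))\<^sup>2 + U (x, Yx x p) * (\<phi> \<delta> (x, Yx x p))\<^sup>2) * Yx' x p \<le>
    (2 * (bump' x1 x2 x)\<^sup>2 + m * (bump x1 x2 x)\<^sup>2) * (exp (- (2 * Wx x p)) * Yx' x p)
    + 288 * R\<^sup>2 / l\<^sup>2 * (bump x1 x2 x)\<^sup>2 * (p\<^sup>2 * Yx' x p * exp (- (3 / 2 * Wx x p)))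
    + (bump x1 x2 x)\<^sup>2 * ((2 * p\<^sup>2 * Yx' x p - 1) * exp (- (2 * Wx x p)))"
proof -
  have xab: "x \<in> {a<..<b}" "x \<in> {a..b}" "x \<in> {a + l/3..b - l/3}" using x x12 by (auto simp: x1_def x2_def)
  interpret px: slope_profile "Yx x" "Yx' x" "Wx x" \<kappa> by (rule profile[OF xab(2)])
  define v where "v = exp (- Wx x p)"
  define k where "k = bump x1 x2 x"
  define k' where "k' = bump' x1 x2 x"
  define c where "c = cut \<delta> v"
  define c' where "c' = cut' \<delta> v"
  have v: "0 < v" "v\<^sup>2 = exp (- (2 * Wx x p))" by (auto simp: v_def exp_double[symmetric])
  have cb: "0 \<le> c" "c \<le> v" "0 \<le> c'" "c' \<le> 1" using cut_bounds[OF v(1) \<delta>] by (auto simp: c_def c'_def)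
  have c2: "c\<^sup>2 \<le> v\<^sup>2" "c'\<^sup>2 \<le> 1" using cb by (auto intro: power_mono power_le_one)
  have in_dom: "(x, Yx x p) \<in> \<Omega>" by (rule Yx_in_dom[OF xab(2)])
  have n: "(norm (\<phi>' \<delta> (x, Yx x p)))\<^sup>2 = (k' * c + k * c' * v * D p / l)\<^sup>2 + (k * c' * v * p)\<^sup>2"
    unfolding \<phi>_on_strip[OF xab(1)] by (simp add: norm_Pair k_def k'_def c_def c'_def v_def)
  have sq: "(k' * c + k * c' * v * D p / l)\<^sup>2 \<le> 2 * (k'\<^sup>2 * v\<^sup>2) + 2 * (k\<^sup>2 * ((D p)\<^sup>2 * v\<^sup>2) / l\<^sup>2)"
  proof -
    have "(a + b)\<^sup>2 \<le> 2 * a\<^sup>2 + 2 * b\<^sup>2" for a b :: real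
      using zero_le_power2[of "a - b"] by (simp add: power2_eq_square algebra_simps)
    then have "(k' * c + k * c' * v * D p / l)\<^sup>2 \<le> 2 * (k' * c)\<^sup>2 + 2 * (k * c' * v * D p / l)\<^sup>2" .
    moreover have "(k' * c)\<^sup>2 \<le> k'\<^sup>2 * v\<^sup>2" unfolding power_mult_distrib using c2 by (intro mult_left_mono) auto
    moreover have "(k * c' * v * D p / l)\<^sup>2 \<le> k\<^sup>2 * ((D p)\<^sup>2 * v\<^sup>2) / l\<^sup>2"
    proof -
      have "(k * c' * v * D p / l)\<^sup>2 = c'\<^sup>2 * (k\<^sup>2 * ((D p)\<^sup>2 * v\<^sup>2) / l\<^sup>2)"
        by (simp add: power_mult_distrib power_divide)
      also have "\<dots> \<le> 1 * (k\<^sup>2 * ((D p)\<^sup>2 * v\<^sup>2) / l\<^sup>2)" using c2 by (intro mult_right_mono) auto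
      finally show ?thesis by simp
    qed
    ultimately show ?thesis by linarith
  qed
  have Dv: "(D p)\<^sup>2 * v\<^sup>2 \<le> 144 * R\<^sup>2 * p\<^sup>2 * exp (- (3 / 2 * Wx x p))"
    using D_bound[OF xab(3)] by (simp add: v(2))
  have kin: "(k * c' * v * p)\<^sup>2 \<le> k\<^sup>2 * (p\<^sup>2 * v\<^sup>2)"
  proof -
    have "(k * c' * v * p)\<^sup>2 = c'\<^sup>2 * (k\<^sup>2 * (p\<^sup>2 * v\<^sup>2))" by (simp add: power_mult_distrib)
    also have "\<dots> \<le> 1 * (k\<^sup>2 * (p\<^sup>2 * v\<^sup>2))" using c2 by (intro mult_right_mono) auto
    finally show ?thesis by simp
  qed
  have pot: "U (x, Yx x p) * (\<phi> \<delta> (x, Yx x p))\<^sup>2 \<le> k\<^sup>2 * ((m + p\<^sup>2 - 1 / Yx' x p) * v\<^sup>2)"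
  proof -
    have "U (x, Yx x p) * (\<phi> \<delta> (x, Yx x p))\<^sup>2 = V (x, Yx x p) * (k\<^sup>2 * c\<^sup>2)"
      unfolding \<phi>_on_strip[OF xab(1)] using in_dom by (simp add: U_def power_mult_distrib k_def c_def v_def)
    also have "\<dots> \<le> (m + p\<^sup>2 - 1 / Yx' x p) * (k\<^sup>2 * v\<^sup>2)"
    proof (intro mult_mono)
      show "V (x, Yx x p) \<le> m + p\<^sup>2 - 1 / Yx' x p" by (rule Yx_V[OF xab(2)])
      with V_ge_1[OF in_dom] show "0 \<le> m + p\<^sup>2 - 1 / Yx' x p" by linarith
    qed (use c2 in \<open>auto intro: mult_left_mono\<close>)
    finally show ?thesis by (simp add: ac_simps)
  qed
  have "k\<^sup>2 * ((D p)\<^sup>2 * v\<^sup>2) / l\<^sup>2 \<le> k\<^sup>2 * (144 * R\<^sup>2 * p\<^sup>2 * exp (- (3 / 2 * Wx x p))) / l\<^sup>2"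
    using Dv by (intro divide_right_mono mult_left_mono) auto
  with sq kin pot have "(norm (\<phi>' \<delta> (x, Yx x p)))\<^sup>2 + U (x, Yx x p) * (\<phi> \<delta> (x, Yx x p))\<^sup>2 \<le>
     2 * (k'\<^sup>2 * v\<^sup>2) + 2 * (k\<^sup>2 * (144 * R\<^sup>2 * p\<^sup>2 * exp (- (3 / 2 * Wx x p))) / l\<^sup>2) + k\<^sup>2 * (p\<^sup>2 * v\<^sup>2)
      + k\<^sup>2 * ((m + p\<^sup>2 - 1 / Yx' x p) * v\<^sup>2)" unfolding n by linarith
  from mult_right_mono[OF this less_imp_le[OF px.Y'_pos[of p]]]
  have "((norm (\<phi>' \<delta> (x, Yx x p)))\<^sup>2 + U (x, Yx x p) * (\<phi> \<delta> (x, Yx x p))\<^sup>2) * Yx' x p \<le>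
     (2 * (k'\<^sup>2 * v\<^sup>2) + 2 * (k\<^sup>2 * (144 * R\<^sup>2 * p\<^sup>2 * exp (- (3 / 2 * Wx x p))) / l\<^sup>2) + k\<^sup>2 * (p\<^sup>2 * v\<^sup>2)
      + k\<^sup>2 * ((m + p\<^sup>2 - 1 / Yx' x p) * v\<^sup>2)) * Yx' x p" .
  also have "\<dots> = (2 * k'\<^sup>2 + m * k\<^sup>2) * (v\<^sup>2 * Yx' x p)
    + 288 * R\<^sup>2 / l\<^sup>2 * k\<^sup>2 * (p\<^sup>2 * Yx' x p * exp (- (3 / 2 * Wx x p)))
    + k\<^sup>2 * ((2 * p\<^sup>2 * Yx' x p - 1) * v\<^sup>2)"
  proof -
    have nz: "Yx' x p \<noteq> 0" using px.Y'_pos[of p] by simp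
    have "k\<^sup>2 * ((m + p\<^sup>2 - 1 / Yx' x p) * v\<^sup>2) * Yx' x p = k\<^sup>2 * v\<^sup>2 * ((m + p\<^sup>2) * Yx' x p - 1)"
      by (simp add: algebra_simps nz)
    then show ?thesis by (simp add: algebra_simps)
  qed
  finally show ?thesis unfolding k_def k'_def v(2) .
qed

text \<open>
  Integrated over \<open>p\<close>, the last term of the pointwise bound is nonpositive by the
  virial inequality. The second moment is at most \<open>6 sqrt \<kappa>\<close> and is converted
  into mass by the lower bound for \<open>Z\<close>.
\<close>

lemma section_energy:
  assumes \<delta>: "0 < \<delta>" "\<delta> \<le> 1" and x: "x \<in> {x1..x2}"
  shows "(\<integral>\<^sup>+y. ennreal ((norm (\<phi>' \<delta> (x, y)))\<^sup>2 + U (x, y) * (\<phi> \<delta> (x, y))\<^sup>2) \<partial>lborel) \<le>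
    ennreal (2 * (bump' x1 x2 x)\<^sup>2 * mass_cap + (m + tilt_const / l\<^sup>2) * (bump x1 x2 x)\<^sup>2 * Z (sqrt \<kappa> / \<delta>) x)"
proof -
  have xab: "x \<in> {a..b}" using x x12 by auto
  interpret px: slope_profile "Yx x" "Yx' x" "Wx x" \<kappa> by (rule profile[OF xab])
  define M where "M = sqrt \<kappa> / \<delta>"
  have M: "sqrt \<kappa> \<le> M" "0 \<le> M" using \<delta> sqrt\<kappa>(1) by (auto simp: M_def le_divide_eq)
  note [measurable] = test_function_measurable[OF \<phi>_test[OF \<delta>(1)]]
  let ?k = "(bump x1 x2 x)\<^sup>2"
  define H where "H p = (2 * (bump' x1 x2 x)\<^sup>2 + m * ?k) * (exp (- (2 * Wx x p)) * Yx' x p)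
    + 288 * R\<^sup>2 / l\<^sup>2 * ?k * (p\<^sup>2 * Yx' x p * exp (- (3 / 2 * Wx x p)))
    + ?k * ((2 * p\<^sup>2 * Yx' x p - 1) * exp (- (2 * Wx x p)))" for p
  have H_cont: "continuous_on {-M..M} H" unfolding H_def[abs_def] by (intro continuous_intros px.cont)
  have H_ge: "((norm (\<phi>' \<delta> (x, Yx x p)))\<^sup>2 + U (x, Yx x p) * (\<phi> \<delta> (x, Yx x p))\<^sup>2) * Yx' x p \<le> H p" for p
    unfolding H_def by (rule section_energy_pointwise[OF \<delta>(1) x])
  have H0: "0 \<le> H p" for p
    using H_ge[of p] U_nonneg[of "(x, Yx x p)"] px.Y'_pos[of p]
    by (meson add_nonneg_nonneg less_imp_le mult_nonneg_nonneg order_trans zero_le_power2)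
  have "(\<integral>\<^sup>+y. ennreal ((norm (\<phi>' \<delta> (x, y)))\<^sup>2 + U (x, y) * (\<phi> \<delta> (x, y))\<^sup>2) \<partial>lborel) =
    (\<integral>\<^sup>+p. ennreal (((norm (\<phi>' \<delta> (x, Yx x p)))\<^sup>2 + U (x, Yx x p) * (\<phi> \<delta> (x, Yx x p))\<^sup>2) * Yx' x p) * indicator {-M..M} p \<partial>lborel)"
  proof (rule nn_integral_section[OF xab M(2)])
    show "(\<lambda>y. (norm (\<phi>' \<delta> (x, y)))\<^sup>2 + U (x, y) * (\<phi> \<delta> (x, y))\<^sup>2) \<in> borel_measurable borel"
      by measurable
    fix y assume "y \<notin> {Yx x (- M)..Yx x M}"
    then show "(norm (\<phi>' \<delta> (x, y)))\<^sup>2 + U (x, y) * (\<phi> \<delta> (x, y))\<^sup>2 = 0"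
      using section_zero[OF \<delta>(1) xab] by (simp add: M_def)
  qed (use U_nonneg in auto)
  also have "\<dots> \<le> (\<integral>\<^sup>+p. ennreal (H p) * indicator {-M..M} p \<partial>lborel)"
    by (intro nn_integral_mono mult_right_mono ennreal_leI H_ge) auto
  also have "\<dots> = ennreal (integral {-M..M} H)"
    by (rule nn_integral_continuous_interval[OF H_cont H0])
  also have "\<dots> \<le> ennreal (2 * (bump' x1 x2 x)\<^sup>2 * mass_cap + (m + tilt_const / l\<^sup>2) * ?k * Z M x)"
  proof (rule ennreal_leI)
    define P2 where "P2 = integral {-M..M} (\<lambda>p. p\<^sup>2 * Yx' x p * exp (- (3 / 2 * Wx x p)))"
    define I where "I = integral {-M..M} (\<lambda>p. (2 * p\<^sup>2 * Yx' x p - 1) * exp (- (2 * Wx x p)))"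
    have "(H has_integral ((2 * (bump' x1 x2 x)\<^sup>2 + m * ?k) * Z M x + 288 * R\<^sup>2 / l\<^sup>2 * ?k * P2 + ?k * I)) {-M..M}"
      unfolding H_def[abs_def] Z_def P2_def I_def
      by (intro has_integral_add has_integral_mult_right integrable_integral integrable_continuous_real continuous_intros px.cont)
    then have "integral {-M..M} H = (2 * (bump' x1 x2 x)\<^sup>2 + m * ?k) * Z M x + 288 * R\<^sup>2 / l\<^sup>2 * ?k * P2 + ?k * I"
      by (rule integral_unique)
    also have "?k * I \<le> 0" using px.virial_inequality[OF M(2)] unfolding I_def by (intro mult_nonneg_nonpos) auto
    also have "288 * R\<^sup>2 / l\<^sup>2 * ?k * P2 \<le> 288 * R\<^sup>2 / l\<^sup>2 * ?k * (24 * \<kappa> * Z M x)"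
    proof (rule mult_left_mono)
      have "P2 \<le> 6 * sqrt \<kappa>" unfolding P2_def by (rule px.second_moment[OF M(2)])
      also have "\<dots> = 24 * \<kappa> * (1 / (4 * sqrt \<kappa>))" using sqrt\<kappa> by (simp add: field_simps)
      also have "\<dots> \<le> 24 * \<kappa> * Z M x" using Z_bounds(1)[OF xab M(1)] pa.\<kappa>_pos by (intro mult_left_mono) auto
      finally show "P2 \<le> 24 * \<kappa> * Z M x" .
    qed simp
    also have "(2 * (bump' x1 x2 x)\<^sup>2 + m * ?k) * Z M x \<le> 2 * (bump' x1 x2 x)\<^sup>2 * mass_cap + m * ?k * Z M x"
      using Z_bounds(2)[OF xab M(1)] by (simp add: distrib_right mult_left_mono)
    finally show "integral {-M..M} H \<le> 2 * (bump' x1 x2 x)\<^sup>2 * mass_cap + (m + tilt_const / l\<^sup>2) * ?k * Z M x"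
      by (simp add: tilt_const_def algebra_simps)
  qed
  finally show ?thesis unfolding M_def .
qed

text \<open>
  The loss in \<open>cut_square_lower\<close> integrates to at most
  \<open>3 sqrt \<delta> mass_cap\<close>, which is compared with the lower bound
  \<open>1 / (4 sqrt \<kappa>)\<close> for \<open>Z\<close>.
\<close>

lemma section_mass:
  assumes \<delta>: "0 < \<delta>" "\<delta> \<le> 1" and x: "x \<in> {x1..x2}" and \<theta>: "12 * sqrt \<delta> * mass_cap * sqrt \<kappa> \<le> \<theta>"
  shows "ennreal ((1 - \<theta>) * (bump x1 x2 x)\<^sup>2 * Z (sqrt \<kappa> / \<delta>) x) \<le> (\<integral>\<^sup>+y. ennreal ((\<phi> \<delta> (x, y))\<^sup>2) \<partial>lborel)"
proof -
  have xab: "x \<in> {a..b}" "x \<in> {a<..<b}" using x x12 by auto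
  interpret px: slope_profile "Yx x" "Yx' x" "Wx x" \<kappa> by (rule profile[OF xab(1)])
  define M where "M = sqrt \<kappa> / \<delta>"
  have M: "sqrt \<kappa> \<le> M" "0 \<le> M" using \<delta> sqrt\<kappa>(1) by (auto simp: M_def le_divide_eq)
  note [measurable] = test_function_measurable[OF \<phi>_test[OF \<delta>(1)]]
  let ?k = "(bump x1 x2 x)\<^sup>2"
  define N where "N p = ?k * (cut \<delta> (exp (- Wx x p)))\<^sup>2 * Yx' x p" for p
  have cut_c: "continuous_on {0<..} (cut \<delta>)" unfolding cut_def[abs_def] by (intro continuous_intros) auto
  have N_cont: "continuous_on {-M..M} N" unfolding N_def[abs_def]
    by (intro continuous_intros px.cont continuous_on_compose2[OF cut_c]) auto
  have N0: "0 \<le> N p" for p using px.Y'_pos[of p] by (simp add: N_def)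
  have N_ge: "?k * (exp (- (2 * Wx x p)) * Yx' x p) - ?k * (3 * sqrt \<delta>) * (exp (- (3 / 2 * Wx x p)) * Yx' x p) \<le> N p" for p
  proof -
    define v where "v = exp (- Wx x p)"
    have v2: "v\<^sup>2 = exp (- (2 * Wx x p))" by (simp add: v_def exp_double[symmetric])
    have "sqrt v = exp (- (Wx x p / 2))"
      by (rule real_sqrt_unique) (auto simp: v_def exp_double[symmetric])
    then have v3: "v * sqrt v = exp (- (3 / 2 * Wx x p))" unfolding v_def by (simp add: exp_add[symmetric])
    have "v\<^sup>2 - 3 * sqrt \<delta> * (v * sqrt v) \<le> (cut \<delta> v)\<^sup>2"
      by (rule cut_square_lower) (use \<delta> in \<open>auto simp: v_def\<close>)
    then have "(?k * Yx' x p) * (v\<^sup>2 - 3 * sqrt \<delta> * (v * sqrt v)) \<le> (?k * Yx' x p) * (cut \<delta> v)\<^sup>2"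
      using px.Y'_pos[of p] by (intro mult_left_mono) auto
    then have "(?k * Yx' x p) * (exp (- (2 * Wx x p)) - 3 * sqrt \<delta> * exp (- (3 / 2 * Wx x p))) \<le> (?k * Yx' x p) * (cut \<delta> v)\<^sup>2"
      unfolding v2 v3 .
    then show ?thesis unfolding N_def v_def by (simp add: algebra_simps)
  qed
  define X where "X = integral {-M..M} (\<lambda>p. exp (- (3 / 2 * Wx x p)) * Yx' x p)"
  have "(1 - \<theta>) * ?k * Z M x \<le> ?k * Z M x - ?k * (3 * sqrt \<delta>) * X"
  proof -
    have "3 * sqrt \<delta> * X \<le> 3 * sqrt \<delta> * mass_cap"
      using three_halves_mass[OF xab(1) M(1)] \<delta> unfolding X_def by (intro mult_left_mono) auto
    also have "\<dots> = (12 * sqrt \<delta> * mass_cap * sqrt \<kappa>) * (1 / (4 * sqrt \<kappa>))" using sqrt\<kappa>(1) by simp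
    also have "\<dots> \<le> \<theta> * Z M x"
      using \<theta> Z_bounds(1)[OF xab(1) M(1)] sqrt\<kappa>(1) \<delta> mass_cap_pos order_trans[OF _ \<theta>, of 0]
      by (intro mult_mono) auto
    finally have "?k * (3 * sqrt \<delta> * X) \<le> ?k * (\<theta> * Z M x)" by (intro mult_left_mono) auto
    then show ?thesis by (simp add: algebra_simps)
  qed
  also have "\<dots> = integral {-M..M} (\<lambda>p. ?k * (exp (- (2 * Wx x p)) * Yx' x p) - ?k * (3 * sqrt \<delta>) * (exp (- (3 / 2 * Wx x p)) * Yx' x p))"
    unfolding Z_def X_def
    by (rule integral_unique[symmetric])
       (intro has_integral_diff has_integral_mult_right integrable_integral integrable_continuous_real continuous_intros px.cont)
  also have "\<dots> \<le> integral {-M..M} N"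
    by (intro integral_le integrable_continuous_real N_cont continuous_intros px.cont N_ge)
  finally have "ennreal ((1 - \<theta>) * ?k * Z M x) \<le> ennreal (integral {-M..M} N)" by (rule ennreal_leI)
  also have "\<dots> = (\<integral>\<^sup>+p. ennreal (N p) * indicator {-M..M} p \<partial>lborel)"
    by (rule nn_integral_continuous_interval[OF N_cont N0, symmetric])
  also have "\<dots> = (\<integral>\<^sup>+p. ennreal ((\<phi> \<delta> (x, Yx x p))\<^sup>2 * Yx' x p) * indicator {-M..M} p \<partial>lborel)"
    by (simp add: \<phi>_on_strip[OF xab(2)] N_def power_mult_distrib)
  also have "\<dots> = (\<integral>\<^sup>+y. ennreal ((\<phi> \<delta> (x, y))\<^sup>2) \<partial>lborel)"
  proof (rule nn_integral_section[OF xab(1) M(2), symmetric])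
    fix y assume "y \<notin> {Yx x (- M)..Yx x M}"
    then show "(\<phi> \<delta> (x, y))\<^sup>2 = 0" using section_zero[OF \<delta>(1) xab(1)] by (simp add: M_def)
  qed auto
  finally show ?thesis unfolding M_def .
qed

text \<open>
  Contribution of the bump in \<open>x\<close>. Its energy is at most
  \<open>w\<^sup>7 mass_cap / 2\<close> and its mass at least
  \<open>w\<^sup>9 / (1700 * 8 sqrt \<kappa>)\<close> with \<open>w = l / 3\<close>; the quotient is
  \<open>61200 mass_cap sqrt \<kappa> / l\<^sup>2\<close>, and the parenthesis is
  \<open>mass_cap * sqrt \<kappa>\<close>.
\<close>

definition bump_const :: real where "bump_const = 61200 * (2 * (R * sqrt \<kappa>) + 6)"

text \<open>
  Integrating the estimates for the sections over \<open>x\<close>. The mass on the right of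
  \<open>section_energy\<close> is that before the cutoff, hence the factor
  \<open>1 - \<theta>\<close>.
\<close>

lemma first_eigenvalue_le_up_to_loss:
  assumes \<theta>: "0 < \<theta>" "\<theta> \<le> 1/2"
  shows "(1 - \<theta>) * first_eigenvalue \<Omega> V \<le> m + (tilt_const + bump_const) / l\<^sup>2"
proof -
  \<comment> \<open>the cutoff height \<open>\<delta> = q\<^sup>2\<close> keeps the loss of mass below the fraction \<open>\<theta>\<close>\<close>
  define q where "q = \<theta> / (12 * mass_cap * sqrt \<kappa> + 1)"
  have den: "0 < 12 * mass_cap * sqrt \<kappa> + 1" using mass_cap_pos sqrt\<kappa>(1) by (simp add: add_nonneg_pos)
  have q: "0 < q" "q \<le> 1/2" "12 * q * mass_cap * sqrt \<kappa> \<le> \<theta>"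
  proof -
    show "0 < q" using \<theta> den by (simp add: q_def)
    have qd: "q * (12 * mass_cap * sqrt \<kappa> + 1) = \<theta>" using den by (simp add: q_def)
    have "q * 1 \<le> q * (12 * mass_cap * sqrt \<kappa> + 1)"
      using \<open>0 < q\<close> mass_cap_pos sqrt\<kappa>(1) by (intro mult_left_mono) auto
    then show "q \<le> 1/2" using qd \<theta> by simp
    show "12 * q * mass_cap * sqrt \<kappa> \<le> \<theta>" using qd \<open>0 < q\<close> by (simp add: algebra_simps)
  qed
  define \<delta> where "\<delta> = q\<^sup>2"
  have \<delta>: "0 < \<delta>" "\<delta> \<le> 1" "12 * sqrt \<delta> * mass_cap * sqrt \<kappa> \<le> \<theta>"
    using q by (auto simp: \<delta>_def power_le_one)
  define M where "M = sqrt \<kappa> / \<delta>"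
  have M: "sqrt \<kappa> \<le> M" using \<delta> sqrt\<kappa>(1) by (auto simp: M_def le_divide_eq)
  note t = \<phi>_test[OF \<delta>(1)]
  note [measurable] = test_function_measurable[OF t]
  let ?e = "\<lambda>z. ennreal ((norm (\<phi>' \<delta> z))\<^sup>2 + U z * (\<phi> \<delta> z)\<^sup>2)"
  let ?n = "\<lambda>z. ennreal ((\<phi> \<delta> z)\<^sup>2)"
  define N where "N x = (\<integral>\<^sup>+y. ?n (x, y) \<partial>lborel)" for x
  define lam where "lam = first_eigenvalue \<Omega> V"
  define m' where "m' = (m + tilt_const / l\<^sup>2) / (1 - \<theta>)"
  have m1: "1 \<le> m"
    using V_ge_1[OF mem(1)[of 0]] pa.Y'_pos[of 0] unfolding Va[of 0] by (simp add: zero_less_divide_1_iff)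
       (smt (verit) zero_less_divide_1_iff)
  have mc: "0 \<le> m + tilt_const / l\<^sup>2" using m1 pa.\<kappa>_pos by (simp add: tilt_const_def)
  have m'0: "0 \<le> m'" using mc \<theta> by (simp add: m'_def)
  have lam0: "0 \<le> lam" unfolding lam_def by (rule first_eigenvalue_nonneg)
  have w: "x2 - x1 = l / 3" by (rule x12(4))
  have zero_off: "\<phi> \<delta> (x, y) = 0 \<and> \<phi>' \<delta> (x, y) = 0" if "x \<notin> {x1..x2}" for x y
  proof -
    have "(x, y) \<notin> supp (sqrt \<kappa> / \<delta>)" using that by (auto simp: supp_def T_def)
    then show ?thesis using \<phi>_zero_outside[OF \<delta>(1)] by auto
  qed
  have dom_off: "\<phi> \<delta> z = 0 \<and> \<phi>' \<delta> z = 0" if "z \<notin> \<Omega>" for z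
    using that G_subset by (auto simp: \<phi>_def \<phi>'_def)
  have "(\<integral>\<^sup>+z\<in>\<Omega>. ?n z \<partial>lborel) = (\<integral>\<^sup>+z. ?n z \<partial>lborel)"
    by (intro nn_integral_cong) (use dom_off in \<open>auto simp: indicator_def\<close>)
  also have "\<dots> = (\<integral>\<^sup>+x. N x \<partial>lborel)" unfolding N_def by (rule nn_integral_plane) measurable
  finally have mass_eq: "(\<integral>\<^sup>+z\<in>\<Omega>. ?n z \<partial>lborel) = (\<integral>\<^sup>+x. N x \<partial>lborel)" .
  have Nm [measurable]: "N \<in> borel_measurable borel"
    unfolding N_def[abs_def] by (rule nn_integral_plane(2)) measurable
  have "(\<integral>\<^sup>+z\<in>\<Omega>. ennreal ((norm (\<phi>' \<delta> z))\<^sup>2 + V z * (\<phi> \<delta> z)\<^sup>2) \<partial>lborel) = (\<integral>\<^sup>+z. ?e z \<partial>lborel)"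
    by (intro nn_integral_cong) (use dom_off in \<open>auto simp: indicator_def U_def\<close>)
  also have "\<dots> = (\<integral>\<^sup>+x. \<integral>\<^sup>+y. ?e (x, y) \<partial>lborel \<partial>lborel)"
    by (rule nn_integral_plane) measurable
  also have "\<dots> \<le> (\<integral>\<^sup>+x. ennreal (2 * mass_cap) * ennreal ((bump' x1 x2 x)\<^sup>2) + ennreal m' * N x \<partial>lborel)"
  proof (rule nn_integral_mono)
    fix x
    show "(\<integral>\<^sup>+y. ?e (x, y) \<partial>lborel) \<le> ennreal (2 * mass_cap) * ennreal ((bump' x1 x2 x)\<^sup>2) + ennreal m' * N x"
    proof (cases "x \<in> {x1..x2}")
      case True
      have xab: "x \<in> {a..b}" using True x12 by auto
      have Z0: "0 \<le> Z M x" using Z_bounds(1)[OF xab M] sqrt\<kappa>(1) by (meson order_trans zero_le_divide_1_iff less_imp_le zero_le_mult_iff zero_le_numeral)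
      have "(\<integral>\<^sup>+y. ?e (x, y) \<partial>lborel) \<le> ennreal (2 * (bump' x1 x2 x)\<^sup>2 * mass_cap + (m + tilt_const / l\<^sup>2) * (bump x1 x2 x)\<^sup>2 * Z M x)"
        unfolding M_def by (rule section_energy[OF \<delta>(1,2) True])
      also have "\<dots> = ennreal (2 * mass_cap) * ennreal ((bump' x1 x2 x)\<^sup>2) + ennreal m' * ennreal ((1 - \<theta>) * (bump x1 x2 x)\<^sup>2 * Z M x)"
      proof -
        have "(m + tilt_const / l\<^sup>2) * (bump x1 x2 x)\<^sup>2 * Z M x = m' * ((1 - \<theta>) * (bump x1 x2 x)\<^sup>2 * Z M x)"
          using \<theta> by (simp add: m'_def)
        moreover have "2 * (bump' x1 x2 x)\<^sup>2 * mass_cap = (2 * mass_cap) * (bump' x1 x2 x)\<^sup>2" by simp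
        ultimately show ?thesis using mass_cap_pos m'0 Z0 \<theta>
          by (subst ennreal_mult[symmetric], simp, simp, subst ennreal_mult[symmetric], simp, simp,
              subst ennreal_plus[symmetric]) (auto simp del: ennreal_plus)
      qed
      also have "\<dots> \<le> ennreal (2 * mass_cap) * ennreal ((bump' x1 x2 x)\<^sup>2) + ennreal m' * N x"
        using section_mass[OF \<delta>(1,2) True \<delta>(3)] unfolding N_def M_def by (intro add_left_mono mult_left_mono) auto
      finally show ?thesis .
    next
      case False
      then have "(\<integral>\<^sup>+y. ?e (x, y) \<partial>lborel) = 0" using zero_off by simp
      then show ?thesis by simp
    qed
  qed
  also have "\<dots> = ennreal (2 * mass_cap) * (\<integral>\<^sup>+x. ennreal ((bump' x1 x2 x)\<^sup>2) \<partial>lborel) + ennreal m' * (\<integral>\<^sup>+x. N x \<partial>lborel)"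
  proof -
    have [measurable]: "bump' x1 x2 \<in> borel_measurable borel"
      by (rule borel_measurable_continuous_onI[OF bump_continuous(2)])
    show ?thesis by (subst nn_integral_add) (auto simp: nn_integral_cmult)
  qed
  also have "\<dots> \<le> ennreal (2 * mass_cap) * ennreal ((l / 3) ^ 7 / 4) + ennreal m' * (\<integral>\<^sup>+x. N x \<partial>lborel)"
    using bump_integrals(1)[OF x12(2)] unfolding w by (intro add_right_mono mult_left_mono) auto
  also have "ennreal (2 * mass_cap) * ennreal ((l / 3) ^ 7 / 4) = ennreal (2 * mass_cap * ((l / 3) ^ 7 / 4))"
    by (rule ennreal_mult[symmetric]) (use mass_cap_pos l_pos in auto)
  finally have E: "(\<integral>\<^sup>+z\<in>\<Omega>. ennreal ((norm (\<phi>' \<delta> z))\<^sup>2 + V z * (\<phi> \<delta> z)\<^sup>2) \<partial>lborel) \<le>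
     ennreal (2 * mass_cap * ((l / 3) ^ 7 / 4)) + ennreal m' * (\<integral>\<^sup>+x. N x \<partial>lborel)" .
  have fin: "(\<integral>\<^sup>+x. N x \<partial>lborel) = ennreal (mass (\<phi> \<delta>) (\<phi> \<delta>))"
    using nn_energy(2)[OF t] mass_eq by simp
  define N0 where "N0 = mass (\<phi> \<delta>) (\<phi> \<delta>)"
  have "ennreal (lam * N0) = ennreal lam * ennreal N0"
    using lam0 mass_nonneg[of "\<phi> \<delta>"] unfolding N0_def by (rule ennreal_mult)
  also have "\<dots> \<le> ennreal (2 * mass_cap * ((l / 3) ^ 7 / 4)) + ennreal m' * ennreal N0"
    using first_eigenvalue_mass_le_energy[OF t] E unfolding mass_eq fin N0_def lam_def by (rule order_trans)
  also have "\<dots> = ennreal (2 * mass_cap * ((l / 3) ^ 7 / 4) + m' * N0)"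
    using mass_cap_pos l_pos m'0 mass_nonneg[of "\<phi> \<delta>"] by (simp add: N0_def ennreal_mult ennreal_plus)
  finally have "ennreal (lam * N0) \<le> ennreal (2 * mass_cap * ((l / 3) ^ 7 / 4) + m' * N0)" .
  moreover have "0 \<le> 2 * mass_cap * ((l / 3) ^ 7 / 4) + m' * N0"
    using mass_cap_pos l_pos m'0 mass_nonneg[of "\<phi> \<delta>"] by (simp add: N0_def)
  ultimately have main: "lam * N0 \<le> 2 * mass_cap * ((l / 3) ^ 7 / 4) + m' * N0" by (simp only: ennreal_le_iff)
  \<comment> \<open>half of the lower bound for the mass of a section, since \<open>1 - \<theta> \<ge> 1/2\<close>\<close>
  define z0 where "z0 = 1 / (8 * sqrt \<kappa>)"
  have z0: "0 < z0" using sqrt\<kappa>(1) by (simp add: z0_def)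
  have "ennreal (z0 * ((l / 3) ^ 9 / 1700)) \<le> ennreal N0"
  proof -
    have "ennreal (z0 * ((l / 3) ^ 9 / 1700)) = ennreal z0 * ennreal ((l / 3) ^ 9 / 1700)"
      by (rule ennreal_mult) (use z0 l_pos in auto)
    also have "\<dots> \<le> ennreal z0 * (\<integral>\<^sup>+x. ennreal ((bump x1 x2 x)\<^sup>2) \<partial>lborel)"
      using bump_integrals(2)[OF x12(2)] unfolding w by (intro mult_left_mono) auto
    also have "\<dots> = (\<integral>\<^sup>+x. ennreal z0 * ennreal ((bump x1 x2 x)\<^sup>2) \<partial>lborel)"
    proof -
      have [measurable]: "bump x1 x2 \<in> borel_measurable borel"
        by (rule borel_measurable_continuous_onI[OF bump_continuous(1)])
      show ?thesis by (simp add: nn_integral_cmult)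
    qed
    also have "\<dots> \<le> (\<integral>\<^sup>+x. N x \<partial>lborel)"
    proof (rule nn_integral_mono)
      fix x
      show "ennreal z0 * ennreal ((bump x1 x2 x)\<^sup>2) \<le> N x"
      proof (cases "x \<in> {x1..x2}")
        case True
        have xab: "x \<in> {a..b}" using True x12 by auto
        have "z0 \<le> (1 - \<theta>) * Z M x"
        proof -
          have "z0 = 1/2 * (1 / (4 * sqrt \<kappa>))" by (simp add: z0_def)
          also have "\<dots> \<le> (1 - \<theta>) * Z M x" using \<theta> Z_bounds(1)[OF xab M] sqrt\<kappa>(1) by (intro mult_mono) auto
          finally show ?thesis .
        qed
        then have "z0 * (bump x1 x2 x)\<^sup>2 \<le> (1 - \<theta>) * (bump x1 x2 x)\<^sup>2 * Z M x"
          using mult_right_mono[of z0 "(1 - \<theta>) * Z M x" "(bump x1 x2 x)\<^sup>2"] by (simp add: ac_simps)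
        then have "ennreal (z0 * (bump x1 x2 x)\<^sup>2) \<le> N x"
          using section_mass[OF \<delta>(1,2) True \<delta>(3)] unfolding N_def M_def by (meson ennreal_leI order_trans)
        then show ?thesis using z0 by (simp add: ennreal_mult)
      next
        case False
        then have "bump x1 x2 x = 0" using x12 by (intro bump_zero) auto
        then show ?thesis by simp
      qed
    qed
    finally show ?thesis unfolding fin N0_def .
  qed
  then have N0: "z0 * ((l / 3) ^ 9 / 1700) \<le> N0"
    using mass_nonneg[of "\<phi> \<delta>"] by (simp add: N0_def ennreal_le_iff)
  have "0 < z0 * ((l / 3) ^ 9 / 1700)" using z0 l_pos by simp
  with N0 have N0pos: "0 < N0" by linarith
  \<comment> \<open>the quotient of the energy of the bump and the lower bound for the mass\<close>
  define J where "J = 2 * mass_cap * 8 * sqrt \<kappa> * 425 * 9 / l\<^sup>2"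
  have J0: "0 \<le> J" using mass_cap_pos sqrt\<kappa>(1) by (simp add: J_def)
  have "2 * mass_cap * ((l / 3) ^ 7 / 4) = J * (z0 * ((l / 3) ^ 9 / 1700))"
    using l_pos sqrt\<kappa>(1) by (simp add: J_def z0_def field_simps eval_nat_numeral)
  also have "\<dots> \<le> J * N0" using N0 J0 by (rule mult_left_mono)
  finally have "lam * N0 \<le> (J + m') * N0" using main by (simp add: distrib_right)
  then have "lam \<le> J + m'" using N0pos by simp
  then have "(1 - \<theta>) * lam \<le> (1 - \<theta>) * (J + m')" using \<theta> by (intro mult_left_mono) auto
  also have "\<dots> = (1 - \<theta>) * J + (m + tilt_const / l\<^sup>2)"
  proof -
    have "1 - \<theta> \<noteq> 0" using \<theta> by simp
    then have "(1 - \<theta>) * m' = m + tilt_const / l\<^sup>2"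
      unfolding m'_def times_divide_eq_right by (rule nonzero_mult_div_cancel_left)
    then show ?thesis by (simp add: distrib_left)
  qed
  also have "\<dots> \<le> J + (m + tilt_const / l\<^sup>2)" using \<theta> J0 mult_right_mono[of "1 - \<theta>" 1 J] by simp
  also have "J \<le> bump_const / l\<^sup>2"
  proof -
    have "mass_cap * sqrt \<kappa> = 2 * (R * sqrt \<kappa>) + 6" using sqrt\<kappa>(1) by (simp add: mass_cap_def field_simps)
    then have "J = 61200 * (2 * (R * sqrt \<kappa>) + 6) / l\<^sup>2" by (simp add: J_def)
    then show ?thesis unfolding bump_const_def by simp
  qed
  finally show ?thesis unfolding lam_def by (simp add: add_divide_distrib)
qed

text \<open>
  The loss \<open>\<theta>\<close> caused by the cutoff is arbitrary and tends to zero.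
\<close>

theorem first_eigenvalue_le: "first_eigenvalue \<Omega> V \<le> m + (tilt_const + bump_const) / l\<^sup>2"
proof (rule field_le_epsilon)
  fix e :: real assume e: "0 < e"
  define lam where "lam = first_eigenvalue \<Omega> V"
  have lam0: "0 \<le> lam" unfolding lam_def by (rule first_eigenvalue_nonneg)
  define \<theta> where "\<theta> = min (1/2) (e / (lam + 1))"
  have \<theta>: "0 < \<theta>" using e lam0 by (auto simp: \<theta>_def)
  have \<theta>2: "\<theta> \<le> 1/2" unfolding \<theta>_def by (rule min.cobounded1)
  have "\<theta> * lam \<le> (e / (lam + 1)) * (lam + 1)"
    using lam0 e by (intro mult_mono) (auto simp: \<theta>_def)
  also have "\<dots> = e" using lam0 by simp
  finally show "first_eigenvalue \<Omega> V \<le> m + (tilt_const + bump_const) / l\<^sup>2 + e"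
    using first_eigenvalue_le_up_to_loss[OF \<theta> \<theta>2] unfolding lam_def[symmetric] by (simp add: algebra_simps)
qed

end

section \<open>The effective potential\<close>

lemma test_function_section_snd:
  fixes \<Omega> :: "(real \<times> real) set"
  assumes t: "test_function \<Omega> \<phi> \<phi>'"
  shows "test_function (cross_section \<Omega> x) (\<lambda>y. \<phi> (x, y)) (\<lambda>y. snd (\<phi>' (x, y)))"
proof -
  obtain K where K: "compact K" "K \<subseteq> \<Omega>" "\<And>x. x \<notin> K \<Longrightarrow> \<phi> x = 0" "\<And>x. x \<notin> K \<Longrightarrow> \<phi>' x = 0"
    using test_functionE[OF t] by blast
  have "((\<lambda>y. \<phi> (x, y)) has_derivative (\<lambda>h. h \<bullet> snd (\<phi>' (x, y)))) (at y)" for y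
  proof -
    have "((\<lambda>y. (x, y)) has_derivative (\<lambda>h. (0, h))) (at y)" by (auto intro!: derivative_eq_intros)
    moreover have "(\<phi> has_derivative (\<lambda>h. h \<bullet> \<phi>' (x, y))) (at (x, y))"
      using t by (auto simp: test_function_def gderiv_def)
    ultimately show ?thesis by (auto dest: has_derivative_compose simp: inner_prod_def)
  qed
  moreover have "continuous_on UNIV (\<lambda>y. snd (\<phi>' (x, y)))"
    by (intro continuous_on_snd continuous_on_compose2[OF test_function_continuous(2)[OF t]] continuous_intros) auto
  moreover have "compact (snd ` (K \<inter> {x} \<times> UNIV))"
    using K(1) by (intro compact_continuous_image continuous_intros compact_Int_closed closed_Times) auto
  moreover have "snd ` (K \<inter> {x} \<times> UNIV) \<subseteq> cross_section \<Omega> x" using K(2) by (auto simp: cross_section_def)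
  moreover have "\<phi> (x, y) = 0" if "y \<notin> snd ` (K \<inter> {x} \<times> UNIV)" for y
    using that K(3)[of "(x, y)"] by force
  ultimately show ?thesis unfolding test_function_def gderiv_def by blast
qed

lemma test_function_section_fst:
  fixes \<Omega> :: "(real \<times> real) set"
  assumes t: "test_function \<Omega> \<phi> \<phi>'"
  shows "test_function (fst ` \<Omega>) (\<lambda>x. \<phi> (x, y)) (\<lambda>x. fst (\<phi>' (x, y)))"
proof -
  obtain K where K: "compact K" "K \<subseteq> \<Omega>" "\<And>x. x \<notin> K \<Longrightarrow> \<phi> x = 0" "\<And>x. x \<notin> K \<Longrightarrow> \<phi>' x = 0"
    using test_functionE[OF t] by blast
  have "((\<lambda>x. \<phi> (x, y)) has_derivative (\<lambda>h. h \<bullet> fst (\<phi>' (x, y)))) (at x)" for x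
  proof -
    have "((\<lambda>x. (x, y)) has_derivative (\<lambda>h. (h, 0))) (at x)" by (auto intro!: derivative_eq_intros)
    moreover have "(\<phi> has_derivative (\<lambda>h. h \<bullet> \<phi>' (x, y))) (at (x, y))"
      using t by (auto simp: test_function_def gderiv_def)
    ultimately show ?thesis by (auto dest: has_derivative_compose simp: inner_prod_def)
  qed
  moreover have "continuous_on UNIV (\<lambda>x. fst (\<phi>' (x, y)))"
    by (intro continuous_on_fst continuous_on_compose2[OF test_function_continuous(2)[OF t]] continuous_intros) auto
  moreover have "compact (fst ` K)"
    using K(1) by (intro compact_continuous_image continuous_intros) auto
  moreover have "fst ` K \<subseteq> fst ` \<Omega>" using K(2) by auto
  moreover have "\<phi> (x, y) = 0" if "x \<notin> fst ` K" for x
    using that K(3)[of "(x, y)"] by force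
  ultimately show ?thesis unfolding test_function_def gderiv_def by blast
qed

context convex_well
begin

abbreviation I where "I \<equiv> fst ` \<Omega>"
definition mu :: "real \<Rightarrow> real" where "mu x = mu_cross \<Omega> V x"

lemma mu_cross_eq: "mu_cross \<Omega> V = mu" by (simp add: mu_def fun_eq_iff)

lemma cross_section_convex: "convex (cross_section \<Omega> x)"
proof (rule convexI)
  fix u v r s :: real assume *: "u \<in> cross_section \<Omega> x" "v \<in> cross_section \<Omega> x" "0 \<le> r" "0 \<le> s" "r + s = 1"
  then have "r *\<^sub>R (x, u) + s *\<^sub>R (x, v) \<in> \<Omega>" by (intro convexD[OF dom(3)]) (auto simp: cross_section_def)
  moreover have "r *\<^sub>R (x, u) + s *\<^sub>R (x, v) = (x, r *\<^sub>R u + s *\<^sub>R v)"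
    using *(5) by (simp add: distrib_right[symmetric])
  ultimately show "r *\<^sub>R u + s *\<^sub>R v \<in> cross_section \<Omega> x" by (simp add: cross_section_def)
qed

lemma cross_section_open: "open (cross_section \<Omega> x)"
proof -
  have "cross_section \<Omega> x = (\<lambda>y. (x, y)) -` \<Omega>" by (auto simp: cross_section_def)
  then show ?thesis using dom(1) by (auto intro!: open_vimage continuous_intros)
qed

lemma V_section_convex: "convex_on (cross_section \<Omega> x) (\<lambda>y. V (x, y))"
proof (rule convex_onI)
  fix s u v :: real assume *: "0 < s" "s < 1" "u \<in> cross_section \<Omega> x" "v \<in> cross_section \<Omega> x"
  have "V ((1 - s) *\<^sub>R (x, u) + s *\<^sub>R (x, v)) \<le> (1 - s) * V (x, u) + s * V (x, v)"
    using * by (intro V_convex) (auto simp: cross_section_def)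
  moreover have "(1 - s) *\<^sub>R (x, u) + s *\<^sub>R (x, v) = (x, (1 - s) *\<^sub>R u + s *\<^sub>R v)" by (simp add: algebra_simps)
  ultimately show "V (x, (1 - s) *\<^sub>R u + s *\<^sub>R v) \<le> (1 - s) * V (x, u) + s * V (x, v)" by simp
qed (rule cross_section_convex)

lemma cross_form:
  assumes "x \<in> I"
  shows "dirichlet_form (cross_section \<Omega> x) (\<lambda>y. V (x, y))"
proof
  show "open (cross_section \<Omega> x)" by (rule cross_section_open)
  show "bounded (cross_section \<Omega> x)"
    using bounded_snd[OF dom(2)] by (rule bounded_subset) (force simp: cross_section_def)
  show "cross_section \<Omega> x \<noteq> {}" using assms by (auto simp: cross_section_def)
  show "0 \<le> V (x, y)" if "y \<in> cross_section \<Omega> x" for y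
    using that V_ge_1[of "(x, y)"] by (simp add: cross_section_def)
  have c: "continuous_on (cross_section \<Omega> x) (\<lambda>y. V (x, y))"
    by (rule convex_on_continuous[OF cross_section_open V_section_convex])
  then show "(\<lambda>y. indicator (cross_section \<Omega> x) y * V (x, y)) \<in> borel_measurable borel"
    using borel_measurable_continuous_on_indicator[OF _ c] cross_section_open by simp
  show "\<exists>c. \<forall>y\<in>K. V (x, y) \<le> c" if K: "compact K" "K \<subseteq> cross_section \<Omega> x" for K
  proof -
    have "bounded ((\<lambda>y. V (x, y)) ` K)"
      using K by (intro compact_imp_bounded compact_continuous_image continuous_on_subset[OF c])
    then obtain c where "\<forall>y\<in>(\<lambda>y. V (x, y)) ` K. norm y \<le> c" using bounded_iff by blast
    then show ?thesis by (intro exI[of _ c]) auto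
  qed
qed

lemma mu_first_eigenvalue: "mu x = first_eigenvalue (cross_section \<Omega> x) (\<lambda>y. V (x, y))"
  by (simp add: mu_def mu_cross_def)

lemma mu_ge_1: assumes "x \<in> I" shows "1 \<le> mu x"
proof -
  interpret f: dirichlet_form "cross_section \<Omega> x" "\<lambda>y. V (x, y)" by (rule cross_form[OF assms])
  show ?thesis unfolding mu_first_eigenvalue
  proof (rule f.le_first_eigenvalue)
    fix \<phi> \<phi>' assume "test_function (cross_section \<Omega> x) \<phi> \<phi>'"
    show "ennreal 1 * (\<integral>\<^sup>+y\<in>cross_section \<Omega> x. ennreal ((\<phi> y)\<^sup>2) \<partial>lborel) \<le>
      (\<integral>\<^sup>+y\<in>cross_section \<Omega> x. ennreal ((norm (\<phi>' y))\<^sup>2 + V (x, y) * (\<phi> y)\<^sup>2) \<partial>lborel)"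
      unfolding ennreal_1 mult_1_left
    proof (rule nn_integral_mono)
      fix y
      show "ennreal ((\<phi> y)\<^sup>2) * indicator (cross_section \<Omega> x) y \<le>
         ennreal ((norm (\<phi>' y))\<^sup>2 + V (x, y) * (\<phi> y)\<^sup>2) * indicator (cross_section \<Omega> x) y"
      proof (cases "y \<in> cross_section \<Omega> x")
        case True
        then have "1 * (\<phi> y)\<^sup>2 \<le> V (x, y) * (\<phi> y)\<^sup>2"
          using V_ge_1[of "(x, y)"] by (intro mult_right_mono) (auto simp: cross_section_def)
        then show ?thesis using True zero_le_power2[of "norm (\<phi>' y)"] by (auto intro!: ennreal_leI add_increasing)
      qed simp
    qed
  qed
qed

lemma mu_less_witness:
  assumes x: "x \<in> I" and c: "mu x < c"
  shows "\<exists>\<phi> \<phi>'. test_function (cross_section \<Omega> x) \<phi> \<phi>' \<and>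
    (\<integral>\<^sup>+y\<in>cross_section \<Omega> x. ennreal ((norm (\<phi>' y))\<^sup>2 + V (x, y) * (\<phi> y)\<^sup>2) \<partial>lborel) <
      ennreal c * (\<integral>\<^sup>+y\<in>cross_section \<Omega> x. ennreal ((\<phi> y)\<^sup>2) \<partial>lborel)"
proof (rule ccontr)
  interpret f: dirichlet_form "cross_section \<Omega> x" "\<lambda>y. V (x, y)" by (rule cross_form[OF x])
  assume "\<not> ?thesis"
  then have "c \<le> first_eigenvalue (cross_section \<Omega> x) (\<lambda>y. V (x, y))"
    by (intro f.le_first_eigenvalue) (meson not_le)
  then show False using c by (simp add: mu_first_eigenvalue)
qed

text \<open>
  A test function on the section at \<open>x0\<close> with Rayleigh quotient below \<open>c\<close>
  has compact support, so it is a test function on all nearby sections, and its Rayleigh quotient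
  varies continuously there.
\<close>

lemma mu_upper_semicontinuous:
  assumes x0: "x0 \<in> I" and c: "mu x0 < c"
  shows "\<exists>e>0. \<forall>x. \<bar>x - x0\<bar> < e \<longrightarrow> x \<in> I \<and> mu x < c"
proof -
  interpret f0: dirichlet_form "cross_section \<Omega> x0" "\<lambda>y. V (x0, y)" by (rule cross_form[OF x0])
  obtain \<phi> \<phi>' where t: "test_function (cross_section \<Omega> x0) \<phi> \<phi>'"
    and small: "(\<integral>\<^sup>+y\<in>cross_section \<Omega> x0. ennreal ((norm (\<phi>' y))\<^sup>2 + V (x0, y) * (\<phi> y)\<^sup>2) \<partial>lborel) <
      ennreal c * (\<integral>\<^sup>+y\<in>cross_section \<Omega> x0. ennreal ((\<phi> y)\<^sup>2) \<partial>lborel)"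
    using mu_less_witness[OF x0 c] by blast
  have c1: "1 < c" using mu_ge_1[OF x0] c by linarith
  obtain K where K: "compact K" "K \<subseteq> cross_section \<Omega> x0" "\<And>y. y \<notin> K \<Longrightarrow> \<phi> y = 0" "\<And>y. y \<notin> K \<Longrightarrow> \<phi>' y = 0"
    using test_functionE[OF t] by blast
  define N where "N = f0.mass \<phi> \<phi>"
  define E where "E = f0.energy \<phi> \<phi>' \<phi> \<phi>'"
  have N: "(\<integral>\<^sup>+y\<in>cross_section \<Omega> x0. ennreal ((\<phi> y)\<^sup>2) \<partial>lborel) = ennreal N" "0 \<le> N"
    unfolding N_def by (rule f0.nn_energy(2)[OF t], rule f0.mass_nonneg)
  have E: "(\<integral>\<^sup>+y\<in>cross_section \<Omega> x0. ennreal ((norm (\<phi>' y))\<^sup>2 + V (x0, y) * (\<phi> y)\<^sup>2) \<partial>lborel) = ennreal E" "0 \<le> E"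
    unfolding E_def by (rule f0.nn_energy(1)[OF t], rule f0.energy_nonneg)
  have EN: "E < c * N" using small c1 N E by (simp add: ennreal_mult[symmetric] ennreal_less_iff)
  then have Npos: "0 < N" using E(2) N(2) by (cases "N = 0") auto
  \<comment> \<open>half of the margin by which the Rayleigh quotient stays below \<open>c\<close>\<close>
  define \<eta> where "\<eta> = (c * N - E) / (2 * N)"
  have \<eta>: "0 < \<eta>" "E + \<eta> * N < c * N" using EN Npos by (auto simp: \<eta>_def field_simps)
  have "compact ({x0} \<times> K)" using K(1) by (intro compact_Times) auto
  moreover have "{x0} \<times> K \<subseteq> \<Omega>" using K(2) by (auto simp: cross_section_def)
  ultimately obtain r where r: "0 < r" "(\<Union>z\<in>{x0} \<times> K. cball z r) \<subseteq> \<Omega>"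
    using compact_subset_open_imp_cball_epsilon_subset[OF _ dom(1)] by blast
  have box: "{x0 - r..x0 + r} \<times> K \<subseteq> \<Omega>"
  proof
    fix z assume "z \<in> {x0 - r..x0 + r} \<times> K"
    then obtain x y where z: "z = (x, y)" "\<bar>x - x0\<bar> \<le> r" "y \<in> K" by (auto simp: abs_le_iff)
    then have "z \<in> cball (x0, y) r" by (simp add: dist_Pair_Pair dist_real_def)
    then show "z \<in> \<Omega>" using r(2) z(3) by blast
  qed
  have "uniformly_continuous_on ({x0 - r..x0 + r} \<times> K) V"
    by (intro compact_uniformly_continuous continuous_on_subset[OF V_continuous box] compact_Times K) auto
  then obtain d where d: "0 < d" "\<And>z z'. z \<in> {x0 - r..x0 + r} \<times> K \<Longrightarrow> z' \<in> {x0 - r..x0 + r} \<times> K \<Longrightarrow>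
      dist z' z < d \<Longrightarrow> dist (V z') (V z) < \<eta>"
    unfolding uniformly_continuous_on_def using \<eta>(1) by metis
  have "x \<in> I \<and> mu x < c" if x: "\<bar>x - x0\<bar> < min r d" for x
  proof -
    have near: "V (x, y) \<le> V (x0, y) + \<eta>" if "y \<in> K" for y
    proof -
      have "dist (V (x, y)) (V (x0, y)) < \<eta>"
        by (rule d(2)) (use that x r(1) in \<open>auto simp: dist_Pair_Pair dist_real_def abs_less_iff\<close>)
      then show ?thesis by (simp add: dist_real_def abs_less_iff)
    qed
    have "x \<in> {x0 - r..x0 + r}" using x by (auto simp: abs_less_iff)
    then have Kx: "K \<subseteq> cross_section \<Omega> x" using box by (auto simp: cross_section_def)
    have "K \<noteq> {}"
    proof
      assume "K = {}"
      then have "\<phi> = (\<lambda>y. 0)" using K(3) by auto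
      then show False using Npos by (simp add: N_def f0.mass_def)
    qed
    then have xI: "x \<in> I" using Kx by (force simp: cross_section_def)
    interpret f: dirichlet_form "cross_section \<Omega> x" "\<lambda>y. V (x, y)" by (rule cross_form[OF xI])
    have tx: "test_function (cross_section \<Omega> x) \<phi> \<phi>'"
      using t K(1,3) Kx unfolding test_function_def by blast
    have m: "f.mass \<phi> \<phi> = N" by (simp add: f.mass_def N_def f0.mass_def)
    have "f.energy \<phi> \<phi>' \<phi> \<phi>' \<le> E + \<eta> * N"
    proof -
      have "f.energy \<phi> \<phi>' \<phi> \<phi>' \<le> (LINT y|lborel. (\<phi>' y \<bullet> \<phi>' y + f0.U y * \<phi> y * \<phi> y) + \<eta> * (\<phi> y * \<phi> y))"
        unfolding f.energy_def
      proof (rule integral_mono)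
        show "integrable lborel (\<lambda>y. \<phi>' y \<bullet> \<phi>' y + f.U y * \<phi> y * \<phi> y)" by (rule f.energy_integrable[OF tx tx])
        show "integrable lborel (\<lambda>y. \<phi>' y \<bullet> \<phi>' y + f0.U y * \<phi> y * \<phi> y + \<eta> * (\<phi> y * \<phi> y))"
          by (intro Bochner_Integration.integrable_add Bochner_Integration.integrable_mult_right
              f0.test_integrable[OF t t])
        fix y
        show "\<phi>' y \<bullet> \<phi>' y + f.U y * \<phi> y * \<phi> y \<le> \<phi>' y \<bullet> \<phi>' y + f0.U y * \<phi> y * \<phi> y + \<eta> * (\<phi> y * \<phi> y)"
        proof (cases "y \<in> K")
          case True
          then have "y \<in> cross_section \<Omega> x" "y \<in> cross_section \<Omega> x0" using K(2) Kx by blast+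
          then have "f.U y \<le> f0.U y + \<eta>" using near[OF True] by (simp add: f.U_def f0.U_def)
          from mult_right_mono[OF this, of "\<phi> y * \<phi> y"] show ?thesis by (simp add: algebra_simps)
        qed (simp add: K)
      qed
      also have "\<dots> = E + \<eta> * N"
        unfolding E_def N_def f0.energy_def f0.mass_def
        using f0.energy_integrable[OF t t] f0.test_integrable(1)[OF t t]
        by (subst Bochner_Integration.integral_add) auto
      finally show ?thesis .
    qed
    then have "f.energy \<phi> \<phi>' \<phi> \<phi>' < c * N" using \<eta>(2) by linarith
    moreover have "mu x * N \<le> f.energy \<phi> \<phi>' \<phi> \<phi>'"
      using f.rayleigh_le[OF tx] unfolding mu_first_eigenvalue f.first_eigenvalue_eq_rayleigh m .
    ultimately have "mu x * N < c * N" by linarith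
    with xI Npos show ?thesis by simp
  qed
  then show ?thesis using r(1) d(1) by (intro exI[of _ "min r d"]) auto
qed

lemma mu_sublevel_open: "open {x \<in> I. mu x < c}"
  unfolding open_dist dist_real_def
proof
  fix x assume "x \<in> {x \<in> I. mu x < c}"
  then obtain e where "0 < e" "\<And>x'. \<bar>x' - x\<bar> < e \<Longrightarrow> x' \<in> I \<and> mu x' < c" using mu_upper_semicontinuous[of x c] by blast
  then show "\<exists>e>0. \<forall>y. \<bar>y - x\<bar> < e \<longrightarrow> y \<in> {x \<in> I. mu x < c}" by (intro exI[of _ e]) auto
qed

text \<open>
  Upper semicontinuity makes \<open>mu\<close> Borel measurable and locally bounded.
\<close>

lemma profile_form: "dirichlet_form I mu"
proof
  show "open I" using dom(1) by (rule open_image_fst)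
  show "bounded I" using dom(2) by (rule bounded_fst)
  show "I \<noteq> {}" using dom(4) by simp
  show "0 \<le> mu x" if "x \<in> I" for x using mu_ge_1[OF that] by simp
  show "(\<lambda>x. indicator I x * mu x) \<in> borel_measurable borel"
    unfolding borel_measurable_iff_less
  proof
    fix c :: real
    have "{w \<in> space borel. indicator I w * mu w < c} = {x \<in> I. mu x < c} \<union> (if 0 < c then - I else {})"
      by (auto simp: indicator_def)
    moreover have "open I" using dom(1) by (rule open_image_fst)
    ultimately show "{w \<in> space borel. indicator I w * mu w < c} \<in> sets borel"
      using mu_sublevel_open[of c] by auto
  qed
  show "\<exists>c. \<forall>x\<in>K. mu x \<le> c" if K: "compact K" "K \<subseteq> I" for K
  proof -
    have "K \<subseteq> (\<Union>n\<in>(UNIV::nat set). {x \<in> I. mu x < real n})"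
    proof
      fix x assume "x \<in> K"
      obtain n where "mu x < real n" using reals_Archimedean2 by blast
      with \<open>x \<in> K\<close> K(2) show "x \<in> (\<Union>n\<in>(UNIV::nat set). {x \<in> I. mu x < real n})" by auto
    qed
    from compactE_image[OF K(1) mu_sublevel_open this]
    obtain C where C: "C \<subseteq> UNIV" "finite (C::nat set)" "K \<subseteq> (\<Union>n\<in>C. {x \<in> I. mu x < real n})" .
    have "mu x \<le> real (Max C)" if xK: "x \<in> K" for x
    proof -
      obtain n where n: "n \<in> C" "mu x < real n" using C(3) xK by auto
      then have "real n \<le> real (Max C)" using C(2) by simp
      with n show ?thesis by linarith
    qed
    then show ?thesis by blast
  qed
qed

definition mu1 :: real where "mu1 = first_eigenvalue I mu"

text \<open>
  Separation of variables. Restricting a test function to horizontal lines and bounding its energy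
  with potential \<open>mu\<close> from below by \<open>mu1\<close>, then to vertical lines and
  bounding \<open>mu\<close> times the mass from above by the remaining energy, gives the estimate
  for the Rayleigh quotient.
\<close>

theorem mu1_le_first_eigenvalue: "mu1 \<le> first_eigenvalue \<Omega> V"
proof (rule le_first_eigenvalue)
  interpret f: dirichlet_form I mu by (rule profile_form)
  fix \<phi> \<phi>' assume t: "test_function \<Omega> \<phi> \<phi>'"
  note [measurable] = test_function_measurable[OF t]
  have [measurable]: "(\<lambda>z. fst (\<phi>' z)) \<in> borel_measurable borel" "(\<lambda>z. snd (\<phi>' z)) \<in> borel_measurable borel"
    by (intro borel_measurable_continuous_onI continuous_intros test_function_continuous[OF t])+
  obtain K where K: "compact K" "K \<subseteq> \<Omega>" "\<And>x. x \<notin> K \<Longrightarrow> \<phi> x = 0" "\<And>x. x \<notin> K \<Longrightarrow> \<phi>' x = 0"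
    using test_functionE[OF t] by blast
  have off: "z \<notin> \<Omega> \<Longrightarrow> \<phi> z = 0" "z \<notin> \<Omega> \<Longrightarrow> \<phi>' z = 0" for z using K(2,3,4) by blast+
  have offx: "x \<notin> I \<Longrightarrow> \<phi> (x, y) = 0" "x \<notin> I \<Longrightarrow> \<phi>' (x, y) = 0" for x y using off[of "(x, y)"] by force+
  have plane: "(\<integral>\<^sup>+z. g z \<partial>lborel) = (\<integral>\<^sup>+x. \<integral>\<^sup>+y. g (x, y) \<partial>lborel \<partial>lborel)"
    if "g \<in> borel_measurable borel" for g :: "real \<times> real \<Rightarrow> ennreal"
    using that by (rule nn_integral_plane)
  have "ennreal mu1 * (\<integral>\<^sup>+z\<in>\<Omega>. ennreal ((\<phi> z)\<^sup>2) \<partial>lborel) = ennreal mu1 * (\<integral>\<^sup>+z. ennreal ((\<phi> z)\<^sup>2) \<partial>lborel)"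
    by (intro arg_cong2[where f="(*)"] refl nn_integral_cong) (use off in \<open>auto simp: indicator_def\<close>)
  also have "\<dots> = ennreal mu1 * (\<integral>\<^sup>+x. \<integral>\<^sup>+y. ennreal ((\<phi> (x, y))\<^sup>2) \<partial>lborel \<partial>lborel)"
    by (subst plane) auto
  also have "\<dots> = ennreal mu1 * (\<integral>\<^sup>+y. \<integral>\<^sup>+x. ennreal ((\<phi> (x, y))\<^sup>2) \<partial>lborel \<partial>lborel)"
    by (subst lborel_pair.Fubini') (auto simp: borel_prod[symmetric])
  also have "\<dots> = (\<integral>\<^sup>+y. ennreal mu1 * (\<integral>\<^sup>+x. ennreal ((\<phi> (x, y))\<^sup>2) \<partial>lborel) \<partial>lborel)"
    by (rule nn_integral_cmult[symmetric]) measurable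
  also have "\<dots> \<le> (\<integral>\<^sup>+y. \<integral>\<^sup>+x. ennreal ((fst (\<phi>' (x, y)))\<^sup>2 + f.U x * (\<phi> (x, y))\<^sup>2) \<partial>lborel \<partial>lborel)"
  proof (rule nn_integral_mono)
    fix y
    have "ennreal mu1 * (\<integral>\<^sup>+x\<in>I. ennreal ((\<phi> (x, y))\<^sup>2) \<partial>lborel) \<le>
       (\<integral>\<^sup>+x\<in>I. ennreal ((norm (fst (\<phi>' (x, y))))\<^sup>2 + mu x * (\<phi> (x, y))\<^sup>2) \<partial>lborel)"
      unfolding mu1_def by (rule f.first_eigenvalue_mass_le_energy[OF test_function_section_fst[OF t]])
    moreover have "(\<integral>\<^sup>+x\<in>I. ennreal ((\<phi> (x, y))\<^sup>2) \<partial>lborel) = (\<integral>\<^sup>+x. ennreal ((\<phi> (x, y))\<^sup>2) \<partial>lborel)"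
      by (intro nn_integral_cong) (use offx in \<open>auto simp: indicator_def\<close>)
    moreover have "(\<integral>\<^sup>+x\<in>I. ennreal ((norm (fst (\<phi>' (x, y))))\<^sup>2 + mu x * (\<phi> (x, y))\<^sup>2) \<partial>lborel) =
       (\<integral>\<^sup>+x. ennreal ((fst (\<phi>' (x, y)))\<^sup>2 + f.U x * (\<phi> (x, y))\<^sup>2) \<partial>lborel)"
      by (intro nn_integral_cong) (use offx in \<open>auto simp: indicator_def f.U_def\<close>)
    ultimately show "ennreal mu1 * (\<integral>\<^sup>+x. ennreal ((\<phi> (x, y))\<^sup>2) \<partial>lborel) \<le>
       (\<integral>\<^sup>+x. ennreal ((fst (\<phi>' (x, y)))\<^sup>2 + f.U x * (\<phi> (x, y))\<^sup>2) \<partial>lborel)" by simp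
  qed
  also have "\<dots> = (\<integral>\<^sup>+x. \<integral>\<^sup>+y. ennreal ((fst (\<phi>' (x, y)))\<^sup>2 + f.U x * (\<phi> (x, y))\<^sup>2) \<partial>lborel \<partial>lborel)"
    by (rule lborel_pair.Fubini'[symmetric]) (auto simp: borel_prod[symmetric])
  also have "\<dots> \<le> (\<integral>\<^sup>+x. \<integral>\<^sup>+y. ennreal ((norm (\<phi>' (x, y)))\<^sup>2 + U (x, y) * (\<phi> (x, y))\<^sup>2) \<partial>lborel \<partial>lborel)"
  proof (rule nn_integral_mono)
    fix x
    show "(\<integral>\<^sup>+y. ennreal ((fst (\<phi>' (x, y)))\<^sup>2 + f.U x * (\<phi> (x, y))\<^sup>2) \<partial>lborel) \<le>
       (\<integral>\<^sup>+y. ennreal ((norm (\<phi>' (x, y)))\<^sup>2 + U (x, y) * (\<phi> (x, y))\<^sup>2) \<partial>lborel)"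
    proof (cases "x \<in> I")
      case False
      then show ?thesis using offx by simp
    next
      case True
      interpret g: dirichlet_form "cross_section \<Omega> x" "\<lambda>y. V (x, y)" by (rule cross_form[OF True])
      have "ennreal (mu x) * (\<integral>\<^sup>+y\<in>cross_section \<Omega> x. ennreal ((\<phi> (x, y))\<^sup>2) \<partial>lborel) \<le>
         (\<integral>\<^sup>+y\<in>cross_section \<Omega> x. ennreal ((norm (snd (\<phi>' (x, y))))\<^sup>2 + V (x, y) * (\<phi> (x, y))\<^sup>2) \<partial>lborel)"
        unfolding mu_first_eigenvalue by (rule g.first_eigenvalue_mass_le_energy[OF test_function_section_snd[OF t]])
      moreover have "(\<integral>\<^sup>+y\<in>cross_section \<Omega> x. ennreal ((\<phi> (x, y))\<^sup>2) \<partial>lborel) = (\<integral>\<^sup>+y. ennreal ((\<phi> (x, y))\<^sup>2) \<partial>lborel)"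
        by (intro nn_integral_cong) (use off in \<open>auto simp: indicator_def cross_section_def\<close>)
      moreover have "(\<integral>\<^sup>+y\<in>cross_section \<Omega> x. ennreal ((norm (snd (\<phi>' (x, y))))\<^sup>2 + V (x, y) * (\<phi> (x, y))\<^sup>2) \<partial>lborel) =
         (\<integral>\<^sup>+y. ennreal ((snd (\<phi>' (x, y)))\<^sup>2 + U (x, y) * (\<phi> (x, y))\<^sup>2) \<partial>lborel)"
        by (intro nn_integral_cong) (use off in \<open>auto simp: indicator_def cross_section_def U_def\<close>)
      ultimately have sec: "ennreal (mu x) * (\<integral>\<^sup>+y. ennreal ((\<phi> (x, y))\<^sup>2) \<partial>lborel) \<le>
         (\<integral>\<^sup>+y. ennreal ((snd (\<phi>' (x, y)))\<^sup>2 + U (x, y) * (\<phi> (x, y))\<^sup>2) \<partial>lborel)" by simp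
      have "(\<integral>\<^sup>+y. ennreal ((fst (\<phi>' (x, y)))\<^sup>2 + f.U x * (\<phi> (x, y))\<^sup>2) \<partial>lborel) =
         (\<integral>\<^sup>+y. ennreal ((fst (\<phi>' (x, y)))\<^sup>2) + ennreal (mu x) * ennreal ((\<phi> (x, y))\<^sup>2) \<partial>lborel)"
        using True mu_ge_1[OF True] by (intro nn_integral_cong) (simp add: f.U_def ennreal_mult ennreal_plus)
      also have "\<dots> = (\<integral>\<^sup>+y. ennreal ((fst (\<phi>' (x, y)))\<^sup>2) \<partial>lborel) + ennreal (mu x) * (\<integral>\<^sup>+y. ennreal ((\<phi> (x, y))\<^sup>2) \<partial>lborel)"
        by (subst nn_integral_add) (auto simp: nn_integral_cmult)
      also have "\<dots> \<le> (\<integral>\<^sup>+y. ennreal ((fst (\<phi>' (x, y)))\<^sup>2) \<partial>lborel) +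
         (\<integral>\<^sup>+y. ennreal ((snd (\<phi>' (x, y)))\<^sup>2 + U (x, y) * (\<phi> (x, y))\<^sup>2) \<partial>lborel)"
        using sec by (rule add_left_mono)
      also have "\<dots> = (\<integral>\<^sup>+y. ennreal ((fst (\<phi>' (x, y)))\<^sup>2) + ennreal ((snd (\<phi>' (x, y)))\<^sup>2 + U (x, y) * (\<phi> (x, y))\<^sup>2) \<partial>lborel)"
        by (rule nn_integral_add[symmetric]) measurable
      also have "\<dots> = (\<integral>\<^sup>+y. ennreal ((norm (\<phi>' (x, y)))\<^sup>2 + U (x, y) * (\<phi> (x, y))\<^sup>2) \<partial>lborel)"
      proof (intro nn_integral_cong)
        fix y
        have "(norm (\<phi>' (x, y)))\<^sup>2 = (fst (\<phi>' (x, y)))\<^sup>2 + (snd (\<phi>' (x, y)))\<^sup>2"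
          by (simp add: norm_prod_def)
        then show "ennreal ((fst (\<phi>' (x, y)))\<^sup>2) + ennreal ((snd (\<phi>' (x, y)))\<^sup>2 + U (x, y) * (\<phi> (x, y))\<^sup>2) =
           ennreal ((norm (\<phi>' (x, y)))\<^sup>2 + U (x, y) * (\<phi> (x, y))\<^sup>2)"
          using U_nonneg[of "(x, y)"] by (simp add: ennreal_plus[symmetric] add.assoc del: ennreal_plus)
      qed
      finally show ?thesis .
    qed
  qed
  also have "\<dots> = (\<integral>\<^sup>+z. ennreal ((norm (\<phi>' z))\<^sup>2 + U z * (\<phi> z)\<^sup>2) \<partial>lborel)"
    by (subst plane) auto
  also have "\<dots> = (\<integral>\<^sup>+z\<in>\<Omega>. ennreal ((norm (\<phi>' z))\<^sup>2 + V z * (\<phi> z)\<^sup>2) \<partial>lborel)"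
    by (intro nn_integral_cong) (use off in \<open>auto simp: indicator_def U_def\<close>)
  finally show "ennreal mu1 * (\<integral>\<^sup>+z\<in>\<Omega>. ennreal ((\<phi> z)\<^sup>2) \<partial>lborel) \<le>
     (\<integral>\<^sup>+z\<in>\<Omega>. ennreal ((norm (\<phi>' z))\<^sup>2 + V z * (\<phi> z)\<^sup>2) \<partial>lborel)" .
qed

definition mu_min :: real where "mu_min = mu_star \<Omega> V"

lemma mu_min_le: "x \<in> I \<Longrightarrow> mu_min \<le> mu x"
  unfolding mu_min_def mu_star_def mu_def[symmetric]
  by (intro cINF_lower bdd_belowI2[where m=1]) (use mu_ge_1 in auto)

lemma mu_min_ge_1: "1 \<le> mu_min"
  unfolding mu_min_def mu_star_def mu_def[symmetric]
  by (intro cINF_greatest) (use mu_ge_1 dom in auto)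

lemma mu_min_le_mu1: "mu_min \<le> mu1"
  unfolding mu1_def
proof -
  interpret f: dirichlet_form I mu by (rule profile_form)
  show "mu_min \<le> first_eigenvalue I mu"
  proof (rule f.le_first_eigenvalue)
    fix \<phi> \<phi>' assume t: "test_function I \<phi> \<phi>'"
    have meas: "(\<lambda>x. ennreal ((\<phi> x)\<^sup>2) * indicator I x) \<in> borel_measurable lborel"
      using test_function_measurable(1)[OF t] borel_open[OF f.open_dom] by measurable
    have "ennreal mu_min * (\<integral>\<^sup>+x\<in>I. ennreal ((\<phi> x)\<^sup>2) \<partial>lborel) = (\<integral>\<^sup>+x. ennreal mu_min * (ennreal ((\<phi> x)\<^sup>2) * indicator I x) \<partial>lborel)"
      by (rule nn_integral_cmult[OF meas, symmetric])
    also have "\<dots> \<le> (\<integral>\<^sup>+x\<in>I. ennreal ((norm (\<phi>' x))\<^sup>2 + mu x * (\<phi> x)\<^sup>2) \<partial>lborel)"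
    proof (rule nn_integral_mono)
      fix x
      show "ennreal mu_min * (ennreal ((\<phi> x)\<^sup>2) * indicator I x) \<le> ennreal ((norm (\<phi>' x))\<^sup>2 + mu x * (\<phi> x)\<^sup>2) * indicator I x"
      proof (cases "x \<in> I")
        case True
        have "mu_min * (\<phi> x)\<^sup>2 \<le> mu x * (\<phi> x)\<^sup>2" using mu_min_le[OF True] by (intro mult_right_mono) auto
        also have "\<dots> \<le> (norm (\<phi>' x))\<^sup>2 + mu x * (\<phi> x)\<^sup>2" by simp
        finally have "ennreal (mu_min * (\<phi> x)\<^sup>2) \<le> ennreal ((norm (\<phi>' x))\<^sup>2 + mu x * (\<phi> x)\<^sup>2)" by (rule ennreal_leI)
        then show ?thesis using True mu_min_ge_1 by (simp add: ennreal_mult)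
      qed simp
    qed
    finally show "ennreal mu_min * (\<integral>\<^sup>+x\<in>I. ennreal ((\<phi> x)\<^sup>2) \<partial>lborel) \<le>
      (\<integral>\<^sup>+x\<in>I. ennreal ((norm (\<phi>' x))\<^sup>2 + mu x * (\<phi> x)\<^sup>2) \<partial>lborel)" .
  qed
qed

end

section \<open>The length scales\<close>

lemma ball_radius_le:
  fixes c :: "real \<times> real"
  assumes S: "S \<subseteq> cball 0 M" "0 \<le> M" and b: "ball c r \<subseteq> S"
  shows "r \<le> M"
proof (rule ccontr)
  assume "\<not> r \<le> M"
  then have r: "M < r" by simp
  define s where "s = (M + r) / 2"
  have s: "M < s" "s < r" "0 \<le> s" using r S(2) by (auto simp: s_def)
  \<comment> \<open>two opposite points of the ball are too far apart\<close>
  have "c + s *\<^sub>R (1, 0) \<in> ball c r" "c - s *\<^sub>R (1, 0) \<in> ball c r" using s by (auto simp: dist_norm norm_Pair)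
  then have "norm (c + s *\<^sub>R (1, 0)) \<le> M" "norm (c - s *\<^sub>R (1, 0)) \<le> M"
    using subsetD[OF b] S(1) by (metis mem_cball_0 subsetD)+
  moreover have "2 * s = norm ((c + s *\<^sub>R (1, 0)) - (c - s *\<^sub>R (1, 0)))" 
  proof -
    have "norm ((c + s *\<^sub>R (1, 0)) - (c - s *\<^sub>R (1, 0))) = norm ((2 * s) *\<^sub>R (1, 0) :: real \<times> real)"
      by (rule arg_cong[where f=norm]) (simp add: algebra_simps prod_eq_iff)
    also have "\<dots> = 2 * s" using s by (simp only: norm_scaleR) (simp add: norm_Pair)
    finally show ?thesis by simp
  qed
  ultimately have "2 * s \<le> 2 * M" using norm_triangle_ineq4[of "c + s *\<^sub>R (1, 0)" "c - s *\<^sub>R (1, 0)"] by linarith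
  then show False using s by simp
qed

lemma inner_radius_bdd:
  fixes S :: "(real \<times> real) set"
  assumes "S \<subseteq> cball 0 M" "0 \<le> M"
  shows "bdd_above {r. \<exists>c. ball c r \<subseteq> S}"
proof (rule bdd_aboveI)
  fix r assume "r \<in> {r. \<exists>c. ball c r \<subseteq> S}"
  then obtain c where "ball c r \<subseteq> S" by blast
  then show "r \<le> M" by (rule ball_radius_le[OF assms])
qed

lemma inner_radius_ge:
  fixes S :: "(real \<times> real) set"
  assumes "S \<subseteq> cball 0 M" "0 \<le> M" "ball c r \<subseteq> S"
  shows "r \<le> inner_radius S"
  unfolding inner_radius_def
proof (rule cSup_upper)
  show "r \<in> {r. \<exists>c. ball c r \<subseteq> S}" using assms(3) by blast
qed (rule inner_radius_bdd[OF assms(1,2)])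

lemma inner_radius_le:
  fixes S :: "(real \<times> real) set"
  assumes "S \<subseteq> cball 0 M" "0 \<le> M"
  shows "inner_radius S \<le> M"
proof -
  have "ball (0::real \<times> real) 0 \<subseteq> S" by simp
  then have "{r. \<exists>c. ball c r \<subseteq> S} \<noteq> {}" by blast
  then show ?thesis unfolding inner_radius_def
    by (rule cSup_least) (use ball_radius_le[OF assms] in blast)
qed

lemma inner_radius_gtD:
  fixes S :: "(real \<times> real) set"
  assumes "s < inner_radius S"
  shows "\<exists>c r. s < r \<and> ball c r \<subseteq> S"
proof -
  have "ball (0::real \<times> real) 0 \<subseteq> S" by simp
  then have "{r. \<exists>c. ball c r \<subseteq> S} \<noteq> {}" by blast
  from less_cSupD[OF this assms[unfolded inner_radius_def]] show ?thesis by blast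
qed

context convex_well
begin

text \<open>
  The bump \<open>(\<rho>\<^sup>2 - \<bar>x - c\<bar>\<^sup>2)\<^sup>2\<close> has squared gradient
  at most \<open>16 \<rho>\<^sup>6\<close>, and its square is at least
  \<open>81/256 \<rho>\<^sup>8\<close> on the disc of half the radius; \<open>203\<close> is
  \<open>16 * 4 * 256 / 81\<close>, rounded up.
\<close>

lemma first_eigenvalue_le_disc:
  assumes \<rho>: "0 < \<rho>" and sub: "cball c \<rho> \<subseteq> \<Omega>" and v: "\<And>z. z \<in> cball c \<rho> \<Longrightarrow> V z \<le> v"
  shows "first_eigenvalue \<Omega> V \<le> v + 203 / \<rho>\<^sup>2"
proof -
  define \<phi> where "\<phi> x = (max 0 (\<rho>\<^sup>2 - (x - c) \<bullet> (x - c)))\<^sup>2" for x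
  define \<phi>' where "\<phi>' x = (- 4 * max 0 (\<rho>\<^sup>2 - (x - c) \<bullet> (x - c))) *\<^sub>R (x - c)" for x
  have t: "test_function \<Omega> \<phi> \<phi>'" unfolding \<phi>_def[abs_def] \<phi>'_def[abs_def] by (rule test_function_bump[OF sub \<rho>])
  have off: "\<phi> x = 0" "\<phi>' x = 0" if "x \<notin> cball c \<rho>" for x
  proof -
    have "\<rho> \<le> norm (x - c)" using that by (simp add: dist_norm norm_minus_commute)
    then have "\<rho>\<^sup>2 \<le> (x - c) \<bullet> (x - c)" unfolding power2_norm_eq_inner[symmetric] using \<rho> by (intro power_mono) auto
    then show "\<phi> x = 0" "\<phi>' x = 0" by (simp_all add: \<phi>_def \<phi>'_def)
  qed
  have grad: "\<phi>' x \<bullet> \<phi>' x \<le> 16 * \<rho> ^ 6" if "x \<in> cball c \<rho>" for x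
  proof -
    have n: "(x - c) \<bullet> (x - c) \<le> \<rho>\<^sup>2" unfolding power2_norm_eq_inner[symmetric]
      using that \<rho> by (intro power_mono) (auto simp: dist_norm norm_minus_commute)
    define k where "k = \<rho>\<^sup>2 - (x - c) \<bullet> (x - c)"
    have k: "0 \<le> k" "k \<le> \<rho>\<^sup>2" using n by (auto simp: k_def)
    have "\<phi>' x \<bullet> \<phi>' x = 16 * k\<^sup>2 * ((x - c) \<bullet> (x - c))"
    proof -
      have "\<phi>' x = (- 4 * k) *\<^sub>R (x - c)" using k(1) by (simp add: \<phi>'_def k_def)
      then show ?thesis by (simp add: power2_eq_square)
    qed
    also have "\<dots> \<le> 16 * (\<rho>\<^sup>2)\<^sup>2 * \<rho>\<^sup>2" using n power_mono[OF k(2,1), of 2] by (intro mult_mono) auto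
    also have "\<dots> = 16 * \<rho> ^ 6" by (simp add: eval_nat_numeral)
    finally show ?thesis .
  qed
  have low: "(81/256) * \<rho> ^ 8 \<le> \<phi> x * \<phi> x" if "x \<in> cball c (\<rho> / 2)" for x
  proof -
    have "(x - c) \<bullet> (x - c) \<le> (\<rho> / 2)\<^sup>2" unfolding power2_norm_eq_inner[symmetric]
      using that \<rho> by (intro power_mono) (auto simp: dist_norm norm_minus_commute)
    then have k: "3/4 * \<rho>\<^sup>2 \<le> \<rho>\<^sup>2 - (x - c) \<bullet> (x - c)" by (simp add: power_divide)
    then have k0: "0 \<le> \<rho>\<^sup>2 - (x - c) \<bullet> (x - c)" using zero_le_power2[of \<rho>] by linarith
    have "(3/4 * \<rho>\<^sup>2) ^ 4 \<le> (\<rho>\<^sup>2 - (x - c) \<bullet> (x - c)) ^ 4" using k by (intro power_mono) auto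
    moreover have "(3/4 * \<rho>\<^sup>2) ^ 4 = (81/256) * \<rho> ^ 8" by (simp add: power_mult_distrib power_divide)
    moreover have "\<phi> x * \<phi> x = (\<rho>\<^sup>2 - (x - c) \<bullet> (x - c)) ^ 4" using k0 by (simp add: \<phi>_def eval_nat_numeral)
    ultimately show ?thesis by simp
  qed
  define k where "k = unit_ball_vol 2"
  have k: "0 < k" by (simp add: k_def)
  have vol: "measure lborel (cball c s) = k * s\<^sup>2" if "0 \<le> s" for s :: real
    using content_cball[of s c] that by (simp add: k_def power2_eq_square)
  have fin: "emeasure lborel (cball c s) < \<infinity>" for s by (rule emeasure_lborel_cball_finite)
  have ind: "integrable lborel (\<lambda>x. C * indicator (cball c s) x)" for C s :: real
    using fin by (intro Bochner_Integration.integrable_mult_right integrable_real_indicator) auto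
  have m1: "(81/256) * \<rho> ^ 8 * (k * (\<rho> / 2)\<^sup>2) \<le> mass \<phi> \<phi>"
  proof -
    have "(81/256) * \<rho> ^ 8 * (k * (\<rho> / 2)\<^sup>2) = (LINT x|lborel. (81/256) * \<rho> ^ 8 * indicator (cball c (\<rho> / 2)) x)"
      using vol[of "\<rho> / 2"] \<rho> by simp
    also have "\<dots> \<le> mass \<phi> \<phi>" unfolding mass_def
    proof (rule integral_mono[OF ind test_integrable(1)[OF t t]])
      fix x show "(81/256) * \<rho> ^ 8 * indicator (cball c (\<rho> / 2)) x \<le> \<phi> x * \<phi> x"
        using low[of x] by (cases "x \<in> cball c (\<rho> / 2)") auto
    qed
    finally show ?thesis .
  qed
  have "energy \<phi> \<phi>' \<phi> \<phi>' \<le> (LINT x|lborel. 16 * \<rho> ^ 6 * indicator (cball c \<rho>) x + v * (\<phi> x * \<phi> x))"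
    unfolding energy_def
  proof (rule integral_mono[OF energy_integrable[OF t t]])
    show "integrable lborel (\<lambda>x. 16 * \<rho> ^ 6 * indicator (cball c \<rho>) x + v * (\<phi> x * \<phi> x))"
      by (intro Bochner_Integration.integrable_add ind Bochner_Integration.integrable_mult_right test_integrable(1)[OF t t])
    fix x
    show "\<phi>' x \<bullet> \<phi>' x + U x * \<phi> x * \<phi> x \<le> 16 * \<rho> ^ 6 * indicator (cball c \<rho>) x + v * (\<phi> x * \<phi> x)"
    proof (cases "x \<in> cball c \<rho>")
      case True
      then have "U x \<le> v" using v[OF True] sub by (auto simp: U_def)
      from mult_right_mono[OF this, of "\<phi> x * \<phi> x"] grad[OF True] True show ?thesis by (simp add: mult.assoc)
    qed (simp add: off)
  qed
  also have "\<dots> = 16 * \<rho> ^ 6 * (k * \<rho>\<^sup>2) + v * mass \<phi> \<phi>"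
    unfolding mass_def using vol[of \<rho>] \<rho> ind[of "16 * \<rho> ^ 6" \<rho>] test_integrable(1)[OF t t]
    by (subst Bochner_Integration.integral_add) auto
  also have "16 * \<rho> ^ 6 * (k * \<rho>\<^sup>2) \<le> 203 / \<rho>\<^sup>2 * ((81/256) * \<rho> ^ 8 * (k * (\<rho> / 2)\<^sup>2))"
  proof -
    have e1: "203 / \<rho>\<^sup>2 * ((81/256) * \<rho> ^ 8 * (k * (\<rho> / 2)\<^sup>2)) = 203 * 81 / 1024 * (k * \<rho> ^ 8)"
      using \<rho> by (simp add: field_simps eval_nat_numeral)
    have e2: "16 * \<rho> ^ 6 * (k * \<rho>\<^sup>2) = 16 * (k * \<rho> ^ 8)" by (simp add: eval_nat_numeral)
    have "0 \<le> k * \<rho> ^ 8" using k \<rho> by simp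
    then show ?thesis unfolding e1 e2 by simp
  qed
  also have "203 / \<rho>\<^sup>2 * ((81/256) * \<rho> ^ 8 * (k * (\<rho> / 2)\<^sup>2)) \<le> 203 / \<rho>\<^sup>2 * mass \<phi> \<phi>"
    using m1 by (rule mult_left_mono) simp
  finally have "energy \<phi> \<phi>' \<phi> \<phi>' \<le> (v + 203 / \<rho>\<^sup>2) * mass \<phi> \<phi>" by (simp add: algebra_simps)
  then have "first_eigenvalue \<Omega> V * mass \<phi> \<phi> \<le> (v + 203 / \<rho>\<^sup>2) * mass \<phi> \<phi>"
    using rayleigh_le[OF t] unfolding first_eigenvalue_eq_rayleigh by linarith
  moreover have "0 < (81/256) * \<rho> ^ 8 * (k * (\<rho> / 2)\<^sup>2)" using k \<rho> by simp
  ultimately show ?thesis using m1 by (simp add: mult_le_cancel_right)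
qed

definition len :: real where "len = L1 \<Omega> V"
definition L1_candidates :: "real set" where "L1_candidates = {L. 0 < L \<and> L \<le> inner_radius (S (1 / L\<^sup>2))}"

lemma len_eq: "len = Sup L1_candidates" by (simp add: len_def L1_def L1_candidates_def)

lemma dom_subset_cball: "\<exists>M>0. \<Omega> \<subseteq> cball 0 M"
  using bounded_subset_ballD[OF dom(2), of 0] ball_subset_cball by blast

lemma L1_candidates_nonempty: "L1_candidates \<noteq> {}"
proof -
  obtain z where z: "z \<in> \<Omega>" using dom(4) by blast
  have "isCont V z" using V_continuous dom(1) z by (simp add: continuous_on_eq_continuous_at)
  then obtain d where d: "0 < d" "\<And>w. dist w z < d \<Longrightarrow> dist (V w) (V z) < 1"
    unfolding continuous_at_eps_delta using zero_less_one by blast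
  obtain e where e: "0 < e" "ball z e \<subseteq> \<Omega>" using dom(1) z open_contains_ball by blast
  \<comment> \<open>small enough that \<open>1 / L\<^sup>2\<close> exceeds \<open>V z\<close> and that \<open>V\<close> grows by less than \<open>1\<close> on the ball\<close>
  define L where "L = min (min d e) (1 / sqrt (V z))"
  have Vz: "1 \<le> V z" by (rule V_ge_1[OF z])
  have L: "0 < L" "L \<le> d" "L \<le> e" "L \<le> 1 / sqrt (V z)" using d e Vz by (auto simp: L_def)
  have "L\<^sup>2 \<le> (1 / sqrt (V z))\<^sup>2" using L by (intro power_mono) auto
  then have "L\<^sup>2 \<le> 1 / V z" using Vz by (simp add: power_divide)
  then have "V z * L\<^sup>2 \<le> 1" using Vz by (simp add: field_simps)
  then have V1: "V z \<le> 1 / L\<^sup>2" using L(1) by (simp add: field_simps)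
  have "ball z L \<subseteq> S (1 / L\<^sup>2)"
  proof
    fix w assume w: "w \<in> ball z L"
    then have "w \<in> \<Omega>" using e L by auto
    moreover have "dist (V w) (V z) < 1" using w L by (intro d(2)) (auto simp: dist_commute)
    then have "V w \<le> 1 + 1 / L\<^sup>2" using V1 by (simp add: dist_real_def abs_less_iff)
    ultimately show "w \<in> S (1 / L\<^sup>2)" by (simp add: sublevel_iff)
  qed
  moreover obtain M where "0 < M" "\<Omega> \<subseteq> cball 0 M" using dom_subset_cball by blast
  ultimately have "L \<le> inner_radius (S (1 / L\<^sup>2))"
    by (intro inner_radius_ge[of _ M]) (auto simp: sublevel_iff)
  with L(1) show ?thesis by (auto simp: L1_candidates_def)
qed

lemma L1_candidates_bdd: "bdd_above L1_candidates"
proof -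
  obtain M where M: "0 < M" "\<Omega> \<subseteq> cball 0 M" using dom_subset_cball by blast
  have "L \<le> M" if "L \<in> L1_candidates" for L
    using that inner_radius_le[of "S (1 / L\<^sup>2)" M] M by (force simp: L1_candidates_def sublevel_iff)
  then show ?thesis by (rule bdd_aboveI)
qed

lemma len_pos: "0 < len"
proof -
  obtain L where "L \<in> L1_candidates" using L1_candidates_nonempty by blast
  then have "0 < L" "L \<le> len" using cSup_upper[OF _ L1_candidates_bdd] by (auto simp: L1_candidates_def len_eq)
  then show ?thesis by simp
qed

text \<open>
  Near the supremum, a disc of radius \<open>len / 4\<close> fits into a level set of height
  \<open>4 / len\<^sup>2\<close>; \<open>3252 = 4 + 16 * 203\<close>.
\<close>

lemma first_eigenvalue_le_len: "first_eigenvalue \<Omega> V \<le> 1 + 3252 / len\<^sup>2"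
proof -
  have "len / 2 < Sup L1_candidates" using len_pos by (simp add: len_eq[symmetric])
  then obtain L where L: "L \<in> L1_candidates" "len / 2 < L" using less_cSupD[OF L1_candidates_nonempty] by blast
  have "L / 2 < inner_radius (S (1 / L\<^sup>2))" using L(1) by (auto simp: L1_candidates_def)
  then obtain c r where r: "L / 2 < r" "ball c r \<subseteq> S (1 / L\<^sup>2)" using inner_radius_gtD by blast
  have sub: "cball c (len / 4) \<subseteq> S (1 / L\<^sup>2)" using r L(2) by (intro subset_trans[OF _ r(2)]) auto
  have "1 / L\<^sup>2 \<le> 1 / (len / 2)\<^sup>2" using L(2) len_pos by (intro divide_left_mono power_mono) auto
  also have "\<dots> = 4 / len\<^sup>2" by (simp add: power_divide)
  finally have "first_eigenvalue \<Omega> V \<le> (1 + 4 / len\<^sup>2) + 203 / (len / 4)\<^sup>2"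
    using sub len_pos by (intro first_eigenvalue_le_disc[where c=c]) (force simp: sublevel_iff)+
  also have "\<dots> = 1 + 3252 / len\<^sup>2" by (simp add: power_divide)
  finally show ?thesis .
qed

text \<open>
  Contraction by the factor \<open>1/8\<close> divides the height of the level set by
  \<open>4\<close>, which corresponds to the length \<open>2 len\<close>. A disc of radius above
  \<open>16 len\<close> would become one of radius above \<open>2 len\<close>, contradicting the
  maximality of \<open>len\<close>.
\<close>

lemma inradius_level_len:
  assumes b: "ball c r \<subseteq> S (1 / len\<^sup>2)"
  shows "r \<le> 16 * len"
proof (rule ccontr)
  assume "\<not> r \<le> 16 * len"
  then have r: "16 * len < r" by simp
  obtain w where w: "\<forall>z\<in>S (1 / len\<^sup>2). (1 - 1/8) *\<^sub>R w + (1/8) *\<^sub>R z \<in> S (2 * (1/8) * (1 / len\<^sup>2))"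
    using sublevel_contraction[of "1/8" "1 / len\<^sup>2"] len_pos by auto
  have eq: "2 * (1/8) * (1 / len\<^sup>2) = 1 / (2 * len)\<^sup>2" by (simp add: power_mult_distrib)
  have "ball ((1 - 1/8) *\<^sub>R w + (1/8) *\<^sub>R c) (r / 8) \<subseteq> S (1 / (2 * len)\<^sup>2)"
  proof
    fix u assume u: "u \<in> ball ((1 - 1/8) *\<^sub>R w + (1/8) *\<^sub>R c) (r / 8)"
    define z where "z = 8 *\<^sub>R (u - (1 - 1/8) *\<^sub>R w)"
    have uz: "u = (1 - 1/8) *\<^sub>R w + (1/8) *\<^sub>R z" by (simp add: z_def)
    have "dist ((1 - 1/8) *\<^sub>R w + (1/8) *\<^sub>R c) u = dist c z / 8"
      unfolding uz dist_norm by (simp add: algebra_simps flip: scaleR_diff_right)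
    then have "z \<in> ball c r" using u by simp
    then have "z \<in> S (1 / len\<^sup>2)" using b by blast
    then show "u \<in> S (1 / (2 * len)\<^sup>2)" using w unfolding uz eq by blast
  qed
  moreover obtain M where "0 < M" "\<Omega> \<subseteq> cball 0 M" using dom_subset_cball by blast
  ultimately have "r / 8 \<le> inner_radius (S (1 / (2 * len)\<^sup>2))"
    by (intro inner_radius_ge[of _ M]) (auto simp: sublevel_iff)
  then have "2 * len \<in> L1_candidates" using r len_pos by (simp add: L1_candidates_def)
  then have "2 * len \<le> len" unfolding len_eq by (rule cSup_upper[OF _ L1_candidates_bdd])
  then show False using len_pos by simp
qed

text \<open>
  Some direction is narrow by the bound on the inradius, and the \<open>y\<close>-axis is at least
  as narrow by the choice of orientation.
\<close>

lemma level_height: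
  assumes orient: "normalized_orientation \<Omega> V" and z: "z \<in> S (1 / len\<^sup>2)" "z' \<in> S (1 / len\<^sup>2)"
  shows "\<bar>snd z - snd z'\<bar> \<le> 192 * len"
proof -
  have "\<exists>e. norm e = 1 \<and> (\<forall>z\<in>S (1 / len\<^sup>2). \<forall>z'\<in>S (1 / len\<^sup>2). \<bar>(z - z') \<bullet> e\<bar> \<le> 12 * (16 * len))"
    by (rule convex_narrow_direction[OF convex_sublevel bounded_sublevel]) (use inradius_level_len len_pos in auto)
  then obtain e where e: "norm e = 1" "\<And>z z'. z \<in> S (1 / len\<^sup>2) \<Longrightarrow> z' \<in> S (1 / len\<^sup>2) \<Longrightarrow> \<bar>(z - z') \<bullet> e\<bar> \<le> 12 * (16 * len)"
    by blast
  have bi: "bounded ((\<lambda>z. z \<bullet> e) ` S (1 / len\<^sup>2))" for e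
    by (intro bounded_linear_image[OF bounded_sublevel] bounded_linear_inner_left)
  have "dist (z \<bullet> (0, 1)) (z' \<bullet> (0, 1)) \<le> diameter ((\<lambda>z. z \<bullet> (0, 1)) ` S (1 / len\<^sup>2))"
    by (rule diameter_bounded_bound[OF bi]) (use z in auto)
  also have "\<dots> \<le> diameter ((\<lambda>z. z \<bullet> e) ` S (1 / len\<^sup>2))"
    using orient e(1) unfolding normalized_orientation_def projection_length_def len_def by blast
  also have "\<dots> \<le> 192 * len"
    by (rule diameter_le) (use e(2) len_pos in \<open>auto simp: inner_diff_left\<close>)
  finally show ?thesis by (cases z; cases z') (simp add: dist_real_def)
qed

text \<open>
  Contraction by the factor \<open>1 / (2 k)\<close> moves the level set into that of height
  \<open>1 / len\<^sup>2\<close>.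
\<close>

lemma level_height_scaled:
  assumes orient: "normalized_orientation \<Omega> V" and k: "1 \<le> k" and z: "z \<in> S (k / len\<^sup>2)" "z' \<in> S (k / len\<^sup>2)"
  shows "\<bar>snd z - snd z'\<bar> \<le> 384 * k * len"
proof -
  define \<theta> where "\<theta> = 1 / (2 * k)"
  have \<theta>: "0 < \<theta>" "\<theta> \<le> 1" "2 * \<theta> * (k / len\<^sup>2) = 1 / len\<^sup>2" using k by (auto simp: \<theta>_def)
  obtain w where w: "\<And>z. z \<in> S (k / len\<^sup>2) \<Longrightarrow> (1 - \<theta>) *\<^sub>R w + \<theta> *\<^sub>R z \<in> S (1 / len\<^sup>2)"
    using sublevel_contraction[OF \<theta>(1,2), of "k / len\<^sup>2"] k len_pos unfolding \<theta>(3) by auto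
  have "\<bar>snd ((1 - \<theta>) *\<^sub>R w + \<theta> *\<^sub>R z) - snd ((1 - \<theta>) *\<^sub>R w + \<theta> *\<^sub>R z')\<bar> \<le> 192 * len"
    by (intro level_height[OF orient] w z)
  moreover have "snd ((1 - \<theta>) *\<^sub>R w + \<theta> *\<^sub>R z) - snd ((1 - \<theta>) *\<^sub>R w + \<theta> *\<^sub>R z') = \<theta> * (snd z - snd z')"
    by (simp add: algebra_simps)
  ultimately have "\<theta> * \<bar>snd z - snd z'\<bar> \<le> 192 * len" using \<theta>(1) by (simp add: abs_mult)
  then show ?thesis using k by (simp add: \<theta>_def field_simps)
qed

text \<open>
  The lower bound for \<open>Y'\<close> in a slope profile is \<open>V \<ge> 1\<close>, read off
  from the Riccati equation.
\<close>

lemma section_profile: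
  assumes x: "x \<in> I" and m: "mu x < m" and \<kappa>: "0 < \<kappa>" "m - 1 \<le> \<kappa>"
  shows "\<exists>Y Y' A. slope_profile Y Y' A \<kappa> \<and> (\<forall>p. (x, Y p) \<in> \<Omega> \<and> V (x, Y p) = m + p\<^sup>2 - 1 / Y' p)"
proof -
  obtain \<phi> \<phi>' where t: "test_function (cross_section \<Omega> x) \<phi> \<phi>'"
    and small: "(\<integral>\<^sup>+y\<in>cross_section \<Omega> x. ennreal ((norm (\<phi>' y))\<^sup>2 + V (x, y) * (\<phi> y)\<^sup>2) \<partial>lborel) <
      ennreal m * (\<integral>\<^sup>+y\<in>cross_section \<Omega> x. ennreal ((\<phi> y)\<^sup>2) \<partial>lborel)"
    using mu_less_witness[OF x m] by blast
  have m0: "0 \<le> m" using mu_ge_1[OF x] m by simp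
  have V0: "0 \<le> V (x, y)" if "y \<in> cross_section \<Omega> x" for y
    using that V_ge_1[of "(x, y)"] by (simp add: cross_section_def)
  obtain Y Y' A where c: "continuous_on UNIV Y'" "A 0 = 0"
    and Y: "\<And>p. (Y has_real_derivative Y' p) (at p)" "\<And>p. (A has_real_derivative p * Y' p) (at p)"
      "\<And>p. 0 < Y' p" "\<And>p. Y p \<in> cross_section \<Omega> x" "\<And>p. V (x, Y p) = m + p\<^sup>2 - 1 / Y' p"
    using ground_state_slope_parametrization[OF cross_section_open cross_section_convex V_section_convex V0 m0 t small]
    by auto
  have mem: "(x, Y p) \<in> \<Omega>" for p using Y(4)[of p] by (simp add: cross_section_def)
  have lower: "1 / (p\<^sup>2 + \<kappa>) \<le> Y' p" for p
  proof -
    have "1 / Y' p \<le> p\<^sup>2 + \<kappa>" using V_ge_1[OF mem[of p]] \<kappa>(2) unfolding Y(5) by linarith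
    moreover have "0 < p\<^sup>2 + \<kappa>" using \<kappa>(1) by (simp add: add_nonneg_pos)
    ultimately show ?thesis using Y(3)[of p] by (simp add: field_simps)
  qed
  have "slope_profile Y Y' A \<kappa>" by unfold_locales (use Y c \<kappa> lower in auto)
  with mem Y(5) show ?thesis by blast
qed

text \<open>
  Where \<open>p\<^sup>2 \<le> \<kappa>\<close> the Riccati equation bounds \<open>V\<close>, so
  these points lie in a level set of known height; \<open>768 = 384 * 2\<close>. Outside, convexity
  of the profile bounds the additional distance by \<open>A / sqrt \<kappa>\<close>.
\<close>

lemma profile_spread:
  assumes orient: "normalized_orientation \<Omega> V" and sp: "slope_profile Y Y' A \<kappa>"
    and \<kappa>: "\<kappa> = k / len\<^sup>2" "1 \<le> k" and m: "m - 1 \<le> \<kappa>"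
    and Y: "\<And>p. (x, Y p) \<in> \<Omega>" "\<And>p. V (x, Y p) = m + p\<^sup>2 - 1 / Y' p"
  shows "p\<^sup>2 \<le> \<kappa> \<Longrightarrow> (x, Y p) \<in> S (2 * k / len\<^sup>2)"
    "\<bar>Y p - Y 0\<bar> \<le> 768 * k * len * (1 + A p)"
    "Y (sqrt \<kappa>) - Y (- sqrt \<kappa>) \<le> 2 * (768 * k * len)"
proof -
  interpret slope_profile Y Y' A \<kappa> by fact
  define R where "R = 768 * k * len"
  have R: "0 < R" using \<kappa> len_pos by (simp add: R_def)
  show level: "(x, Y p) \<in> S (2 * k / len\<^sup>2)" if "p\<^sup>2 \<le> \<kappa>" for p
  proof -
    have "0 < 1 / Y' p" using Y'_pos[of p] by simp
    then have "V (x, Y p) \<le> 1 + 2 * \<kappa>" using that m unfolding Y(2) by linarith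
    then show ?thesis using Y(1) by (simp add: sublevel_iff \<kappa>(1))
  qed
  have h: "\<bar>Y p - Y q\<bar> \<le> R" if "p\<^sup>2 \<le> \<kappa>" "q\<^sup>2 \<le> \<kappa>" for p q
    using level_height_scaled[OF orient _ level[OF that(1)] level[OF that(2)]] \<kappa>(2) by (simp add: R_def)
  have s: "0 < sqrt \<kappa>" "(sqrt \<kappa>)\<^sup>2 = \<kappa>" using \<kappa>_pos by auto
  have s_R: "1 / sqrt \<kappa> \<le> R"
  proof -
    have "sqrt \<kappa> = sqrt k / len" using len_pos by (simp add: \<kappa>(1) real_sqrt_divide)
    then have "1 / sqrt \<kappa> = len / sqrt k" by simp
    also have "\<dots> \<le> len / 1" using \<kappa>(2) len_pos by (intro divide_left_mono) auto
    also have "\<dots> \<le> R" using \<kappa>(2) len_pos mult_right_mono[of 1 "768 * k" len] by (simp add: R_def)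
    finally show ?thesis .
  qed
  have far: "q * (Y p - Y q) \<le> A p" for p q using legendre[of p q] W_nonneg[of q] by linarith
  have tail: "A p / sqrt \<kappa> \<le> R * A p"
    using mult_right_mono[OF s_R W_nonneg[of p]] by simp
  have "\<bar>Y p - Y 0\<bar> \<le> R * (1 + A p)"
  proof -
    have RA: "0 \<le> R * A p" using R W_nonneg[of p] by simp
    consider "p\<^sup>2 \<le> \<kappa>" | "sqrt \<kappa> < p" | "p < - sqrt \<kappa>"
      using s by (metis abs_le_iff abs_le_square_iff abs_of_pos leI minus_le_iff)
    then show ?thesis
    proof cases
      case 1
      then have "\<bar>Y p - Y 0\<bar> \<le> R" using \<kappa>_pos by (intro h) auto
      then show ?thesis using RA by (simp add: distrib_left)
    next
      case 2
      have "Y p - Y (sqrt \<kappa>) \<le> A p / sqrt \<kappa>" using far[of "sqrt \<kappa>" p] s by (simp add: field_simps)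
      moreover have "\<bar>Y (sqrt \<kappa>) - Y 0\<bar> \<le> R" using s \<kappa>_pos by (intro h) auto
      moreover have "0 \<le> p" using 2 s(1) by linarith
      then have "Y 0 \<le> Y p" using Y_strict_mono by (simp add: strict_mono_less_eq)
      ultimately show ?thesis using tail by (simp add: distrib_left)
    next
      case 3
      have "Y (- sqrt \<kappa>) - Y p \<le> A p / sqrt \<kappa>" using far[of "- sqrt \<kappa>" p] s by (simp add: field_simps)
      moreover have "\<bar>Y (- sqrt \<kappa>) - Y 0\<bar> \<le> R" using s \<kappa>_pos by (intro h) auto
      moreover have "p \<le> 0" using 3 s(1) by linarith
      then have "Y p \<le> Y 0" using Y_strict_mono by (simp add: strict_mono_less_eq)
      ultimately show ?thesis using tail by (simp add: distrib_left)
    qed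
  qed
  then show "\<bar>Y p - Y 0\<bar> \<le> 768 * k * len * (1 + A p)" by (simp add: R_def)
  have "\<bar>Y (sqrt \<kappa>) - Y (- sqrt \<kappa>)\<bar> \<le> R" using s by (intro h) auto
  then show "Y (sqrt \<kappa>) - Y (- sqrt \<kappa>) \<le> 2 * (768 * k * len)" using R unfolding R_def by linarith
qed

end

section \<open>The eigenvalue estimate\<close>

text \<open>
  \<open>level_const\<close> is \<open>3252 + 2\<close>, so that the eigenvalue
  \<open>m = mu_min + 2 / L\<^sup>2\<close> of the profiles satisfies
  \<open>m - 1 \<le> level_const / len\<^sup>2\<close> for \<open>L \<ge> len\<close>.
  \<open>spread_const\<close> is the bound of \<open>profile_spread\<close>, in units of
  \<open>len\<close>. The factor \<open>4\<close> in \<open>gap_const\<close> accounts for bridging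
  only half of the interval.
\<close>

definition level_const :: real where "level_const = 3254"
definition spread_const :: real where "spread_const = 768 * level_const"
definition gap_const :: real where "gap_const = 3252 + 2 + 4 * (6912 * spread_const\<^sup>2 * level_const + 61200 * (2 * (spread_const * sqrt level_const) + 6))"

lemma gap_const_ge: "3252 \<le> gap_const"
  unfolding gap_const_def by (simp add: spread_const_def level_const_def)

context convex_well
begin

text \<open>
  The two profiles are taken at the quarter points, since \<open>mu\<close> is controlled only in
  the open interval. Both \<open>\<kappa>\<close> and \<open>R\<close> are tied to
  \<open>len\<close>, and the error constants depend only on the scale invariant combination
  \<open>R sqrt \<kappa>\<close>.
\<close>

lemma first_eigenvalue_le_on_interval:
  assumes orient: "normalized_orientation \<Omega> V" and L: "len \<le> L" "L \<le> b - a" "{a<..<b} \<subseteq> I"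
    and mu_le: "\<And>x. x \<in> {a<..<b} \<Longrightarrow> mu x \<le> mu_min + 1 / L\<^sup>2"
  shows "first_eigenvalue \<Omega> V \<le> mu_min + gap_const / L\<^sup>2"
proof -
  have L0: "0 < L" using L(1) len_pos by simp
  define a' where "a' = a + L / 4"
  define b' where "b' = a + 3 * L / 4"
  have ab: "a' \<in> {a<..<b}" "b' \<in> {a<..<b}" "b' - a' = L / 2" "a' < b'" using L0 L(2) by (auto simp: a'_def b'_def)
  define m where "m = mu_min + 2 / L\<^sup>2"
  define \<kappa> where "\<kappa> = level_const / len\<^sup>2"
  have \<kappa>: "0 < \<kappa>" using len_pos by (simp add: \<kappa>_def level_const_def)
  have "1 / L\<^sup>2 \<le> 1 / len\<^sup>2" using L len_pos by (intro divide_left_mono power_mono) auto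
  moreover have "mu_min \<le> 1 + 3252 / len\<^sup>2"
    using mu_min_le_mu1 mu1_le_first_eigenvalue first_eigenvalue_le_len by linarith
  ultimately have m\<kappa>: "m - 1 \<le> \<kappa>" by (simp add: m_def \<kappa>_def level_const_def add_divide_distrib[symmetric])
  have lt: "mu x < m" if "x \<in> {a<..<b}" for x
  proof -
    have "mu_min + 1 / L\<^sup>2 < m" using L0 by (simp add: m_def divide_strict_right_mono)
    with mu_le[OF that] show ?thesis by linarith
  qed
  obtain Ya Ya' A where pa: "slope_profile Ya Ya' A \<kappa>" "\<And>p. (a', Ya p) \<in> \<Omega>" "\<And>p. V (a', Ya p) = m + p\<^sup>2 - 1 / Ya' p"
    using section_profile[OF _ lt[OF ab(1)] \<kappa> m\<kappa>] ab(1) L(3) by blast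
  obtain Yb Yb' B where pb: "slope_profile Yb Yb' B \<kappa>" "\<And>p. (b', Yb p) \<in> \<Omega>" "\<And>p. V (b', Yb p) = m + p\<^sup>2 - 1 / Yb' p"
    using section_profile[OF _ lt[OF ab(2)] \<kappa> m\<kappa>] ab(2) L(3) by blast
  have k1: "1 \<le> level_const" by (simp add: level_const_def)
  note sa = profile_spread[OF orient pa(1) \<kappa>_def k1 m\<kappa> pa(2,3)]
  note sb = profile_spread[OF orient pb(1) \<kappa>_def k1 m\<kappa> pb(2,3)]
  define R where "R = spread_const * len"
  interpret br: slope_bridge \<Omega> h Ya Ya' A Yb Yb' B \<kappa> a' b' m R
  proof (unfold_locales)
    interpret pa: slope_profile Ya Ya' A \<kappa> by (rule pa(1))
    interpret pb: slope_profile Yb Yb' B \<kappa> by (rule pb(1))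
    fix p
    show "(Ya has_real_derivative Ya' p) (at p)" "(A has_real_derivative p * Ya' p) (at p)"
      "continuous_on UNIV Ya'" "A 0 = 0" "0 < \<kappa>" "1 / (p\<^sup>2 + \<kappa>) \<le> Ya' p"
      by (fact pa.dY pa.dW pa.Y'_cont pa.W0 pa.\<kappa>_pos pa.Y'_lower)+
    show "(Yb has_real_derivative Yb' p) (at p)" "(B has_real_derivative p * Yb' p) (at p)"
      "continuous_on UNIV Yb'" "B 0 = 0" "1 / (p\<^sup>2 + \<kappa>) \<le> Yb' p"
      by (fact pb.dY pb.dW pb.Y'_cont pb.W0 pb.Y'_lower)+
    show "a' < b'" by (rule ab(4))
    show "(a', Ya p) \<in> \<Omega>" "(b', Yb p) \<in> \<Omega>" "V (a', Ya p) = m + p\<^sup>2 - 1 / Ya' p" "V (b', Yb p) = m + p\<^sup>2 - 1 / Yb' p"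
      by (fact pa(2,3) pb(2,3))+
    show "\<bar>Ya p - Ya 0\<bar> \<le> R * (1 + A p)" "Ya (sqrt \<kappa>) - Ya (- sqrt \<kappa>) \<le> 2 * R"
      using sa(2,3) by (simp_all add: R_def spread_const_def)
    show "\<bar>Yb p - Yb 0\<bar> \<le> R * (1 + B p)" "Yb (sqrt \<kappa>) - Yb (- sqrt \<kappa>) \<le> 2 * R"
      using sb(2,3) by (simp_all add: R_def spread_const_def)
    have "\<bar>snd (b', Yb 0) - snd (a', Ya 0)\<bar> \<le> 384 * (2 * level_const) * len"
      by (rule level_height_scaled[OF orient]) (use sa(1)[of 0] sb(1)[of 0] \<kappa> k1 in auto)
    then show "\<bar>Yb 0 - Ya 0\<bar> \<le> R" by (simp add: R_def spread_const_def)
  qed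
  have "first_eigenvalue \<Omega> V \<le> m + (br.tilt_const + br.bump_const) / br.l\<^sup>2" by (rule br.first_eigenvalue_le)
  also have "br.tilt_const + br.bump_const = 6912 * spread_const\<^sup>2 * level_const + 61200 * (2 * (spread_const * sqrt level_const) + 6)"
  proof -
    have "R * sqrt \<kappa> = spread_const * sqrt level_const" using len_pos by (simp add: R_def \<kappa>_def real_sqrt_divide)
    moreover have "R\<^sup>2 * \<kappa> = spread_const\<^sup>2 * level_const" using len_pos by (simp add: R_def \<kappa>_def power_mult_distrib)
    ultimately show ?thesis by (simp add: br.tilt_const_def br.bump_const_def mult.assoc)
  qed
  also have "br.l\<^sup>2 = L\<^sup>2 / 4" unfolding br.l_def ab(3) by (simp add: power_divide)
  also have "m + (6912 * spread_const\<^sup>2 * level_const + 61200 * (2 * (spread_const * sqrt level_const) + 6)) / (L\<^sup>2 / 4) = mu_min + (gap_const - 3252) / L\<^sup>2"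
    by (simp add: m_def gap_const_def add_divide_distrib)
  also have "\<dots> \<le> mu_min + gap_const / L\<^sup>2" by (simp add: divide_right_mono)
  finally show ?thesis .
qed

definition L2_candidates :: "real set" where
  "L2_candidates = {L. 0 < L \<and> (\<exists>a b. L \<le> b - a \<and> {a<..<b} \<subseteq> I \<and>
     (\<forall>x\<in>{a<..<b}. mu_min \<le> mu x \<and> mu x \<le> mu_min + 1 / L\<^sup>2))}"

text \<open>
  For \<open>L < len\<close> the bump on a disc already gives more than is claimed.
\<close>

lemma first_eigenvalue_le_L2_candidate:
  assumes orient: "normalized_orientation \<Omega> V" and L: "L \<in> L2_candidates"
  shows "first_eigenvalue \<Omega> V \<le> mu_min + gap_const / L\<^sup>2"
proof (cases "len \<le> L")
  case True
  then show ?thesis using L first_eigenvalue_le_on_interval[OF orient True] unfolding L2_candidates_def by blast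
next
  case False
  then have L0: "0 < L" "L \<le> len" using L by (auto simp: L2_candidates_def)
  have "first_eigenvalue \<Omega> V \<le> 1 + 3252 / len\<^sup>2" by (rule first_eigenvalue_le_len)
  also have "\<dots> \<le> mu_min + gap_const / L\<^sup>2"
    using L0 mu_min_ge_1 gap_const_ge by (intro add_mono frac_le power_mono) auto
  finally show ?thesis .
qed

text \<open>
  Upper semicontinuity provides a neighbourhood on which \<open>mu\<close> is bounded by
  \<open>mu_min + d\<close>, and every \<open>L\<close> with \<open>d \<le> 1 / L\<^sup>2\<close>
  that fits into it is a candidate.
\<close>

lemma L2_candidates_nonempty: "L2_candidates \<noteq> {}"
proof -
  obtain x0 where x0: "x0 \<in> I" using dom(4) by blast
  obtain e where e: "0 < e" "\<And>x. \<bar>x - x0\<bar> < e \<Longrightarrow> x \<in> I \<and> mu x < mu x0 + 1"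
    using mu_upper_semicontinuous[OF x0, of "mu x0 + 1"] by auto
  define d where "d = mu x0 + 1 - mu_min"
  have d: "0 < d" using mu_min_le[OF x0] by (simp add: d_def)
  define L where "L = min e (1 / sqrt d)"
  have L: "0 < L" "L \<le> e" "L \<le> 1 / sqrt d" using e d by (auto simp: L_def)
  have "L\<^sup>2 \<le> (1 / sqrt d)\<^sup>2" using L by (intro power_mono) auto
  then have "L\<^sup>2 \<le> 1 / d" using d by (simp add: power_divide)
  then have dL: "d \<le> 1 / L\<^sup>2" using d L(1) by (simp add: field_simps)
  have "{x0 - e<..<x0 + e} \<subseteq> I" "\<forall>x\<in>{x0 - e<..<x0 + e}. mu_min \<le> mu x \<and> mu x \<le> mu_min + 1 / L\<^sup>2"
  proof -
    have *: "x \<in> I \<and> mu x < mu x0 + 1" if "x \<in> {x0 - e<..<x0 + e}" for x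
      using that by (intro e(2)) (auto simp: abs_less_iff)
    then show "{x0 - e<..<x0 + e} \<subseteq> I" by blast
    show "\<forall>x\<in>{x0 - e<..<x0 + e}. mu_min \<le> mu x \<and> mu x \<le> mu_min + 1 / L\<^sup>2"
    proof
      fix x assume "x \<in> {x0 - e<..<x0 + e}"
      from *[OF this] mu_min_le[of x] dL show "mu_min \<le> mu x \<and> mu x \<le> mu_min + 1 / L\<^sup>2" by (simp add: d_def)
    qed
  qed
  moreover have "L \<le> (x0 + e) - (x0 - e)" using L e by simp
  ultimately have "L \<in> L2_candidates" unfolding L2_candidates_def using L(1) by blast
  then show ?thesis by blast
qed

lemma L2_candidates_bdd: "bdd_above L2_candidates"
proof -
  have "bounded I" using dom(2) by (rule bounded_fst)
  then obtain M where M: "\<And>x. x \<in> I \<Longrightarrow> \<bar>x\<bar> \<le> M" unfolding bounded_iff by auto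
  have "L \<le> 2 * M" if "L \<in> L2_candidates" for L
  proof -
    obtain a b where ab: "0 < L" "L \<le> b - a" "{a<..<b} \<subseteq> I" using \<open>L \<in> L2_candidates\<close> unfolding L2_candidates_def by blast
    show ?thesis
    proof (rule field_le_epsilon)
      fix e :: real assume e: "0 < e"
      \<comment> \<open>stay inside the open interval, where membership in \<open>I\<close> is known\<close>
      define d where "d = min (e / 2) (L / 4)"
      have d: "0 < d" "d \<le> e / 2" "d \<le> L / 4" using e ab by (auto simp: d_def)
      have "a + d \<in> I" "b - d \<in> I" using d ab by (auto intro!: subsetD[OF ab(3)])
      then have "\<bar>a + d\<bar> \<le> M" "\<bar>b - d\<bar> \<le> M" by (auto intro: M)
      then show "L \<le> 2 * M + e" using d ab by linarith
    qed
  qed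
  then show ?thesis by (rule bdd_aboveI)
qed

text \<open>
  The bound for all candidates passes to their supremum: a positive gap \<open>d\<close> bounds
  every candidate by \<open>sqrt (gap_const / d)\<close>.
\<close>

lemma first_eigenvalue_le_mu1:
  assumes orient: "normalized_orientation \<Omega> V"
  shows "first_eigenvalue \<Omega> V \<le> mu1 + gap_const / (L2 Ct \<Omega> V)\<^sup>2"
proof (cases "L1_tilde \<Omega> V < Ct * L1 \<Omega> V")
  case True
  then have "L2 Ct \<Omega> V = len" by (simp add: L2_def len_def)
  moreover have "3252 / len\<^sup>2 \<le> gap_const / len\<^sup>2" using gap_const_ge by (intro divide_right_mono) auto
  ultimately show ?thesis using first_eigenvalue_le_len mu_min_ge_1 mu_min_le_mu1 by simp
next
  case False
  then have L2: "L2 Ct \<Omega> V = Sup L2_candidates" by (simp add: L2_def L2_candidates_def mu_min_def mu_def)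
  define d where "d = first_eigenvalue \<Omega> V - mu1"
  have L_le: "d \<le> gap_const / L\<^sup>2" if "L \<in> L2_candidates" for L
    using first_eigenvalue_le_L2_candidate[OF orient that] mu_min_le_mu1 by (simp add: d_def)
  show ?thesis
  proof (cases "d \<le> 0")
    case True
    moreover have "0 \<le> gap_const / (L2 Ct \<Omega> V)\<^sup>2" using gap_const_ge by simp
    ultimately show ?thesis by (simp add: d_def)
  next
    case False
    then have d: "0 < d" by simp
    have "L \<le> sqrt (gap_const / d)" if "L \<in> L2_candidates" for L
    proof -
      have "0 < L" using that by (simp add: L2_candidates_def)
      then have "L\<^sup>2 \<le> gap_const / d" using L_le[OF that] d by (simp add: field_simps)
      then show ?thesis by (rule real_le_rsqrt)
    qed
    then have "Sup L2_candidates \<le> sqrt (gap_const / d)" by (rule cSup_least[OF L2_candidates_nonempty])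
    moreover have pos: "0 < Sup L2_candidates"
    proof -
      obtain L where "L \<in> L2_candidates" using L2_candidates_nonempty by blast
      then have "0 < L" "L \<le> Sup L2_candidates" using cSup_upper[OF _ L2_candidates_bdd] by (auto simp: L2_candidates_def)
      then show ?thesis by simp
    qed
    ultimately have "(Sup L2_candidates)\<^sup>2 \<le> (sqrt (gap_const / d))\<^sup>2" by (intro power_mono) auto
    then have "(Sup L2_candidates)\<^sup>2 \<le> gap_const / d" using gap_const_ge d by simp
    then have "d \<le> gap_const / (Sup L2_candidates)\<^sup>2" using d pos by (simp add: field_simps)
    then show ?thesis unfolding L2 by (simp add: d_def)
  qed
qed

end

theorem theorem1p12:
  fixes c :: real
  assumes "0 < c"
  shows "\<exists>B\<^sub>0 Ct\<^sub>0. \<forall>B \<ge> B\<^sub>0. \<forall>Ct \<ge> Ct\<^sub>0. \<exists>C > 0.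
    \<forall>(\<Omega> :: (real \<times> real) set) (h :: real \<times> real \<Rightarrow> real).
      admissible \<Omega> h \<and> c \<le> inner_radius \<Omega> \<and> B \<le> diameter \<Omega> \<and>
      normalized_orientation \<Omega> (potential h) \<longrightarrow>
      (let V = potential h;
           lam = first_eigenvalue \<Omega> V;
           mu = first_eigenvalue (fst ` \<Omega>) (mu_cross \<Omega> V)
       in mu \<le> lam \<and> lam \<le> mu + C / (L2 Ct \<Omega> V)\<^sup>2)"
proof -
  have "let V = potential h; lam = first_eigenvalue \<Omega> V; mu = first_eigenvalue (fst ` \<Omega>) (mu_cross \<Omega> V)
       in mu \<le> lam \<and> lam \<le> mu + gap_const / (L2 Ct \<Omega> V)\<^sup>2"
    if "admissible \<Omega> h" "normalized_orientation \<Omega> (potential h)"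
    for Ct and \<Omega> :: "(real \<times> real) set" and h :: "real \<times> real \<Rightarrow> real"
  proof -
    interpret convex_well \<Omega> h by unfold_locales (rule that(1))
    show ?thesis
      using mu1_le_first_eigenvalue first_eigenvalue_le_mu1[of Ct] that(2)
      unfolding Let_def V_def[symmetric] mu1_def mu_cross_eq by blast
  qed
  moreover have "0 < gap_const" using gap_const_ge by simp
  ultimately show ?thesis by blast
qed

end
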